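(* Let $L\in(0,\infty]$, let $\omega\in H^{-1}_{\mathrm{loc}}[0,L)$ be a real-valued distribution, let $\upsilon$ be a non-negative Borel measure on $[0,L)$, and let $m$ be the Weyl--Titchmarsh function of $(L,\omega,\upsilon)$ with spectral measure $\mu$. Then $m$ is a Stieltjes function if and only if $\upsilon$ vanishes identically and $\omega$ is a non-negative Borel measure on $[0,L)$. In this case, $m$ has the integral representation $$m(z)=\omega(\{0\})-\frac{1}{Lz}+\int_{(0,\infty)}\frac{d\mu(\lambda)}{\lambda-z},\qquad z\in\mathbb{C}\setminus\mathbb{R},$$ where $\frac{1}{Lz}$ is interpreted as $0$ if $L=\infty$.
   Context: $H^1_{\mathrm{loc}}[0,L)$ is the space of locally absolutely continuous (complex-valued) functions $f$ on $[0,L)$ with $f'\in L^2_{\mathrm{loc}}[0,L)$ (square integrable on $[0,c]$ for each $c<L$). $H^1_{\mathrm{c}}[0,L)$ is the space of $f\in H^1_{\mathrm{loc}}[0,L)$ with $f,f'\in L^2[0,L)$ and support compact in $[0,L)$ ($f(0)\neq0$ is allowed). $H^{-1}_{\mathrm{loc}}[0,L)$ is the topological dual of $H^1_{\mathrm{c}}[0,L)$. The formula $\chi(h)=-\int_0^L \mathsf{q}(x)h'(x)\,dx$ gives a one-to-one correspondence between $\mathsf{q}\in L^2_{\mathrm{loc}}[0,L)$ and $\chi\in H^{-1}_{\mathrm{loc}}[0,L)$; $\mathsf q$ is the normalized anti-derivative of $\chi$, and $\chi$ is real-valued if $\mathsf{q}$ is real-valued almost everywhere. Borel measures on $[0,L)$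 are finite on compact subsets of $[0,L)$. A Borel measure $\chi$ on $[0,L)$ is identified with the distribution $h\mapsto\int_{[0,L)}h\,d\chi$ in $H^{-1}_{\mathrm{loc}}[0,L)$ (its normalized anti-derivative is $x\mapsto\chi([0,x))$). $H'[0,L)$ is the space of $f\in H^1_{\mathrm{loc}}[0,L)$ with $f'\in L^2[0,L)$ and, if $L<\infty$, additionally $\lim_{x\to L}f(x)=0$. For $z\in\mathbb{C}$, a solution of $-f''=z\,\omega f+z^2\upsilon f$ is a function $f\in H^1_{\mathrm{loc}}[0,L)$ for which there is a constant $\Delta_f\in\mathbb{C}$ with $\Delta_f h(0)+\int_0^L f'h'\,dx=z\,\omega(fh)+z^2\int_{[0,L)}fh\,d\upsilon$ for all $h\in H^1_{\mathrm{c}}[0,L)$; the constant is unique and denoted by $f'(0-)$. For every $z\in\mathbb{C}\setminus\mathbb{R}$ there is, up to scalar multiples, a unique non-trivial solution $\psi(z,\cdot)$ lying in $H'[0,L)$ and in $L^2([0,L);\upsilon)$, and $\psi(z,0)\neq0$. The Weyl--Titchmarsh function is $m(z)=\psi'(z,0-)/(z\,\psi(z,0))$, $z\in\mathbb{C}\setminus\mathbb{R}$. It has a unique representation $$m(z)=c_1z+c_2-\frac{1}{Lz}+\int_{\mathbb{R}}\frac{1}{\lambda-z}-\frac{\lambda}{1+\lambda^2}\,d\mu(\lambda)$$ with $c_1\geq0$, $c_2\in\mathbb{R}$ and $\mu$ a non-negative Borel measure on $\mathbb{R}$ with $\mu(\{0\})=0$ and $\int_{\mathbb R}(1+\lambda^2)^{-1}d\mu(\lambda)<\infty$;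 $\mu$ is the spectral measure. A function $m$ on $\mathbb{C}\setminus\mathbb{R}$ is a Herglotz--Nevanlinna function if it is analytic, maps the open upper half-plane into the closed upper half-plane and satisfies $\overline{m(z)}=m(\overline z)$. A Herglotz--Nevanlinna function $m$ is a Stieltjes function if $z\mapsto z\,m(z)$ is a Herglotz--Nevanlinna function as well. *)

theory Defs
  imports "HOL-Analysis.Analysis"
begin

text \<open>
  A function on the interval \<open>[0, L)\<close> is a total function on the reals whose values
  outside of \<open>[0, L)\<close> are irrelevant: every notion below depends on its restriction
  to \<open>[0, L)\<close> only.
\<close>

definition half_open :: "ereal \<Rightarrow> real set" where
  "half_open L = {x. 0 \<le> x \<and> ereal x < L}"

definition square_integrable :: "real measure \<Rightarrow> (real \<Rightarrow> complex) \<Rightarrow> bool" where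
  "square_integrable M f \<longleftrightarrow>
     f \<in> borel_measurable M \<and> integrable M (\<lambda>x. (cmod (f x))\<^sup>2)"

definition L2_loc :: "ereal \<Rightarrow> (real \<Rightarrow> complex) set" where
  "L2_loc L = {f. \<forall>c\<in>half_open L. square_integrable (lebesgue_on {0..c}) f}"

definition abs_continuous_on :: "real \<Rightarrow> real \<Rightarrow> (real \<Rightarrow> complex) \<Rightarrow> bool" where
  "abs_continuous_on a b f \<longleftrightarrow>
     (\<forall>\<epsilon>>0. \<exists>\<delta>>0. \<forall>D :: (real \<times> real) set.
        finite D \<and> (\<forall>(s, t)\<in>D. a \<le> s \<and> s \<le> t \<and> t \<le> b) \<and>
        disjoint_family_on (\<lambda>(s, t). {s<..<t}) D \<and>
        (\<Sum>(s, t)\<in>D. t - s) < \<delta> \<longrightarrow>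
        (\<Sum>(s, t)\<in>D. cmod (f t - f s)) < \<epsilon>)"

text \<open>
  The derivative of a locally absolutely continuous function on \<open>[0, L)\<close>. It exists almost
  everywhere; the value at the remaining points is an unspecified constant, and these points
  form a null set.
\<close>

definition der :: "ereal \<Rightarrow> (real \<Rightarrow> complex) \<Rightarrow> real \<Rightarrow> complex" where
  "der L f x = vector_derivative f (at x within half_open L)"

definition H1_loc :: "ereal \<Rightarrow> (real \<Rightarrow> complex) set" where
  "H1_loc L = {f. (\<forall>c\<in>half_open L. abs_continuous_on 0 c f) \<and> der L f \<in> L2_loc L}"

definition H1_c :: "ereal \<Rightarrow> (real \<Rightarrow> complex) set" where
  "H1_c L = {f \<in> H1_loc L.
     square_integrable (lebesgue_on (half_open L)) f \<and>
     square_integrable (lebesgue_on (half_open L)) (der L f) \<and>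
     compact (half_open L \<inter> closure {x \<in> half_open L. f x \<noteq> 0})}"

definition H1_norm :: "ereal \<Rightarrow> (real \<Rightarrow> complex) \<Rightarrow> real" where
  "H1_norm L f = sqrt ((LINT x|lebesgue_on (half_open L). (cmod (f x))\<^sup>2)
                     + (LINT x|lebesgue_on (half_open L). (cmod (der L f x))\<^sup>2))"

text \<open>
  The space \<open>H\<^sup>1\<^sub>c[0, L)\<close> carries the inductive limit topology of its subspaces of functions
  with support in \<open>[0, c]\<close>, \<open>c < L\<close>, under the \<open>H\<^sup>1\<close>-norm. A linear functional is continuous
  if and only if its restriction to each of these subspaces is bounded. Boundedness also makes
  the functional independent of the values of its argument outside of \<open>[0, L)\<close>.
\<close>

definition Hm1_loc :: "ereal \<Rightarrow> ((real \<Rightarrow> complex) \<Rightarrow> complex) set" where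
  "Hm1_loc L = {\<xi>.
     (\<forall>f\<in>H1_c L. \<forall>g\<in>H1_c L. \<xi> (\<lambda>x. f x + g x) = \<xi> f + \<xi> g) \<and>
     (\<forall>a. \<forall>f\<in>H1_c L. \<xi> (\<lambda>x. a * f x) = a * \<xi> f) \<and>
     (\<forall>c\<in>half_open L. \<exists>C. \<forall>h\<in>H1_c L.
        (\<forall>x\<in>half_open L. x > c \<longrightarrow> h x = 0) \<longrightarrow> cmod (\<xi> h) \<le> C * H1_norm L h)}"

definition normalized_antiderivative ::
    "ereal \<Rightarrow> ((real \<Rightarrow> complex) \<Rightarrow> complex) \<Rightarrow> (real \<Rightarrow> complex) \<Rightarrow> bool" where
  "normalized_antiderivative L \<xi> q \<longleftrightarrow>
     q \<in> L2_loc L \<and>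
     (\<forall>h\<in>H1_c L. \<xi> h = - (LINT x|lebesgue_on (half_open L). q x * der L h x))"

definition real_valued :: "ereal \<Rightarrow> ((real \<Rightarrow> complex) \<Rightarrow> complex) \<Rightarrow> bool" where
  "real_valued L \<xi> \<longleftrightarrow>
     (\<exists>q. normalized_antiderivative L \<xi> q \<and> (AE x in lebesgue_on (half_open L). q x \<in> \<real>))"

definition borel_measure_on :: "ereal \<Rightarrow> real measure \<Rightarrow> bool" where
  "borel_measure_on L \<nu> \<longleftrightarrow>
     sets \<nu> = sets (restrict_space borel (half_open L)) \<and>
     (\<forall>K. compact K \<and> K \<subseteq> half_open L \<longrightarrow> emeasure \<nu> K < \<infinity>)"

definition is_measure_distribution ::
    "ereal \<Rightarrow> ((real \<Rightarrow> complex) \<Rightarrow> complex) \<Rightarrow> real measure \<Rightarrow> bool" where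
  "is_measure_distribution L \<xi> \<nu> \<longleftrightarrow>
     borel_measure_on L \<nu> \<and> (\<forall>h\<in>H1_c L. \<xi> h = (LINT x|\<nu>. h x))"

definition H_prime :: "ereal \<Rightarrow> (real \<Rightarrow> complex) set" where
  "H_prime L = {f \<in> H1_loc L.
     square_integrable (lebesgue_on (half_open L)) (der L f) \<and>
     (L < \<infinity> \<longrightarrow> (f \<longlongrightarrow> 0) (at_left (real_of_ereal L)))}"

text \<open>
  \<open>f\<close> is a solution of \<open>- f'' = z \<omega> f + z\<^sup>2 \<upsilon> f\<close> and \<open>\<Delta>\<close> is the constant denoted by \<open>f'(0-)\<close>.
\<close>

definition solution ::
    "ereal \<Rightarrow> ((real \<Rightarrow> complex) \<Rightarrow> complex) \<Rightarrow> real measure \<Rightarrow> complex \<Rightarrow>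
     (real \<Rightarrow> complex) \<Rightarrow> complex \<Rightarrow> bool" where
  "solution L \<omega> \<upsilon> z f \<Delta> \<longleftrightarrow>
     f \<in> H1_loc L \<and>
     (\<forall>h\<in>H1_c L.
        \<Delta> * h 0 + (LINT x|lebesgue_on (half_open L). der L f x * der L h x) =
        z * \<omega> (\<lambda>x. f x * h x) + z\<^sup>2 * (LINT x|\<upsilon>. f x * h x))"

text \<open>
  \<open>m\<close> is the Weyl--Titchmarsh function of \<open>(L, \<omega>, \<upsilon>)\<close>. Only its values off the real line
  matter. As the Weyl solution \<open>\<psi>\<close> is unique up to scalar multiples, the value of \<open>m\<close> at \<open>z\<close>
  does not depend on the choice of \<open>\<psi>\<close>.
\<close>

definition weyl_titchmarsh_function ::
    "ereal \<Rightarrow> ((real \<Rightarrow> complex) \<Rightarrow> complex) \<Rightarrow> real measure \<Rightarrow> (complex \<Rightarrow> complex) \<Rightarrow> bool" where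
  "weyl_titchmarsh_function L \<omega> \<upsilon> m \<longleftrightarrow>
     (\<forall>z. z \<notin> \<real> \<longrightarrow>
        (\<exists>\<psi> \<Delta>. solution L \<omega> \<upsilon> z \<psi> \<Delta> \<and> (\<exists>x\<in>half_open L. \<psi> x \<noteq> 0) \<and>
               \<psi> \<in> H_prime L \<and> square_integrable \<upsilon> \<psi> \<and>
               \<psi> 0 \<noteq> 0 \<and> m z = \<Delta> / (z * \<psi> 0)))"

definition recip_Lz :: "ereal \<Rightarrow> complex \<Rightarrow> complex" where
  "recip_Lz L z = (if L = \<infinity> then 0 else 1 / (complex_of_real (real_of_ereal L) * z))"

definition spectral_measure :: "ereal \<Rightarrow> (complex \<Rightarrow> complex) \<Rightarrow> real measure \<Rightarrow> bool" where
  "spectral_measure L m \<mu> \<longleftrightarrow>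
     sets \<mu> = sets borel \<and> emeasure \<mu> {0} = 0 \<and>
     integrable \<mu> (\<lambda>t. 1 / (1 + t\<^sup>2)) \<and>
     (\<exists>c1 c2 :: real. c1 \<ge> 0 \<and>
        (\<forall>z. z \<notin> \<real> \<longrightarrow>
           m z = of_real c1 * z + of_real c2 - recip_Lz L z +
             (LINT t|\<mu>. 1 / (of_real t - z) - of_real (t / (1 + t\<^sup>2)))))"

text \<open>Functions on \<open>\<complex> \<setminus> \<real>\<close>; the values on the real line are irrelevant.\<close>

definition herglotz_nevanlinna :: "(complex \<Rightarrow> complex) \<Rightarrow> bool" where
  "herglotz_nevanlinna m \<longleftrightarrow>
     m analytic_on (- \<real>) \<and>
     (\<forall>z. Im z > 0 \<longrightarrow> Im (m z) \<ge> 0) \<and>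
     (\<forall>z. z \<notin> \<real> \<longrightarrow> cnj (m z) = m (cnj z))"

definition stieltjes_function :: "(complex \<Rightarrow> complex) \<Rightarrow> bool" where
  "stieltjes_function m \<longleftrightarrow>
     herglotz_nevanlinna m \<and> herglotz_nevanlinna (\<lambda>z. z * m z)"

end

(*
  The Weyl solution psi(z,.) is normalized by psi(z,0) = 1, and testing the equation with psi(w,.)
  (cut off near L) gives the Gram identity
    m(z) - m(w) = (z - w) (int psi(z) psi(w) d upsilon + (z w)^{-1} int psi'(z) psi'(w) dx).

  Suppose that m is a Stieltjes function. Then mu lives on (0,oo), m extends to the negative axis with
  values m(-l) >= 0, and as z -> -l the Weyl solutions converge to real solutions r_l. Comparing Gram
  matrices shows that no r_l can have a first zero, so r_l > 0, and Picone's identity (test with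
  h^2 / r_l) yields, with q the normalized anti-derivative of omega and real test functions h,
    int h'^2 dx >= l m(-l) h(0)^2 + 2 l int q h h' dx + l^2 int h^2 d upsilon   for all l > 0.
  Letting l tend to infinity forces upsilon = 0, and after that int q h h' dx <= 0. Trapezoidal h show
  that q is non-negative and non-decreasing almost everywhere, so that omega is its Stieltjes measure.

  Conversely, if upsilon = 0 and omega is a measure nu, testing with the conjugate of psi(z,.) gives
    m(z) = int |psi|^2 d nu - z^{-1} int |psi'|^2 dx,
  so Im (z m(z)) >= 0. Along z = iy this identity and the trial function max(0, 1 - x/e) give
    nu({0}) <= Re m(iy) <= |m(iy)| <= (sqrt nu([0,e]) + 1 / sqrt(y e))^2,
  which identifies the constants in the integral representation.
*)
theory Submission
  imports Defs
begin

hide_fact (open)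
  Henstock_Kurzweil_Integration.integral_diff
  Henstock_Kurzweil_Integration.integrable_bound
  Henstock_Kurzweil_Integration.integrable_diff
  Henstock_Kurzweil_Integration.integrable_add
  Henstock_Kurzweil_Integration.integral_add
  Henstock_Kurzweil_Integration.integral_cong
  Henstock_Kurzweil_Integration.integral_nonneg
  Henstock_Kurzweil_Integration.integral_norm_bound_integral

section \<open>Absolutely continuous functions\<close>

text \<open>The distribution \<open>\<omega>\<close> is rough: a solution need not have a derivative
  at a given point, and its zeros cannot be treated by classical arguments for differential
  equations. The proof relies on energies alone. To this end the pointwise derivative of the
  definitions is replaced by pairs \<open>(f, g)\<close> with \<open>f\<close> the primitive of a
  Borel function \<open>g\<close>, which is legitimate because absolutely continuous functions are
  integrals of their derivatives. The Gram identity opens the negative axis: \<open>\<omega>\<close>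
  has cancelled from it, and its divided left side extends smoothly across that axis once
  \<open>\<mu>\<close> lives on the positive half-line, so Weyl solutions form Cauchy sequences
  there. Zeros of r_l are excluded by looking at the least l for which one occurs on
  \<open>[0,c]\<close>. The normalization r_l(0) = 1 makes the descent to 0 too expensive for small
  l, where the energy is governed by 1/L. At a positive least l, the quotient (m(-k) - m(-l)) / (l -
  k) tends to the energy of r_l as k tends to l from below, and Picone's inequality bounds it by the
  part of that energy before the zero. Nothing is left beyond the zero, which unique continuation
  forbids.\<close>

definition intervals :: "real \<Rightarrow> real \<Rightarrow> (real \<times> real) set \<Rightarrow> bool" where
  "intervals a b D \<longleftrightarrow> finite D \<and> (\<forall>(s, t)\<in>D. a \<le> s \<and> s < t \<and> t \<le> b) \<and>
     disjoint_family_on (\<lambda>(s, t). {s<..<t}) D"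

definition ac_on :: "real \<Rightarrow> real \<Rightarrow> (real \<Rightarrow> 'a::real_normed_vector) \<Rightarrow> bool" where
  "ac_on a b f \<longleftrightarrow> (\<forall>e>0. \<exists>d>0. \<forall>D. intervals a b D \<and> (\<Sum>(s, t)\<in>D. t - s) < d \<longrightarrow>
     (\<Sum>(s, t)\<in>D. norm (f t - f s)) < e)"

lemma abs_continuous_on_iff_ac_on: "abs_continuous_on a b f \<longleftrightarrow> ac_on a b f"
proof
  assume "abs_continuous_on a b f"
  then show "ac_on a b f"
    unfolding abs_continuous_on_def ac_on_def intervals_def
    by (metis (no_types, lifting) case_prodD case_prodI2 less_imp_le)
next
  assume ac: "ac_on a b f"
  show "abs_continuous_on a b f"
    unfolding abs_continuous_on_def
  proof (intro allI impI)
    fix e :: real assume "e > 0"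
    with ac obtain d where d: "d > 0"
      and D: "\<And>D. intervals a b D \<Longrightarrow> (\<Sum>(s, t)\<in>D. t - s) < d \<Longrightarrow>
        (\<Sum>(s, t)\<in>D. norm (f t - f s)) < e"
      unfolding ac_on_def by metis
    show "\<exists>\<delta>>0. \<forall>D. finite D \<and> (\<forall>(s, t)\<in>D. a \<le> s \<and> s \<le> t \<and> t \<le> b) \<and>
        disjoint_family_on (\<lambda>(s, t). {s<..<t}) D \<and> (\<Sum>(s, t)\<in>D. t - s) < \<delta> \<longrightarrow>
        (\<Sum>(s, t)\<in>D. cmod (f t - f s)) < e"
    proof (intro exI[of _ d] conjI allI impI d)
      fix E assume E: "finite E \<and> (\<forall>(s, t)\<in>E. a \<le> s \<and> s \<le> t \<and> t \<le> b) \<and>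
        disjoint_family_on (\<lambda>(s, t). {s<..<t}) E \<and> (\<Sum>(s, t)\<in>E. t - s) < d"
      define E' where "E' = {p\<in>E. fst p < snd p}"
      have eq: "(\<Sum>(s, t)\<in>E. g s t) = (\<Sum>(s, t)\<in>E'. g s t)" if "\<And>s. g s s = (0::real)" for g
        by (rule sum.mono_neutral_right) (use E that in \<open>fastforce simp: E'_def\<close>)+
      have "intervals a b E'"
        using E by (fastforce simp: intervals_def E'_def disjoint_family_on_def)
      then show "(\<Sum>(s, t)\<in>E. cmod (f t - f s)) < e"
        using D[of E'] E eq[of "\<lambda>s t. t - s"] eq[of "\<lambda>s t. cmod (f t - f s)"] by simp
    qed
  qed
qed

text \<open>The total length is the Lebesgue measure of a disjoint union inside
  \<open>{a..b}\<close>. An empty family needs \<open>a \<le> b\<close>, because its sum is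
  0.\<close>

lemma intervals_sum_length:
  assumes "intervals a b D" "D \<noteq> {} \<or> a \<le> b"
  shows "(\<Sum>(s, t)\<in>D. t - s) \<le> b - a"
proof (cases "a \<le> b")
  case True
  let ?I = "\<lambda>(s, t). {s<..<t::real}"
  have fin: "finite D" and sub: "\<And>s t. (s, t) \<in> D \<Longrightarrow> a \<le> s \<and> s < t \<and> t \<le> b"
    and disj: "disjoint_family_on ?I D"
    using assms by (auto simp: intervals_def)
  have "(\<Sum>p\<in>D. measure lborel (?I p)) = measure lborel (\<Union>p\<in>D. ?I p)"
    by (rule measure_finite_Union[symmetric]) (use fin disj in \<open>auto simp: sub less_imp_le\<close>)
  also have "\<dots> \<le> measure lborel {a..b}"
  proof (rule measure_mono_fmeasurable)
    show "(\<Union>p\<in>D. ?I p) \<subseteq> {a..b}" using sub by force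
    show "(\<Union>p\<in>D. ?I p) \<in> sets lborel" using fin by (auto intro!: sets.finite_UN)
  qed (simp add: fmeasurable_def True)
  also have "\<dots> = b - a" using True by simp
  also have "(\<Sum>p\<in>D. measure lborel (?I p)) = (\<Sum>(s, t)\<in>D. t - s)"
    by (rule sum.cong) (auto dest: sub)
  finally show ?thesis .
qed (use assms in \<open>force simp: intervals_def\<close>)

lemma intervals_subset: "intervals a b D \<Longrightarrow> a' \<le> a \<Longrightarrow> b \<le> b' \<Longrightarrow> intervals a' b' D"
  by (fastforce simp: intervals_def)

lemma intervals_single: "a \<le> s \<Longrightarrow> s < t \<Longrightarrow> t \<le> b \<Longrightarrow> intervals a b {(s, t)}"
  by (auto simp: intervals_def disjoint_family_on_def)

lemma ac_on_subset: "ac_on a b f \<Longrightarrow> a \<le> a' \<Longrightarrow> b' \<le> b \<Longrightarrow> ac_on a' b' f"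
  unfolding ac_on_def by (meson intervals_subset)

lemma ac_on_dominated:
  assumes f: "ac_on a b f" and g: "ac_on a b g" and C: "C \<ge> 0"
    and le: "\<And>s t. a \<le> s \<Longrightarrow> s < t \<Longrightarrow> t \<le> b \<Longrightarrow>
      norm (h t - h s) \<le> C * (norm (f t - f s) + norm (g t - g s))"
  shows "ac_on a b h"
  unfolding ac_on_def
proof (intro allI impI)
  fix e :: real assume "e > 0"
  \<comment> \<open>The divisor \<open>C + 1\<close> instead of \<open>C\<close> covers
    \<open>C = 0\<close> and keeps the final estimate strict.\<close>
  define e' where "e' = e / (C + 1) / 2"
  have e': "e' > 0" using \<open>e > 0\<close> C by (simp add: e'_def)
  obtain d1 where d1: "d1 > 0" "\<And>D. intervals a b D \<Longrightarrow> (\<Sum>(s, t)\<in>D. t - s) < d1 \<Longrightarrow>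
      (\<Sum>(s, t)\<in>D. norm (f t - f s)) < e'"
    using f e' unfolding ac_on_def by metis
  obtain d2 where d2: "d2 > 0" "\<And>D. intervals a b D \<Longrightarrow> (\<Sum>(s, t)\<in>D. t - s) < d2 \<Longrightarrow>
      (\<Sum>(s, t)\<in>D. norm (g t - g s)) < e'"
    using g e' unfolding ac_on_def by metis
  show "\<exists>d>0. \<forall>D. intervals a b D \<and> (\<Sum>(s, t)\<in>D. t - s) < d \<longrightarrow>
      (\<Sum>(s, t)\<in>D. norm (h t - h s)) < e"
  proof (intro exI[of _ "min d1 d2"] conjI allI impI)
    fix D assume D: "intervals a b D \<and> (\<Sum>(s, t)\<in>D. t - s) < min d1 d2"
    have "(\<Sum>(s, t)\<in>D. norm (h t - h s)) \<le>
        (\<Sum>(s, t)\<in>D. C * (norm (f t - f s) + norm (g t - g s)))"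
      by (rule sum_mono) (use D in \<open>auto simp: intervals_def intro!: le\<close>)
    also have "\<dots> = C * ((\<Sum>(s, t)\<in>D. norm (f t - f s)) + (\<Sum>(s, t)\<in>D. norm (g t - g s)))"
      by (simp add: sum.distrib sum_distrib_left[symmetric] case_prod_beta)
    also have "\<dots> \<le> C * (e' + e')"
      by (rule mult_left_mono) (use d1(2)[of D] d2(2)[of D] D C in auto)
    also have "\<dots> = e * (C / (C + 1))" 
    proof -
      have "e' + e' = e / (C + 1)" unfolding e'_def by (rule field_sum_of_halves)
      then show ?thesis by (simp add: mult.commute)
    qed
    also have "\<dots> < e * 1"
      by (rule mult_strict_left_mono) (use C \<open>e > 0\<close> in auto)
    finally show "(\<Sum>(s, t)\<in>D. norm (h t - h s)) < e" by simp
  qed (use d1 d2 in auto)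
qed

lemma ac_on_continuous:
  assumes "ac_on a b f"
  shows "continuous_on {a..b} f"
proof (rule continuous_onI)
  fix x e :: real assume x: "x \<in> {a..b}" and "e > 0"
  then obtain d where d: "d > 0" "\<And>D. intervals a b D \<Longrightarrow> (\<Sum>(s, t)\<in>D. t - s) < d \<Longrightarrow>
      (\<Sum>(s, t)\<in>D. norm (f t - f s)) < e"
    using assms unfolding ac_on_def by metis
  have "dist (f y) (f x) \<le> e" if y: "y \<in> {a..b}" "dist y x < d" for y
  proof (cases x y rule: linorder_cases)
    case less
    then show ?thesis using d(2)[of "{(x, y)}"] x y intervals_single[of a x y b]
      by (auto simp: dist_norm)
  next
    case greater
    then show ?thesis using d(2)[of "{(y, x)}"] x y intervals_single[of a y x b]
      by (auto simp: dist_norm norm_minus_commute)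
  qed (use \<open>e > 0\<close> in auto)
  with d(1) show "\<exists>d>0. \<forall>x'\<in>{a..b}. dist x' x < d \<longrightarrow> dist (f x') (f x) \<le> e" by blast
qed

lemma ac_on_mono_diff:
  assumes "ac_on a b f" "\<And>s t. a \<le> s \<Longrightarrow> s < t \<Longrightarrow> t \<le> b \<Longrightarrow> norm (h t - h s) \<le> norm (f t - f s)"
  shows "ac_on a b h"
proof (rule ac_on_dominated[OF assms(1) assms(1), of 1])
  fix s t assume "a \<le> s" "s < t" "t \<le> b"
  then have "norm (h t - h s) \<le> norm (f t - f s)" by (rule assms(2))
  also have "\<dots> \<le> norm (f t - f s) + norm (f t - f s)" by simp
  finally show "norm (h t - h s) \<le> 1 * (norm (f t - f s) + norm (f t - f s))" by (simp only: mult_1)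
qed simp

text \<open>The total length of a finite disjoint family controls the measure given to it by a monotone
  absolutely continuous function, so its Stieltjes measure has a density.\<close>

lemma mono_ac_primitive:
  fixes f :: "real \<Rightarrow> real"
  assumes ab: "a \<le> b" and ac: "ac_on a b f"
    and mono: "\<And>x y. a \<le> x \<Longrightarrow> x \<le> y \<Longrightarrow> y \<le> b \<Longrightarrow> f x \<le> f y"
  obtains g where "integrable lborel g"
    "\<And>x. x \<in> {a..b} \<Longrightarrow> f x = f a + (LBINT t. indicator {a..x} t *\<^sub>R g t)"
proof -
  \<comment> \<open>Clamping to \<open>{a..b}\<close> extends \<open>f\<close> to a monotone
    continuous function on the line, constant outside the interval, as
    \<open>interval_measure\<close> expects.\<close>
  define cl where "cl x = max a (min x b)" for x
  define F where "F x = f (cl x)" for x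
  have cl: "a \<le> cl x" "cl x \<le> b" "x \<le> y \<Longrightarrow> cl x \<le> cl y" "x \<le> y \<Longrightarrow> cl y - cl x \<le> y - x" for x y
    using ab by (auto simp: cl_def)
  have monoF: "F x \<le> F y" if "x \<le> y" for x y
    using that by (auto simp: F_def intro!: mono cl)
  have contF: "continuous_on UNIV F"
  proof -
    have "continuous_on UNIV cl" unfolding cl_def by (intro continuous_intros)
    then show ?thesis unfolding F_def
      by (rule continuous_on_compose2[OF ac_on_continuous[OF ac]]) (use cl in auto)
  qed
  then have rcont: "continuous (at_right x) F" for x
    by (simp add: continuous_at_imp_continuous_at_within continuous_on_eq_continuous_at)
  let ?\<mu> = "interval_measure F"
  have Ioc: "emeasure ?\<mu> {x<..y} = F y - F x" if "x \<le> y" for x y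
    by (rule emeasure_interval_measure_Ioc) (use that monoF rcont in auto)
  \<comment> \<open>Finiteness of the Stieltjes measure serves its inner regularity and the
    integrability of the density.\<close>
  have bound: "emeasure ?\<mu> A \<le> F b - F a" if "A \<in> sets borel" for A
  proof -
    have "(\<lambda>n::nat. emeasure ?\<mu> {- real n<..real n}) \<longlonglongrightarrow> emeasure ?\<mu> (\<Union>n. {- real n<..real n})"
      by (rule Lim_emeasure_incseq) (auto simp: incseq_def)
    moreover have "(\<Union>n. {- real n<..real n}) = UNIV"
    proof -
      have "x \<in> (\<Union>n. {- real n<..real n})" for x
      proof -
        obtain n where "\<bar>x\<bar> < real n" using reals_Archimedean2 by blast
        then have "x \<in> {- real n<..real n}" by auto
        then show ?thesis by blast
      qed
      then show ?thesis by auto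
    qed
    moreover have "emeasure ?\<mu> {- real n<..real n} \<le> F b - F a" for n
    proof -
      have "F (real n) \<le> f b" "f a \<le> F (- real n)"
        unfolding F_def by (rule mono; use cl ab in simp)+
      moreover have "F a = f a" "F b = f b" using ab by (simp_all add: F_def cl_def)
      ultimately have "F (real n) - F (- real n) \<le> F b - F a" by linarith
      then show ?thesis by (subst Ioc) (auto intro!: ennreal_leI)
    qed
    ultimately have "emeasure ?\<mu> UNIV \<le> F b - F a"
      by (intro LIMSEQ_le_const2) auto
    then show ?thesis
      by (rule order_trans[rotated]) (auto intro: emeasure_mono that)
  qed
  have abscont: "absolutely_continuous lborel ?\<mu>"
    unfolding absolutely_continuous_def
  proof
    fix N :: "real set" assume N: "N \<in> null_sets lborel"
    have Nb: "N \<in> sets borel" using N by (auto dest: null_setsD2)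
    \<comment> \<open>A null set lies in an open set of measure below the \<open>d\<close> of
      absolute continuity. A compact part of that open set is covered by finitely many grid cells
      that stay inside it, and these cells form a family to which \<open>d\<close> applies; inner
      regularity passes from compact parts to the open set.\<close>
    have small: "emeasure ?\<mu> N \<le> ennreal e" if e: "e > 0" for e
    proof -
      obtain d where d: "d > 0" "\<And>D. intervals a b D \<Longrightarrow> (\<Sum>(s, t)\<in>D. t - s) < d \<Longrightarrow>
          (\<Sum>(s, t)\<in>D. norm (f t - f s)) < e"
        using ac e unfolding ac_on_def by metis
      obtain U where U: "open U" "N \<subseteq> U" "emeasure lborel (U - N) < ennreal d"
        using outer_regular_lborel[OF Nb d(1)] by metis
      have Ub: "U \<in> sets borel" using U(1) by auto
      have "emeasure lborel U \<le> emeasure lborel (U - N) + emeasure lborel N"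
        using emeasure_subadditive[of "U - N" lborel N] U N
        by (auto simp: Un_absorb2 null_setsD2)
      then have Ud: "emeasure lborel U < ennreal d" using U N by (auto simp: null_setsD1)
      have K: "emeasure ?\<mu> K \<le> ennreal e" if K: "compact K" "K \<subseteq> U" for K
      proof -
        obtain r where r: "r > 0" "(\<Union>x\<in>K. ball x r) \<subseteq> U"
          using compact_subset_open_imp_ball_epsilon_subset[OF K(1) U(1) K(2)] by blast
        define h where "h = r / 2"
        have h: "h > 0" "h < r" using r by (auto simp: h_def)
        \<comment> \<open>Half-open cells tile the line without overlap and have a known Stieltjes
          measure. Since their length \<open>h\<close> is below \<open>r\<close>, a cell that meets
          \<open>K\<close> stays in \<open>U\<close>.\<close>
        define c where "c j = {of_int j * h<..(of_int j + 1) * h}" for j :: int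
        define J where "J = {j. c j \<inter> K \<noteq> {}}"
        have cU: "c j \<subseteq> U" if jJ: "j \<in> J" for j
        proof
          fix y assume y: "y \<in> c j"
          obtain x where x: "x \<in> c j" "x \<in> K" using jJ by (auto simp: J_def)
          then have "y \<in> ball x r" using y h by (auto simp: c_def dist_real_def algebra_simps)
          then show "y \<in> U" using x r by blast
        qed
        have finJ: "finite J"
        proof -
          obtain B where B: "\<And>x. x \<in> K \<Longrightarrow> \<bar>x\<bar> \<le> B"
            using compact_imp_bounded[OF K(1)] by (auto simp: bounded_iff)
          have "J \<subseteq> {\<lfloor>- B / h\<rfloor> - 2..\<lceil>B / h\<rceil> + 2}"
          proof
            fix j assume "j \<in> J"
            then obtain x where x: "x \<in> c j" "\<bar>x\<bar> \<le> B" using B by (auto simp: J_def)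
            then have "of_int j * h \<le> B" "- B \<le> (of_int j + 1) * h" by (auto simp: c_def)
            then have "of_int j \<le> B / h" "- B / h \<le> of_int j + 1"
              using h by (auto simp: field_simps)
            then show "j \<in> {\<lfloor>- B / h\<rfloor> - 2..\<lceil>B / h\<rceil> + 2}" by simp linarith
          qed
          then show ?thesis using finite_subset by blast
        qed
        have KJ: "K \<subseteq> (\<Union>j\<in>J. c j)"
        proof
          fix x assume x: "x \<in> K"
          define j where "j = \<lceil>x / h\<rceil> - 1"
          have "of_int j < x / h" "x / h \<le> of_int j + 1" unfolding j_def by linarith+
          then have "x \<in> c j" using h by (auto simp: c_def field_simps)
          then show "x \<in> (\<Union>j\<in>J. c j)" using x by (auto simp: J_def)
        qed
        have cdisj: "j = k" if "x \<in> c j" "x \<in> c k" for x j k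
        proof -
          have "of_int j * h < (of_int k + 1) * h" "of_int k * h < (of_int j + 1) * h"
            using that by (auto simp: c_def)
          then have "of_int j < (of_int k + 1 :: real)" "of_int k < (of_int j + 1 :: real)"
            using h by auto
          then show ?thesis by linarith
        qed
        \<comment> \<open>Cells are clamped to \<open>{a..b}\<close> before absolute continuity is
          applied. Those that become degenerate are left out in \<open>J'\<close>; \<open>F\<close>
          does not change across them.\<close>
        define T where "T j = (cl (of_int j * h), cl ((of_int j + 1) * h))" for j :: int
        define J' where "J' = {j\<in>J. fst (T j) < snd (T j)}"
        have Tsub: "{fst (T j)<..<snd (T j)} \<subseteq> c j" for j
          using ab by (auto simp: T_def c_def cl_def)
        have injT: "inj_on T J'"
        proof (rule inj_onI)
          fix j k assume jk: "j \<in> J'" "k \<in> J'" "T j = T k"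
          then obtain x where "fst (T j) < x" "x < snd (T j)"
            using dense unfolding J'_def by blast
          with jk(3) Tsub[of j] Tsub[of k] show "j = k" by (intro cdisj[of x]) auto
        qed
        have int: "intervals a b (T ` J')"
          unfolding intervals_def
        proof (intro conjI)
          show "\<forall>(s, t)\<in>T ` J'. a \<le> s \<and> s < t \<and> t \<le> b"
            by (auto simp: J'_def T_def cl)
          show "disjoint_family_on (\<lambda>(s, t). {s<..<t}) (T ` J')"
            unfolding disjoint_family_on_def
          proof (intro ballI impI)
            fix p q assume pq: "p \<in> T ` J'" "q \<in> T ` J'" "p \<noteq> q"
            then obtain j k where jk: "p = T j" "q = T k" "j \<noteq> k" by auto
            then show "(case p of (s, t) \<Rightarrow> {s<..<t}) \<inter> (case q of (s, t) \<Rightarrow> {s<..<t}) = {}"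
              using Tsub[of j] Tsub[of k] cdisj by (fastforce simp: case_prod_beta)
          qed
        qed (use finJ in \<open>auto simp: J'_def\<close>)
        have cm [measurable]: "c j \<in> sets borel" for j by (simp add: c_def)
        have c_len: "emeasure lborel (c j) = ennreal h" for j
          using h by (simp add: c_def algebra_simps)
        have c_F: "emeasure ?\<mu> (c j) = ennreal (F ((of_int j + 1) * h) - F (of_int j * h))" for j
          unfolding c_def by (rule Ioc) (use h in simp)
        have cd: "disjoint_family_on c J" using cdisj by (fastforce simp: disjoint_family_on_def)
        have "ennreal (\<Sum>j\<in>J. h) = (\<Sum>j\<in>J. emeasure lborel (c j))"
          using h by (simp only: c_len) (intro sum_ennreal[symmetric] less_imp_le)
        also have "\<dots> = emeasure lborel (\<Union>j\<in>J. c j)"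
          by (rule sum_emeasure) (use finJ cd cm in auto)
        also have "\<dots> \<le> emeasure lborel U"
          by (rule emeasure_mono) (use cU Ub in auto)
        finally have "ennreal (\<Sum>j\<in>J. h) < ennreal d" using Ud by simp
        then have sumh: "(\<Sum>j\<in>J. h) < d"
          using h by (subst (asm) ennreal_less_iff) (auto intro: sum_nonneg)
        have "(\<Sum>(s, t)\<in>T ` J'. t - s) = (\<Sum>j\<in>J'. snd (T j) - fst (T j))"
          by (subst sum.reindex[OF injT]) (simp add: case_prod_beta)
        also have "\<dots> \<le> (\<Sum>j\<in>J'. h)"
        proof (rule sum_mono)
          show "snd (T j) - fst (T j) \<le> h" for j
            using cl(4)[of "of_int j * h" "(of_int j + 1) * h"] h by (auto simp: T_def algebra_simps)
        qed
        also have "\<dots> \<le> (\<Sum>j\<in>J. h)"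
          by (rule sum_mono2) (use finJ h in \<open>auto simp: J'_def\<close>)
        finally have small: "(\<Sum>(s, t)\<in>T ` J'. norm (f t - f s)) < e"
          using d(2)[OF int] sumh by simp
        have "emeasure ?\<mu> K \<le> emeasure ?\<mu> (\<Union>j\<in>J. c j)"
          by (rule emeasure_mono[OF KJ]) (use finJ cm in auto)
        also have "\<dots> \<le> (\<Sum>j\<in>J. emeasure ?\<mu> (c j))"
          by (rule emeasure_subadditive_finite) (use finJ cm in auto)
        also have "\<dots> = (\<Sum>j\<in>J. ennreal (F ((of_int j + 1) * h) - F (of_int j * h)))"
          by (simp add: c_F)
        also have "\<dots> = ennreal (\<Sum>j\<in>J. F ((of_int j + 1) * h) - F (of_int j * h))"
          using h by (intro sum_ennreal) (auto intro!: monoF)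
        also have "(\<Sum>j\<in>J. F ((of_int j + 1) * h) - F (of_int j * h)) =
            (\<Sum>j\<in>J'. F ((of_int j + 1) * h) - F (of_int j * h))"
        proof (rule sum.mono_neutral_right)
          show "\<forall>j\<in>J - J'. F ((of_int j + 1) * h) - F (of_int j * h) = 0"
          proof
            fix j assume "j \<in> J - J'"
            then have "cl ((of_int j + 1) * h) \<le> cl (of_int j * h)" by (auto simp: J'_def T_def)
            with cl(3)[of "of_int j * h" "(of_int j + 1) * h"] h
            show "F ((of_int j + 1) * h) - F (of_int j * h) = 0" by (simp add: F_def)
          qed
        qed (use finJ in \<open>auto simp: J'_def\<close>)
        also have "\<dots> = (\<Sum>(s, t)\<in>T ` J'. f t - f s)"
          by (subst sum.reindex[OF injT]) (simp add: case_prod_beta T_def F_def)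
        also have "\<dots> \<le> (\<Sum>(s, t)\<in>T ` J'. norm (f t - f s))"
          by (rule sum_mono) auto
        also have "\<dots> \<le> e" using small by simp
        finally show ?thesis by (simp add: ennreal_leI)
      qed
      have "emeasure ?\<mu> (space ?\<mu>) \<noteq> \<infinity>"
        using bound[of UNIV] by (auto simp: top_unique)
      then have "emeasure ?\<mu> U = (SUP K \<in> {K. K \<subseteq> U \<and> compact K}. emeasure ?\<mu> K)"
        by (intro inner_regular) (use Ub in auto)
      also have "\<dots> \<le> ennreal e" by (rule SUP_least) (use K in auto)
      finally show ?thesis
        using emeasure_mono[OF U(2), of ?\<mu>] Ub by (auto intro: order_trans)
    qed
    have "emeasure ?\<mu> N \<le> 0"
      by (rule ennreal_le_epsilon) (use small in simp)
    then have "emeasure ?\<mu> N = 0" by simp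
    then show "N \<in> null_sets ?\<mu>" using N by (auto simp: null_sets_def)
  qed
  obtain u where u: "u \<in> borel_measurable borel" "density lborel u = ?\<mu>"
    using sigma_finite_measure.Radon_Nikodym[OF sigma_finite_lborel abscont] by auto
  have "(\<integral>\<^sup>+x. u x \<partial>lborel) = emeasure ?\<mu> UNIV"
    using u by (simp add: u(2)[symmetric] emeasure_density)
  also have "\<dots> < \<infinity>" using bound[of UNIV] by (auto simp: less_top[symmetric] top_unique)
  finally have fin: "(\<integral>\<^sup>+x. u x \<partial>lborel) < \<infinity>" .
  then have ae: "AE x in lborel. u x \<noteq> \<infinity>"
    by (intro nn_integral_PInf_AE) (use u in auto)
  \<comment> \<open>The density is finite almost everywhere, so passing to real values changes it on
    a null set only.\<close>
  define g where "g x = enn2real (u x)" for x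
  have gu: "AE x in lborel. ennreal (g x) = u x" using ae by (auto simp: g_def less_top)
  note u(1)[measurable]
  have gm [measurable]: "g \<in> borel_measurable borel" unfolding g_def[abs_def] by measurable
  have "(\<integral>\<^sup>+x. ennreal (g x) \<partial>lborel) = (\<integral>\<^sup>+x. u x \<partial>lborel)"
    by (rule nn_integral_cong_AE[OF gu])
  then have gi: "integrable lborel g"
    using fin by (intro integrableI_nonneg) (auto simp: g_def)
  have "f x = f a + (LBINT t. indicator {a..x} t *\<^sub>R g t)" if x: "x \<in> {a..b}" for x
  proof -
    have "(LBINT t. indicator {a..x} t *\<^sub>R g t) = (LBINT t. indicator {a<..x} t *\<^sub>R g t)"
      by (rule integral_cong_AE) (auto intro!: AE_I[of _ _ "{a}"] simp: indicator_def)
    moreover have "(LBINT t. indicator {a<..x} t *\<^sub>R g t) = F x - F a"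
    proof -
      have "ennreal (LBINT t. indicator {a<..x} t *\<^sub>R g t) =
          (\<integral>\<^sup>+t. ennreal (indicator {a<..x} t *\<^sub>R g t) \<partial>lborel)"
        by (rule nn_integral_eq_integral[symmetric], rule integrable_mult_indicator[OF _ gi])
          (auto simp: g_def)
      also have "\<dots> = (\<integral>\<^sup>+t. u t * indicator {a<..x} t \<partial>lborel)"
        by (rule nn_integral_cong_AE) (use gu in \<open>eventually_elim, auto simp: indicator_def\<close>)
      also have "\<dots> = emeasure (density lborel u) {a<..x}"
        by (rule emeasure_density[symmetric]) (use u(1) in auto)
      also have "\<dots> = ennreal (F x - F a)"
        unfolding u(2) by (rule Ioc) (use x in auto)
      finally show ?thesis
        by (rule ennreal_inj[THEN iffD1, rotated 2])
          (use x monoF in \<open>auto simp: g_def intro!: integral_nonneg_AE\<close>)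
    qed
    ultimately have "(LBINT t. indicator {a..x} t *\<^sub>R g t) = F x - F a" by simp
    then show ?thesis using x ab by (simp add: F_def cl_def)
  qed
  with gi show ?thesis by (rule that)
qed

section \<open>Jordan decomposition of an absolutely continuous function\<close>

definition restrict_intervals :: "real \<Rightarrow> real \<Rightarrow> (real \<times> real) set \<Rightarrow> (real \<times> real) set" where
  "restrict_intervals s t D = (\<lambda>p. (max (fst p) s, min (snd p) t)) ` {p\<in>D. max (fst p) s < min (snd p) t}"

lemma intervals_disjointD:
  "intervals a b D \<Longrightarrow> p \<in> D \<Longrightarrow> q \<in> D \<Longrightarrow> fst p < x \<Longrightarrow> x < snd p \<Longrightarrow> fst q < x \<Longrightarrow> x < snd q \<Longrightarrow> p = q"
  unfolding intervals_def disjoint_family_on_def by (fastforce simp: case_prod_beta)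

lemma intervals_memD: "intervals a b D \<Longrightarrow> p \<in> D \<Longrightarrow> a \<le> fst p \<and> fst p < snd p \<and> snd p \<le> b"
  by (auto simp: intervals_def)

lemma intervals_finite: "intervals a b D \<Longrightarrow> finite D"
  by (simp add: intervals_def)

lemma intervalsI:
  assumes "finite D" "\<And>p. p \<in> D \<Longrightarrow> a \<le> fst p \<and> fst p < snd p \<and> snd p \<le> b"
    "\<And>p q x. p \<in> D \<Longrightarrow> q \<in> D \<Longrightarrow> fst p < x \<Longrightarrow> x < snd p \<Longrightarrow> fst q < x \<Longrightarrow> x < snd q \<Longrightarrow> p = q"
  shows "intervals a b D"
  unfolding intervals_def disjoint_family_on_def
proof (intro conjI ballI impI)
  fix p q assume pq: "p \<in> D" "q \<in> D" "p \<noteq> q"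
  show "(case p of (s, t) \<Rightarrow> {s<..<t}) \<inter> (case q of (s, t) \<Rightarrow> {s<..<t}) = {}"
    using assms(3)[OF pq(1,2)] pq(3) by (auto simp: case_prod_beta set_eq_iff)
next
  fix p assume "p \<in> D"
  then show "case p of (s, t) \<Rightarrow> a \<le> s \<and> s < t \<and> t \<le> b" using assms(2) by (auto simp: case_prod_beta)
qed (rule assms(1))

lemma inj_on_restrict_intervals:
  assumes "intervals a b D"
  shows "inj_on (\<lambda>p. (max (fst p) s, min (snd p) t)) {p\<in>D. max (fst p) s < min (snd p) t}"
proof (rule inj_onI)
  fix p q assume pq: "p \<in> {p\<in>D. max (fst p) s < min (snd p) t}"
    "q \<in> {p\<in>D. max (fst p) s < min (snd p) t}"
    "(max (fst p) s, min (snd p) t) = (max (fst q) s, min (snd q) t)"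
  then obtain x where "max (fst p) s < x" "x < min (snd p) t" using dense by blast
  with pq show "p = q" using intervals_disjointD[OF assms, of p q x] by auto
qed

lemma intervals_restrict:
  assumes "intervals a b D"
  shows "intervals s t (restrict_intervals s t D)"
proof (rule intervalsI)
  show "finite (restrict_intervals s t D)"
    using intervals_finite[OF assms] by (simp add: restrict_intervals_def)
  fix p q x assume pq: "p \<in> restrict_intervals s t D" "q \<in> restrict_intervals s t D"
    "fst p < x" "x < snd p" "fst q < x" "x < snd q"
  then obtain p' q' where "p' \<in> D" "q' \<in> D" "p = (max (fst p') s, min (snd p') t)"
    "q = (max (fst q') s, min (snd q') t)" by (auto simp: restrict_intervals_def)
  with pq intervals_disjointD[OF assms, of p' q' x] show "p = q" by auto
qed (auto simp: restrict_intervals_def)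

definition positive_variation :: "(real \<Rightarrow> real) \<Rightarrow> (real \<times> real) set \<Rightarrow> real" where
  "positive_variation f D = (\<Sum>p\<in>D. max 0 (f (snd p) - f (fst p)))"

text \<open>Cutting an interval at \<open>c\<close> can only raise the sum, since positive parts are
  subadditive.\<close>

lemma positive_variation_split:
  assumes D: "intervals a b D" and c: "a \<le> c" "c \<le> b"
  shows "positive_variation f D \<le>
    positive_variation f (restrict_intervals a c D) + positive_variation f (restrict_intervals c b D)"
proof -
  let ?h = "\<lambda>s t p. max 0 (f (min (snd p) t) - f (max (fst p) s))"
  have eq: "positive_variation f (restrict_intervals s t D) =
      (\<Sum>p\<in>D. if max (fst p) s < min (snd p) t then ?h s t p else 0)" for s t
    unfolding positive_variation_def restrict_intervals_def
    by (subst sum.reindex[OF inj_on_restrict_intervals[OF D]])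
      (use intervals_finite[OF D] in \<open>simp add: sum.inter_filter\<close>)
  show ?thesis
    unfolding eq sum.distrib[symmetric] positive_variation_def[of f D]
  proof (rule sum_mono)
    fix p assume "p \<in> D"
    then have p: "a \<le> fst p" "fst p < snd p" "snd p \<le> b" using intervals_memD[OF D] by auto
    consider "snd p \<le> c" | "c \<le> fst p" | "fst p < c" "c < snd p" by linarith
    then show "max 0 (f (snd p) - f (fst p)) \<le>
        (if max (fst p) a < min (snd p) c then ?h a c p else 0) +
        (if max (fst p) c < min (snd p) b then ?h c b p else 0)"
      by cases (use p in auto)
  qed
qed

definition has_primitive_on :: "real \<Rightarrow> real \<Rightarrow> (real \<Rightarrow> 'a::euclidean_space) \<Rightarrow> bool" where
  "has_primitive_on a b f \<longleftrightarrow> (\<exists>g. integrable lborel g \<and>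
     (\<forall>x\<in>{a..b}. f x = f a + (LBINT t. indicator {a..x} t *\<^sub>R g t)))"

text \<open>Jordan decomposition: with \<open>P x\<close> the supremum of the positive variations
  over families in \<open>{a..x}\<close>, both \<open>P\<close> and \<open>P - f\<close> are
  monotone and absolutely continuous, and the monotone case applies to each. Small total variation
  makes the supremum finite; it is achieved later by subdividing the interval.\<close>

lemma ac_small_variation_has_primitive:
  fixes f :: "real \<Rightarrow> real"
  assumes ab: "a \<le> b" and ac: "ac_on a b f"
    and small: "\<And>D. intervals a b D \<Longrightarrow> (\<Sum>(s, t)\<in>D. norm (f t - f s)) < 1"
  shows "has_primitive_on a b f"
proof -
  let ?V = "positive_variation f"
  define P where "P x = Sup (?V ` {D. intervals a x D})" for x
  have Vle: "?V D \<le> (\<Sum>(s, t)\<in>D. norm (f t - f s))" for D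
    unfolding positive_variation_def by (rule sum_mono) auto
  have bdd: "bdd_above (?V ` {D. intervals a x D})" if "x \<le> b" for x
  proof (rule bdd_aboveI2)
    fix D assume "D \<in> {D. intervals a x D}"
    then have "intervals a b D" using that by (auto intro: intervals_subset)
    then show "?V D \<le> 1" using Vle[of D] small[of D] by simp
  qed
  have ne: "?V ` {D. intervals a x D} \<noteq> {}" for x
    by (auto simp: intervals_def disjoint_family_on_def intro!: exI[of _ "{}"])
  have up: "?V D \<le> P x" if "intervals a x D" "x \<le> b" for D x
    unfolding P_def by (rule cSUP_upper[OF _ bdd]) (use that in auto)
  \<comment> \<open>Adjoining the interval \<open>(x, y)\<close> to a family in
    \<open>{a..x}\<close> gives a family in \<open>{a..y}\<close>. This single inequality yields
    monotonicity of both \<open>P\<close> and \<open>P - f\<close>.\<close>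
  have step: "P x + max 0 (f y - f x) \<le> P y" if xy: "a \<le> x" "x \<le> y" "y \<le> b" for x y
  proof (cases "x = y")
    case False
    have "P x \<le> P y - max 0 (f y - f x)"
      unfolding P_def[of x]
    proof (rule cSUP_least)
      show "{D. intervals a x D} \<noteq> {}" using ne[of x] by auto
      fix D assume "D \<in> {D. intervals a x D}"
      then have D: "intervals a x D" by simp
      have notin: "(x, y) \<notin> D" using intervals_memD[OF D, of "(x, y)"] False xy by auto
      have "intervals a y (insert (x, y) D)"
      proof (rule intervalsI)
        fix p assume "p \<in> insert (x, y) D"
        then show "a \<le> fst p \<and> fst p < snd p \<and> snd p \<le> y"
          using intervals_memD[OF D, of p] xy False by auto
      next
        fix p q z assume "p \<in> insert (x, y) D" "q \<in> insert (x, y) D"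
          "fst p < z" "z < snd p" "fst q < z" "z < snd q"
        then show "p = q"
          using intervals_disjointD[OF D, of p q z] intervals_memD[OF D, of p]
            intervals_memD[OF D, of q] by auto
      qed (use intervals_finite[OF D] in auto)
      then have "?V (insert (x, y) D) \<le> P y" by (rule up) (use xy in auto)
      then show "?V D \<le> P y - max 0 (f y - f x)"
        using notin intervals_finite[OF D] by (simp add: positive_variation_def)
    qed
    then show ?thesis by simp
  qed simp
  \<comment> \<open>Conversely, an increment of \<open>P\<close> is almost attained by a family
    inside \<open>{x..y}\<close>; in this way absolute continuity of \<open>f\<close> controls
    \<open>P\<close>.\<close>
  have incr: "\<exists>E. intervals x y E \<and> P y - P x \<le> ?V E + e"
    if xy: "a \<le> x" "x \<le> y" "y \<le> b" and e: "e > 0" for x y e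
  proof -
    have "P y - e < P y" using e by simp
    then obtain D where D: "intervals a y D" "P y - e < ?V D"
      unfolding P_def[of y] by (subst (asm) less_cSup_iff[OF ne bdd]) (use xy in auto)
    have "?V D \<le> ?V (restrict_intervals a x D) + ?V (restrict_intervals x y D)"
      by (rule positive_variation_split[OF D(1)]) (use xy in auto)
    moreover have "?V (restrict_intervals a x D) \<le> P x"
      by (rule up[OF intervals_restrict[OF D(1)]]) (use xy in auto)
    ultimately show ?thesis using D(2) intervals_restrict[OF D(1), of x y]
      by (intro exI[of _ "restrict_intervals x y D"]) auto
  qed
  have acP: "ac_on a b P"
    unfolding ac_on_def
  proof (intro allI impI)
    fix e :: real assume e: "e > 0"
    obtain d where d: "d > 0" "\<And>D. intervals a b D \<Longrightarrow> (\<Sum>(s, t)\<in>D. t - s) < d \<Longrightarrow>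
        (\<Sum>(s, t)\<in>D. norm (f t - f s)) < e / 2"
      using ac e unfolding ac_on_def by (metis half_gt_zero)
    show "\<exists>d>0. \<forall>D. intervals a b D \<and> (\<Sum>(s, t)\<in>D. t - s) < d \<longrightarrow>
        (\<Sum>(s, t)\<in>D. norm (P t - P s)) < e"
    proof (intro exI[of _ d] conjI allI impI d(1))
      fix D assume "intervals a b D \<and> (\<Sum>(s, t)\<in>D. t - s) < d"
      then have D: "intervals a b D" and Dd: "(\<Sum>p\<in>D. snd p - fst p) < d"
        by (auto simp: case_prod_beta)
      \<comment> \<open>One error \<open>e'\<close> is made for each member of \<open>D\<close>;
        together they stay within \<open>e / 2\<close>. The \<open>+ 1\<close> covers an empty
        \<open>D\<close>.\<close>
      define e' where "e' = e / (2 * (real (card D) + 1))"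
      have e': "e' > 0" using e by (simp add: e'_def)
      have "\<exists>E. intervals (fst p) (snd p) E \<and> P (snd p) - P (fst p) \<le> ?V E + e'" if "p \<in> D" for p
        by (rule incr) (use intervals_memD[OF D that] e' in auto)
      then obtain E where E: "\<And>p. p \<in> D \<Longrightarrow> intervals (fst p) (snd p) (E p)"
          "\<And>p. p \<in> D \<Longrightarrow> P (snd p) - P (fst p) \<le> ?V (E p) + e'" by metis
      define U where "U = (\<Union>p\<in>D. E p)"
      have same: "p = p'" if "p \<in> D" "p' \<in> D" "u \<in> E p" "v \<in> E p'"
        "fst u < x" "x < snd u" "fst v < x" "x < snd v" for p p' u v x
        using intervals_memD[OF E(1)[OF that(1)] that(3)] intervals_memD[OF E(1)[OF that(2)] that(4)] that
        by (intro intervals_disjointD[OF D, of p p' x]) auto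
      have U: "intervals a b U"
      proof (rule intervalsI)
        show "finite U" unfolding U_def using intervals_finite[OF D] intervals_finite[OF E(1)] by auto
        fix u v x assume "u \<in> U" "v \<in> U" and uv: "fst u < x" "x < snd u" "fst v < x" "x < snd v"
        then obtain p p' where pp: "p \<in> D" "p' \<in> D" "u \<in> E p" "v \<in> E p'" by (auto simp: U_def)
        with uv same[OF pp uv] show "u = v" using intervals_disjointD[OF E(1)[OF pp(1)], of u v x] by auto
      next
        fix u assume "u \<in> U"
        then obtain p where p: "p \<in> D" "u \<in> E p" by (auto simp: U_def)
        then show "a \<le> fst u \<and> fst u < snd u \<and> snd u \<le> b"
          using intervals_memD[OF E(1)[OF p(1)] p(2)] intervals_memD[OF D p(1)] by auto
      qed
      have sumU: "(\<Sum>u\<in>U. h u) = (\<Sum>p\<in>D. \<Sum>u\<in>E p. h u)" for h :: "real \<times> real \<Rightarrow> real"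
        unfolding U_def
      proof (rule sum.UNION_disjoint[OF intervals_finite[OF D]])
        show "\<forall>p\<in>D. finite (E p)" using intervals_finite[OF E(1)] by auto
        show "\<forall>p\<in>D. \<forall>p'\<in>D. p \<noteq> p' \<longrightarrow> E p \<inter> E p' = {}"
        proof (intro ballI impI, rule ccontr)
          fix p p' assume pp: "p \<in> D" "p' \<in> D" "p \<noteq> p'" "E p \<inter> E p' \<noteq> {}"
          then obtain u where u: "u \<in> E p" "u \<in> E p'" by auto
          then obtain x where "fst u < x" "x < snd u"
            using intervals_memD[OF E(1)[OF pp(1)] u(1)] dense by blast
          with same[OF pp(1,2) u] pp(3) show False by auto
        qed
      qed
      have "(\<Sum>u\<in>U. snd u - fst u) \<le> (\<Sum>p\<in>D. snd p - fst p)"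
        unfolding sumU
      proof (rule sum_mono)
        fix p assume p: "p \<in> D"
        show "(\<Sum>u\<in>E p. snd u - fst u) \<le> snd p - fst p"
          using intervals_sum_length[OF E(1)[OF p]] intervals_memD[OF D p]
          by (simp add: case_prod_beta)
      qed
      then have "(\<Sum>u\<in>U. norm (f (snd u) - f (fst u))) < e / 2"
        using d(2)[OF U] Dd by (simp add: case_prod_beta)
      then have V: "?V U < e / 2" using Vle[of U] by (simp add: case_prod_beta)
      have "(\<Sum>(s, t)\<in>D. norm (P t - P s)) = (\<Sum>p\<in>D. P (snd p) - P (fst p))"
        unfolding case_prod_beta
      proof (rule sum.cong[OF refl])
        fix p assume "p \<in> D"
        then have "P (fst p) + max 0 (f (snd p) - f (fst p)) \<le> P (snd p)"
          by (intro step) (use intervals_memD[OF D, of p] in auto)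
        then show "norm (P (snd p) - P (fst p)) = P (snd p) - P (fst p)" by auto
      qed
      also have "\<dots> \<le> (\<Sum>p\<in>D. ?V (E p) + e')" by (rule sum_mono) (rule E(2))
      also have "\<dots> = ?V U + real (card D) * e'"
        by (simp add: sum.distrib positive_variation_def sumU)
      also have "real (card D) * e' \<le> (real (card D) + 1) * e'"
        using e' by (intro mult_right_mono) auto
      also have "(real (card D) + 1) * e' = e / 2" unfolding e'_def
        by (simp add: field_simps)
      finally show "(\<Sum>(s, t)\<in>D. norm (P t - P s)) < e" using V by simp
    qed
  qed
  have monoP: "P x \<le> P y" "P x - f x \<le> P y - f y" if "a \<le> x" "x \<le> y" "y \<le> b" for x y
    using step[OF that] by auto
  have acN: "ac_on a b (\<lambda>x. P x - f x)"
    by (rule ac_on_dominated[OF acP ac, of 1]) auto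
  obtain g1 where g1: "integrable lborel g1"
      "\<And>x. x \<in> {a..b} \<Longrightarrow> P x = P a + (LBINT t. indicator {a..x} t *\<^sub>R g1 t)"
    using mono_ac_primitive[OF ab acP monoP(1)] by blast
  obtain g2 where g2: "integrable lborel g2"
      "\<And>x. x \<in> {a..b} \<Longrightarrow>
        P x - f x = P a - f a + (LBINT t. indicator {a..x} t *\<^sub>R g2 t)"
    using mono_ac_primitive[OF ab acN monoP(2)] by blast
  show ?thesis
    unfolding has_primitive_on_def
  proof (intro exI[of _ "\<lambda>t. g1 t - g2 t"] conjI ballI)
    fix x assume x: "x \<in> {a..b}"
    have "(LBINT t. indicator {a..x} t *\<^sub>R (g1 t - g2 t)) =
        (LBINT t. indicator {a..x} t *\<^sub>R g1 t) - (LBINT t. indicator {a..x} t *\<^sub>R g2 t)"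
      unfolding scaleR_diff_right
      by (rule integral_diff; rule integrable_mult_indicator)
        (auto intro: g1(1) g2(1))
    then show "f x = f a + (LBINT t. indicator {a..x} t *\<^sub>R (g1 t - g2 t))"
      using g1(2)[OF x] g2(2)[OF x] by linarith
  qed (rule integrable_diff[OF g1(1) g2(1)])
qed

lemma has_primitive_on_glue:
  assumes "has_primitive_on a c f" "has_primitive_on c b f" "a \<le> c" "c \<le> b"
  shows "has_primitive_on a b f"
proof -
  obtain g1 where g1: "integrable lborel g1"
      "\<And>x. x \<in> {a..c} \<Longrightarrow> f x = f a + (LBINT t. indicator {a..x} t *\<^sub>R g1 t)"
    using assms(1) unfolding has_primitive_on_def by blast
  obtain g2 where g2: "integrable lborel g2"
      "\<And>x. x \<in> {c..b} \<Longrightarrow> f x = f c + (LBINT t. indicator {c..x} t *\<^sub>R g2 t)"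
    using assms(2) unfolding has_primitive_on_def by blast
  define g where "g t = indicator {..c} t *\<^sub>R g1 t + indicator {c<..} t *\<^sub>R g2 t" for t
  show ?thesis
    unfolding has_primitive_on_def
  proof (intro exI[of _ g] conjI ballI)
    show "integrable lborel g" unfolding g_def
      by (intro integrable_add integrable_mult_indicator g1 g2) auto
    fix x assume x: "x \<in> {a..b}"
    show "f x = f a + (LBINT t. indicator {a..x} t *\<^sub>R g t)"
    proof (cases "x \<le> c")
      case True
      then have "(\<lambda>t. indicator {a..x} t *\<^sub>R g t) = (\<lambda>t. indicator {a..x} t *\<^sub>R g1 t)"
        by (auto simp: g_def indicator_def)
      then show ?thesis using g1(2)[of x] x True by simp
    next
      case False
      have "(LBINT t. indicator {a..x} t *\<^sub>R g t) =
          (LBINT t. indicator {a..c} t *\<^sub>R g1 t + indicator {c<..x} t *\<^sub>R g2 t)"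
        by (rule arg_cong[where f="integral\<^sup>L lborel"])
          (use False assms in \<open>auto simp: g_def indicator_def fun_eq_iff\<close>)
      also have "\<dots> = (LBINT t. indicator {a..c} t *\<^sub>R g1 t) + (LBINT t. indicator {c<..x} t *\<^sub>R g2 t)"
        by (rule integral_add; intro integrable_mult_indicator g1 g2) auto
      also have "(LBINT t. indicator {c<..x} t *\<^sub>R g2 t) = (LBINT t. indicator {c..x} t *\<^sub>R g2 t)"
        by (rule integral_cong_AE)
          (use g2(1) in \<open>auto intro!: AE_I[of _ _ "{c}"] simp: indicator_def\<close>)
      finally show ?thesis using g1(2)[of c] g2(2)[of x] False x assms by (simp add: algebra_simps)
    qed
  qed
qed

text \<open>On pieces shorter than the \<open>d\<close> that belongs to the bound 1, every family
  has variation below 1; finitely many pieces of length at most \<open>d / 2\<close> are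
  glued.\<close>

lemma ac_on_has_primitive_real:
  fixes f :: "real \<Rightarrow> real"
  assumes "a \<le> b" "ac_on a b f"
  shows "has_primitive_on a b f"
proof -
  obtain d where d: "d > 0" "\<And>D. intervals a b D \<Longrightarrow> (\<Sum>(s, t)\<in>D. t - s) < d \<Longrightarrow>
      (\<Sum>(s, t)\<in>D. norm (f t - f s)) < 1"
    using assms(2) unfolding ac_on_def by (metis zero_less_one)
  have "has_primitive_on a c f" if "a \<le> c" "c \<le> b" "c - a \<le> real n * (d / 2)" for n c
    using that
  proof (induction n arbitrary: c)
    case 0
    then have "c = a" by simp
    have *: "D = {}" if "intervals a a D" for D using intervals_memD[OF that] by fastforce
    show ?case unfolding \<open>c = a\<close>
    proof (rule ac_small_variation_has_primitive)
      fix D assume "intervals a a D"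
      then have "D = {}" by (rule *)
      then show "(\<Sum>(s, t)\<in>D. norm (f t - f s)) < 1" by simp
    qed (use assms in \<open>auto intro: ac_on_subset\<close>)
  next
    case (Suc n)
    define x where "x = max a (c - d / 2)"
    have "c - a \<le> real n * (d / 2) + d / 2" "0 \<le> real n * (d / 2)"
      using Suc.prems d(1) by (auto simp: distrib_right)
    then have x: "a \<le> x" "x \<le> c" "c - x < d" "x - a \<le> real n * (d / 2)"
      using Suc.prems d(1) unfolding x_def max_def by auto
    have "has_primitive_on x c f"
    proof (rule ac_small_variation_has_primitive[OF x(2)])
      show "ac_on x c f" using Suc.prems x by (intro ac_on_subset[OF assms(2)]) auto
      fix D assume D: "intervals x c D"
      show "(\<Sum>(s, t)\<in>D. norm (f t - f s)) < 1"
        using intervals_sum_length[OF D] x Suc.prems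
        by (intro d(2) intervals_subset[OF D]) auto
    qed
    with Suc.IH[of x] Suc.prems x show ?case by (intro has_primitive_on_glue[of a x f c]) auto
  qed
  moreover obtain n where "(b - a) / (d / 2) < real n" using reals_Archimedean2 by blast
  then have "b - a \<le> real n * (d / 2)" using d(1) by (simp add: field_simps)
  ultimately show ?thesis using assms(1) by blast
qed

lemma ac_on_has_primitive:
  fixes f :: "real \<Rightarrow> 'a::euclidean_space"
  assumes "a \<le> b" "ac_on a b f"
  shows "has_primitive_on a b f"
proof -
  have "has_primitive_on a b (\<lambda>x. f x \<bullet> i)" if "i \<in> Basis" for i
    by (rule ac_on_has_primitive_real[OF assms(1)], rule ac_on_mono_diff[OF assms(2)])
      (use that in \<open>simp add: inner_diff_left[symmetric] Basis_le_norm\<close>)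
  then obtain g where g: "\<And>i. i \<in> Basis \<Longrightarrow> integrable lborel (g i)"
      "\<And>i x. i \<in> Basis \<Longrightarrow> x \<in> {a..b} \<Longrightarrow>
        f x \<bullet> i = f a \<bullet> i + (LBINT t. indicator {a..x} t *\<^sub>R g i t)"
    unfolding has_primitive_on_def by metis
  define G where "G t = (\<Sum>i\<in>Basis. g i t *\<^sub>R i)" for t
  have G: "integrable lborel G" unfolding G_def
    by (intro Bochner_Integration.integrable_sum) (auto intro!: g)
  show ?thesis
    unfolding has_primitive_on_def
  proof (intro exI[of _ G] conjI ballI G)
    fix x assume x: "x \<in> {a..b}"
    show "f x = f a + (LBINT t. indicator {a..x} t *\<^sub>R G t)"
    proof (rule euclidean_eqI)
      fix i :: 'a assume i: "i \<in> Basis"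
      have "(LBINT t. indicator {a..x} t *\<^sub>R G t) \<bullet> i = (LBINT t. (indicator {a..x} t *\<^sub>R G t) \<bullet> i)"
        by (rule integral_inner_left[symmetric]) (auto intro!: integrable_mult_indicator G)
      also have "\<dots> = (LBINT t. indicator {a..x} t *\<^sub>R g i t)"
        using i by (simp add: G_def inner_sum_left inner_Basis if_distrib cong: if_cong)
      finally show "f x \<bullet> i = (f a + (LBINT t. indicator {a..x} t *\<^sub>R G t)) \<bullet> i"
        using g(2)[OF i x] by (simp add: inner_add_left)
    qed
  qed
qed

section \<open>Locally absolutely continuous functions with square integrable derivative\<close>

text \<open>Lebesgue's differentiation theorem for intervals to the right of \<open>x\<close>. The
  form without division fits the definition of the derivative.\<close>

lemma integral_at_right_quotient:
  fixes g :: "real \<Rightarrow> 'a::euclidean_space"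
  assumes g: "integrable lborel g"
  shows "AE x in lborel. \<forall>e>0. \<exists>d>0. \<forall>h. 0 < h \<and> h < d \<longrightarrow>
    norm ((LBINT t. indicator {x..x + h} t *\<^sub>R g t) - h *\<^sub>R g x) \<le> e * h"
proof -
  have si: "set_integrable lborel S g" if "S \<in> sets borel" for S
    unfolding set_integrable_def by (rule integrable_mult_indicator[OF _ g]) (use that in simp)
  obtain N where N: "negligible N"
      "\<And>x e. x \<notin> N \<Longrightarrow> 0 < e \<Longrightarrow> \<exists>d>0. \<forall>h. 0 < h \<and> h < d \<longrightarrow>
         norm (integral (cbox x (x + h *\<^sub>R One)) g /\<^sub>R h ^ DIM(real) - g x) < e"
  proof (rule integrable_ccontinuous_explicit)
    show "g integrable_on cbox a b" for a b
      using si[of "cbox a b"] by (intro set_borel_integral_eq_integral(1)) auto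
  qed blast
  have key: "\<exists>d>0. \<forall>h. 0 < h \<and> h < d \<longrightarrow>
      norm ((LBINT t. indicator {x..x + h} t *\<^sub>R g t) - h *\<^sub>R g x) \<le> e * h"
    if x: "x \<notin> N" and e: "e > 0" for x e
  proof -
    obtain d where d: "d > 0" "\<And>h. 0 < h \<Longrightarrow> h < d \<Longrightarrow>
        norm (integral (cbox x (x + h *\<^sub>R One)) g /\<^sub>R h ^ DIM(real) - g x) < e"
      using N(2)[OF x e] by blast
    show ?thesis
    proof (intro exI[of _ d] conjI allI impI d(1))
      fix h assume h: "0 < h \<and> h < d"
      let ?I = "\<integral>t. indicator {x..x + h} t *\<^sub>R g t \<partial>lborel"
      have "?I = integral {x..x + h} g"
        using set_borel_integral_eq_integral(2)[OF si[of "{x..x + h}"]]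
        by (simp add: set_lebesgue_integral_def)
      then have "norm (?I /\<^sub>R h - g x) \<le> e"
        using d(2)[of h] h by (simp add: less_imp_le)
      then have "h * norm (?I /\<^sub>R h - g x) \<le> h * e" using h by (intro mult_left_mono) auto
      moreover have "h * norm (?I /\<^sub>R h - g x) = norm (h *\<^sub>R (?I /\<^sub>R h - g x))"
        using h by simp
      moreover have "h *\<^sub>R (?I /\<^sub>R h - g x) = ?I - h *\<^sub>R g x"
        using h by (simp add: scaleR_diff_right)
      ultimately show "norm (?I - h *\<^sub>R g x) \<le> e * h" by (simp add: mult.commute)
    qed
  qed
  have "N \<in> null_sets lebesgue" using N(1) by (simp add: negligible_iff_null_sets)
  then have "AE x in completion lborel. x \<notin> N" by (rule AE_not_in)
  then have "AE x in lborel. x \<notin> N" by (simp add: AE_completion_iff)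
  then show ?thesis by eventually_elim (use key in blast)
qed

text \<open>Increments to the right are settled by the one-sided theorem for \<open>g\<close>; those
  to the left of \<open>x\<close> are increments to the right of \<open>- x\<close> for the
  reflected function \<open>g (- t)\<close>.\<close>

lemma primitive_has_vector_derivative_AE:
  fixes g :: "real \<Rightarrow> 'a::euclidean_space"
  assumes g: "integrable lborel g"
  shows "AE x in lborel. x > a \<longrightarrow>
    ((\<lambda>x. LBINT t. indicator {a..x} t *\<^sub>R g t) has_vector_derivative g x) (at x)"
proof -
  let ?F = "\<lambda>x. \<integral>t. indicator {a..x} t *\<^sub>R g t \<partial>lborel"
  let ?Q = "\<lambda>g x. \<forall>e>0. \<exists>d>0. \<forall>h. 0 < h \<and> h < d \<longrightarrow>
    norm ((LBINT t. indicator {x..x + h} t *\<^sub>R g t) - h *\<^sub>R g x) \<le> (e::real) * h"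
  have gi: "integrable lborel (\<lambda>t. indicator S t *\<^sub>R g t)" if "S \<in> sets borel" for S
    by (rule integrable_mult_indicator[OF _ g]) (use that in simp)
  have gm [measurable]: "g \<in> borel_measurable borel" using borel_measurable_integrable[OF g] by simp
  have R: "AE x in lborel. ?Q g x" by (rule integral_at_right_quotient[OF g])
  have g': "integrable lborel (\<lambda>t. g (- t))"
    using lborel_integrable_real_affine[OF g, of "-1" 0] by simp
  have "AE x in lborel. ?Q (\<lambda>t. g (- t)) x" by (rule integral_at_right_quotient[OF g'])
  then obtain N where N: "N \<in> null_sets lborel" "\<And>x. x \<notin> N \<Longrightarrow> ?Q (\<lambda>t. g (- t)) x"
    by (auto elim!: AE_E3)
  have "AE x in lborel. - x \<notin> N"
  proof -
    have "AE x in distr lborel borel uminus. x \<notin> N"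
      unfolding lborel_distr_uminus by (rule AE_not_in[OF N(1)])
    then show ?thesis by (subst (asm) AE_distr_iff) (use N(1) in auto)
  qed
  with R show ?thesis
  proof eventually_elim
    fix x assume Rx: "?Q g x" and Nx: "- x \<notin> N"
    have Lx: "?Q (\<lambda>t. g (- t)) (- x)" by (rule N(2)[OF Nx])
    show "a < x \<longrightarrow> (?F has_vector_derivative g x) (at x)"
    proof
      assume ax: "a < x"
      have split: "?F y - ?F x = (LBINT t. indicator {x..y} t *\<^sub>R g t)" if "a \<le> x" "x \<le> y" for x y
      proof -
        have "?F y - ?F x = (LBINT t. indicator {a..y} t *\<^sub>R g t - indicator {a..x} t *\<^sub>R g t)"
          by (rule integral_diff[symmetric]; rule gi) auto
        also have "\<dots> = (LBINT t. indicator {x..y} t *\<^sub>R g t)"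
        proof (rule integral_cong_AE)
          show "AE t in lborel. indicator {a..y} t *\<^sub>R g t - indicator {a..x} t *\<^sub>R g t =
              indicator {x..y} t *\<^sub>R g t"
            using AE_lborel_singleton[of x]
          proof eventually_elim
            fix t assume "t \<noteq> x"
            then consider "t < x" | "x < t" by linarith
            then show "indicator {a..y} t *\<^sub>R g t - indicator {a..x} t *\<^sub>R g t =
                indicator {x..y} t *\<^sub>R g t"
              by cases (use that in \<open>simp_all add: indicator_def\<close>)
          qed
        qed measurable
        finally show ?thesis .
      qed
      show "(?F has_vector_derivative g x) (at x)"
        unfolding has_vector_derivative_def has_derivative_at_alt
      proof (intro conjI allI impI bounded_linear_scaleR_left)
        fix e :: real assume e: "e > 0"
        obtain d1 where d1: "d1 > 0" "\<forall>h. 0 < h \<and> h < d1 \<longrightarrow>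
            norm ((LBINT t. indicator {x..x + h} t *\<^sub>R g t) - h *\<^sub>R g x) \<le> e * h"
          using Rx[THEN spec, THEN mp, OF e] by (elim exE conjE)
        obtain d2 where d2: "d2 > 0" "\<forall>h. 0 < h \<and> h < d2 \<longrightarrow>
            norm ((LBINT t. indicator {- x..- x + h} t *\<^sub>R g (- t)) - h *\<^sub>R g (- (- x))) \<le> e * h"
          using Lx[THEN spec, THEN mp, OF e] by (elim exE conjE)
        show "\<exists>d>0. \<forall>y. norm (y - x) < d \<longrightarrow>
            norm (?F y - ?F x - (y - x) *\<^sub>R g x) \<le> e * norm (y - x)"
        proof (intro exI[of _ "min (x - a) (min d1 d2)"] conjI allI impI)
          fix y assume y: "norm (y - x) < min (x - a) (min d1 d2)"
          consider "y = x" | "x < y" | "y < x" by linarith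
          then show "norm (?F y - ?F x - (y - x) *\<^sub>R g x) \<le> e * norm (y - x)"
          proof cases
            case 2
            then show ?thesis using d1(2)[rule_format, of "y - x"] y ax by (simp add: split)
          next
            case 3
            have ay: "a \<le> y" using y 3 by auto
            have "(LBINT t. indicator {- x..- x + (x - y)} t *\<^sub>R g (- t)) =
                (LBINT t. indicator {y..x} (- t) *\<^sub>R g (- t))"
              by (rule arg_cong[where f="integral\<^sup>L lborel"]) (auto simp: indicator_def fun_eq_iff)
            also have "\<dots> = (LBINT t. indicator {y..x} t *\<^sub>R g t)"
              using lborel_integral_real_affine[of "-1" "\<lambda>t. indicator {y..x} t *\<^sub>R g t" 0] by simp
            also have "\<dots> = ?F x - ?F y" using split[OF ay] 3 by simp
            finally have "norm ((?F x - ?F y) - (x - y) *\<^sub>R g x) \<le> e * (x - y)"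
              using d2(2)[rule_format, of "x - y"] 3 y by simp
            moreover have "?F y - ?F x - (y - x) *\<^sub>R g x = - ((?F x - ?F y) - (x - y) *\<^sub>R g x)"
              by (simp add: algebra_simps)
            ultimately show ?thesis using 3 by (simp only: norm_minus_cancel) simp
          qed simp
        qed (use d1 d2 ax in auto)
      qed
    qed
  qed
qed

text \<open>Working form of \<open>H1_loc\<close>. The derivative is carried along as a Borel
  function that is 0 outside \<open>[0, L)\<close>, so integrals run over the whole line with
  respect to \<open>lborel\<close>. The codomain is general because real solutions and real test
  functions occur too.\<close>

definition weak_derivative :: "ereal \<Rightarrow> (real \<Rightarrow> 'a::euclidean_space) \<Rightarrow> (real \<Rightarrow> 'a) \<Rightarrow> bool" where
  "weak_derivative L f g \<longleftrightarrow> g \<in> borel_measurable borel \<and> (\<forall>x. x \<notin> half_open L \<longrightarrow> g x = 0) \<and>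
     (\<forall>c\<in>half_open L. integrable lborel (\<lambda>t. indicator {0..c} t *\<^sub>R (norm (g t))\<^sup>2)) \<and>
     (\<forall>x\<in>half_open L. f x = f 0 + (LBINT t. indicator {0..x} t *\<^sub>R g t))"

lemma half_open_downward: "c \<in> half_open L \<Longrightarrow> 0 \<le> x \<Longrightarrow> x \<le> c \<Longrightarrow> x \<in> half_open L"
  unfolding half_open_def by (auto intro: le_less_trans[of "ereal x" "ereal c"])

lemma half_open_nonneg: "c \<in> half_open L \<Longrightarrow> 0 \<le> c"
  by (simp add: half_open_def)

lemma zero_in_half_open: "0 < L \<Longrightarrow> 0 \<in> half_open L"
  by (simp add: half_open_def zero_ereal_def)

lemma half_open_measurable [measurable]: "half_open L \<in> sets borel"
proof -
  have "{x \<in> space borel. 0 \<le> x \<and> ereal x < L} \<in> sets borel" by measurable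
  then show ?thesis by (simp add: half_open_def)
qed

text \<open>A rational larger point makes countably many intervals \<open>{0..c}\<close> exhaust
  \<open>[0, L)\<close>, for finite and for infinite \<open>L\<close> alike.\<close>

lemma half_open_extend:
  assumes "c \<in> half_open L"
  obtains c' where "c < c'" "c' \<in> half_open L" "c' \<in> \<rat>"
proof -
  have "ereal c < L" using assms by (simp add: half_open_def)
  then obtain r where r: "ereal c < ereal (real_of_rat r)" "ereal (real_of_rat r) < L"
    using ereal_dense3 by blast
  have "c < real_of_rat r" using r(1) by simp
  then have "0 \<le> real_of_rat r" using half_open_nonneg[OF assms] by linarith
  with r show ?thesis by (intro that[of "real_of_rat r"]) (auto simp: half_open_def)
qed

lemma weak_derivative_measurable: "weak_derivative L f g \<Longrightarrow> g \<in> borel_measurable borel"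
  by (simp add: weak_derivative_def)

lemma weak_derivative_outside: "weak_derivative L f g \<Longrightarrow> x \<notin> half_open L \<Longrightarrow> g x = 0"
  by (simp add: weak_derivative_def)

lemma weak_derivative_square_integrable:
  "weak_derivative L f g \<Longrightarrow> c \<in> half_open L \<Longrightarrow>
    integrable lborel (\<lambda>t. indicator {0..c} t * (norm (g t))\<^sup>2)"
  by (simp add: weak_derivative_def)

lemma integrable_of_square_integrable_on:
  fixes g :: "real \<Rightarrow> 'a::euclidean_space"
  assumes [measurable]: "g \<in> borel_measurable borel"
    and "integrable lborel (\<lambda>t. indicator {a..b} t * (norm (g t))\<^sup>2)"
  shows "integrable lborel (\<lambda>t. indicator {a..b} t *\<^sub>R g t)"
proof (rule integrable_bound)
  show "integrable lborel (\<lambda>t. indicator {a..b} t + indicator {a..b} t * (norm (g t))\<^sup>2)"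
    by (rule integrable_add[OF _ assms(2)]) (simp add: integrable_indicator_iff emeasure_lborel_Icc_eq)
  have "norm (g t) \<le> 1 + (norm (g t))\<^sup>2" for t
    using sum_power2_ge_zero[of "norm (g t) - 1" "norm (g t)"] by (simp add: power2_eq_square algebra_simps)
  then show "AE t in lborel. norm (indicator {a..b} t *\<^sub>R g t) \<le>
      norm (indicator {a..b} t + indicator {a..b} t * (norm (g t))\<^sup>2)"
    by (auto simp: indicator_def)
qed measurable

lemma weak_derivative_integrable:
  "weak_derivative L f g \<Longrightarrow> c \<in> half_open L \<Longrightarrow> integrable lborel (\<lambda>t. indicator {0..c} t *\<^sub>R g t)"
  by (intro integrable_of_square_integrable_on weak_derivative_measurable
      weak_derivative_square_integrable)

lemma weak_derivative_integrable_sub: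
  assumes "weak_derivative L f g" "c \<in> half_open L" "S \<subseteq> {0..c}" "S \<in> sets borel"
  shows "integrable lborel (\<lambda>t. indicator S t *\<^sub>R g t)"
proof -
  have "integrable lborel (\<lambda>t. indicator S t *\<^sub>R indicator {0..c} t *\<^sub>R g t)"
    by (rule integrable_mult_indicator[OF _ weak_derivative_integrable[OF assms(1,2)]])
      (use assms(4) in simp)
  moreover have "indicator S t *\<^sub>R indicator {0..c} t *\<^sub>R g t = indicator S t *\<^sub>R g t" for t
    using assms(3) by (auto simp: indicator_def)
  ultimately show ?thesis by (simp only:)
qed

lemma weak_derivative_eq:
  "weak_derivative L f g \<Longrightarrow> x \<in> half_open L \<Longrightarrow> f x = f 0 + (LBINT t. indicator {0..x} t *\<^sub>R g t)"
  unfolding weak_derivative_def by blast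

lemma weak_derivative_diff:
  assumes "weak_derivative L f g" "0 \<le> x" "x \<le> y" "y \<in> half_open L"
  shows "f y - f x = (LBINT t. indicator {x<..y} t *\<^sub>R g t)"
proof -
  have x: "x \<in> half_open L" using assms half_open_downward by blast
  have "f y - f x = (LBINT t. indicator {0..y} t *\<^sub>R g t) - (LBINT t. indicator {0..x} t *\<^sub>R g t)"
    using weak_derivative_eq[OF assms(1) x] weak_derivative_eq[OF assms(1,4)] by (simp add: algebra_simps)
  also have "\<dots> = (LBINT t. indicator {0..y} t *\<^sub>R g t - indicator {0..x} t *\<^sub>R g t)"
    by (rule integral_diff[symmetric])
      (use weak_derivative_integrable[OF assms(1)] x assms(4) in auto)
  also have "(\<lambda>t. indicator {0..y} t *\<^sub>R g t - indicator {0..x} t *\<^sub>R g t) = (\<lambda>t. indicator {x<..y} t *\<^sub>R g t)"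
  proof
    fix t
    consider "t \<le> x" | "x < t" by linarith
    then show "indicator {0..y} t *\<^sub>R g t - indicator {0..x} t *\<^sub>R g t = indicator {x<..y} t *\<^sub>R g t"
      by cases (use assms(2,3) in \<open>auto simp: indicator_def\<close>)
  qed
  finally show ?thesis .
qed

text \<open>\<open>2 |g| \<le> 1 / \<eta> + \<eta> |g|\<^sup>2\<close> turns square integrability into absolute continuity of the primitive.\<close>

lemma weak_derivative_ac_on:
  assumes wd: "weak_derivative L f g" and c: "c \<in> half_open L"
  shows "ac_on 0 c f"
  unfolding ac_on_def
proof (intro allI impI)
  fix e :: real assume e: "e > 0"
  note [measurable] = weak_derivative_measurable[OF wd]
  define A where "A = (LBINT t. indicator {0..c} t * (norm (g t))\<^sup>2)"
  have A: "A \<ge> 0" unfolding A_def by (intro integral_nonneg_AE) auto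
  \<comment> \<open>This weight keeps the contribution \<open>\<eta> * A\<close> of the derivative
    below \<open>e\<close>. The rest of \<open>e\<close> is left for the total length, which yields
    the bound \<open>\<eta> * (e - \<eta> * A)\<close> used below.\<close>
  define \<eta> where "\<eta> = e / (A + 1)"
  have \<eta>: "\<eta> > 0" using A e by (simp add: \<eta>_def)
  have \<eta>A: "\<eta> * A < e"
  proof -
    have "\<eta> * A < \<eta> * (A + 1)" using \<eta> by simp
    also have "\<dots> = e" using A by (simp add: \<eta>_def)
    finally show ?thesis .
  qed
  have sq: "integrable lborel (\<lambda>t. indicator S t * (norm (g t))\<^sup>2)" if "S \<subseteq> {0..c}" "S \<in> sets borel" for S
  proof -
    have "integrable lborel (\<lambda>t. indicator S t *\<^sub>R (indicator {0..c} t * (norm (g t))\<^sup>2))"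
      by (rule integrable_mult_indicator[OF _ weak_derivative_square_integrable[OF wd c]])
        (use that in simp)
    moreover have "indicator S t *\<^sub>R (indicator {0..c} t * (norm (g t))\<^sup>2) = indicator S t * (norm (g t))\<^sup>2" for t
      using that by (auto simp: indicator_def)
    ultimately show ?thesis by (simp only:)
  qed
  have incr: "norm (f t - f s) \<le> (t - s) / \<eta> + \<eta> * (LBINT u. indicator {s<..t} u * (norm (g u))\<^sup>2)"
    if st: "0 \<le> s" "s < t" "t \<le> c" for s t
  proof -
    have tL: "t \<in> half_open L" using c st by (intro half_open_downward[OF c]) auto
    have S: "{s<..t} \<subseteq> {0..c}" using st by auto
    have I: "integrable lborel (\<lambda>u. indicator {s<..t} u *\<^sub>R g u)"
      by (rule weak_derivative_integrable_sub[OF wd c S]) simp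
    have "norm (f t - f s) \<le> (LBINT u. norm (indicator {s<..t} u *\<^sub>R g u))"
      unfolding weak_derivative_diff[OF wd st(1) less_imp_le[OF st(2)] tL]
      by (rule integral_norm_bound)
    also have "\<dots> \<le> (LBINT u. indicator {s<..t} u / \<eta> + \<eta> * (indicator {s<..t} u * (norm (g u))\<^sup>2))"
    proof (rule integral_mono)
      show "integrable lborel (\<lambda>u. norm (indicator {s<..t} u *\<^sub>R g u))" by (rule integrable_norm[OF I])
      show "integrable lborel (\<lambda>u. indicator {s<..t} u / \<eta> + \<eta> * (indicator {s<..t} u * (norm (g u))\<^sup>2))"
        using sq[OF S] st by (auto intro!: integrable_add simp: integrable_indicator_iff)
      fix u
      have "0 \<le> (1 - \<eta> * norm (g u))\<^sup>2 + (\<eta> * norm (g u))\<^sup>2 + 1" by (intro add_nonneg_nonneg) auto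
      then have "2 * (\<eta> * norm (g u)) \<le> 2 * (1 + \<eta>\<^sup>2 * (norm (g u))\<^sup>2)"
        by (simp add: power2_eq_square algebra_simps)
      then have "norm (g u) \<le> 1 / \<eta> + \<eta> * (norm (g u))\<^sup>2"
        using \<eta> by (simp add: field_simps power2_eq_square)
      then show "norm (indicator {s<..t} u *\<^sub>R g u) \<le>
          indicator {s<..t} u / \<eta> + \<eta> * (indicator {s<..t} u * (norm (g u))\<^sup>2)"
        by (auto simp: indicator_def)
    qed
    also have "\<dots> = (t - s) / \<eta> + \<eta> * (LBINT u. indicator {s<..t} u * (norm (g u))\<^sup>2)"
      using sq[OF S] st by (subst integral_add) (auto simp: integrable_indicator_iff)
    finally show ?thesis .
  qed
  show "\<exists>d>0. \<forall>D. intervals 0 c D \<and> (\<Sum>(s, t)\<in>D. t - s) < d \<longrightarrow>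
      (\<Sum>(s, t)\<in>D. norm (f t - f s)) < e"
  proof (intro exI[of _ "\<eta> * (e - \<eta> * A)"] conjI allI impI)
    fix D assume "intervals 0 c D \<and> (\<Sum>(s, t)\<in>D. t - s) < \<eta> * (e - \<eta> * A)"
    then have D: "intervals 0 c D" and Dd: "(\<Sum>p\<in>D. snd p - fst p) < \<eta> * (e - \<eta> * A)"
      by (auto simp: case_prod_beta)
    note memD = intervals_memD[OF D]
    let ?J = "\<lambda>p u. indicator {fst p<..snd p} u * (norm (g u))\<^sup>2"
    have Ji: "integrable lborel (?J p)" if "p \<in> D" for p
      by (rule sq) (use memD[OF that] in auto)
    \<comment> \<open>The right ends may be added to disjoint open intervals: a common point of two
      half-open members would force common interior points just left of it.\<close>
    have disj: "(\<Sum>p\<in>D. indicator {fst p<..snd p} u) \<le> (indicator {0..c} u :: real)" for u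
    proof (cases "\<exists>p\<in>D. u \<in> {fst p<..snd p}")
      case True
      then obtain p where p: "p \<in> D" "u \<in> {fst p<..snd p}" by blast
      have "(\<Sum>q\<in>D. indicator {fst q<..snd q} u) = (\<Sum>q\<in>D. if q = p then 1 else (0::real))"
      proof (rule sum.cong[OF refl])
        fix q assume q: "q \<in> D"
        have *: "q = p" if u: "u \<in> {fst q<..snd q}"
        proof -
          obtain v where "max (fst p) (fst q) < v" "v < u" using p u dense[of "max (fst p) (fst q)" u] by auto
          then show ?thesis using intervals_disjointD[OF D q p(1), of v] u p(2) by auto
        qed
        show "indicator {fst q<..snd q} u = (if q = p then 1 else (0::real))"
        proof (cases "q = p")
          case False
          then have "u \<notin> {fst q<..snd q}" using * by blast
          with False show ?thesis by (subst indicator_simps(2)) simp_all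
        qed (use p(2) in simp)
      qed
      also have "\<dots> = 1" using p(1) intervals_finite[OF D] by simp
      finally show ?thesis using p memD[OF p(1)] by (auto simp: indicator_def)
    qed (simp add: sum.neutral)
    have "(\<Sum>(s, t)\<in>D. norm (f t - f s)) \<le>
        (\<Sum>p\<in>D. (snd p - fst p) / \<eta> + \<eta> * (LBINT u. ?J p u))"
      unfolding case_prod_beta by (rule sum_mono) (rule incr; use memD in auto)
    also have "\<dots> = (\<Sum>p\<in>D. snd p - fst p) / \<eta> + \<eta> * (LBINT u. (\<Sum>p\<in>D. ?J p u))"
      by (subst Bochner_Integration.integral_sum)
        (auto intro: Ji simp: sum.distrib sum_distrib_left sum_divide_distrib)
    also have "(LBINT u. (\<Sum>p\<in>D. ?J p u)) \<le> A"
      unfolding A_def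
    proof (rule integral_mono)
      show "integrable lborel (\<lambda>u. \<Sum>p\<in>D. ?J p u)" by (rule Bochner_Integration.integrable_sum) (rule Ji)
      show "(\<Sum>p\<in>D. ?J p u) \<le> indicator {0..c} u * (norm (g u))\<^sup>2" for u
        unfolding sum_distrib_right[symmetric] by (rule mult_right_mono[OF disj]) simp
    qed (rule weak_derivative_square_integrable[OF wd c])
    also have "(\<Sum>p\<in>D. snd p - fst p) / \<eta> < e - \<eta> * A"
      using Dd \<eta> by (simp add: pos_divide_less_eq mult.commute)
    finally show "(\<Sum>(s, t)\<in>D. norm (f t - f s)) < e" using \<eta> by simp
  qed (use \<eta> \<eta>A in simp)
qed

lemma ac_on_continuous_on_half_open:
  assumes "\<And>c. c \<in> half_open L \<Longrightarrow> ac_on 0 c f"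
  shows "continuous_on (half_open L) f"
  unfolding continuous_on_eq_continuous_within
proof
  fix x assume x: "x \<in> half_open L"
  obtain c where c: "x < c" "c \<in> half_open L" using half_open_extend[OF x] by blast
  have "continuous_on {0..c} f" by (rule ac_on_continuous[OF assms[OF c(2)]])
  then have "continuous (at x within {0..c}) f"
    using x c by (auto simp: continuous_on_eq_continuous_within half_open_def)
  moreover have "at x within {0..c} = at x within half_open L"
  proof (rule at_within_nhd[of _ "{..<c}"])
    show "{0..c} \<inter> {..<c} - {x} = half_open L \<inter> {..<c} - {x}"
      using half_open_downward[OF c(2)] by (auto simp: half_open_def)
  qed (use c in auto)
  ultimately show "continuous (at x within half_open L) f" by (simp only:)
qed

lemma weak_derivative_continuous_on: "weak_derivative L f g \<Longrightarrow> continuous_on (half_open L) f"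
  by (rule ac_on_continuous_on_half_open) (rule weak_derivative_ac_on)

lemma AE_half_open:
  assumes "\<And>c. c \<in> half_open L \<Longrightarrow> AE x in M. 0 < x \<and> x < c \<longrightarrow> P x" "AE x in M. x \<noteq> 0"
  shows "AE x in M. x \<in> half_open L \<longrightarrow> P x"
proof -
  have "countable (\<rat> \<inter> half_open L)" by (rule countable_subset[OF _ countable_rat]) auto
  then have "AE x in M. \<forall>c\<in>\<rat> \<inter> half_open L. 0 < x \<and> x < c \<longrightarrow> P x"
    by (subst AE_ball_countable) (use assms(1) in auto)
  with assms(2) show ?thesis
  proof eventually_elim
    fix x assume x: "x \<noteq> 0" "\<forall>c\<in>\<rat> \<inter> half_open L. 0 < x \<and> x < c \<longrightarrow> P x"
    show "x \<in> half_open L \<longrightarrow> P x"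
    proof
      assume xL: "x \<in> half_open L"
      obtain c where "x < c" "c \<in> half_open L" "c \<in> \<rat>" using half_open_extend[OF xL] by blast
      then show "P x" using x xL by (auto simp: half_open_def)
    qed
  qed
qed

lemma AE_half_open_lborel:
  "(\<And>c. c \<in> half_open L \<Longrightarrow> AE x in lborel. 0 < x \<and> x < c \<longrightarrow> P x) \<Longrightarrow>
    AE x in lborel. x \<in> half_open L \<longrightarrow> P x"
  by (rule AE_half_open[OF _ AE_lborel_singleton[of 0]])

lemma primitive_on_has_vector_derivative_AE:
  fixes f :: "real \<Rightarrow> 'a::euclidean_space"
  assumes "integrable lborel g" "\<And>x. x \<in> {0..c} \<Longrightarrow> f x = f 0 + (LBINT t. indicator {0..x} t *\<^sub>R g t)"
  shows "AE x in lborel. 0 < x \<and> x < c \<longrightarrow> (f has_vector_derivative g x) (at x)"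
  using primitive_has_vector_derivative_AE[OF assms(1), of 0]
proof eventually_elim
  fix x assume x: "0 < x \<longrightarrow> ((\<lambda>x. LBINT t. indicator {0..x} t *\<^sub>R g t) has_vector_derivative g x) (at x)"
  show "0 < x \<and> x < c \<longrightarrow> (f has_vector_derivative g x) (at x)"
  proof
    assume xc: "0 < x \<and> x < c"
    have "((\<lambda>x. f 0 + (LBINT t. indicator {0..x} t *\<^sub>R g t)) has_vector_derivative 0 + g x) (at x)"
      using x xc by (intro has_vector_derivative_add) auto
    then have D: "((\<lambda>x. f 0 + (LBINT t. indicator {0..x} t *\<^sub>R g t)) has_vector_derivative g x) (at x)"
      by simp
    show "(f has_vector_derivative g x) (at x)"
    proof (rule has_vector_derivative_transform_within_open[OF D, of "{0<..<c}"])
      fix y assume "y \<in> {0<..<c}"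
      then show "f 0 + (LBINT t. indicator {0..y} t *\<^sub>R g t) = f y"
        by (intro assms(2)[symmetric]) simp
    qed (use xc in auto)
  qed
qed

lemma weak_derivative_AE:
  assumes wd: "weak_derivative L f g"
  shows "AE x in lborel. x \<in> half_open L \<longrightarrow> 0 < x \<and> (f has_vector_derivative g x) (at x)"
proof (rule AE_half_open_lborel)
  fix c assume c: "c \<in> half_open L"
  have "f x = f 0 + (LBINT t. indicator {0..x} t *\<^sub>R indicator {0..c} t *\<^sub>R g t)" if "x \<in> {0..c}" for x
  proof -
    have "(\<lambda>t. indicator {0..x} t *\<^sub>R indicator {0..c} t *\<^sub>R g t) = (\<lambda>t. indicator {0..x} t *\<^sub>R g t)"
      using that by (auto simp: indicator_def)
    moreover have "x \<in> half_open L" using that half_open_downward[OF c] by simp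
    ultimately show ?thesis using weak_derivative_eq[OF wd, of x] by (simp only:)
  qed
  then have "AE x in lborel. 0 < x \<and> x < c \<longrightarrow> (f has_vector_derivative indicator {0..c} x *\<^sub>R g x) (at x)"
    by (rule primitive_on_has_vector_derivative_AE[OF weak_derivative_integrable[OF wd c]])
  then show "AE x in lborel. 0 < x \<and> x < c \<longrightarrow> 0 < x \<and> (f has_vector_derivative g x) (at x)"
    by eventually_elim auto
qed

text \<open>By absolute continuity \<open>f\<close> is locally the integral of some
  \<open>u\<close>; both \<open>u\<close> and \<open>g\<close> are its derivative almost everywhere,
  so they agree. Product and reciprocal rules thus reduce to the rules at points of
  differentiability.\<close>

lemma weak_derivativeI:
  fixes f :: "real \<Rightarrow> 'a::euclidean_space"
  assumes g [measurable]: "g \<in> borel_measurable borel" and out: "\<And>x. x \<notin> half_open L \<Longrightarrow> g x = 0"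
    and sq: "\<And>c. c \<in> half_open L \<Longrightarrow> integrable lborel (\<lambda>t. indicator {0..c} t * (norm (g t))\<^sup>2)"
    and ac: "\<And>c. c \<in> half_open L \<Longrightarrow> ac_on 0 c f"
    and der: "AE x in lborel. x \<in> half_open L \<longrightarrow> 0 < x \<longrightarrow> (f has_vector_derivative g x) (at x)"
  shows "weak_derivative L f g"
  unfolding weak_derivative_def
proof (intro conjI ballI allI impI)
  fix c assume c: "c \<in> half_open L"
  obtain u where u: "integrable lborel u"
      "\<And>x. x \<in> {0..c} \<Longrightarrow> f x = f 0 + (LBINT t. indicator {0..x} t *\<^sub>R u t)"
    using ac_on_has_primitive[OF half_open_nonneg[OF c] ac[OF c]] unfolding has_primitive_on_def by blast
  have "AE x in lborel. 0 < x \<and> x < c \<longrightarrow> (f has_vector_derivative u x) (at x)"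
    using u by (rule primitive_on_has_vector_derivative_AE)
  then have "AE t in lborel. indicator {0..c} t *\<^sub>R u t = indicator {0..c} t *\<^sub>R g t"
    using der AE_lborel_singleton[of c] AE_lborel_singleton[of 0]
  proof eventually_elim
    fix t assume t: "0 < t \<and> t < c \<longrightarrow> (f has_vector_derivative u t) (at t)"
      "t \<in> half_open L \<longrightarrow> 0 < t \<longrightarrow> (f has_vector_derivative g t) (at t)" "t \<noteq> c" "t \<noteq> 0"
    show "indicator {0..c} t *\<^sub>R u t = indicator {0..c} t *\<^sub>R g t"
    proof (cases "t \<in> {0..c}")
      case True
      then have "t \<in> half_open L" using half_open_downward[OF c] by auto
      then have "u t = g t" using t True by (intro vector_derivative_unique_at[of f]) auto
      then show ?thesis by simp
    qed simp
  qed
  then have "(LBINT t. indicator {0..c} t *\<^sub>R u t) = (LBINT t. indicator {0..c} t *\<^sub>R g t)"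
    by (intro integral_cong_AE) (use u(1) in auto)
  then show "f c = f 0 + (LBINT t. indicator {0..c} t *\<^sub>R g t)"
    using u(2)[of c] half_open_nonneg[OF c] by simp
qed (use g out sq in auto)

section \<open>Algebraic operations on weak derivatives\<close>

lemma ac_on_bounded:
  assumes "ac_on a b f"
  shows "\<exists>A\<ge>0. \<forall>x\<in>{a..b}. norm (f x) \<le> A"
proof -
  have "compact (f ` {a..b})" by (rule compact_continuous_image[OF ac_on_continuous[OF assms]]) simp
  then have "bounded (f ` {a..b})" by (rule compact_imp_bounded)
  then obtain A where "\<forall>y\<in>f ` {a..b}. norm y \<le> A" unfolding bounded_iff by blast
  then show ?thesis by (intro exI[of _ "max 0 A"]) (auto simp: le_max_iff_disj)
qed

lemma ac_on_mult:
  fixes f h :: "real \<Rightarrow> 'a::real_normed_algebra"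
  assumes f: "ac_on a b f" and h: "ac_on a b h"
  shows "ac_on a b (\<lambda>x. f x * h x)"
proof -
  obtain A B where A: "\<And>x. x \<in> {a..b} \<Longrightarrow> norm (f x) \<le> A" "A \<ge> 0"
      and B: "\<And>x. x \<in> {a..b} \<Longrightarrow> norm (h x) \<le> B"
    using ac_on_bounded[OF f] ac_on_bounded[OF h] by metis
  define C where "C = max A B"
  have C: "\<And>x. x \<in> {a..b} \<Longrightarrow> norm (f x) \<le> C" "\<And>x. x \<in> {a..b} \<Longrightarrow> norm (h x) \<le> C" "C \<ge> 0"
    using A B by (auto simp: C_def le_max_iff_disj)
  show ?thesis
  proof (rule ac_on_dominated[OF f h C(3)])
    fix s t assume st: "a \<le> s" "s < t" "t \<le> b"
    have "f t * h t - f s * h s = (f t - f s) * h t + f s * (h t - h s)" by (simp add: algebra_simps)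
    then have "norm (f t * h t - f s * h s) \<le> norm (f t - f s) * norm (h t) + norm (f s) * norm (h t - h s)"
      by (metis norm_triangle_le add_mono norm_mult_ineq)
    also have "\<dots> \<le> norm (f t - f s) * C + C * norm (h t - h s)"
      using C(1)[of s] C(2)[of t] st by (intro add_mono mult_left_mono mult_right_mono) auto
    finally show "norm (f t * h t - f s * h s) \<le> C * (norm (f t - f s) + norm (h t - h s))"
      by (simp add: algebra_simps)
  qed
qed

lemma ac_on_inverse:
  fixes f :: "real \<Rightarrow> 'a::real_normed_field"
  assumes f: "ac_on a b f" and nz: "\<And>x. x \<in> {a..b} \<Longrightarrow> f x \<noteq> 0"
  shows "ac_on a b (\<lambda>x. inverse (f x))"
proof -
  have "continuous_on {a..b} (\<lambda>x. inverse (f x))"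
    by (intro continuous_intros ac_on_continuous[OF f]) (use nz in auto)
  then have "compact ((\<lambda>x. inverse (f x)) ` {a..b})" by (rule compact_continuous_image) simp
  then have "bounded ((\<lambda>x. inverse (f x)) ` {a..b})" by (rule compact_imp_bounded)
  then obtain A where "\<forall>y\<in>(\<lambda>x. inverse (f x)) ` {a..b}. norm y \<le> A" unfolding bounded_iff by blast
  then have A: "\<And>x. x \<in> {a..b} \<Longrightarrow> norm (inverse (f x)) \<le> A" by blast
  show ?thesis
  proof (rule ac_on_dominated[OF f f, of "A * A"])
    fix s t assume st: "a \<le> s" "s < t" "t \<le> b"
    have nn: "0 \<le> A" using order_trans[OF norm_ge_zero A[of s]] st by simp
    have "inverse (f t) - inverse (f s) = inverse (f t) * (f s - f t) * inverse (f s)"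
      using nz[of s] nz[of t] st by (simp add: field_simps)
    then have "norm (inverse (f t) - inverse (f s)) = norm (inverse (f t)) * norm (inverse (f s)) * norm (f t - f s)"
      by (simp add: norm_mult norm_minus_commute)
    also have "\<dots> \<le> A * A * norm (f t - f s)"
      using A[of s] A[of t] st nn by (intro mult_right_mono mult_mono) auto
    also have "\<dots> \<le> A * A * (norm (f t - f s) + norm (f t - f s))"
      using nn by (intro mult_left_mono) auto
    finally show "norm (inverse (f t) - inverse (f s)) \<le> A * A * (norm (f t - f s) + norm (f t - f s))" .
  qed simp
qed

lemma square_norm_sum_le: "(norm (u + v :: 'a::real_normed_vector))\<^sup>2 \<le> 2 * (norm u)\<^sup>2 + 2 * (norm v)\<^sup>2"
proof -
  have "(norm (u + v))\<^sup>2 \<le> (norm u + norm v)\<^sup>2" by (intro power_mono norm_triangle_ineq) simp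
  also have "\<dots> \<le> 2 * (norm u)\<^sup>2 + 2 * (norm v)\<^sup>2"
    using zero_le_power2[of "norm u - norm v"] by (simp add: power2_eq_square algebra_simps)
  finally show ?thesis .
qed

lemma square_integrable_dominated:
  fixes f :: "real \<Rightarrow> 'a::euclidean_space" and g :: "real \<Rightarrow> 'b::euclidean_space"
    and h :: "real \<Rightarrow> 'c::euclidean_space"
  assumes [measurable]: "h \<in> borel_measurable borel"
    and "integrable lborel (\<lambda>t. indicator {a..b} t * (norm (f t))\<^sup>2)"
    and "integrable lborel (\<lambda>t. indicator {a..b} t * (norm (g t))\<^sup>2)"
    and le: "\<And>t. t \<in> {a..b} \<Longrightarrow> norm (h t) \<le> C * norm (f t) + D * norm (g t)"
    and CD: "C \<ge> 0" "D \<ge> 0"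
  shows "integrable lborel (\<lambda>t. indicator {a..b} t * (norm (h t))\<^sup>2)"
proof (rule integrable_bound)
  show "integrable lborel (\<lambda>t. 2 * C\<^sup>2 * (indicator {a..b} t * (norm (f t))\<^sup>2) +
      2 * D\<^sup>2 * (indicator {a..b} t * (norm (g t))\<^sup>2))"
    using assms(2,3) by (intro integrable_add integrable_mult_right)
  show "AE t in lborel. norm (indicator {a..b} t * (norm (h t))\<^sup>2) \<le>
      norm (2 * C\<^sup>2 * (indicator {a..b} t * (norm (f t))\<^sup>2) +
        2 * D\<^sup>2 * (indicator {a..b} t * (norm (g t))\<^sup>2))"
  proof (rule AE_I2)
    fix t
    show "norm (indicator {a..b} t * (norm (h t))\<^sup>2) \<le>
      norm (2 * C\<^sup>2 * (indicator {a..b} t * (norm (f t))\<^sup>2) +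
        2 * D\<^sup>2 * (indicator {a..b} t * (norm (g t))\<^sup>2))"
    proof (cases "t \<in> {a..b}")
      case True
      have "(norm (h t))\<^sup>2 \<le> (norm (C * norm (f t) + D * norm (g t)))\<^sup>2"
        using le[OF True] CD by (intro power_mono) auto
      also have "\<dots> \<le> 2 * (norm (C * norm (f t)))\<^sup>2 + 2 * (norm (D * norm (g t)))\<^sup>2"
        by (rule square_norm_sum_le)
      finally show ?thesis using True by (simp add: power_mult_distrib abs_mult)
    qed simp
  qed
qed measurable

lemma weak_derivative_add:
  assumes "weak_derivative L f1 g1" "weak_derivative L f2 g2"
  shows "weak_derivative L (\<lambda>x. f1 x + f2 x) (\<lambda>x. g1 x + g2 x)"
  unfolding weak_derivative_def
proof (intro conjI ballI allI impI)
  note [measurable] = weak_derivative_measurable[OF assms(1)] weak_derivative_measurable[OF assms(2)]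
  show "(\<lambda>x. g1 x + g2 x) \<in> borel_measurable borel" by measurable
  fix c assume c: "c \<in> half_open L"
  have "integrable lborel (\<lambda>t. indicator {0..c} t * (norm (g1 t + g2 t))\<^sup>2)"
    by (rule square_integrable_dominated[where C=1 and D=1, OF _ weak_derivative_square_integrable[OF assms(1) c]
          weak_derivative_square_integrable[OF assms(2) c]]) (auto intro: norm_triangle_ineq)
  then show "integrable lborel (\<lambda>t. indicator {0..c} t *\<^sub>R (norm (g1 t + g2 t))\<^sup>2)" by simp
  have "(LBINT t. indicator {0..c} t *\<^sub>R (g1 t + g2 t)) =
      (LBINT t. indicator {0..c} t *\<^sub>R g1 t) + (LBINT t. indicator {0..c} t *\<^sub>R g2 t)"
    unfolding scaleR_add_right
    by (rule integral_add) (rule weak_derivative_integrable[OF _ c]; fact assms)+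
  then show "f1 c + f2 c = f1 0 + f2 0 + (LBINT t. indicator {0..c} t *\<^sub>R (g1 t + g2 t))"
    using weak_derivative_eq[OF assms(1) c] weak_derivative_eq[OF assms(2) c] by (simp only: ac_simps)
qed (use weak_derivative_outside[OF assms(1)] weak_derivative_outside[OF assms(2)] in simp)

lemma weak_derivative_linear:
  fixes f :: "real \<Rightarrow> 'a::euclidean_space" and T :: "'a \<Rightarrow> 'b::euclidean_space"
  assumes wd: "weak_derivative L f g" and T: "bounded_linear T"
  shows "weak_derivative L (\<lambda>x. T (f x)) (\<lambda>x. T (g x))"
  unfolding weak_derivative_def
proof (intro conjI ballI allI impI)
  interpret T: bounded_linear T by (rule T)
  note [measurable] = weak_derivative_measurable[OF wd]
  have [measurable]: "T \<in> borel_measurable borel"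
    by (rule borel_measurable_continuous_onI[OF linear_continuous_on[OF T]])
  show m: "(\<lambda>x. T (g x)) \<in> borel_measurable borel" by measurable
  fix c assume c: "c \<in> half_open L"
  obtain K where K: "\<And>x. norm (T x) \<le> norm x * K" "K \<ge> 0" using T.nonneg_bounded by metis
  have "integrable lborel (\<lambda>t. indicator {0..c} t * (norm (T (g t)))\<^sup>2)"
    by (rule square_integrable_dominated[where C=K and D=0, OF m weak_derivative_square_integrable[OF wd c]
          weak_derivative_square_integrable[OF wd c]]) (use K in \<open>auto simp: mult.commute\<close>)
  then show "integrable lborel (\<lambda>t. indicator {0..c} t *\<^sub>R (norm (T (g t)))\<^sup>2)" by simp
  have "(LBINT t. T (indicator {0..c} t *\<^sub>R g t)) = T (LBINT t. indicator {0..c} t *\<^sub>R g t)"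
    by (rule integral_bounded_linear[OF T weak_derivative_integrable[OF wd c]])
  then have "(LBINT t. indicator {0..c} t *\<^sub>R T (g t)) = T (LBINT t. indicator {0..c} t *\<^sub>R g t)"
    by (simp only: T.scaleR)
  then show "T (f c) = T (f 0) + (LBINT t. indicator {0..c} t *\<^sub>R T (g t))"
    by (simp only: weak_derivative_eq[OF wd c] T.add)
next
  interpret T: bounded_linear T by (rule T)
  fix x assume "x \<notin> half_open L"
  then show "T (g x) = 0" using weak_derivative_outside[OF wd] by (simp add: T.zero)
qed

lemma weak_derivative_of_real:
  fixes f :: "real \<Rightarrow> real"
  shows "weak_derivative L f g \<Longrightarrow> weak_derivative L (\<lambda>x. complex_of_real (f x)) (\<lambda>x. complex_of_real (g x))"
  by (rule weak_derivative_linear[OF _ bounded_linear_of_real])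

lemma weak_derivative_cmult:
  fixes f :: "real \<Rightarrow> 'a::{euclidean_space,real_normed_algebra}"
  shows "weak_derivative L f g \<Longrightarrow> weak_derivative L (\<lambda>x. a * f x) (\<lambda>x. a * g x)"
  by (rule weak_derivative_linear[OF _ bounded_linear_mult_right])

lemma weak_derivative_const: "weak_derivative L (\<lambda>_. a) (\<lambda>_. 0)"
  by (simp add: weak_derivative_def)

lemma weak_derivative_sub:
  fixes f1 :: "real \<Rightarrow> 'a::euclidean_space"
  assumes "weak_derivative L f1 g1" "weak_derivative L f2 g2"
  shows "weak_derivative L (\<lambda>x. f1 x - f2 x) (\<lambda>x. g1 x - g2 x)"
  using weak_derivative_add[OF assms(1) weak_derivative_linear[OF assms(2) bounded_linear_minus[OF bounded_linear_ident]]]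
  by simp

text \<open>Stopping the argument at \<open>c\<close> freezes the function beyond \<open>c\<close>.
  This continues data from \<open>{0..c}\<close> to \<open>[0, L)\<close> without leaving the
  class.\<close>

lemma weak_derivative_min:
  assumes wd: "weak_derivative L f g" and c: "c \<in> half_open L"
  shows "weak_derivative L (\<lambda>x. f (min x c)) (\<lambda>x. indicator {..c} x *\<^sub>R g x)"
  unfolding weak_derivative_def
proof (intro conjI ballI allI impI)
  note [measurable] = weak_derivative_measurable[OF wd]
  show "(\<lambda>x. indicator {..c} x *\<^sub>R g x) \<in> borel_measurable borel" by measurable
  fix d assume d: "d \<in> half_open L"
  have "integrable lborel (\<lambda>t. indicator {..c} t *\<^sub>R (indicator {0..d} t * (norm (g t))\<^sup>2))"
    by (rule integrable_mult_indicator[OF _ weak_derivative_square_integrable[OF wd d]]) simp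
  also have "(\<lambda>t. indicator {..c} t *\<^sub>R (indicator {0..d} t * (norm (g t))\<^sup>2)) =
      (\<lambda>t. indicator {0..d} t *\<^sub>R (norm (indicator {..c} t *\<^sub>R g t))\<^sup>2)"
    by (auto simp: indicator_def)
  finally show "integrable lborel (\<lambda>t. indicator {0..d} t *\<^sub>R (norm (indicator {..c} t *\<^sub>R g t))\<^sup>2)" .
  have m: "min d c \<in> half_open L" using c d by (simp add: min_def)
  have "(\<lambda>t. indicator {0..d} t *\<^sub>R indicator {..c} t *\<^sub>R g t) = (\<lambda>t. indicator {0..min d c} t *\<^sub>R g t)"
    by (auto simp: indicator_def)
  then show "f (min d c) = f (min 0 c) + (LBINT t. indicator {0..d} t *\<^sub>R indicator {..c} t *\<^sub>R g t)"
    using weak_derivative_eq[OF wd m] half_open_nonneg[OF c] by (simp only: min_absorb1)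
qed (use weak_derivative_outside[OF wd] in simp)

lemma weak_derivative_max:
  assumes wd: "weak_derivative L f g" and c: "c \<in> half_open L"
  shows "weak_derivative L (\<lambda>x. f (max x c)) (\<lambda>x. indicator {c<..} x *\<^sub>R g x)"
  unfolding weak_derivative_def
proof (intro conjI ballI allI impI)
  note [measurable] = weak_derivative_measurable[OF wd]
  show "(\<lambda>x. indicator {c<..} x *\<^sub>R g x) \<in> borel_measurable borel" by measurable
  fix d assume d: "d \<in> half_open L"
  have "integrable lborel (\<lambda>t. indicator {c<..} t *\<^sub>R (indicator {0..d} t * (norm (g t))\<^sup>2))"
    by (rule integrable_mult_indicator[OF _ weak_derivative_square_integrable[OF wd d]]) simp
  also have "(\<lambda>t. indicator {c<..} t *\<^sub>R (indicator {0..d} t * (norm (g t))\<^sup>2)) =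
      (\<lambda>t. indicator {0..d} t *\<^sub>R (norm (indicator {c<..} t *\<^sub>R g t))\<^sup>2)"
    by (auto simp: indicator_def)
  finally show "integrable lborel (\<lambda>t. indicator {0..d} t *\<^sub>R (norm (indicator {c<..} t *\<^sub>R g t))\<^sup>2)" .
  have m: "max d c \<in> half_open L" using c d by (simp add: max_def)
  have "(\<lambda>t. indicator {0..d} t *\<^sub>R indicator {c<..} t *\<^sub>R g t) = (\<lambda>t. indicator {c<..max d c} t *\<^sub>R g t)"
    using half_open_nonneg[OF c] by (auto simp: indicator_def fun_eq_iff)
  then have "f (max d c) - f c = (LBINT t. indicator {0..d} t *\<^sub>R indicator {c<..} t *\<^sub>R g t)"
    using weak_derivative_diff[OF wd half_open_nonneg[OF c] _ m] by (simp only: max.cobounded2)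
  then show "f (max d c) = f (max 0 c) + (LBINT t. indicator {0..d} t *\<^sub>R indicator {c<..} t *\<^sub>R g t)"
    using half_open_nonneg[OF c] by (simp add: max_absorb2 algebra_simps)
qed (use weak_derivative_outside[OF wd] in simp)

lemma weak_derivative_ident: "weak_derivative L (\<lambda>x. x) (indicator (half_open L) :: real \<Rightarrow> real)"
  unfolding weak_derivative_def
proof (intro conjI ballI allI impI)
  fix c assume c: "c \<in> half_open L"
  have eq: "(\<lambda>t. indicator {0..c} t *\<^sub>R indicator (half_open L) t) = (indicator {0..c} :: real \<Rightarrow> real)"
    using half_open_downward[OF c] by (auto simp: indicator_def)
  show "c = 0 + (LBINT t. indicator {0..c} t *\<^sub>R indicator (half_open L) t)"
    using half_open_nonneg[OF c] unfolding eq by simp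
  have eq2: "(\<lambda>t. indicator {0..c} t *\<^sub>R (norm (indicator (half_open L) t :: real))\<^sup>2) = (indicator {0..c} :: real \<Rightarrow> real)"
    using half_open_downward[OF c] by (auto simp: indicator_def)
  show "integrable lborel (\<lambda>t. indicator {0..c} t *\<^sub>R (norm (indicator (half_open L) t :: real))\<^sup>2)"
    unfolding eq2 by (simp add: integrable_indicator_iff emeasure_lborel_Icc_eq)
qed simp_all

text \<open>\<open>f\<close> is controlled on \<open>[0, L)\<close> only and may be anything
  elsewhere; the zeros of \<open>g\<close> outside hide these values.\<close>

lemma measurable_mult_outside:
  fixes f g :: "real \<Rightarrow> 'a::{euclidean_space,real_normed_algebra}"
  assumes "weak_derivative L f f'" "g \<in> borel_measurable borel" "\<And>x. x \<notin> half_open L \<Longrightarrow> g x = 0"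
  shows "(\<lambda>x. f x * g x) \<in> borel_measurable borel" "(\<lambda>x. g x * f x) \<in> borel_measurable borel"
proof -
  have fm: "(\<lambda>x. indicator (half_open L) x *\<^sub>R f x) \<in> borel_measurable borel"
    by (rule borel_measurable_continuous_on_indicator[OF _ weak_derivative_continuous_on[OF assms(1)]]) simp
  have "(\<lambda>x. (indicator (half_open L) x *\<^sub>R f x) * g x) \<in> borel_measurable borel"
    "(\<lambda>x. g x * (indicator (half_open L) x *\<^sub>R f x)) \<in> borel_measurable borel"
    by (rule borel_measurable_times; fact fm assms(2))+
  moreover have "(\<lambda>x. (indicator (half_open L) x *\<^sub>R f x) * g x) = (\<lambda>x. f x * g x)"
    "(\<lambda>x. g x * (indicator (half_open L) x *\<^sub>R f x)) = (\<lambda>x. g x * f x)"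
    using assms(3) by (auto simp: indicator_def fun_eq_iff)
  ultimately show "(\<lambda>x. f x * g x) \<in> borel_measurable borel" "(\<lambda>x. g x * f x) \<in> borel_measurable borel"
    by (simp_all only:)
qed

lemma weak_derivative_mult:
  fixes f h :: "real \<Rightarrow> 'a::{euclidean_space,real_normed_field}"
  assumes f: "weak_derivative L f f'" and h: "weak_derivative L h h'"
  shows "weak_derivative L (\<lambda>x. f x * h x) (\<lambda>x. f x * h' x + f' x * h x)"
proof (rule weak_derivativeI)
  show m: "(\<lambda>x. f x * h' x + f' x * h x) \<in> borel_measurable borel"
    by (rule borel_measurable_add[OF
          measurable_mult_outside(1)[OF f weak_derivative_measurable[OF h] weak_derivative_outside[OF h]]
          measurable_mult_outside(2)[OF h weak_derivative_measurable[OF f] weak_derivative_outside[OF f]]])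
  fix c assume c: "c \<in> half_open L"
  show "ac_on 0 c (\<lambda>x. f x * h x)"
    by (rule ac_on_mult[OF weak_derivative_ac_on[OF f c] weak_derivative_ac_on[OF h c]])
  obtain A where A: "A \<ge> 0" "\<forall>x\<in>{0..c}. norm (f x) \<le> A"
    using ac_on_bounded[OF weak_derivative_ac_on[OF f c]] by blast
  obtain B where B: "B \<ge> 0" "\<forall>x\<in>{0..c}. norm (h x) \<le> B"
    using ac_on_bounded[OF weak_derivative_ac_on[OF h c]] by blast
  show "integrable lborel (\<lambda>t. indicator {0..c} t * (norm (f t * h' t + f' t * h t))\<^sup>2)"
  proof (rule square_integrable_dominated[where C=A and D=B, OF m weak_derivative_square_integrable[OF h c]
        weak_derivative_square_integrable[OF f c]])
    fix t assume t: "t \<in> {0..c}"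
    have "norm (f t * h' t + f' t * h t) \<le> norm (f t) * norm (h' t) + norm (h t) * norm (f' t)"
      using norm_triangle_ineq[of "f t * h' t" "f' t * h t"] by (simp add: norm_mult mult.commute)
    also have "\<dots> \<le> A * norm (h' t) + B * norm (f' t)"
      using A B t by (intro add_mono mult_right_mono) auto
    finally show "norm (f t * h' t + f' t * h t) \<le> A * norm (h' t) + B * norm (f' t)" .
  qed (use A B in auto)
next
  show "AE x in lborel. x \<in> half_open L \<longrightarrow> 0 < x \<longrightarrow>
      ((\<lambda>x. f x * h x) has_vector_derivative f x * h' x + f' x * h x) (at x)"
    using weak_derivative_AE[OF f] weak_derivative_AE[OF h]
    by eventually_elim (auto intro: has_vector_derivative_mult)
qed (use weak_derivative_outside[OF f] weak_derivative_outside[OF h] in simp)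

lemma weak_derivative_inverse:
  fixes f :: "real \<Rightarrow> real"
  assumes f: "weak_derivative L f f'" and nz: "\<And>x. x \<in> half_open L \<Longrightarrow> f x \<noteq> 0"
  shows "weak_derivative L (\<lambda>x. inverse (f x)) (\<lambda>x. - (f' x / (f x)\<^sup>2))"
proof (rule weak_derivativeI)
  have fm: "(\<lambda>x. indicator (half_open L) x *\<^sub>R f x) \<in> borel_measurable borel"
    by (rule borel_measurable_continuous_on_indicator[OF _ weak_derivative_continuous_on[OF f]]) simp
  have "(\<lambda>x. - (f' x / (indicator (half_open L) x *\<^sub>R f x)\<^sup>2)) \<in> borel_measurable borel"
    by (intro borel_measurable_uminus borel_measurable_divide borel_measurable_power fm
        weak_derivative_measurable[OF f])
  also have "(\<lambda>x. - (f' x / (indicator (half_open L) x *\<^sub>R f x)\<^sup>2)) = (\<lambda>x. - (f' x / (f x)\<^sup>2))"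
    using weak_derivative_outside[OF f] by (auto simp: indicator_def fun_eq_iff)
  finally show m: "(\<lambda>x. - (f' x / (f x)\<^sup>2)) \<in> borel_measurable borel" .
  fix c assume c: "c \<in> half_open L"
  have nzc: "f x \<noteq> 0" if "x \<in> {0..c}" for x using nz[OF half_open_downward[OF c, of x]] that by simp
  show ac: "ac_on 0 c (\<lambda>x. inverse (f x))"
    by (rule ac_on_inverse[OF weak_derivative_ac_on[OF f c] nzc])
  obtain A where A: "A \<ge> 0" "\<forall>x\<in>{0..c}. norm (inverse (f x)) \<le> A"
    using ac_on_bounded[OF ac] by blast
  show "integrable lborel (\<lambda>t. indicator {0..c} t * (norm (- (f' t / (f t)\<^sup>2)))\<^sup>2)"
  proof (rule square_integrable_dominated[where C="A\<^sup>2" and D=0, OF m weak_derivative_square_integrable[OF f c]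
        weak_derivative_square_integrable[OF f c]])
    fix t assume t: "t \<in> {0..c}"
    have "norm (- (f' t / (f t)\<^sup>2)) = (norm (inverse (f t)))\<^sup>2 * norm (f' t)"
      by (simp add: power2_eq_square abs_mult divide_inverse)
    also have "\<dots> \<le> A\<^sup>2 * norm (f' t) + 0 * norm (f' t)"
      using A t by (simp add: mult_right_mono power_mono)
    finally show "norm (- (f' t / (f t)\<^sup>2)) \<le> A\<^sup>2 * norm (f' t) + 0 * norm (f' t)" .
  qed auto
next
  show "AE x in lborel. x \<in> half_open L \<longrightarrow> 0 < x \<longrightarrow>
      ((\<lambda>x. inverse (f x)) has_vector_derivative - (f' x / (f x)\<^sup>2)) (at x)"
    using weak_derivative_AE[OF f]
  proof eventually_elim
    fix x assume x: "x \<in> half_open L \<longrightarrow> 0 < x \<and> (f has_vector_derivative f' x) (at x)"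
    show "x \<in> half_open L \<longrightarrow> 0 < x \<longrightarrow> ((\<lambda>x. inverse (f x)) has_vector_derivative - (f' x / (f x)\<^sup>2)) (at x)"
      using x nz[of x] unfolding has_real_derivative_iff_has_vector_derivative[symmetric]
      by (auto intro!: derivative_eq_intros simp: power2_eq_square divide_inverse)
  qed
qed (use weak_derivative_outside[OF f] in simp)

section \<open>The Sobolev spaces of the definitions\<close>

lemma at_within_half_open: "x \<in> half_open L \<Longrightarrow> 0 < x \<Longrightarrow> at x within half_open L = at x"
proof (rule at_within_interior)
  assume x: "x \<in> half_open L" "0 < x"
  obtain c where c: "x < c" "c \<in> half_open L" using half_open_extend[OF x(1)] by blast
  show "x \<in> interior (half_open L)"
    by (rule interiorI[of "{0<..<c}"]) (use x c half_open_downward[OF c(2)] in auto)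
qed

lemma der_eq: "x \<in> half_open L \<Longrightarrow> 0 < x \<Longrightarrow> (f has_vector_derivative u) (at x) \<Longrightarrow> der L f x = u"
  by (simp add: der_def at_within_half_open vector_derivative_at)

lemma AE_der:
  assumes "weak_derivative L f g"
  shows "AE x in lborel. x \<in> half_open L \<longrightarrow> der L f x = g x"
  using weak_derivative_AE[OF assms] by eventually_elim (auto intro: der_eq)

text \<open>The definitions integrate over \<open>lebesgue_on\<close>, the proof over
  \<open>lborel\<close> with indicators. A function that agrees almost everywhere with a Borel
  function passes from one to the other, because Lebesgue measure is complete.\<close>

lemma lebesgue_on_transfer:
  fixes F G :: "real \<Rightarrow> 'a::euclidean_space"
  assumes ae: "AE x in lborel. x \<in> half_open L \<longrightarrow> F x = G x"
    and G [measurable]: "G \<in> borel_measurable borel" and S [measurable]: "S \<in> sets borel" and sub: "S \<subseteq> half_open L"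
  shows "F \<in> borel_measurable (lebesgue_on S)"
    and "(LINT x|lebesgue_on S. F x) = (LBINT x. indicator S x *\<^sub>R G x)"
    and "integrable (lebesgue_on S) F \<longleftrightarrow> integrable lborel (\<lambda>x. indicator S x *\<^sub>R G x)"
proof -
  have SL: "S \<inter> space lebesgue \<in> sets lebesgue" using S by simp
  have eq: "AE x in lebesgue. indicator S x *\<^sub>R G x = indicator S x *\<^sub>R F x"
    by (rule AE_completion, use ae in eventually_elim) (use sub in \<open>auto simp: indicator_def\<close>)
  have mG: "(\<lambda>x. indicator S x *\<^sub>R G x) \<in> borel_measurable lborel" by simp
  then have mG': "(\<lambda>x. indicator S x *\<^sub>R G x) \<in> borel_measurable lebesgue" by (rule measurable_completion)
  then have mF: "(\<lambda>x. indicator S x *\<^sub>R F x) \<in> borel_measurable lebesgue" using eq by (rule borel_measurable_AE)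
  then show "F \<in> borel_measurable (lebesgue_on S)"
    using borel_measurable_restrict_space_iff[OF SL] by blast
  show "(LINT x|lebesgue_on S. F x) = (LBINT x. indicator S x *\<^sub>R G x)"
    unfolding integral_restrict_space[OF SL] integral_completion[OF mG, symmetric]
    by (rule integral_cong_AE[OF mF mG']) (use eq in eventually_elim, auto)
  show "integrable (lebesgue_on S) F \<longleftrightarrow> integrable lborel (\<lambda>x. indicator S x *\<^sub>R G x)"
    unfolding integrable_restrict_space[OF SL] integrable_completion[OF mG, symmetric]
    by (rule integrable_cong_AE[OF mF mG']) (use eq in eventually_elim, auto)
qed

lemma weak_derivative_cong:
  assumes "weak_derivative L f g" "0 < L" "\<And>x. x \<in> half_open L \<Longrightarrow> f x = f' x"
  shows "weak_derivative L f' g"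
  unfolding weak_derivative_def
proof (intro conjI ballI)
  fix x assume x: "x \<in> half_open L"
  show "f' x = f' 0 + (LBINT t. indicator {0..x} t *\<^sub>R g t)"
    using weak_derivative_eq[OF assms(1) x]
    by (simp only: assms(3)[OF x] assms(3)[OF zero_in_half_open[OF assms(2)]])
qed (use assms(1) in \<open>auto simp: weak_derivative_def\<close>)

lemma weak_derivative_imp_H1_loc:
  assumes wd: "weak_derivative L f g"
  shows "f \<in> H1_loc L"
proof -
  note [measurable] = weak_derivative_measurable[OF wd]
  have "square_integrable (lebesgue_on {0..c}) (der L f)" if c: "c \<in> half_open L" for c
  proof -
    have sub: "{0..c} \<subseteq> half_open L" using half_open_downward[OF c] by auto
    have "AE x in lborel. x \<in> half_open L \<longrightarrow> (cmod (der L f x))\<^sup>2 = (cmod (g x))\<^sup>2"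
      using AE_der[OF wd] by eventually_elim simp
    then show ?thesis
      unfolding square_integrable_def
      using lebesgue_on_transfer(1)[OF AE_der[OF wd] _ _ sub]
        lebesgue_on_transfer(3)[of L "\<lambda>x. (cmod (der L f x))\<^sup>2" "\<lambda>x. (cmod (g x))\<^sup>2", OF _ _ _ sub]
        weak_derivative_square_integrable[OF wd c] by simp
  qed
  then show ?thesis
    by (simp add: H1_loc_def L2_loc_def abs_continuous_on_iff_ac_on weak_derivative_ac_on[OF wd])
qed

text \<open>A Borel derivative is obtained as the limit of difference quotients at steps
  \<open>1 / (n + 1)\<close>. On \<open>[0, L)\<close> it equals the derivative wherever that
  exists, hence almost everywhere, and at the remaining points \<open>lim\<close> keeps it Borel
  measurable.\<close>

lemma H1_loc_imp_weak_derivative: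
  assumes f: "f \<in> H1_loc L"
  shows "\<exists>g. weak_derivative L f g"
proof -
  have ac: "ac_on 0 c f" if "c \<in> half_open L" for c
    using f that by (simp add: H1_loc_def abs_continuous_on_iff_ac_on)
  have L2: "square_integrable (lebesgue_on {0..c}) (der L f)" if "c \<in> half_open L" for c
    using f that by (simp add: H1_loc_def L2_loc_def)
  define F where "F x = indicator (half_open L) x *\<^sub>R f x" for x
  have [measurable]: "F \<in> borel_measurable borel" unfolding F_def
    by (rule borel_measurable_continuous_on_indicator[OF _ ac_on_continuous_on_half_open[OF ac]]) simp_all
  define g where "g x = indicator (half_open L) x *\<^sub>R
    lim (\<lambda>n. real (Suc n) *\<^sub>R (F (x + 1 / real (Suc n)) - F x))" for x
  have gm [measurable]: "g \<in> borel_measurable borel" unfolding g_def by measurable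
  have g_eq: "g x = u" if x: "x \<in> half_open L" and D: "(f has_vector_derivative u) (at x)" for x u
  proof -
    have "((\<lambda>h. norm (f (x + h) - f x - h *\<^sub>R u) / norm h) \<longlongrightarrow> 0) (at 0)"
      using D by (simp add: has_vector_derivative_def has_derivative_at)
    moreover have "filterlim (\<lambda>n. 1 / real (Suc n)) (at 0) sequentially"
      unfolding filterlim_at using LIMSEQ_inverse_real_of_nat by (simp add: inverse_eq_divide)
    ultimately have lim0: "(\<lambda>n. norm (f (x + 1 / real (Suc n)) - f x - (1 / real (Suc n)) *\<^sub>R u) /
        norm (1 / real (Suc n))) \<longlonglongrightarrow> 0"
      by (rule filterlim_compose)
    obtain c where c: "x < c" "c \<in> half_open L" using half_open_extend[OF x] by blast
    have "\<forall>\<^sub>F n in sequentially. 1 / real (Suc n) < c - x"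
      using c LIMSEQ_inverse_real_of_nat by (intro order_tendstoD(2)[of _ 0]) (auto simp: inverse_eq_divide)
    then have ev: "\<forall>\<^sub>F n in sequentially. norm (f (x + 1 / real (Suc n)) - f x - (1 / real (Suc n)) *\<^sub>R u) /
        norm (1 / real (Suc n)) = norm (real (Suc n) *\<^sub>R (F (x + 1 / real (Suc n)) - F x) - u)"
    proof eventually_elim
      fix n assume n: "1 / real (Suc n) < c - x"
      let ?s = "real (Suc n)"
      have "x + 1 / ?s \<in> half_open L"
        by (rule half_open_downward[OF c(2)]) (use half_open_nonneg[OF x] n in auto)
      then have F: "F (x + 1 / ?s) - F x = f (x + 1 / ?s) - f x" using x by (simp add: F_def)
      have scale: "norm (s *\<^sub>R v) = norm v / norm (1 / s)" if "s > 0" for s and v :: complex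
        using that by simp
      have "norm (?s *\<^sub>R (f (x + 1 / ?s) - f x - (1 / ?s) *\<^sub>R u)) =
          norm (f (x + 1 / ?s) - f x - (1 / ?s) *\<^sub>R u) / norm (1 / ?s)"
        by (rule scale) simp
      then show "norm (f (x + 1 / ?s) - f x - (1 / ?s) *\<^sub>R u) / norm (1 / ?s) =
          norm (?s *\<^sub>R (F (x + 1 / ?s) - F x) - u)"
        unfolding F by (simp add: scaleR_diff_right del: of_nat_Suc)
    qed
    have "(\<lambda>n. norm (real (Suc n) *\<^sub>R (F (x + 1 / real (Suc n)) - F x) - u)) \<longlonglongrightarrow> 0"
      using tendsto_cong[OF ev] lim0 by blast
    then have "(\<lambda>n. real (Suc n) *\<^sub>R (F (x + 1 / real (Suc n)) - F x)) \<longlonglongrightarrow> u"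
      by (subst LIM_zero_iff[symmetric]) (rule tendsto_norm_zero_cancel)
    then show ?thesis using x by (simp add: g_def limI)
  qed
  have D: "AE x in lborel. x \<in> half_open L \<longrightarrow> 0 < x \<and> (f has_vector_derivative g x) (at x)"
  proof (rule AE_half_open_lborel)
    fix c assume c: "c \<in> half_open L"
    obtain u where u: "integrable lborel u"
        "\<And>x. x \<in> {0..c} \<Longrightarrow> f x = f 0 + (LBINT t. indicator {0..x} t *\<^sub>R u t)"
      using ac_on_has_primitive[OF half_open_nonneg[OF c] ac[OF c]] unfolding has_primitive_on_def by blast
    have "AE x in lborel. 0 < x \<and> x < c \<longrightarrow> (f has_vector_derivative u x) (at x)"
      using u by (rule primitive_on_has_vector_derivative_AE)
    then show "AE x in lborel. 0 < x \<and> x < c \<longrightarrow> 0 < x \<and> (f has_vector_derivative g x) (at x)"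
    proof eventually_elim
      fix x assume D: "0 < x \<and> x < c \<longrightarrow> (f has_vector_derivative u x) (at x)"
      show "0 < x \<and> x < c \<longrightarrow> 0 < x \<and> (f has_vector_derivative g x) (at x)"
      proof (intro impI)
        assume x: "0 < x \<and> x < c"
        then have "x \<in> half_open L" using half_open_downward[OF c] by simp
        then have "g x = u x" using D x by (intro g_eq) auto
        then show "0 < x \<and> (f has_vector_derivative g x) (at x)" using D x by simp
      qed
    qed
  qed
  have "weak_derivative L f g"
  proof (rule weak_derivativeI[OF gm])
    fix c assume c: "c \<in> half_open L"
    have sub: "{0..c} \<subseteq> half_open L" using half_open_downward[OF c] by auto
    have "AE x in lborel. x \<in> half_open L \<longrightarrow> (cmod (der L f x))\<^sup>2 = (cmod (g x))\<^sup>2"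
      using D by eventually_elim (auto simp: der_eq)
    from lebesgue_on_transfer(3)[OF this _ _ sub] L2[OF c]
    show "integrable lborel (\<lambda>t. indicator {0..c} t * (norm (g t))\<^sup>2)"
      by (simp add: square_integrable_def)
  next
    show "AE x in lborel. x \<in> half_open L \<longrightarrow> 0 < x \<longrightarrow> (f has_vector_derivative g x) (at x)"
      using D by eventually_elim auto
  qed (use ac in \<open>auto simp: g_def\<close>)
  then show ?thesis by blast
qed

text \<open>\<open>H1_c\<close> in the form of pairs. The value at 0 is free, since the support is
  compact in an interval that contains 0. Beyond \<open>c\<close> the derivative has to vanish at
  every point, which is a choice of its representative.\<close>

definition test_function :: "ereal \<Rightarrow> (real \<Rightarrow> 'a::euclidean_space) \<Rightarrow> (real \<Rightarrow> 'a) \<Rightarrow> bool" where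
  "test_function L h k \<longleftrightarrow> weak_derivative L h k \<and>
     (\<exists>c\<in>half_open L. \<forall>x\<in>half_open L. c < x \<longrightarrow> h x = 0 \<and> k x = 0)"

lemma test_function_imp_weak_derivative: "test_function L h k \<Longrightarrow> weak_derivative L h k"
  by (simp add: test_function_def)

lemma test_function_imp_H1_c:
  assumes h: "test_function L h k"
  shows "h \<in> H1_c L"
proof -
  have wd: "weak_derivative L h k" using h by (simp add: test_function_def)
  obtain c where c: "c \<in> half_open L" and 0: "\<And>x. x \<in> half_open L \<Longrightarrow> c < x \<Longrightarrow> h x = 0 \<and> k x = 0"
    using h unfolding test_function_def by blast
  note [measurable] = weak_derivative_measurable[OF wd]
  have sub: "{0..c} \<subseteq> half_open L" using half_open_downward[OF c] by auto
  have supp: "x \<in> {0..c}" if "x \<in> half_open L" "h x \<noteq> 0 \<or> k x \<noteq> 0" for x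
    using that 0[of x] half_open_nonneg[OF that(1)] by force
  have cont: "continuous_on {0..c} h"
    by (rule continuous_on_subset[OF weak_derivative_continuous_on[OF wd] sub])
  have hm: "(\<lambda>x. indicator {0..c} x *\<^sub>R h x) \<in> borel_measurable borel"
    by (rule borel_measurable_continuous_on_indicator[OF _ cont]) simp
  have eq1: "AE x in lborel. x \<in> half_open L \<longrightarrow> h x = indicator {0..c} x *\<^sub>R h x"
    using supp by (auto simp: indicator_def)
  have eq2: "AE x in lborel. x \<in> half_open L \<longrightarrow> (cmod (h x))\<^sup>2 = indicator {0..c} x *\<^sub>R (cmod (h x))\<^sup>2"
    using supp by (auto simp: indicator_def)
  have hm2: "(\<lambda>x. indicator {0..c} x *\<^sub>R (cmod (h x))\<^sup>2) \<in> borel_measurable borel"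
    by (rule borel_measurable_continuous_on_indicator) (auto intro!: continuous_intros cont)
  have hi: "integrable lborel (\<lambda>x. indicator {0..c} x *\<^sub>R (cmod (h x))\<^sup>2)"
    by (rule borel_integrable_compact) (auto intro!: continuous_intros cont)
  have e1: "(\<lambda>x. indicator (half_open L) x *\<^sub>R indicator {0..c} x *\<^sub>R (cmod (h x))\<^sup>2) =
      (\<lambda>x. indicator {0..c} x *\<^sub>R (cmod (h x))\<^sup>2)"
  proof
    fix x
    show "indicator (half_open L) x *\<^sub>R indicator {0..c} x *\<^sub>R (cmod (h x))\<^sup>2 =
        indicator {0..c} x *\<^sub>R (cmod (h x))\<^sup>2"
      using sub by (cases "x \<in> {0..c}") auto
  qed
  have sq_h: "square_integrable (lebesgue_on (half_open L)) h"
    unfolding square_integrable_def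
    using lebesgue_on_transfer(1)[OF eq1 hm, of "half_open L"]
      lebesgue_on_transfer(3)[OF eq2 hm2, of "half_open L"] hi unfolding e1 by simp
  have eq3: "AE x in lborel. x \<in> half_open L \<longrightarrow> (cmod (der L h x))\<^sup>2 = (cmod (k x))\<^sup>2"
    using AE_der[OF wd] by eventually_elim simp
  have e2: "(\<lambda>x. indicator (half_open L) x *\<^sub>R (cmod (k x))\<^sup>2) = (\<lambda>x. indicator {0..c} x * (cmod (k x))\<^sup>2)"
  proof
    fix x
    show "indicator (half_open L) x *\<^sub>R (cmod (k x))\<^sup>2 = indicator {0..c} x * (cmod (k x))\<^sup>2"
      using sub supp[of x] by (cases "k x = 0") (auto simp: indicator_def)
  qed
  have km2: "(\<lambda>x. (cmod (k x))\<^sup>2) \<in> borel_measurable borel" by measurable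
  have sq_k: "square_integrable (lebesgue_on (half_open L)) (der L h)"
    unfolding square_integrable_def
    using lebesgue_on_transfer(1)[OF AE_der[OF wd], of "half_open L"]
      lebesgue_on_transfer(3)[OF eq3 km2, of "half_open L"] weak_derivative_square_integrable[OF wd c]
    unfolding e2 by simp
  have "closure {x \<in> half_open L. h x \<noteq> 0} \<subseteq> {0..c}"
    by (rule closure_minimal) (use supp in auto)
  then have "half_open L \<inter> closure {x \<in> half_open L. h x \<noteq> 0} = {0..c} \<inter> closure {x \<in> half_open L. h x \<noteq> 0}"
    using sub by auto
  moreover have "compact ({0..c} \<inter> closure {x \<in> half_open L. h x \<noteq> 0})"
    by (intro compact_Int_closed) auto
  ultimately show ?thesis
    using weak_derivative_imp_H1_loc[OF wd] sq_h sq_k by (simp add: H1_c_def)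
qed

lemma H1_c_imp_test_function:
  assumes h: "h \<in> H1_c L" and L: "0 < L"
  shows "\<exists>k. test_function L h k"
proof -
  obtain k where wd: "weak_derivative L h k"
    using h H1_loc_imp_weak_derivative unfolding H1_c_def by blast
  let ?K = "half_open L \<inter> closure {x \<in> half_open L. h x \<noteq> 0}"
  have K: "compact ?K" using h by (simp add: H1_c_def)
  have inK: "x \<in> ?K" if "x \<in> half_open L" "h x \<noteq> 0" for x
    using that closure_subset[of "{x \<in> half_open L. h x \<noteq> 0}"] by blast
  obtain c where c: "c \<in> half_open L" "\<And>x. x \<in> half_open L \<Longrightarrow> c < x \<Longrightarrow> h x = 0"
  proof (cases "?K = {}")
    case True
    then have "h x = 0" if "x \<in> half_open L" for x using inK[OF that] by blast
    then show ?thesis using that[of 0] zero_in_half_open[OF L] by blast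
  next
    case False
    then obtain c where "c \<in> ?K" "\<And>y. y \<in> ?K \<Longrightarrow> y \<le> c" using compact_attains_sup[OF K] by blast
    then show ?thesis using that[of c] inK by force
  qed
  \<comment> \<open>Beyond the support the value \<open>h d = 0\<close> is known, so stopping at
    \<open>d\<close> leaves \<open>h\<close> unchanged and clears the derivative beyond
    \<open>d\<close>.\<close>
  obtain d where d: "c < d" "d \<in> half_open L" using half_open_extend[OF c(1)] by blast
  have "weak_derivative L h (\<lambda>x. indicator {..d} x *\<^sub>R k x)"
  proof (rule weak_derivative_cong[OF weak_derivative_min[OF wd d(2)] L])
    fix x assume x: "x \<in> half_open L"
    show "h (min x d) = h x"
      using c(2)[OF x] c(2)[OF d(2) d(1)] d(1) by (cases "x \<le> d") (auto simp: min_def)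
  qed
  then have "test_function L h (\<lambda>x. indicator {..d} x *\<^sub>R k x)"
    unfolding test_function_def using d c(2) by (intro conjI bexI[of _ d]) auto
  then show ?thesis by blast
qed

definition local_L2 :: "ereal \<Rightarrow> (real \<Rightarrow> real) \<Rightarrow> bool" where
  "local_L2 L q \<longleftrightarrow> q \<in> borel_measurable borel \<and> (\<forall>x. x \<notin> half_open L \<longrightarrow> q x = 0) \<and>
     (\<forall>c\<in>half_open L. integrable lborel (\<lambda>t. indicator {0..c} t * (q t)\<^sup>2))"

definition represents :: "ereal \<Rightarrow> (real \<Rightarrow> real) \<Rightarrow> ((real \<Rightarrow> complex) \<Rightarrow> complex) \<Rightarrow> bool" where
  "represents L q \<omega> \<longleftrightarrow> local_L2 L q \<and>
     (\<forall>h k. test_function L h k \<longrightarrow> \<omega> h = - (LBINT x. of_real (q x) * k x))"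

text \<open>The given anti-derivative is measurable on each \<open>{0..c}\<close> separately and
  real almost everywhere. Its real part is glued from countably many pieces and then replaced by a
  Borel function.\<close>

lemma real_valued_represents:
  assumes "real_valued L \<omega>"
  shows "\<exists>q. represents L q \<omega>"
proof -
  obtain p where p: "p \<in> L2_loc L" "\<And>h. h \<in> H1_c L \<Longrightarrow> \<omega> h = - (LINT x|lebesgue_on (half_open L). p x * der L h x)"
      and real: "AE x in lebesgue_on (half_open L). p x \<in> \<real>"
    using assms unfolding real_valued_def normalized_antiderivative_def by blast
  have half: "half_open L \<inter> space lebesgue \<in> sets lebesgue" by simp
  define r where "r x = indicator (half_open L) x * Re (p x)" for x
  have rm: "r \<in> borel_measurable lebesgue"
  proof (rule measurable_piecewise_restrict[where C="insert (- half_open L) ((\<lambda>c. {0..c}) ` (\<rat> \<inter> half_open L))"])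
    show "countable (insert (- half_open L) ((\<lambda>c. {0..c}) ` (\<rat> \<inter> half_open L)))"
      by (intro countable_insert countable_image) (rule countable_subset[OF _ countable_rat], auto)
    show "space lebesgue \<subseteq> \<Union> (insert (- half_open L) ((\<lambda>c. {0..c}) ` (\<rat> \<inter> half_open L)))"
    proof
      fix x :: real
      show "x \<in> \<Union> (insert (- half_open L) ((\<lambda>c. {0..c}) ` (\<rat> \<inter> half_open L)))"
      proof (cases "x \<in> half_open L")
        case True
        then obtain c where "x < c" "c \<in> half_open L" "c \<in> \<rat>" using half_open_extend by blast
        then show ?thesis using half_open_nonneg[OF True] by (auto intro!: bexI[of _ c])
      qed auto
    qed
    fix S assume S: "S \<in> insert (- half_open L) ((\<lambda>c. {0..c}) ` (\<rat> \<inter> half_open L))"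
    then show "S \<inter> space lebesgue \<in> sets lebesgue" by auto
    from S consider "S = - half_open L" | c where "c \<in> half_open L" "S = {0..c}" by blast
    then show "r \<in> borel_measurable (restrict_space lebesgue S)"
    proof cases
      case 1
      have "(\<lambda>_. 0) \<in> borel_measurable (restrict_space lebesgue S)" by simp
      then show ?thesis
        by (subst measurable_cong[where g="\<lambda>_. 0"]) (auto simp: r_def 1 space_restrict_space)
    next
      case 2
      then have "p \<in> borel_measurable (lebesgue_on S)" using p(1) by (auto simp: L2_loc_def square_integrable_def)
      then have "(\<lambda>x. Re (p x)) \<in> borel_measurable (lebesgue_on S)" by measurable
      then show ?thesis
        by (subst measurable_cong[where g="\<lambda>x. Re (p x)"])
          (use half_open_downward[OF 2(1)] in \<open>auto simp: r_def 2 space_restrict_space\<close>)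
    qed
  qed
  then obtain r' where r': "r' \<in> borel_measurable lborel" "AE x in lborel. r x = r' x"
    using completion_ex_borel_measurable_real by blast
  define q where "q x = indicator (half_open L) x * r' x" for x
  have qm [measurable]: "q \<in> borel_measurable borel" using r'(1) unfolding q_def by simp
  have "AE x in lborel. x \<in> half_open L \<longrightarrow> p x \<in> \<real>"
    using real unfolding AE_restrict_space_iff[OF half] AE_completion_iff .
  with r'(2) have pq: "AE x in lborel. x \<in> half_open L \<longrightarrow> p x = of_real (q x)"
    by eventually_elim (auto simp: r_def q_def complex_is_Real_iff complex_eq_iff)
  have "local_L2 L q"
    unfolding local_L2_def
  proof (intro conjI ballI allI impI)
    fix c assume c: "c \<in> half_open L"
    have sub: "{0..c} \<subseteq> half_open L" using half_open_downward[OF c] by auto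
    have "AE x in lborel. x \<in> half_open L \<longrightarrow> (cmod (p x))\<^sup>2 = (q x)\<^sup>2"
      using pq by eventually_elim simp
    moreover have "integrable (lebesgue_on {0..c}) (\<lambda>x. (cmod (p x))\<^sup>2)"
      using p(1) c by (simp add: L2_loc_def square_integrable_def)
    ultimately show "integrable lborel (\<lambda>t. indicator {0..c} t * (q t)\<^sup>2)"
      using lebesgue_on_transfer(3)[of L "\<lambda>x. (cmod (p x))\<^sup>2" "\<lambda>x. (q x)\<^sup>2", OF _ _ _ sub] by simp
  qed (auto simp: q_def)
  moreover have "\<omega> h = - (LBINT x. of_real (q x) * k x)" if h: "test_function L h k" for h k
  proof -
    have wd: "weak_derivative L h k" using h by (simp add: test_function_def)
    note [measurable] = weak_derivative_measurable[OF wd]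
    have "AE x in lborel. x \<in> half_open L \<longrightarrow> p x * der L h x = of_real (q x) * k x"
      using pq AE_der[OF wd] by eventually_elim simp
    then have "(LINT x|lebesgue_on (half_open L). p x * der L h x) =
        (LBINT x. indicator (half_open L) x *\<^sub>R (of_real (q x) * k x))"
      by (rule lebesgue_on_transfer(2)) auto
    also have "(\<lambda>x. indicator (half_open L) x *\<^sub>R (of_real (q x) * k x)) = (\<lambda>x. of_real (q x) * k x)"
      by (auto simp: fun_eq_iff q_def indicator_def)
    finally show ?thesis using p(2)[OF test_function_imp_H1_c[OF h]] by simp
  qed
  ultimately show ?thesis by (auto simp: represents_def)
qed

lemma test_function_mult:
  fixes f h :: "real \<Rightarrow> 'a::{euclidean_space,real_normed_field}"
  assumes "weak_derivative L f f'" "test_function L h h'"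
  shows "test_function L (\<lambda>x. f x * h x) (\<lambda>x. f x * h' x + f' x * h x)"
  using weak_derivative_mult[OF assms(1) test_function_imp_weak_derivative[OF assms(2)]] assms(2)
  unfolding test_function_def by force

text \<open>The distribution acts on the product of \<open>f\<close> and \<open>h\<close> through
  its anti-derivative, as \<open>- q\<close> integrated against the derivative of the product. The
  number field is a parameter: solutions are complex for nonreal \<open>z\<close> and real in the
  limit on the negative axis.\<close>

definition weak_solution ::
    "ereal \<Rightarrow> (real \<Rightarrow> real) \<Rightarrow> real measure \<Rightarrow> 'a::{euclidean_space,real_normed_field} \<Rightarrow>
     (real \<Rightarrow> 'a) \<Rightarrow> (real \<Rightarrow> 'a) \<Rightarrow> 'a \<Rightarrow> bool" where
  "weak_solution L q \<upsilon> z f g \<Delta> \<longleftrightarrow> weak_derivative L f g \<and>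
     (\<forall>h k. test_function L h k \<longrightarrow>
        \<Delta> * h 0 + (LBINT x. g x * k x) =
        z\<^sup>2 * (\<integral>x. f x * h x \<partial>\<upsilon>) - z * (LBINT x. of_real (q x) * (f x * k x + g x * h x)))"

lemma solution_imp_weak_solution:
  assumes sol: "solution L \<omega> \<upsilon> z f \<Delta>" and q: "represents L q \<omega>"
  shows "\<exists>g. weak_solution L q \<upsilon> z f g \<Delta>"
proof -
  obtain g where wd: "weak_derivative L f g"
    using sol H1_loc_imp_weak_derivative unfolding solution_def by blast
  have "\<Delta> * h 0 + (LBINT x. g x * k x) =
      z\<^sup>2 * (\<integral>x. f x * h x \<partial>\<upsilon>) - z * (LBINT x. of_real (q x) * (f x * k x + g x * h x))"
    if h: "test_function L h k" for h k
  proof -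
    have wdh: "weak_derivative L h k" using h by (simp add: test_function_def)
    note [measurable] = weak_derivative_measurable[OF wd] weak_derivative_measurable[OF wdh]
    have "AE x in lborel. x \<in> half_open L \<longrightarrow> der L f x * der L h x = g x * k x"
      using AE_der[OF wd] AE_der[OF wdh] by eventually_elim simp
    then have "(LINT x|lebesgue_on (half_open L). der L f x * der L h x) =
        (LBINT x. indicator (half_open L) x *\<^sub>R (g x * k x))"
      by (rule lebesgue_on_transfer(2)) auto
    also have "(\<lambda>x. indicator (half_open L) x *\<^sub>R (g x * k x)) = (\<lambda>x. g x * k x)"
      using weak_derivative_outside[OF wd] by (auto simp: fun_eq_iff indicator_def)
    finally have 1: "(LINT x|lebesgue_on (half_open L). der L f x * der L h x) = (LBINT x. g x * k x)" .
    have 2: "\<omega> (\<lambda>x. f x * h x) = - (LBINT x. of_real (q x) * (f x * k x + g x * h x))"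
      using q test_function_mult[OF wd h] unfolding represents_def by blast
    have "\<Delta> * h 0 + (LINT x|lebesgue_on (half_open L). der L f x * der L h x) =
        z * \<omega> (\<lambda>x. f x * h x) + z\<^sup>2 * (\<integral>x. f x * h x \<partial>\<upsilon>)"
      using sol test_function_imp_H1_c[OF h] unfolding solution_def by blast
    then show ?thesis unfolding 1 2 by (simp add: algebra_simps)
  qed
  with wd show ?thesis unfolding weak_solution_def by blast
qed

section \<open>Weyl solutions\<close>

lemma integrable_L2_mult:
  fixes f g :: "'a \<Rightarrow> 'b::{euclidean_space,real_normed_field}"
  assumes [measurable]: "f \<in> borel_measurable M" "g \<in> borel_measurable M"
    and "integrable M (\<lambda>x. (norm (f x))\<^sup>2)" "integrable M (\<lambda>x. (norm (g x))\<^sup>2)"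
  shows "integrable M (\<lambda>x. f x * g x)"
proof (rule integrable_bound)
  show "integrable M (\<lambda>x. (norm (f x))\<^sup>2 + (norm (g x))\<^sup>2)"
    using assms by (intro integrable_add)
  have "u * v \<le> u\<^sup>2 + v\<^sup>2" if "u \<ge> 0" "v \<ge> 0" for u v :: real
    using zero_le_power2[of "u - v"] mult_nonneg_nonneg[OF that] by (simp add: power2_eq_square algebra_simps)
  then show "AE x in M. norm (f x * g x) \<le> norm ((norm (f x))\<^sup>2 + (norm (g x))\<^sup>2)"
    by (auto simp: norm_mult)
qed measurable

lemma Cauchy_Schwarz_integral:
  fixes f g :: "'a \<Rightarrow> 'b::{euclidean_space,real_normed_field}"
  assumes [measurable]: "f \<in> borel_measurable M" "g \<in> borel_measurable M"
    and f: "integrable M (\<lambda>x. (norm (f x))\<^sup>2)" and g: "integrable M (\<lambda>x. (norm (g x))\<^sup>2)"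
  shows "(\<integral>x. norm (f x) * norm (g x) \<partial>M)\<^sup>2 \<le> (\<integral>x. (norm (f x))\<^sup>2 \<partial>M) * (\<integral>x. (norm (g x))\<^sup>2 \<partial>M)"
proof -
  define A where "A = (\<integral>x. (norm (f x))\<^sup>2 \<partial>M)"
  define B where "B = (\<integral>x. norm (f x) * norm (g x) \<partial>M)"
  define C where "C = (\<integral>x. (norm (g x))\<^sup>2 \<partial>M)"
  have fg: "integrable M (\<lambda>x. norm (f x) * norm (g x))"
    using integrable_L2_mult[of "\<lambda>x. norm (f x)" M "\<lambda>x. norm (g x)"] f g by simp
  have quad: "0 \<le> s\<^sup>2 * A - 2 * s * B + C" for s
  proof -
    have "0 \<le> (\<integral>x. (s * norm (f x) - norm (g x))\<^sup>2 \<partial>M)" by (intro integral_nonneg_AE) simp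
    also have "\<dots> = (\<integral>x. s\<^sup>2 * (norm (f x))\<^sup>2 - 2 * s * (norm (f x) * norm (g x)) + (norm (g x))\<^sup>2 \<partial>M)"
      by (simp add: power2_eq_square algebra_simps)
    also have "\<dots> = s\<^sup>2 * A - 2 * s * B + C"
      unfolding A_def B_def C_def using f g fg by simp
    finally show ?thesis .
  qed
  have A0: "A \<ge> 0" unfolding A_def by (intro integral_nonneg_AE) simp
  have "B\<^sup>2 \<le> A * C"
  proof (cases "A = 0")
    case True
    have "B = 0"
    proof (rule ccontr)
      assume B: "B \<noteq> 0"
      \<comment> \<open>For \<open>A = 0\<close> the quadratic expression is linear in
        \<open>s\<close>; this choice of \<open>s\<close> gives it the value -1.\<close>
      then show False using quad[of "(C + 1) / (2 * B)"] True by simp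
    qed
    then show ?thesis using True by simp
  next
    case False
    then have A: "A > 0" using A0 by simp
    have "0 \<le> A * ((B / A)\<^sup>2 * A - 2 * (B / A) * B + C)" using quad[of "B / A"] A by (intro mult_nonneg_nonneg) auto
    also have "\<dots> = A * C - B\<^sup>2" using A by (simp add: field_simps power2_eq_square)
    finally show ?thesis by simp
  qed
  then show ?thesis by (simp add: A_def B_def C_def)
qed

lemma Cauchy_Schwarz_integral_norm:
  fixes f g :: "'a \<Rightarrow> 'b::{euclidean_space,real_normed_field}"
  assumes "f \<in> borel_measurable M" "g \<in> borel_measurable M"
    and "integrable M (\<lambda>x. (norm (f x))\<^sup>2)" "integrable M (\<lambda>x. (norm (g x))\<^sup>2)"
  shows "(norm (\<integral>x. f x * g x \<partial>M))\<^sup>2 \<le> (\<integral>x. (norm (f x))\<^sup>2 \<partial>M) * (\<integral>x. (norm (g x))\<^sup>2 \<partial>M)"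
proof -
  have "norm (\<integral>x. f x * g x \<partial>M) \<le> (\<integral>x. norm (f x) * norm (g x) \<partial>M)"
    using integral_norm_bound[of M "\<lambda>x. f x * g x"] by (simp add: norm_mult)
  then have "(norm (\<integral>x. f x * g x \<partial>M))\<^sup>2 \<le> (\<integral>x. norm (f x) * norm (g x) \<partial>M)\<^sup>2"
    by (intro power_mono) auto
  also note Cauchy_Schwarz_integral[OF assms]
  finally show ?thesis .
qed

lemma weak_derivative_square_integrable_sub:
  assumes "weak_derivative L f g" "c \<in> half_open L" "S \<subseteq> {0..c}" "S \<in> sets borel"
  shows "integrable lborel (\<lambda>t. indicator S t * (norm (g t))\<^sup>2)"
proof -
  have "integrable lborel (\<lambda>t. indicator S t *\<^sub>R (indicator {0..c} t * (norm (g t))\<^sup>2))"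
    by (rule integrable_mult_indicator[OF _ weak_derivative_square_integrable[OF assms(1,2)]])
      (use assms(4) in simp)
  moreover have "indicator S t *\<^sub>R (indicator {0..c} t * (norm (g t))\<^sup>2) = indicator S t * (norm (g t))\<^sup>2" for t
    using assms(3) by (auto simp: indicator_def)
  ultimately show ?thesis by (simp only:)
qed

lemma weak_derivative_diff_bound:
  fixes f :: "real \<Rightarrow> 'a::{euclidean_space,real_normed_field}"
  assumes wd: "weak_derivative L f g" and xy: "0 \<le> x" "x \<le> y" "y \<in> half_open L"
  shows "(norm (f y - f x))\<^sup>2 \<le> (y - x) * (LBINT t. indicator {x<..y} t * (norm (g t))\<^sup>2)"
proof -
  note [measurable] = weak_derivative_measurable[OF wd]
  have sq: "integrable lborel (\<lambda>t. indicator {x<..y} t * (norm (g t))\<^sup>2)"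
    by (rule weak_derivative_square_integrable_sub[OF wd xy(3)]) (use xy in auto)
  have e1: "(norm (indicator {x<..y} t *\<^sub>R g t))\<^sup>2 = indicator {x<..y} t * (norm (g t))\<^sup>2" for t
    by (auto simp: indicator_def)
  have e2: "(norm (indicator {x<..y} t :: 'a))\<^sup>2 = (indicator {x<..y} t :: real)" for t
    by (auto simp: indicator_def)
  have e3: "(indicator {x<..y} t :: 'a) * (indicator {x<..y} t *\<^sub>R g t) = indicator {x<..y} t *\<^sub>R g t" for t
    by (auto simp: indicator_def)
  have "(norm (LBINT t. (indicator {x<..y} t :: 'a) * (indicator {x<..y} t *\<^sub>R g t)))\<^sup>2 \<le>
      (LBINT t. (norm (indicator {x<..y} t :: 'a))\<^sup>2) * (LBINT t. (norm (indicator {x<..y} t *\<^sub>R g t))\<^sup>2)"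
  proof (rule Cauchy_Schwarz_integral_norm)
    show "integrable lborel (\<lambda>t. (norm (indicator {x<..y} t :: 'a))\<^sup>2)"
      unfolding e2 using xy by (simp add: integrable_indicator_iff)
    show "integrable lborel (\<lambda>t. (norm (indicator {x<..y} t *\<^sub>R g t))\<^sup>2)" unfolding e1 by (rule sq)
  qed measurable
  also have "(LBINT t. (norm (indicator {x<..y} t :: 'a))\<^sup>2) = y - x"
    unfolding e2 using xy by simp
  finally show ?thesis unfolding e1 e3 weak_derivative_diff[OF wd xy] .
qed

section \<open>Functions of finite energy and cut-offs\<close>

definition finite_energy :: "ereal \<Rightarrow> (real \<Rightarrow> 'a::{euclidean_space,real_normed_field}) \<Rightarrow> (real \<Rightarrow> 'a) \<Rightarrow> bool" where
  "finite_energy L f g \<longleftrightarrow> weak_derivative L f g \<and> integrable lborel (\<lambda>x. (norm (g x))\<^sup>2) \<and>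
     (L < \<infinity> \<longrightarrow> (f \<longlongrightarrow> 0) (at_left (real_of_ereal L)))"

lemma finite_energyD:
  assumes "finite_energy L f g"
  shows "weak_derivative L f g" "g \<in> borel_measurable borel" "integrable lborel (\<lambda>x. (norm (g x))\<^sup>2)"
    "\<And>x. x \<notin> half_open L \<Longrightarrow> g x = 0"
  using assms weak_derivative_measurable[of L f g] weak_derivative_outside[of L f g]
  by (auto simp: finite_energy_def)

lemma finite_energy_diff_bound:
  fixes f :: "real \<Rightarrow> 'a::{euclidean_space,real_normed_field}"
  assumes fe: "finite_energy L f g" and xy: "0 \<le> x" "x \<le> y" "y \<in> half_open L"
  shows "(norm (f y - f x))\<^sup>2 \<le> (y - x) * (LBINT t. (norm (g t))\<^sup>2)"
proof -
  have wd: "weak_derivative L f g" using fe by (simp add: finite_energy_def)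
  have "(LBINT t. indicator {x<..y} t * (norm (g t))\<^sup>2) \<le> (LBINT t. (norm (g t))\<^sup>2)"
  proof (rule integral_mono)
    show "integrable lborel (\<lambda>t. indicator {x<..y} t * (norm (g t))\<^sup>2)"
      by (rule weak_derivative_square_integrable_sub[OF wd xy(3)]) (use xy in auto)
  qed (use fe in \<open>auto simp: finite_energy_def indicator_def\<close>)
  then show ?thesis
    using weak_derivative_diff_bound[OF wd xy] xy(2)
    by (meson diff_ge_0_iff_ge mult_left_mono order_trans)
qed

text \<open>The increment bound between \<open>x\<close> and \<open>y\<close> survives the limit of
  \<open>y\<close> to \<open>l\<close>, where \<open>f\<close> tends to 0.\<close>

lemma finite_energy_decay:
  fixes f :: "real \<Rightarrow> 'a::{euclidean_space,real_normed_field}"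
  assumes fe: "finite_energy L f g" and L: "L = ereal l" and x: "x \<in> half_open L"
  shows "(norm (f x))\<^sup>2 \<le> (l - x) * (LBINT t. (norm (g t))\<^sup>2)"
proof -
  have lim: "(f \<longlongrightarrow> 0) (at_left l)" using fe by (simp add: finite_energy_def L)
  have xl: "0 \<le> x" "x < l" using x by (auto simp: half_open_def L)
  have 1: "((\<lambda>y. (norm (f y - f x))\<^sup>2) \<longlongrightarrow> (norm (0 - f x))\<^sup>2) (at_left l)"
    by (intro tendsto_intros lim)
  have 2: "((\<lambda>y. (y - x) * (LBINT t. (norm (g t))\<^sup>2)) \<longlongrightarrow> (l - x) * (LBINT t. (norm (g t))\<^sup>2)) (at_left l)"
    by (intro tendsto_intros)
  have "\<forall>\<^sub>F y in at_left l. (norm (f y - f x))\<^sup>2 \<le> (y - x) * (LBINT t. (norm (g t))\<^sup>2)"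
    using eventually_at_left_real[OF xl(2)]
  proof eventually_elim
    fix y assume "y \<in> {x<..<l}"
    then show "(norm (f y - f x))\<^sup>2 \<le> (y - x) * (LBINT t. (norm (g t))\<^sup>2)"
      by (intro finite_energy_diff_bound[OF fe xl(1)]) (use xl in \<open>auto simp: half_open_def L\<close>)
  qed
  from tendsto_le[OF _ 2 1 this] show ?thesis by simp
qed

text \<open>The cut-offs interpolate linearly between 1 at \<open>c n\<close> and 0 at \<open>d n\<close>. A function of finite energy
  grows at most like a square root on these intervals, so the slope is compensated.\<close>

lemma cutoff_intervals:
  assumes "0 < L"
  obtains c d :: "nat \<Rightarrow> real" where "\<And>n. 0 \<le> c n" "\<And>n. c n < d n" "\<And>n. d n \<in> half_open L"
    "\<And>x. x \<in> half_open L \<Longrightarrow> \<forall>\<^sub>F n in sequentially. x < c n"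
    "\<And>(f :: real \<Rightarrow> complex) g. finite_energy L f g \<Longrightarrow>
      \<exists>C\<ge>0. \<forall>n. \<forall>x\<in>{c n..d n}. (norm (f x))\<^sup>2 \<le> C * (d n - c n)"
proof (cases "L = \<infinity>")
  case True
  show ?thesis
  \<comment> \<open>The length of such an interval equals its left end, and \<open>|f x|^2\<close>
    is at most a multiple of \<open>x\<close> for \<open>x \<ge> 1\<close>.\<close>
  proof (rule that[of "\<lambda>n. real (Suc n)" "\<lambda>n. 2 * real (Suc n)"])
    show "\<forall>\<^sub>F n in sequentially. x < real (Suc n)" for x
    proof -
      obtain N where "x < real N" using reals_Archimedean2 by blast
      then show ?thesis by (intro eventually_sequentiallyI[of N]) auto
    qed
    fix f g :: "real \<Rightarrow> complex" assume fe: "finite_energy L f g"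
    let ?G = "\<integral>t. (norm (g t))\<^sup>2 \<partial>lborel"
    have G: "?G \<ge> 0" by (intro integral_nonneg_AE) simp
    show "\<exists>C\<ge>0. \<forall>n. \<forall>x\<in>{real (Suc n)..2 * real (Suc n)}. (norm (f x))\<^sup>2 \<le> C * (2 * real (Suc n) - real (Suc n))"
    proof (intro exI[of _ "2 * (norm (f 0))\<^sup>2 + 4 * ?G"] conjI allI ballI)
      fix n x assume x: "x \<in> {real (Suc n)..2 * real (Suc n)}"
      have "(norm (f x))\<^sup>2 \<le> 2 * (norm (f 0))\<^sup>2 + 2 * (norm (f x - f 0))\<^sup>2"
        using square_norm_sum_le[of "f 0" "f x - f 0"] by simp
      also have "(norm (f x - f 0))\<^sup>2 \<le> (x - 0) * ?G"
        by (rule finite_energy_diff_bound[OF fe]) (use x True in \<open>auto simp: half_open_def\<close>)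
      also have "(x - 0) * ?G \<le> (2 * real (Suc n)) * ?G" using x G by (intro mult_right_mono) auto
      also have "2 * (norm (f 0))\<^sup>2 \<le> (2 * (norm (f 0))\<^sup>2) * real (Suc n)"
        using mult_left_mono[of 1 "real (Suc n)" "2 * (norm (f 0))\<^sup>2"] by simp
      finally show "(norm (f x))\<^sup>2 \<le> (2 * (norm (f 0))\<^sup>2 + 4 * ?G) * (2 * real (Suc n) - real (Suc n))"
        by (simp add: algebra_simps)
    qed (use G in auto)
  qed (use True in \<open>auto simp: half_open_def\<close>)
next
  case False
  then obtain l where L: "L = ereal l" "l > 0" using assms by (cases L) auto
  \<comment> \<open>The 2 in the denominator keeps the left end \<open>l - 2 * e n\<close>
    non-negative. The distance to \<open>l\<close> and the length of the interval are comparable, so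
    the decay of \<open>f\<close> at \<open>l\<close> suffices.\<close>
  define e where "e n = l / (real n + 2)" for n :: nat
  have e: "e n > 0" "2 * e n \<le> l" for n using L by (auto simp: e_def field_simps)
  have elim: "e \<longlonglongrightarrow> 0"
    unfolding e_def using LIMSEQ_ignore_initial_segment[OF lim_const_over_n[of l], of 2] by (simp add: add.commute)
  show ?thesis
  proof (rule that[of "\<lambda>n. l - 2 * e n" "\<lambda>n. l - e n"])
    show "l - e n \<in> half_open L" for n using e[of n] by (auto simp: half_open_def L)
    show "\<forall>\<^sub>F n in sequentially. x < l - 2 * e n" if "x \<in> half_open L" for x
    proof -
      have "(\<lambda>n. l - 2 * e n) \<longlonglongrightarrow> l - 2 * 0" by (intro tendsto_intros elim)
      then show ?thesis by (rule order_tendstoD(1)) (use that in \<open>simp add: half_open_def L\<close>)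
    qed
    fix f g :: "real \<Rightarrow> complex" assume fe: "finite_energy L f g"
    let ?G = "\<integral>t. (norm (g t))\<^sup>2 \<partial>lborel"
    have G: "?G \<ge> 0" by (intro integral_nonneg_AE) simp
    show "\<exists>C\<ge>0. \<forall>n. \<forall>x\<in>{l - 2 * e n..l - e n}. (norm (f x))\<^sup>2 \<le> C * (l - e n - (l - 2 * e n))"
    proof (intro exI[of _ "2 * ?G"] conjI allI ballI)
      fix n x assume x: "x \<in> {l - 2 * e n..l - e n}"
      have "(norm (f x))\<^sup>2 \<le> (l - x) * ?G"
        by (rule finite_energy_decay[OF fe L(1)]) (use x e[of n] in \<open>auto simp: half_open_def L\<close>)
      also have "\<dots> \<le> (2 * e n) * ?G" using x G by (intro mult_right_mono) auto
      finally show "(norm (f x))\<^sup>2 \<le> 2 * ?G * (l - e n - (l - 2 * e n))" by (simp add: algebra_simps)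
    qed (use G in auto)
  qed (use e in auto)
qed

lemma weak_derivative_ramp:
  assumes "0 \<le> c" "c < d" "d \<in> half_open L"
  shows "weak_derivative L (\<lambda>x. (d - min (max x c) d) / (d - c))
    (\<lambda>x. - (indicator {c<..d} x * indicator (half_open L) x / (d - c)))"
proof -
  have c: "c \<in> half_open L" using assms by (intro half_open_downward[OF assms(3)]) auto
  have eq: "(\<lambda>x. d / (d - c) + min (max x c) d * (- 1 / (d - c))) = (\<lambda>x. (d - min (max x c) d) / (d - c))"
    using assms(2) by (auto simp: fun_eq_iff diff_divide_distrib)
  have eq': "(\<lambda>x. 0 + (indicator {c<..} x *\<^sub>R (indicator {..d} x *\<^sub>R indicator (half_open L) x)) * (- 1 / (d - c))) =
      (\<lambda>x. - (indicator {c<..d} x * indicator (half_open L) x / (d - c)))"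
    by (auto simp: fun_eq_iff indicator_def)
  show ?thesis
    using weak_derivative_add[OF weak_derivative_const[of L "d / (d - c)"]
        weak_derivative_linear[OF weak_derivative_max[OF weak_derivative_min[OF weak_derivative_ident assms(3)] c]
          bounded_linear_mult_left[of "- 1 / (d - c)"]]]
    unfolding eq eq' .
qed

lemma tendsto_zero_of_square:
  fixes X :: "nat \<Rightarrow> 'a::real_normed_vector"
  assumes "\<And>n. (norm (X n))\<^sup>2 \<le> Y n" "Y \<longlonglongrightarrow> 0"
  shows "X \<longlonglongrightarrow> 0"
proof -
  have "(\<lambda>n. (norm (X n))\<^sup>2) \<longlonglongrightarrow> 0"
    by (rule tendsto_sandwich[OF _ _ tendsto_const assms(2)]) (use assms(1) in auto)
  then have "(\<lambda>n. sqrt ((norm (X n))\<^sup>2)) \<longlonglongrightarrow> sqrt 0" by (rule tendsto_real_sqrt)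
  then show ?thesis by (simp add: tendsto_norm_zero_iff)
qed

text \<open>The slope of the cut-off has size \<open>1 / (d n - c n)\<close> and
  \<open>|b|^2\<close> is at most \<open>C * (d n - c n)\<close> there, so the square integral of
  \<open>b * \<kappa> n\<close> is bounded by \<open>C\<close>. The square integral of
  \<open>a'\<close> over the same interval tends to 0, because the intervals leave every compact
  part of \<open>[0, L)\<close>; by the Cauchy-Schwarz inequality the mixed term disappears in the
  limit.\<close>

lemma cutoff_sequence:
  assumes "0 < L"
  obtains \<rho> :: "nat \<Rightarrow> real \<Rightarrow> real" and \<kappa> :: "nat \<Rightarrow> real \<Rightarrow> real" where
    "\<And>n. test_function L (\<lambda>x. complex_of_real (\<rho> n x)) (\<lambda>x. complex_of_real (\<kappa> n x))"
    "\<And>n. \<rho> n 0 = 1" "\<And>n x. 0 \<le> \<rho> n x" "\<And>n x. \<rho> n x \<le> 1"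
    "\<And>x. x \<in> half_open L \<Longrightarrow> (\<lambda>n. \<rho> n x) \<longlonglongrightarrow> 1"
    "\<And>n. \<rho> n \<in> borel_measurable borel"
    "\<And>a a' b b'. finite_energy L a a' \<Longrightarrow> finite_energy L b b' \<Longrightarrow>
      (\<lambda>n. LBINT x. a' x * (b x * complex_of_real (\<kappa> n x))) \<longlonglongrightarrow> 0"
    "\<And>n a a' b b'. finite_energy L a a' \<Longrightarrow> finite_energy L b b' \<Longrightarrow>
      integrable lborel (\<lambda>x. a' x * (b x * complex_of_real (\<kappa> n x)))"
proof -
  obtain c d :: "nat \<Rightarrow> real" where cd: "\<And>n. 0 \<le> c n" "\<And>n. c n < d n" "\<And>n. d n \<in> half_open L"
      and ev: "\<And>x. x \<in> half_open L \<Longrightarrow> \<forall>\<^sub>F n in sequentially. x < c n"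
      and decay: "\<And>(f :: real \<Rightarrow> complex) g. finite_energy L f g \<Longrightarrow>
        \<exists>C\<ge>0. \<forall>n. \<forall>x\<in>{c n..d n}. (norm (f x))\<^sup>2 \<le> C * (d n - c n)"
    using cutoff_intervals[OF assms] by blast
  define \<rho> where "\<rho> n x = (d n - min (max x (c n)) (d n)) / (d n - c n)" for n x
  define \<kappa> where "\<kappa> n x = - (indicator {c n<..d n} x * indicator (half_open L) x / (d n - c n))" for n and x :: real
  have wd: "weak_derivative L (\<lambda>x. complex_of_real (\<rho> n x)) (\<lambda>x. complex_of_real (\<kappa> n x))" for n
    unfolding \<rho>_def \<kappa>_def by (rule weak_derivative_of_real[OF weak_derivative_ramp[OF cd]])
  have km: "(\<lambda>x. complex_of_real (\<kappa> n x)) \<in> borel_measurable borel" for n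
    by (rule weak_derivative_measurable[OF wd])
  have key: "integrable lborel (\<lambda>x. a' x * (b x * complex_of_real (\<kappa> n x)))" (is ?I)
    "(norm (LBINT x. a' x * (b x * complex_of_real (\<kappa> n x))))\<^sup>2 \<le>
      (LBINT x. indicator {c n<..d n} x * (norm (a' x))\<^sup>2) * C" (is ?B)
    if a: "finite_energy L a a'" and b: "finite_energy L b b'"
      and C: "C \<ge> 0" "\<forall>x\<in>{c n..d n}. (norm (b x))\<^sup>2 \<le> C * (d n - c n)" for a a' b b' n C
  proof -
    have am [measurable]: "a' \<in> borel_measurable borel"
      by (rule finite_energyD(2)[OF a])
    have bm [measurable]: "(\<lambda>x. b x * complex_of_real (\<kappa> n x)) \<in> borel_measurable borel"
      by (rule measurable_mult_outside(1)[of L b b']) (use b km in \<open>auto simp: finite_energy_def \<kappa>_def\<close>)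
    let ?A = "\<lambda>x. indicator {c n<..d n} x *\<^sub>R a' x" and ?K = "\<lambda>x. b x * complex_of_real (\<kappa> n x)"
    have e1: "(norm (?A x))\<^sup>2 = indicator {c n<..d n} x * (norm (a' x))\<^sup>2" for x by (auto simp: indicator_def)
    have e2: "?A x * ?K x = a' x * ?K x" for x by (auto simp: indicator_def \<kappa>_def)
    have Ai: "integrable lborel (\<lambda>x. (norm (?A x))\<^sup>2)"
      unfolding e1 using integrable_mult_indicator[of "{c n<..d n}" lborel "\<lambda>x. (norm (a' x))\<^sup>2"] a
      by (simp add: finite_energy_def)
    have Kle: "(norm (?K x))\<^sup>2 \<le> indicator {c n<..d n} x * (C / (d n - c n))" for x
    proof (cases "x \<in> {c n<..d n}")
      case True
      have "\<bar>\<kappa> n x\<bar> \<le> 1 / (d n - c n)" using cd(2)[of n] by (auto simp: \<kappa>_def indicator_def)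
      then have "(norm (?K x))\<^sup>2 \<le> (norm (b x))\<^sup>2 * (1 / (d n - c n))\<^sup>2"
        unfolding norm_mult norm_of_real power_mult_distrib by (intro mult_left_mono power_mono) auto
      also have "\<dots> \<le> (C * (d n - c n)) * (1 / (d n - c n))\<^sup>2"
        using C True by (intro mult_right_mono) auto
      also have "\<dots> = C / (d n - c n)" using cd(2)[of n] by (simp add: power2_eq_square)
      finally show ?thesis using True by simp
    qed (simp add: \<kappa>_def)
    have Ii: "integrable lborel (\<lambda>x. indicator {c n<..d n} x * (C / (d n - c n)))"
      using cd(2)[of n] by (simp add: integrable_indicator_iff)
    have Ki: "integrable lborel (\<lambda>x. (norm (?K x))\<^sup>2)"
    proof (rule integrable_bound[OF Ii], measurable, rule AE_I2)
      fix x
      have "norm ((norm (?K x))\<^sup>2) \<le> indicator {c n<..d n} x * (C / (d n - c n))" using Kle[of x] by simp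
      also have "\<dots> \<le> norm (indicator {c n<..d n} x * (C / (d n - c n)))"
        unfolding real_norm_def by (rule abs_ge_self)
      finally show "norm ((norm (?K x))\<^sup>2) \<le> norm (indicator {c n<..d n} x * (C / (d n - c n)))" .
    qed
    show ?I using integrable_L2_mult[OF _ _ Ai Ki] unfolding e2 by simp
    have "(LBINT x. (norm (?K x))\<^sup>2) \<le> (LBINT x. indicator {c n<..d n} x * (C / (d n - c n)))"
      by (rule integral_mono[OF Ki Ii Kle])
    also have "\<dots> = C" using cd(2)[of n] by simp
    finally have KC: "(LBINT x. (norm (?K x))\<^sup>2) \<le> C" .
    have "(norm (LBINT x. ?A x * ?K x))\<^sup>2 \<le> (LBINT x. (norm (?A x))\<^sup>2) * (LBINT x. (norm (?K x))\<^sup>2)"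
      by (rule Cauchy_Schwarz_integral_norm[OF _ _ Ai Ki]) (use am bm in simp_all)
    also have "\<dots> \<le> (LBINT x. (norm (?A x))\<^sup>2) * C"
      by (rule mult_left_mono[OF KC]) (intro integral_nonneg_AE, simp)
    finally show ?B unfolding e1 e2 .
  qed
  show ?thesis
  proof (rule that[of \<rho> \<kappa>])
    show "test_function L (\<lambda>x. complex_of_real (\<rho> n x)) (\<lambda>x. complex_of_real (\<kappa> n x))" for n
      unfolding test_function_def
      by (intro conjI wd bexI[of _ "d n"]) (use cd(2,3)[of n] in \<open>auto simp: \<rho>_def \<kappa>_def\<close>)
    show "\<rho> n 0 = 1" "0 \<le> \<rho> n x" "\<rho> n x \<le> 1" for n x
      using cd(1,2)[of n] by (auto simp: \<rho>_def)
    show "\<rho> n \<in> borel_measurable borel" for n unfolding \<rho>_def by measurable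
    show "(\<lambda>n. \<rho> n x) \<longlonglongrightarrow> 1" if "x \<in> half_open L" for x
    proof (rule tendsto_eventually)
      show "\<forall>\<^sub>F n in sequentially. \<rho> n x = 1"
        using ev[OF that]
      proof eventually_elim
        fix n assume "x < c n"
        then show "\<rho> n x = 1" using cd(2)[of n] by (simp add: \<rho>_def)
      qed
    qed
    fix a a' b b' :: "real \<Rightarrow> complex" assume a: "finite_energy L a a'" and b: "finite_energy L b b'"
    obtain C where C: "C \<ge> 0" "\<forall>n. \<forall>x\<in>{c n..d n}. (norm (b x))\<^sup>2 \<le> C * (d n - c n)"
      using decay[OF b] by blast
    show "integrable lborel (\<lambda>x. a' x * (b x * complex_of_real (\<kappa> n x)))" for n
      by (rule key(1)[OF a b C(1)]) (use C(2) in blast)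
    have am [measurable]: "a' \<in> borel_measurable borel"
      by (rule finite_energyD(2)[OF a])
    have "(\<lambda>n. LBINT x. indicator {c n<..d n} x * (norm (a' x))\<^sup>2) \<longlonglongrightarrow> (\<integral>x. 0 \<partial>(lborel :: real measure))"
    proof (rule integral_dominated_convergence[where w="\<lambda>x. (norm (a' x))\<^sup>2"])
      show "AE x in lborel. (\<lambda>n. indicator {c n<..d n} x * (norm (a' x))\<^sup>2) \<longlonglongrightarrow> 0"
      proof (rule AE_I2)
        fix x
        show "(\<lambda>n. indicator {c n<..d n} x * (norm (a' x))\<^sup>2) \<longlonglongrightarrow> 0"
        proof (cases "x \<in> half_open L")
          case True
          show ?thesis
            by (rule tendsto_eventually) (use ev[OF True] in eventually_elim, simp)
        next
          case False
          then show ?thesis using finite_energyD(4)[OF a] by simp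
        qed
      qed
    qed (use a in \<open>auto simp: finite_energy_def indicator_def\<close>)
    then have "(\<lambda>n. (LBINT x. indicator {c n<..d n} x * (norm (a' x))\<^sup>2) * C) \<longlonglongrightarrow> 0"
      using tendsto_mult_left_zero by fastforce
    then show "(\<lambda>n. LBINT x. a' x * (b x * complex_of_real (\<kappa> n x))) \<longlonglongrightarrow> 0"
      by (rule tendsto_zero_of_square[rotated]) (rule key(2)[OF a b C(1)], use C(2) in blast)
  qed
qed

text \<open>With the value 1 at 0 the constant \<open>\<Delta>\<close> becomes
  \<open>z * m z\<close>, so no boundary value has to be divided out later.\<close>

definition weyl_solution ::
    "ereal \<Rightarrow> (real \<Rightarrow> real) \<Rightarrow> real measure \<Rightarrow> complex \<Rightarrow>
     (real \<Rightarrow> complex) \<Rightarrow> (real \<Rightarrow> complex) \<Rightarrow> complex \<Rightarrow> bool" where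
  "weyl_solution L q \<upsilon> z f g \<Delta> \<longleftrightarrow> weak_solution L q \<upsilon> z f g \<Delta> \<and> finite_energy L f g \<and> f 0 = 1 \<and>
     integrable \<upsilon> (\<lambda>x. (norm (f x))\<^sup>2)"

section \<open>Integration against Borel measures on the half-open interval\<close>

lemma borel_measure_on_measurable:
  assumes "borel_measure_on L \<upsilon>" "continuous_on (half_open L) f"
  shows "f \<in> borel_measurable \<upsilon>"
proof -
  have "f \<in> borel_measurable (restrict_space borel (half_open L))"
    by (rule borel_measurable_continuous_on_restrict[OF assms(2)])
  moreover have "sets \<upsilon> = sets (restrict_space borel (half_open L))"
    using assms(1) by (simp add: borel_measure_on_def)
  ultimately show ?thesis by (simp cong: measurable_cong_sets)
qed

lemma borel_measure_on_space: "borel_measure_on L \<upsilon> \<Longrightarrow> space \<upsilon> = half_open L"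
  unfolding borel_measure_on_def by (drule conjunct1, drule sets_eq_imp_space_eq) (simp add: space_restrict_space)

lemma borel_measure_on_Icc:
  assumes "borel_measure_on L \<nu>" "c \<in> half_open L"
  shows "{0..c} \<in> sets \<nu>" "emeasure \<nu> {0..c} < \<infinity>"
proof -
  have sub: "{0..c} \<subseteq> half_open L" using half_open_downward[OF assms(2)] by auto
  then have "{0..c} = half_open L \<inter> {0..c}" by blast
  then show "{0..c} \<in> sets \<nu>" using assms(1) by (auto simp: borel_measure_on_def sets_restrict_space)
  show "emeasure \<nu> {0..c} < \<infinity>" using assms(1) sub by (simp add: borel_measure_on_def)
qed

lemma borel_measure_on_integrable:
  fixes f :: "real \<Rightarrow> 'a::{banach,second_countable_topology}"
  assumes \<nu>: "borel_measure_on L \<nu>" and c: "c \<in> half_open L" and f: "continuous_on (half_open L) f"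
  shows "integrable \<nu> (\<lambda>x. indicator {0..c} x *\<^sub>R f x)"
proof -
  have "continuous_on {0..c} f"
    by (rule continuous_on_subset[OF f]) (use half_open_downward[OF c] in auto)
  then have "compact (f ` {0..c})" by (rule compact_continuous_image) simp
  then obtain B where B: "\<And>x. x \<in> {0..c} \<Longrightarrow> norm (f x) \<le> B" using compact_imp_bounded bounded_iff by (metis imageI)
  have m: "f \<in> borel_measurable \<nu>" by (rule borel_measure_on_measurable[OF \<nu> f])
  show ?thesis
    by (rule integrableI_bounded_set_indicator[where B = B]) (use borel_measure_on_Icc[OF \<nu> c] m B in auto)
qed

lemma borel_measure_on_supported:
  fixes f :: "real \<Rightarrow> 'a::{banach,second_countable_topology}"
  assumes \<nu>: "borel_measure_on L \<nu>" and c: "c \<in> half_open L"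
    and 0: "\<And>x. x \<in> half_open L \<Longrightarrow> c < x \<Longrightarrow> f x = 0"
  shows "(\<integral>x. f x \<partial>\<nu>) = (\<integral>x. indicator {0..c} x *\<^sub>R f x \<partial>\<nu>)"
    and "integrable \<nu> f \<longleftrightarrow> integrable \<nu> (\<lambda>x. indicator {0..c} x *\<^sub>R f x)"
proof -
  have eq: "f x = indicator {0..c} x *\<^sub>R f x" if "x \<in> space \<nu>" for x
    using that 0[of x] half_open_nonneg[of x L] by (cases "x \<le> c") (auto simp: borel_measure_on_space[OF \<nu>])
  show "(\<integral>x. f x \<partial>\<nu>) = (\<integral>x. indicator {0..c} x *\<^sub>R f x \<partial>\<nu>)"
    by (rule integral_cong[OF refl eq])
  show "integrable \<nu> f \<longleftrightarrow> integrable \<nu> (\<lambda>x. indicator {0..c} x *\<^sub>R f x)"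
    by (rule Bochner_Integration.integrable_cong[OF refl eq])
qed

lemma test_function_square_integrable:
  fixes h :: "real \<Rightarrow> 'a::{euclidean_space,real_normed_field}"
  assumes h: "test_function L h k"
  shows "integrable lborel (\<lambda>x. (norm (k x))\<^sup>2)" "borel_measure_on L \<upsilon> \<Longrightarrow> integrable \<upsilon> (\<lambda>x. (norm (h x))\<^sup>2)"
    "\<exists>B. \<forall>x\<in>half_open L. norm (h x) \<le> B"
proof -
  have wd: "weak_derivative L h k" using h by (simp add: test_function_def)
  obtain c where c: "c \<in> half_open L" and 0: "\<And>x. x \<in> half_open L \<Longrightarrow> c < x \<Longrightarrow> h x = 0 \<and> k x = 0"
    using h unfolding test_function_def by blast
  have *: "indicator {0..c} x * (norm (k x))\<^sup>2 = (norm (k x))\<^sup>2" for x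
    using 0[of x] half_open_nonneg[of x L] weak_derivative_outside[OF wd, of x] by (cases "x \<in> {0..c}") force+
  show "integrable lborel (\<lambda>x. (norm (k x))\<^sup>2)"
    using weak_derivative_square_integrable[OF wd c] unfolding * .
  obtain B where B: "B \<ge> 0" "\<forall>x\<in>{0..c}. norm (h x) \<le> B" using ac_on_bounded[OF weak_derivative_ac_on[OF wd c]] by blast
  have B': "norm (h x) \<le> indicator {0..c} x * B" if x: "x \<in> half_open L" for x
    using B 0[OF x] half_open_nonneg[OF x] by (cases "x \<le> c") auto
  have "norm (h x) \<le> B" if x: "x \<in> half_open L" for x
    using B'[OF x] B(1) by (cases "x \<in> {0..c}") auto
  then show "\<exists>B. \<forall>x\<in>half_open L. norm (h x) \<le> B" by blast
  assume \<upsilon>: "borel_measure_on L \<upsilon>"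
  show "integrable \<upsilon> (\<lambda>x. (norm (h x))\<^sup>2)"
  proof (rule borel_measure_on_supported(2)[OF \<upsilon> c, THEN iffD2])
    show "integrable \<upsilon> (\<lambda>x. indicator {0..c} x *\<^sub>R (norm (h x))\<^sup>2)"
      by (intro borel_measure_on_integrable[OF \<upsilon> c] continuous_intros weak_derivative_continuous_on[OF wd])
  qed (simp add: 0)
qed

lemma square_integrable_q_mult:
  fixes h :: "real \<Rightarrow> 'a::{euclidean_space,real_normed_field}"
  assumes q: "local_L2 L q" and h: "test_function L h k"
  shows "integrable lborel (\<lambda>x. (norm (of_real (q x) * h x))\<^sup>2)" "(\<lambda>x. of_real (q x) * h x) \<in> borel_measurable borel"
    "integrable lborel (\<lambda>x. of_real (q x) * k x)"
proof -
  have wd: "weak_derivative L h k" using h by (simp add: test_function_def)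
  note [measurable] = weak_derivative_measurable[OF wd]
  obtain c where c: "c \<in> half_open L" and 0: "\<And>x. x \<in> half_open L \<Longrightarrow> c < x \<Longrightarrow> h x = 0 \<and> k x = 0"
    using h unfolding test_function_def by blast
  have qm [measurable]: "q \<in> borel_measurable borel" and q0: "\<And>x. x \<notin> half_open L \<Longrightarrow> q x = 0"
    and qi: "integrable lborel (\<lambda>t. indicator {0..c} t * (q t)\<^sup>2)" using q c by (auto simp: local_L2_def)
  obtain B where B: "\<forall>x\<in>half_open L. norm (h x) \<le> B" using test_function_square_integrable(3)[OF h] by blast
  show m: "(\<lambda>x. of_real (q x) * h x) \<in> borel_measurable borel"
    by (rule measurable_mult_outside(2)[OF wd]) (use q0 in auto)
  have out: "x \<in> {0..c}" if "q x \<noteq> 0" "h x \<noteq> 0 \<or> k x \<noteq> 0" for x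
    using that q0[of x] 0[of x] half_open_nonneg[of x L] by (cases "x \<in> half_open L") force+
  show "integrable lborel (\<lambda>x. (norm (of_real (q x) * h x))\<^sup>2)"
  proof (rule integrable_bound)
    show "integrable lborel (\<lambda>x. B\<^sup>2 * (indicator {0..c} x * (q x)\<^sup>2))" using qi by simp
    show "AE x in lborel. norm ((norm (of_real (q x) * h x))\<^sup>2) \<le> norm (B\<^sup>2 * (indicator {0..c} x * (q x)\<^sup>2))"
    proof (rule AE_I2)
      fix x
      show "norm ((norm (of_real (q x) * h x))\<^sup>2) \<le> norm (B\<^sup>2 * (indicator {0..c} x * (q x)\<^sup>2))"
      proof (cases "q x = 0 \<or> h x = 0")
        case False
        then have "x \<in> {0..c}" "x \<in> half_open L" using out[of x] q0[of x] by auto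
        moreover from this have "(norm (h x))\<^sup>2 \<le> B\<^sup>2" using B by (intro power_mono) auto
        ultimately have "(norm (h x))\<^sup>2 * (q x)\<^sup>2 \<le> B\<^sup>2 * (indicator {0..c} x * (q x)\<^sup>2)"
          by (simp add: mult_right_mono)
        moreover have "norm ((norm (of_real (q x) * h x))\<^sup>2) = (norm (h x))\<^sup>2 * (q x)\<^sup>2"
          by (simp add: norm_mult power_mult_distrib)
        ultimately show ?thesis using abs_ge_self order_trans unfolding real_norm_def by metis
      qed auto
    qed
  qed (use m in measurable)
  have "integrable lborel (\<lambda>x. (indicator {0..c} x *\<^sub>R of_real (q x)) * k x)"
  proof (rule integrable_L2_mult)
    have "(norm (indicator {0..c} x *\<^sub>R of_real (q x) :: 'a))\<^sup>2 = indicator {0..c} x * (q x)\<^sup>2" for x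
      by (auto simp: indicator_def)
    then show "integrable lborel (\<lambda>x. (norm (indicator {0..c} x *\<^sub>R of_real (q x) :: 'a))\<^sup>2)" using qi by simp
  qed (use test_function_square_integrable(1)[OF h] in measurable)
  moreover have "(indicator {0..c} x *\<^sub>R of_real (q x)) * k x = of_real (q x) * k x" for x
    using out[of x] by (cases "x \<in> {0..c}") auto
  ultimately show "integrable lborel (\<lambda>x. of_real (q x) * k x)" by simp
qed

section \<open>The Gram identity\<close>

lemma finite_energy_cnj:
  assumes "finite_energy L f g"
  shows "finite_energy L (\<lambda>x. cnj (f x)) (\<lambda>x. cnj (g x))"
  using assms weak_derivative_linear[OF _ bounded_linear_cnj, of L f g] tendsto_cnj[of f 0 "at_left (real_of_ereal L)"]
  by (auto simp: finite_energy_def)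

lemma finite_energy_cutoff_limit:
  assumes L: "0 < L" and a: "finite_energy L a a'" and b: "finite_energy L b b'"
    and \<rho>: "\<And>n x. 0 \<le> \<rho> n x" "\<And>n x. \<rho> n x \<le> (1::real)" "\<And>x. x \<in> half_open L \<Longrightarrow> (\<lambda>n. \<rho> n x) \<longlonglongrightarrow> 1"
      "\<And>n. \<rho> n \<in> borel_measurable borel"
    and \<kappa>: "(\<lambda>n. LBINT x. a' x * (b x * complex_of_real (\<kappa> n x))) \<longlonglongrightarrow> 0"
      "\<And>n. integrable lborel (\<lambda>x. a' x * (b x * complex_of_real (\<kappa> n x)))"
  shows "(\<lambda>n. LBINT x. a' x * (b x * complex_of_real (\<kappa> n x) + b' x * complex_of_real (\<rho> n x)))
    \<longlonglongrightarrow> (LBINT x. a' x * b' x)"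
    and "integrable lborel (\<lambda>x. a' x * b' x)"
proof -
  have [measurable]: "a' \<in> borel_measurable borel" "b' \<in> borel_measurable borel"
    by (rule finite_energyD(2)[OF a], rule finite_energyD(2)[OF b])
  note [measurable] = \<rho>(4)
  show ab: "integrable lborel (\<lambda>x. a' x * b' x)"
    by (rule integrable_L2_mult) (use a b in \<open>auto simp: finite_energy_def\<close>)
  have le: "norm (a' x * b' x * complex_of_real (\<rho> n x)) \<le> norm (a' x * b' x)" for n x
    using \<rho>(1,2)[of n x] by (simp add: norm_mult mult_left_le)
  have conv: "(\<lambda>n. LBINT x. a' x * b' x * complex_of_real (\<rho> n x)) \<longlonglongrightarrow> (LBINT x. a' x * b' x)"
  proof (rule integral_dominated_convergence[where w="\<lambda>x. norm (a' x * b' x)"])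
    show "AE x in lborel. (\<lambda>n. a' x * b' x * complex_of_real (\<rho> n x)) \<longlonglongrightarrow> a' x * b' x"
    proof (rule AE_I2)
      fix x
      show "(\<lambda>n. a' x * b' x * complex_of_real (\<rho> n x)) \<longlonglongrightarrow> a' x * b' x"
      proof (cases "x \<in> half_open L")
        case True
        have "(\<lambda>n. a' x * b' x * complex_of_real (\<rho> n x)) \<longlonglongrightarrow> a' x * b' x * complex_of_real 1"
          by (intro tendsto_intros \<rho>(3) True)
        then show ?thesis by simp
      next
        case False
        then have "a' x = 0" by (rule finite_energyD(4)[OF a])
        then show ?thesis by simp
      qed
    qed
  qed (use ab le in auto)
  have i: "integrable lborel (\<lambda>x. a' x * b' x * complex_of_real (\<rho> n x))" for n
    by (rule integrable_bound[OF ab]) (use le in auto)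
  have eq: "(LBINT x. a' x * (b x * complex_of_real (\<kappa> n x) + b' x * complex_of_real (\<rho> n x))) =
      (LBINT x. a' x * (b x * complex_of_real (\<kappa> n x))) + (LBINT x. a' x * b' x * complex_of_real (\<rho> n x))" for n
    using integral_add[OF \<kappa>(2) i] by (simp add: algebra_simps)
  show "(\<lambda>n. LBINT x. a' x * (b x * complex_of_real (\<kappa> n x) + b' x * complex_of_real (\<rho> n x)))
    \<longlonglongrightarrow> (LBINT x. a' x * b' x)"
    unfolding eq using tendsto_add[OF \<kappa>(1) conv] by simp
qed

text \<open>Each equation is tested with the other solution times the same cut-off. The terms
  \<open>W n\<close> with the anti-derivative then coincide and cancel after division by
  \<open>z\<close> and \<open>w\<close>, so their convergence never becomes an issue; only
  \<open>A\<close>, \<open>B\<close> and \<open>U\<close> have to converge.\<close>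

lemma weyl_solution_gram:
  assumes L: "0 < L" and \<upsilon>: "borel_measure_on L \<upsilon>"
    and a: "weyl_solution L q \<upsilon> z a a' \<Delta>a" and b: "weyl_solution L q \<upsilon> w b b' \<Delta>b"
    and zw: "z \<noteq> 0" "w \<noteq> 0"
  shows "\<Delta>a / z - \<Delta>b / w = (z - w) * ((\<integral>x. a x * b x \<partial>\<upsilon>) + (LBINT x. a' x * b' x) / (z * w))"
proof -
  obtain \<rho> \<kappa> :: "nat \<Rightarrow> real \<Rightarrow> real" where
      test: "\<And>n. test_function L (\<lambda>x. complex_of_real (\<rho> n x)) (\<lambda>x. complex_of_real (\<kappa> n x))"
      and \<rho>0: "\<And>n. \<rho> n 0 = 1" and \<rho>: "\<And>n x. 0 \<le> \<rho> n x" "\<And>n x. \<rho> n x \<le> 1"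
        "\<And>x. x \<in> half_open L \<Longrightarrow> (\<lambda>n. \<rho> n x) \<longlonglongrightarrow> 1" "\<And>n. \<rho> n \<in> borel_measurable borel"
      and \<kappa>: "\<And>a a' b b'. finite_energy L a a' \<Longrightarrow> finite_energy L b b' \<Longrightarrow>
          (\<lambda>n. LBINT x. a' x * (b x * complex_of_real (\<kappa> n x))) \<longlonglongrightarrow> 0"
        "\<And>n a a' b b'. finite_energy L a a' \<Longrightarrow> finite_energy L b b' \<Longrightarrow>
          integrable lborel (\<lambda>x. a' x * (b x * complex_of_real (\<kappa> n x)))"
    using cutoff_sequence[OF L] by blast
  have ea: "finite_energy L a a'" and eb: "finite_energy L b b'" and 0: "a 0 = 1" "b 0 = 1"
    and wa: "weak_solution L q \<upsilon> z a a' \<Delta>a" and wb: "weak_solution L q \<upsilon> w b b' \<Delta>b"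
    and a2: "integrable \<upsilon> (\<lambda>x. (norm (a x))\<^sup>2)" and b2: "integrable \<upsilon> (\<lambda>x. (norm (b x))\<^sup>2)"
    using a b by (auto simp: weyl_solution_def)
  have wda: "weak_derivative L a a'" and wdb: "weak_derivative L b b'"
    using ea eb by (auto simp: finite_energy_def)
  have [measurable]: "a \<in> borel_measurable \<upsilon>" "b \<in> borel_measurable \<upsilon>"
    using borel_measure_on_measurable[OF \<upsilon>] weak_derivative_continuous_on wda wdb by blast+
  define X where "X n x = complex_of_real (\<rho> n x)" for n x
  define K where "K n x = complex_of_real (\<kappa> n x)" for n x
  define W where "W n = (LBINT x. of_real (q x) * (a x * (b x * K n x + b' x * X n x) + a' x * (b x * X n x)))" for n
  define U where "U n = (\<integral>x. a x * (b x * X n x) \<partial>\<upsilon>)" for n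
  define A where "A n = (LBINT x. a' x * (b x * K n x + b' x * X n x))" for n
  define B where "B n = (LBINT x. b' x * (a x * K n x + a' x * X n x))" for n
  have eq1: "\<Delta>a + A n = z\<^sup>2 * U n - z * W n" for n
  proof -
    have "test_function L (\<lambda>x. b x * X n x) (\<lambda>x. b x * K n x + b' x * X n x)"
      unfolding X_def K_def by (rule test_function_mult[OF wdb test])
    then have "\<Delta>a * (b 0 * X n 0) + A n = z\<^sup>2 * U n - z * W n"
      using wa unfolding weak_solution_def A_def U_def W_def by blast
    then show ?thesis using 0 \<rho>0 by (simp add: X_def)
  qed
  have eq2: "\<Delta>b + B n = w\<^sup>2 * U n - w * W n" for n
  proof -
    have "test_function L (\<lambda>x. a x * X n x) (\<lambda>x. a x * K n x + a' x * X n x)"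
      unfolding X_def K_def by (rule test_function_mult[OF wda test])
    then have "\<Delta>b * (a 0 * X n 0) + B n = w\<^sup>2 * (\<integral>x. b x * (a x * X n x) \<partial>\<upsilon>) -
        w * (LBINT x. of_real (q x) * (b x * (a x * K n x + a' x * X n x) + b' x * (a x * X n x)))"
      using wb unfolding weak_solution_def B_def by blast
    moreover have "(\<integral>x. b x * (a x * X n x) \<partial>\<upsilon>) = U n"
      unfolding U_def by (simp add: mult_ac)
    moreover have "(LBINT x. of_real (q x) * (b x * (a x * K n x + a' x * X n x) + b' x * (a x * X n x))) = W n"
      unfolding W_def by (rule integral_cong) (auto simp: algebra_simps)
    ultimately show ?thesis using 0 \<rho>0 by (simp add: X_def)
  qed
  have eq: "\<Delta>a / z - \<Delta>b / w + A n / z - B n / w = (z - w) * U n" for n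
  proof -
    have "\<Delta>a / z + A n / z = z * U n - W n" "\<Delta>b / w + B n / w = w * U n - W n"
      using eq1[of n] eq2[of n] zw
      by (simp_all add: add_divide_distrib[symmetric] power2_eq_square right_diff_distrib[symmetric] mult.assoc)
    moreover have "\<Delta>a / z - \<Delta>b / w + A n / z - B n / w = (\<Delta>a / z + A n / z) - (\<Delta>b / w + B n / w)" by simp
    ultimately show ?thesis by (simp only:) (simp add: algebra_simps)
  qed
  have limA: "A \<longlonglongrightarrow> (LBINT x. a' x * b' x)"
    unfolding A_def X_def K_def
    by (rule finite_energy_cutoff_limit(1)[OF L ea eb \<rho> \<kappa>(1)[OF ea eb] \<kappa>(2)[OF ea eb]])
  have "B \<longlonglongrightarrow> (LBINT x. b' x * a' x)"
    unfolding B_def X_def K_def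
    by (rule finite_energy_cutoff_limit(1)[OF L eb ea \<rho> \<kappa>(1)[OF eb ea] \<kappa>(2)[OF eb ea]])
  then have limB: "B \<longlonglongrightarrow> (LBINT x. a' x * b' x)" by (simp add: mult.commute)
  have ab: "integrable \<upsilon> (\<lambda>x. a x * b x)" by (rule integrable_L2_mult[OF _ _ a2 b2]) measurable
  have Xm: "X n \<in> borel_measurable \<upsilon>" for n unfolding X_def
    using borel_measure_on_measurable[OF \<upsilon> weak_derivative_continuous_on[OF test_function_imp_weak_derivative[OF test]]] .
  have limU: "U \<longlonglongrightarrow> (\<integral>x. a x * b x \<partial>\<upsilon>)"
    unfolding U_def
  proof (rule integral_dominated_convergence[where w="\<lambda>x. norm (a x * b x)"])
    show "(\<lambda>x. a x * (b x * X n x)) \<in> borel_measurable \<upsilon>" for n using Xm by measurable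
    show "AE x in \<upsilon>. (\<lambda>n. a x * (b x * X n x)) \<longlonglongrightarrow> a x * b x"
    proof (rule AE_I2)
      fix x assume "x \<in> space \<upsilon>"
      then have "(\<lambda>n. a x * (b x * X n x)) \<longlonglongrightarrow> a x * (b x * complex_of_real 1)"
        unfolding X_def borel_measure_on_space[OF \<upsilon>] by (intro tendsto_intros \<rho>(3))
      then show "(\<lambda>n. a x * (b x * X n x)) \<longlonglongrightarrow> a x * b x" by simp
    qed
    show "AE x in \<upsilon>. norm (a x * (b x * X n x)) \<le> norm (a x * b x)" for n
      using \<rho>(1,2) by (auto simp: X_def norm_mult intro!: mult_left_mono mult_left_le)
  qed (use ab in auto)
  have "(\<lambda>n. \<Delta>a / z - \<Delta>b / w + A n / z - B n / w) \<longlonglongrightarrow>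
      \<Delta>a / z - \<Delta>b / w + (LBINT x. a' x * b' x) / z - (LBINT x. a' x * b' x) / w"
    by (intro tendsto_intros limA limB zw)
  moreover have "(\<lambda>n. \<Delta>a / z - \<Delta>b / w + A n / z - B n / w) \<longlonglongrightarrow> (z - w) * (\<integral>x. a x * b x \<partial>\<upsilon>)"
    unfolding eq by (intro tendsto_intros limU)
  ultimately have "\<Delta>a / z - \<Delta>b / w + (LBINT x. a' x * b' x) / z - (LBINT x. a' x * b' x) / w =
      (z - w) * (\<integral>x. a x * b x \<partial>\<upsilon>)" by (rule LIMSEQ_unique)
  note E = this
  have I: "(LBINT x. a' x * b' x) / z - (LBINT x. a' x * b' x) / w =
      - ((z - w) * ((LBINT x. a' x * b' x) / (z * w)))"
    using zw by (simp add: field_simps)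
  have "\<Delta>a / z - \<Delta>b / w = (z - w) * (\<integral>x. a x * b x \<partial>\<upsilon>) -
      ((LBINT x. a' x * b' x) / z - (LBINT x. a' x * b' x) / w)"
    unfolding E[symmetric] by simp
  then show ?thesis unfolding I by (simp add: distrib_left)
qed

section \<open>The spectral measure of a Stieltjes function\<close>

definition inverse_length :: "ereal \<Rightarrow> real" where
  "inverse_length L = (if L = \<infinity> then 0 else 1 / real_of_ereal L)"

lemma recip_Lz_eq: "recip_Lz L z = of_real (inverse_length L) / z"
  by (simp add: recip_Lz_def inverse_length_def)

text \<open>\<open>\<gamma>\<close> stands for \<open>1 / L\<close>, read as 0 for infinite
  \<open>L\<close>. The length itself is kept out, so that this part concerns the representing
  function alone.\<close>

locale herglotz_representation =
  fixes \<mu> :: "real measure" and m :: "complex \<Rightarrow> complex" and c1 c2 \<gamma> :: real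
  assumes sets_\<mu> [measurable_cong]: "sets \<mu> = sets borel" and \<mu>_0: "emeasure \<mu> {0} = 0"
    and \<mu>_int: "integrable \<mu> (\<lambda>t. 1 / (1 + t\<^sup>2))" and c1: "c1 \<ge> 0" and \<gamma>: "\<gamma> \<ge> 0"
    and m_eq: "z \<notin> \<real> \<Longrightarrow> m z = of_real c1 * z + of_real c2 - of_real \<gamma> / z +
      (\<integral>t. 1 / (of_real t - z) - of_real (t / (1 + t\<^sup>2)) \<partial>\<mu>)"
begin

lemma space_\<mu>: "space \<mu> = UNIV"
  using sets_eq_imp_space_eq[OF sets_\<mu>] by simp

lemma integrable_\<mu>_bound:
  fixes f :: "real \<Rightarrow> 'a::{banach,second_countable_topology}"
  assumes "f \<in> borel_measurable borel" "AE t in \<mu>. norm (f t) \<le> C * (1 / (1 + t\<^sup>2))"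
  shows "integrable \<mu> f"
proof (rule integrable_bound)
  show "integrable \<mu> (\<lambda>t. C * (1 / (1 + t\<^sup>2)))" by (rule integrable_mult_right[OF \<mu>_int])
  show "AE t in \<mu>. norm (f t) \<le> norm (C * (1 / (1 + t\<^sup>2)))"
    using assms(2)
  proof eventually_elim
    fix t assume "norm (f t) \<le> C * (1 / (1 + t\<^sup>2))"
    from order_trans[OF this abs_ge_self] show "norm (f t) \<le> norm (C * (1 / (1 + t\<^sup>2)))"
      by (simp only: real_norm_def)
  qed
qed (use assms(1) sets_\<mu> in \<open>simp cong: measurable_cong_sets\<close>)

lemma nonreal_iff: "z \<notin> \<real> \<longleftrightarrow> Im z \<noteq> 0"
  by (simp add: complex_is_Real_iff)

lemma Im_le_norm: "\<bar>Im z\<bar> \<le> norm (of_real t - z)"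
  using abs_Im_le_cmod[of "of_real t - z"] by simp

text \<open>Over a common denominator the numerator is \<open>1 + t z\<close>. It is bounded by a
  multiple of \<open>|t - z|\<close>, because \<open>|t - z|\<close> dominates both
  \<open>|Im z|\<close> and \<open>|t| - |z|\<close>.\<close>

lemma integrable_kernel:
  fixes z :: complex
  assumes z: "z \<notin> \<real>"
  shows "integrable \<mu> (\<lambda>t. 1 / (of_real t - z) - of_real (t / (1 + t\<^sup>2)))"
proof (rule integrable_\<mu>_bound)
  let ?C = "(1 + (norm z)\<^sup>2) / \<bar>Im z\<bar> + norm z"
  show "AE t in \<mu>. norm (1 / (of_real t - z) - of_real (t / (1 + t\<^sup>2))) \<le> ?C * (1 / (1 + t\<^sup>2))"
  proof (rule AE_I2)
    fix t
    have y: "\<bar>Im z\<bar> > 0" using z by (simp add: nonreal_iff)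
    have nz: "of_real t - z \<noteq> 0" using y by (auto simp: complex_eq_iff)
    have p: "1 + t\<^sup>2 > 0" by (intro add_pos_nonneg) auto
    have p': "of_real (1 + t\<^sup>2) \<noteq> (0::complex)" using p by (metis of_real_eq_0_iff less_irrefl)
    have frac: "1 / A - B / P = (P - B * A) / (A * P)" if "A \<noteq> 0" "P \<noteq> 0" for A B P :: complex
      using that by (simp add: field_simps)
    have "1 / (of_real t - z) - of_real (t / (1 + t\<^sup>2)) =
        (of_real (1 + t\<^sup>2) - of_real t * (of_real t - z)) / ((of_real t - z) * of_real (1 + t\<^sup>2))"
      unfolding of_real_divide by (rule frac[OF nz p'])
    also have "of_real (1 + t\<^sup>2) - of_real t * (of_real t - z) = 1 + of_real t * z"
      by (simp add: algebra_simps power2_eq_square)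
    finally have eq: "norm (1 / (of_real t - z) - of_real (t / (1 + t\<^sup>2))) =
        norm (1 + of_real t * z) / (norm (of_real t - z) * (1 + t\<^sup>2))"
      using p by (simp only: norm_divide norm_mult norm_of_real abs_of_pos)
    have "norm (1 + of_real t * z) \<le> 1 + \<bar>t\<bar> * norm z"
      using norm_triangle_ineq[of 1 "of_real t * z"] by (simp add: norm_mult)
    also have "\<bar>t\<bar> \<le> norm (of_real t - z) + norm z"
      using norm_triangle_ineq[of "of_real t - z" z] by simp
    finally have "norm (1 + of_real t * z) \<le> 1 + (norm (of_real t - z) + norm z) * norm z"
      by (simp add: mult_right_mono)
    also have "\<dots> = (1 + (norm z)\<^sup>2) / \<bar>Im z\<bar> * \<bar>Im z\<bar> + norm z * norm (of_real t - z)"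
    proof -
      have cancel: "(1 + (norm z)\<^sup>2) / \<bar>Im z\<bar> * \<bar>Im z\<bar> = 1 + (norm z)\<^sup>2" using y by simp
      show ?thesis unfolding cancel by (simp add: algebra_simps power2_eq_square)
    qed
    also have "\<dots> \<le> (1 + (norm z)\<^sup>2) / \<bar>Im z\<bar> * norm (of_real t - z) + norm z * norm (of_real t - z)"
      by (intro add_right_mono mult_left_mono Im_le_norm) simp
    also have "\<dots> = ?C * norm (of_real t - z)" by (simp only: distrib_right)
    finally have "norm (1 + of_real t * z) / (norm (of_real t - z) * (1 + t\<^sup>2)) \<le>
        (?C * norm (of_real t - z)) / (norm (of_real t - z) * (1 + t\<^sup>2))"
      using p by (intro divide_right_mono) auto
    also have "\<dots> = ?C * (1 / (1 + t\<^sup>2))" using nz by simp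
    finally show "norm (1 / (of_real t - z) - of_real (t / (1 + t\<^sup>2))) \<le> ?C * (1 / (1 + t\<^sup>2))"
      unfolding eq .
  qed
qed measurable

lemma emeasure_bounded: "emeasure \<mu> {a..b} < \<infinity>"
proof -
  let ?R = "1 + (\<bar>a\<bar> + \<bar>b\<bar>)\<^sup>2"
  have "integrable \<mu> (indicator {a..b} :: real \<Rightarrow> real)"
  proof (rule integrable_\<mu>_bound)
    show "AE t in \<mu>. norm (indicator {a..b} t :: real) \<le> ?R * (1 / (1 + t\<^sup>2))"
    proof (rule AE_I2)
      fix t
      show "norm (indicator {a..b} t :: real) \<le> ?R * (1 / (1 + t\<^sup>2))"
      proof (cases "t \<in> {a..b}")
        case True
        then have "\<bar>t\<bar>\<^sup>2 \<le> (\<bar>a\<bar> + \<bar>b\<bar>)\<^sup>2" by (intro power_mono) auto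
        then have "1 \<le> ?R / (1 + t\<^sup>2)" by (subst le_divide_eq_1) (auto intro: add_pos_nonneg)
        then show ?thesis using True by simp
      qed (auto intro!: mult_nonneg_nonneg)
    qed
  qed measurable
  then show ?thesis using space_\<mu> by (simp add: integrable_indicator_iff sets_\<mu>)
qed

text \<open>The imaginary part of \<open>z / (t - z)\<close> is \<open>Im z * t / |t - z|^2\<close>,
  which has the sign of \<open>t\<close>. This is what will keep \<open>\<mu>\<close> away from the
  negative axis.\<close>

lemma Im_z_m:
  assumes z: "Im z > 0"
  shows "Im (z * m z) = Im z * (2 * c1 * Re z + c2 + (\<integral>t. t / (norm (of_real t - z))\<^sup>2 - t / (1 + t\<^sup>2) \<partial>\<mu>))"
    and "integrable \<mu> (\<lambda>t. t / (norm (of_real t - z))\<^sup>2 - t / (1 + t\<^sup>2))"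
proof -
  have nr: "z \<notin> \<real>" and z0: "z \<noteq> 0" using z by (auto simp: nonreal_iff)
  let ?F = "\<lambda>t. 1 / (of_real t - z) - of_real (t / (1 + t\<^sup>2))"
  have Fi: "integrable \<mu> (\<lambda>t. z * ?F t)" by (rule integrable_mult_right[OF integrable_kernel[OF nr]])
  have pw: "Im (z * ?F t) = Im z * (t / (norm (of_real t - z))\<^sup>2 - t / (1 + t\<^sup>2))" for t
  proof -
    have "z * (1 / (of_real t - z)) = z * cnj (of_real t - z) / of_real ((norm (of_real t - z))\<^sup>2)"
      using complex_div_cnj[of z "of_real t - z"] by simp
    then have "Im (z * (1 / (of_real t - z))) = Im z * t / (norm (of_real t - z))\<^sup>2"
      by (simp only: Im_divide_of_real) (simp add: algebra_simps)
    moreover have "Im (z * of_real (t / (1 + t\<^sup>2))) = Im z * (t / (1 + t\<^sup>2))" by simp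
    ultimately show ?thesis
      by (simp only: right_diff_distrib minus_complex.simps) simp
  qed
  have "integrable \<mu> (\<lambda>t. Im (z * ?F t))" by (rule integrable_Im[OF Fi])
  then have "integrable \<mu> (\<lambda>t. Im z * (t / (norm (of_real t - z))\<^sup>2 - t / (1 + t\<^sup>2)))" unfolding pw .
  then show i: "integrable \<mu> (\<lambda>t. t / (norm (of_real t - z))\<^sup>2 - t / (1 + t\<^sup>2))"
    using z by (subst (asm) integrable_mult_left_iff) auto
  have I: "(\<integral>t. z * ?F t \<partial>\<mu>) = z * (\<integral>t. ?F t \<partial>\<mu>)" by (rule integral_mult_right_zero)
  have "z * m z = of_real c1 * z * z + of_real c2 * z - of_real \<gamma> + (\<integral>t. z * ?F t \<partial>\<mu>)"
    unfolding m_eq[OF nr] I using z0 by (simp only: distrib_left right_diff_distrib) (simp add: mult_ac)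
  then have "Im (z * m z) = Im (of_real c1 * z * z + of_real c2 * z - of_real \<gamma>) + Im (\<integral>t. z * ?F t \<partial>\<mu>)"
    by (simp only: plus_complex.simps)
  also have "\<dots> = 2 * c1 * Re z * Im z + c2 * Im z + (\<integral>t. Im (z * ?F t) \<partial>\<mu>)"
    unfolding integral_Im[OF Fi] by (simp add: algebra_simps)
  also have "\<dots> = Im z * (2 * c1 * Re z + c2 + (\<integral>t. t / (norm (of_real t - z))\<^sup>2 - t / (1 + t\<^sup>2) \<partial>\<mu>))"
    unfolding pw integral_mult_right_zero by (simp add: algebra_simps)
  finally show "Im (z * m z) = Im z * (2 * c1 * Re z + c2 + (\<integral>t. t / (norm (of_real t - z))\<^sup>2 - t / (1 + t\<^sup>2) \<partial>\<mu>))" .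
qed

lemma m_cnj:
  assumes z: "z \<notin> \<real>"
  shows "m (cnj z) = cnj (m z)"
proof -
  have nr: "cnj z \<notin> \<real>" using z by (simp add: complex_is_Real_iff)
  have "(\<integral>t. 1 / (of_real t - cnj z) - of_real (t / (1 + t\<^sup>2)) \<partial>\<mu>) =
      (\<integral>t. cnj (1 / (of_real t - z) - of_real (t / (1 + t\<^sup>2))) \<partial>\<mu>)" by simp
  also have "\<dots> = cnj (\<integral>t. 1 / (of_real t - z) - of_real (t / (1 + t\<^sup>2)) \<partial>\<mu>)" by (rule Bochner_Integration.integral_cnj)
  finally show ?thesis unfolding m_eq[OF z] m_eq[OF nr] by simp
qed

end

text \<open>The kernel belongs to \<open>z = x + i e\<close> with \<open>x\<close> negative. Close
  to \<open>x\<close> its first term is negative of order \<open>1 / e^2\<close>; elsewhere the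
  difference is at most a fixed multiple of \<open>1 / (1 + t^2)\<close>, uniformly in
  \<open>x\<close> and \<open>e\<close>. The restriction \<open>e \<le> - b / 2\<close> keeps the
  exceptional interval to the left of \<open>b / 2\<close>.\<close>

lemma stieltjes_kernel_bound:
  fixes a b x e t :: real
  assumes ab: "a \<le> x" "x \<le> b" "b < 0" and e: "0 < e" "e \<le> 1" "e \<le> - b / 2"
  shows "t / ((t - x)\<^sup>2 + e\<^sup>2) - t / (1 + t\<^sup>2) \<le>
    (1 + (1 - a)\<^sup>2 - 1 / (2 * b)) * (1 / (1 + t\<^sup>2)) + b / (4 * e\<^sup>2) * indicator {x - e..x + e} t"
proof -
  define C where "C = 1 + (1 - a)\<^sup>2 - 1 / (2 * b)"
  have b': "- 1 / (2 * b) > 0" using ab by (simp add: divide_less_0_iff)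
  \<comment> \<open>One bound for each region: the first near \<open>x\<close>, the second for
    \<open>t \<ge> 0\<close>, the third for \<open>x / 2 < t < 0\<close>. For
    \<open>t \<le> x / 2\<close> outside the exceptional interval the quotient is not positive, and
    \<open>C > 0\<close> is enough.\<close>
  have C: "C \<ge> 1 + (1 - a)\<^sup>2" "C \<ge> - 1 / (2 * b)" "C \<ge> - (2 * a)" "C > 0"
  proof -
    have "C = 1 + (1 - a)\<^sup>2 + (- 1 / (2 * b))" by (simp add: C_def)
    moreover have "- (2 * a) \<le> 1 + (1 - a)\<^sup>2"
      using zero_le_power2[of a] by (simp add: power2_eq_square algebra_simps)
    ultimately show "C \<ge> 1 + (1 - a)\<^sup>2" "C \<ge> - 1 / (2 * b)" "C \<ge> - (2 * a)" "C > 0"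
      using b' zero_le_power2[of "1 - a"] by linarith+
  qed
  have e2: "e\<^sup>2 > 0" "e\<^sup>2 \<le> 1" using e power_le_one[of e 2] by auto
  define D where "D = (t - x)\<^sup>2 + e\<^sup>2"
  have D: "D > 0" unfolding D_def using e2 by (intro add_nonneg_pos) auto
  have p: "1 + t\<^sup>2 > 0" by (intro add_pos_nonneg) auto
  show ?thesis
  proof (cases "t \<in> {x - e..x + e}")
    case True
    have "\<bar>t - x\<bar>\<^sup>2 \<le> e\<^sup>2" using True by (intro power_mono) auto
    then have D2: "D \<le> 2 * e\<^sup>2" by (simp add: D_def)
    have tb: "t \<le> b / 2" using True ab e by auto
    have "t / D \<le> b / (4 * e\<^sup>2)"
    proof -
      have "t * (4 * e\<^sup>2) \<le> (b / 2) * (4 * e\<^sup>2)" using tb e2 by (intro mult_right_mono) auto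
      also have "\<dots> = b * (2 * e\<^sup>2)" by simp
      also have "\<dots> \<le> b * D" using D2 ab by (intro mult_left_mono_neg) auto
      finally show ?thesis using D e2 by (simp add: divide_simps mult.commute)
    qed
    moreover have "- t / (1 + t\<^sup>2) \<le> C * (1 / (1 + t\<^sup>2))"
    proof -
      have "- t \<le> 1 - a" using True e ab by auto
      also have "\<dots> \<le> 1 + (1 - a)\<^sup>2"
        using zero_le_power2[of "1 - a - 1 / 2"] by (simp add: power2_eq_square algebra_simps)
      also have "\<dots> \<le> C" by (rule C(1))
      finally show ?thesis using p divide_right_mono[of "- t" C "1 + t\<^sup>2"] by simp
    qed
    ultimately show ?thesis using True by (simp add: D_def C_def)
  next
    case False
    have eq: "t / D - t / (1 + t\<^sup>2) = t * (1 + 2 * t * x - x\<^sup>2 - e\<^sup>2) / D * (1 / (1 + t\<^sup>2))"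
      using D p by (simp add: D_def power2_eq_square field_simps)
    have "t * (1 + 2 * t * x - x\<^sup>2 - e\<^sup>2) / D \<le> C"
    proof (cases "t \<ge> 0")
      case True
      have "t * x \<le> 0" using True ab by (simp add: mult_nonneg_nonpos)
      then have tx: "2 * t * x \<le> 0" by simp
      have "t * (1 + 2 * t * x - x\<^sup>2 - e\<^sup>2) \<le> t * 1"
        using True tx e2 zero_le_power2[of x] by (intro mult_left_mono) linarith+
      also have "t * 1 \<le> - 1 / (2 * b) * D"
      proof -
        have "t * (- 2 * b) \<le> t * (- 2 * x)" using True ab by (simp add: mult_left_mono)
        also have "\<dots> \<le> D" using e2 zero_le_power2[of t] zero_le_power2[of x]
          by (simp add: D_def power2_eq_square algebra_simps)
        finally show ?thesis using ab by (simp add: field_simps)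
      qed
      also have "\<dots> \<le> C * D" using C(2) D by (intro mult_right_mono) auto
      finally show ?thesis using D by (simp add: pos_divide_le_eq)
    next
      case neg: False
      show ?thesis
      proof (cases "t \<le> x / 2")
        case True
        have "2 * t * x \<ge> x\<^sup>2"
          using mult_right_mono_neg[OF True, of x] ab by (simp add: power2_eq_square)
        then have "t * (1 + 2 * t * x - x\<^sup>2 - e\<^sup>2) \<le> 0"
          using neg e2 by (intro mult_nonpos_nonneg) auto
        then show ?thesis using divide_nonpos_pos[OF _ D] C(4) by force
      next
        case far: False
        have "(- x / 2)\<^sup>2 \<le> (t - x)\<^sup>2" using far ab by (intro power_mono) auto
        then have Dx: "x\<^sup>2 / 4 \<le> D" using e2 by (simp add: D_def power2_eq_square)
        have "t * (1 + 2 * t * x - x\<^sup>2 - e\<^sup>2) \<le> t * (- (x\<^sup>2))"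
        proof (rule mult_left_mono_neg)
          have "0 \<le> t * x" using neg ab by (simp add: mult_nonpos_nonpos)
          then show "- (x\<^sup>2) \<le> 1 + 2 * t * x - x\<^sup>2 - e\<^sup>2" using e2 by linarith
        qed (use neg in simp)
        also have "\<dots> = (- 4 * t) * (x\<^sup>2 / 4)" by simp
        also have "\<dots> \<le> (- 4 * t) * D" using Dx neg by (intro mult_left_mono) auto
        also have "\<dots> \<le> C * D" using C(3) far ab D by (intro mult_right_mono) auto
        finally show ?thesis using D by (simp add: pos_divide_le_eq)
      qed
    qed
    then have "t * (1 + 2 * t * x - x\<^sup>2 - e\<^sup>2) / D * (1 / (1 + t\<^sup>2)) \<le> C * (1 / (1 + t\<^sup>2))"
      using p by (intro mult_right_mono) auto
    then show ?thesis using False eq by (simp add: D_def C_def)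
  qed
qed

locale stieltjes_representation = herglotz_representation +
  assumes Im_zm: "Im z > 0 \<Longrightarrow> Im (z * m z) \<ge> 0"
begin

lemma kernel_integral_nonneg:
  "Im z > 0 \<Longrightarrow> 0 \<le> 2 * c1 * Re z + c2 + (\<integral>t. t / (norm (of_real t - z))\<^sup>2 - t / (1 + t\<^sup>2) \<partial>\<mu>)"
  using Im_z_m(1)[of z] Im_zm[of z] by (simp add: zero_le_mult_iff)

text \<open>The rest of the integral must outweigh the large negative contribution near
  \<open>x\<close>, so little measure can sit there. The quadratic order in \<open>e\<close> is what
  matters: it beats the number of intervals in a cover.\<close>

lemma measure_small_interval:
  assumes ab: "a \<le> b" "b < 0"
  obtains K where "\<And>x e. a \<le> x \<Longrightarrow> x \<le> b \<Longrightarrow> 0 < e \<Longrightarrow> e \<le> 1 \<Longrightarrow> e \<le> - b / 2 \<Longrightarrow>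
    measure \<mu> {x - e..x + e} \<le> K * e\<^sup>2"
proof -
  define C where "C = 1 + (1 - a)\<^sup>2 - 1 / (2 * b)"
  define J where "J = (\<integral>t. 1 / (1 + t\<^sup>2) \<partial>\<mu>)"
  show ?thesis
  proof (rule that[of "(c2 + C * J) * 4 / (- b)"])
    fix x e assume x: "a \<le> x" "x \<le> b" and e: "0 < e" "e \<le> 1" "e \<le> - b / 2"
    let ?z = "Complex x e"
    have nz: "(norm (of_real t - ?z))\<^sup>2 = (t - x)\<^sup>2 + e\<^sup>2" for t by (simp add: cmod_power2)
    have ii: "integrable \<mu> (indicator {x - e..x + e} :: real \<Rightarrow> real)"
      using emeasure_bounded by (simp add: integrable_indicator_iff sets_\<mu>)
    have "0 \<le> 2 * c1 * x + c2 + (\<integral>t. t / ((t - x)\<^sup>2 + e\<^sup>2) - t / (1 + t\<^sup>2) \<partial>\<mu>)"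
      using kernel_integral_nonneg[of ?z] e unfolding nz by simp
    also have "(\<integral>t. t / ((t - x)\<^sup>2 + e\<^sup>2) - t / (1 + t\<^sup>2) \<partial>\<mu>) \<le>
        (\<integral>t. C * (1 / (1 + t\<^sup>2)) + b / (4 * e\<^sup>2) * indicator {x - e..x + e} t \<partial>\<mu>)"
    proof (rule integral_mono)
      show "integrable \<mu> (\<lambda>t. t / ((t - x)\<^sup>2 + e\<^sup>2) - t / (1 + t\<^sup>2))"
        using Im_z_m(2)[of ?z] e unfolding nz by simp
      show "integrable \<mu> (\<lambda>t. C * (1 / (1 + t\<^sup>2)) + b / (4 * e\<^sup>2) * indicator {x - e..x + e} t)"
        by (intro integrable_add integrable_mult_right \<mu>_int ii)
    qed (unfold C_def, rule stieltjes_kernel_bound[OF x ab(2) e])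
    also have "\<dots> = C * J + b / (4 * e\<^sup>2) * measure \<mu> {x - e..x + e}"
      unfolding J_def
      by (subst integral_add)
        (auto intro!: integrable_mult_right \<mu>_int ii simp: space_\<mu> simp del: mult_divide_mult_cancel_left_if times_divide_eq_right)
    finally have "0 \<le> 2 * c1 * x + c2 + (C * J + b / (4 * e\<^sup>2) * measure \<mu> {x - e..x + e})" by simp
    moreover have "2 * c1 * x \<le> 0" using c1 x ab by (simp add: mult_nonneg_nonpos)
    ultimately have "- b / (4 * e\<^sup>2) * measure \<mu> {x - e..x + e} \<le> c2 + C * J" by simp
    then show "measure \<mu> {x - e..x + e} \<le> (c2 + C * J) * 4 / (- b) * e\<^sup>2"
      using ab e by (simp add: field_simps)
  qed
qed

lemma measure_negative_interval:
  assumes ab: "a \<le> b" "b < 0"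
  shows "emeasure \<mu> {a..b} = 0"
proof -
  obtain K where K: "\<And>x e. a \<le> x \<Longrightarrow> x \<le> b \<Longrightarrow> 0 < e \<Longrightarrow> e \<le> 1 \<Longrightarrow> e \<le> - b / 2 \<Longrightarrow>
      measure \<mu> {x - e..x + e} \<le> K * e\<^sup>2"
    using measure_small_interval[OF ab] by blast
  have fm: "{u..v} \<in> fmeasurable \<mu>" for u v using emeasure_bounded by (simp add: fmeasurable_def sets_\<mu>)
  \<comment> \<open>The \<open>+ 1\<close> makes the step positive also for \<open>a = b\<close>,
    and \<open>n + 1\<close> steps reach beyond \<open>b\<close>. The \<open>n + 1\<close> intervals
    have measure of order \<open>(h n)\<^sup>2\<close> each, in total of order
    \<open>h n\<close>.\<close>
  define h where "h n = (b - a + 1) / real (Suc n)" for n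
  have hlim: "h \<longlonglongrightarrow> 0" unfolding h_def
    using LIMSEQ_ignore_initial_segment[OF lim_const_over_n[of "b - a + 1"], of 1] by simp
  have h0: "h n > 0" for n using ab by (simp add: h_def)
  have "\<forall>\<^sub>F n in sequentially. h n < min 1 (- b / 2)"
    by (rule order_tendstoD(2)[OF hlim]) (use ab in simp)
  then have "\<forall>\<^sub>F n in sequentially. measure \<mu> {a..b} \<le> K * (b - a + 1) * h n"
  proof eventually_elim
    fix n assume n: "h n < min 1 (- b / 2)"
    define x where "x j = min b (a + real j * h n)" for j
    have hs: "h n * real (Suc n) = b - a + 1" by (simp add: h_def)
    have "{a..b} \<subseteq> (\<Union>j\<le>n. {x j - h n..x j + h n})"
    proof
      fix u assume u: "u \<in> {a..b}"
      define j where "j = nat \<lfloor>(u - a) / h n\<rfloor>"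
      have q0: "(u - a) / h n \<ge> 0" using u h0[of n] by simp
      have j1: "real j \<le> (u - a) / h n" "(u - a) / h n < real j + 1"
        using q0 unfolding j_def by linarith+
      have j2: "real j * h n \<le> u - a" "u - a < real j * h n + h n"
        using j1 h0[of n] by (auto simp: field_simps)
      have "real j * h n < real (Suc n) * h n" using j2 u hs by (simp add: mult.commute)
      then have "j \<le> n" using h0[of n] by simp
      moreover have "x j \<le> u" "u \<le> x j + h n" using u j2 h0[of n] by (auto simp: x_def min_def)
      ultimately show "u \<in> (\<Union>j\<le>n. {x j - h n..x j + h n})" using h0[of n] by (auto intro!: bexI[of _ j])
    qed
    then have "measure \<mu> {a..b} \<le> measure \<mu> (\<Union>j\<le>n. {x j - h n..x j + h n})"
      by (intro measure_mono_fmeasurable fmeasurable.finite_UN fm) (auto simp: sets_\<mu> intro: fm)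
    also have "\<dots> \<le> (\<Sum>j\<le>n. measure \<mu> {x j - h n..x j + h n})"
      by (rule measure_UNION_le) (auto simp: sets_\<mu>)
    also have "\<dots> \<le> (\<Sum>j\<le>n. K * (h n)\<^sup>2)"
    proof (rule sum_mono)
      fix j
      have "0 \<le> real j * h n" using h0[of n] by simp
      then show "measure \<mu> {x j - h n..x j + h n} \<le> K * (h n)\<^sup>2"
        by (intro K) (use n h0[of n] ab in \<open>auto simp: x_def\<close>)
    qed
    also have "\<dots> = K * (h n * real (Suc n)) * h n" by (simp add: power2_eq_square mult_ac)
    finally show "measure \<mu> {a..b} \<le> K * (b - a + 1) * h n" unfolding hs .
  qed
  moreover have "(\<lambda>n. K * (b - a + 1) * h n) \<longlonglongrightarrow> K * (b - a + 1) * 0" by (intro tendsto_intros hlim)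
  ultimately have "measure \<mu> {a..b} \<le> 0"
    using tendsto_le[OF _ _ tendsto_const, of sequentially] by force
  then have "measure \<mu> {a..b} = 0" using measure_nonneg[of \<mu>] by (simp add: order_antisym)
  then show ?thesis using emeasure_bounded[of a b] by (auto simp: measure_def enn2real_eq_0_iff)
qed

lemma AE_positive: "AE t in \<mu>. 0 < t"
proof -
  have "AE t in \<mu>. \<forall>n. t \<notin> {- real n..- 1 / real (Suc n)}"
  proof (subst AE_all_countable, rule allI)
    fix n
    show "AE t in \<mu>. t \<notin> {- real n..- 1 / real (Suc n)}"
    proof (cases "- real n \<le> - 1 / real (Suc n)")
      case True
      have "emeasure \<mu> {- real n..- 1 / real (Suc n)} = 0"
        by (rule measure_negative_interval[OF True]) simp
      then show ?thesis by (intro AE_not_in) (simp add: null_sets_def sets_\<mu>)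
    qed simp
  qed
  moreover have "AE t in \<mu>. t \<noteq> 0"
    using AE_not_in[of "{0}" \<mu>] \<mu>_0 by (simp add: null_sets_def sets_\<mu>)
  ultimately show ?thesis
  proof eventually_elim
    fix t :: real assume t: "\<forall>n. t \<notin> {- real n..- 1 / real (Suc n)}" "t \<noteq> 0"
    show "0 < t"
    proof (rule ccontr)
      assume "\<not> 0 < t"
      then have neg: "t < 0" using t(2) by simp
      obtain k where k: "max (- t) (1 / (- t)) < real k" using reals_Archimedean2 by blast
      have "1 < real k * (- t)" using k neg by (simp add: field_simps)
      also have "\<dots> \<le> real (Suc k) * (- t)" using neg by (intro mult_right_mono) auto
      finally have "t \<le> - 1 / real (Suc k)" using neg by (simp add: field_simps)
      moreover have "- real k \<le> t" using k by simp
      ultimately show False using t(1) by auto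
    qed
  qed
qed

end

section \<open>The function and its divided differences at the negative axis\<close>

context stieltjes_representation
begin

text \<open>The divided difference of \<open>m\<close>, written so that it makes sense for
  \<open>z = w\<close> and on the negative axis, which keeps a positive distance from the positive
  \<open>t\<close> that carry \<open>\<mu>\<close>.\<close>

definition negative_kernel :: "complex \<Rightarrow> complex \<Rightarrow> complex" where
  "negative_kernel z w = of_real c1 + of_real \<gamma> / (z * w) +
     (\<integral>t. 1 / ((of_real t - z) * (of_real t - w)) \<partial>\<mu>)"

text \<open>The representation read at \<open>z = - l\<close>. The given \<open>m\<close> carries no
  information at real points, so the value is defined anew and justified by a limit.\<close>

definition m_neg :: "real \<Rightarrow> real" where
  "m_neg l = - c1 * l + c2 + \<gamma> / l + (\<integral>t. 1 / (t + l) - t / (1 + t\<^sup>2) \<partial>\<mu>)"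

lemma norm_kernel_ge:
  assumes "0 < t" "Re z \<le> - l"
  shows "t + l \<le> norm (of_real t - z)"
  using abs_Re_le_cmod[of "of_real t - z"] assms by simp

lemma AE_square_kernel_le:
  assumes "l > 0"
  shows "AE t in \<mu>. 1 / (t + l)\<^sup>2 \<le> (1 + 1 / l\<^sup>2) * (1 / (1 + t\<^sup>2))"
  using AE_positive
proof eventually_elim
  fix t :: real assume t: "0 < t"
  have "1 + t\<^sup>2 \<le> (1 + 1 / l\<^sup>2) * (t + l)\<^sup>2"
  proof -
    have "l\<^sup>2 \<le> (t + l)\<^sup>2" "t\<^sup>2 \<le> (t + l)\<^sup>2" using t assms by (auto intro!: power_mono)
    then have "1 \<le> (1 / l\<^sup>2) * (t + l)\<^sup>2" using assms by (simp add: field_simps)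
    then show ?thesis using \<open>t\<^sup>2 \<le> (t + l)\<^sup>2\<close> by (simp add: distrib_right)
  qed
  then show "1 / (t + l)\<^sup>2 \<le> (1 + 1 / l\<^sup>2) * (1 / (1 + t\<^sup>2))"
    using t assms by (simp add: divide_simps add_pos_nonneg mult.commute)
qed

lemma integrable_square_kernel:
  assumes "l > 0"
  shows "integrable \<mu> (\<lambda>t. 1 / (t + l)\<^sup>2)"
  by (rule integrable_\<mu>_bound, measurable) (use AE_square_kernel_le[OF assms] in simp)

lemma integrable_product_kernel:
  assumes l: "l > 0" and z: "Re z \<le> - l" and w: "Re w \<le> - l"
  shows "integrable \<mu> (\<lambda>t. 1 / ((of_real t - z) * (of_real t - w)))"
proof (rule integrable_bound[OF integrable_square_kernel[OF l]])
  show "AE t in \<mu>. norm (1 / ((of_real t - z) * (of_real t - w))) \<le> norm (1 / (t + l)\<^sup>2)"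
    using AE_positive
  proof eventually_elim
    fix t :: real assume t: "0 < t"
    have "(t + l)\<^sup>2 \<le> norm (of_real t - z) * norm (of_real t - w)"
      unfolding power2_eq_square using t l norm_kernel_ge[OF t z] norm_kernel_ge[OF t w]
      by (intro mult_mono) auto
    then show "norm (1 / ((of_real t - z) * (of_real t - w))) \<le> norm (1 / (t + l)\<^sup>2)"
      using t l by (simp add: norm_divide norm_mult frac_le)
  qed
qed (simp cong: measurable_cong_sets add: sets_\<mu>)

lemma AE_kernel_diff_le:
  assumes l: "l > 0"
  shows "AE t in \<mu>. \<bar>1 / (t + l) - t / (1 + t\<^sup>2)\<bar> \<le> (l + 1 / l) * (1 / (1 + t\<^sup>2))"
  using AE_positive
proof eventually_elim
  fix t :: real assume t: "0 < t"
  have p: "1 + t\<^sup>2 > 0" by (intro add_pos_nonneg) auto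
  have "1 / (t + l) - t / (1 + t\<^sup>2) = (1 - t * l) / (t + l) * (1 / (1 + t\<^sup>2))"
    using t l p by (simp add: field_simps power2_eq_square)
  then have "\<bar>1 / (t + l) - t / (1 + t\<^sup>2)\<bar> = \<bar>(1 - t * l) / (t + l)\<bar> * (1 / (1 + t\<^sup>2))"
    using p by (simp add: abs_mult)
  moreover have "\<bar>(1 - t * l) / (t + l)\<bar> \<le> l + 1 / l"
  proof -
    have "\<bar>1 - t * l\<bar> \<le> 1 + t * l" using t l by (simp add: abs_le_iff)
    also have "1 + t * l \<le> (l + 1 / l) * (t + l)"
      using t l by (simp add: field_simps)
    finally show ?thesis using t l by (simp add: abs_divide pos_divide_le_eq)
  qed
  ultimately show "\<bar>1 / (t + l) - t / (1 + t\<^sup>2)\<bar> \<le> (l + 1 / l) * (1 / (1 + t\<^sup>2))"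
    using p by (simp only: mult_right_mono zero_le_divide_1_iff less_imp_le)
qed

lemma integrable_m_neg:
  assumes "l > 0"
  shows "integrable \<mu> (\<lambda>t. 1 / (t + l) - t / (1 + t\<^sup>2))"
  by (rule integrable_\<mu>_bound, measurable) (use AE_kernel_diff_le[OF assms] in simp)

text \<open>The positivity of \<open>Im (z * m z)\<close> is used at \<open>z = - l + i\<close>.
  There the integrand is below that of \<open>m_neg\<close>, since
  \<open>t / ((t + l)^2 + 1)\<close> is at most \<open>1 / (t + l)\<close>, and the other terms do
  not exceed those of \<open>m_neg\<close> either.\<close>

lemma m_neg_nonneg:
  assumes l: "l > 0"
  shows "0 \<le> m_neg l"
proof -
  let ?z = "Complex (- l) 1"
  have nz: "(norm (of_real t - ?z))\<^sup>2 = (t + l)\<^sup>2 + 1" for t by (simp add: cmod_power2)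
  have "0 \<le> c2 - 2 * (c1 * l) + (\<integral>t. t / ((t + l)\<^sup>2 + 1) - t / (1 + t\<^sup>2) \<partial>\<mu>)"
    using kernel_integral_nonneg[of ?z] unfolding nz by (simp add: mult_ac)
  moreover have "(\<integral>t. t / ((t + l)\<^sup>2 + 1) - t / (1 + t\<^sup>2) \<partial>\<mu>) \<le> (\<integral>t. 1 / (t + l) - t / (1 + t\<^sup>2) \<partial>\<mu>)"
  proof (rule integral_mono_AE)
    show "integrable \<mu> (\<lambda>t. t / ((t + l)\<^sup>2 + 1) - t / (1 + t\<^sup>2))"
      using Im_z_m(2)[of ?z] unfolding nz by simp
    show "AE t in \<mu>. t / ((t + l)\<^sup>2 + 1) - t / (1 + t\<^sup>2) \<le> 1 / (t + l) - t / (1 + t\<^sup>2)"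
      using AE_positive
    proof eventually_elim
      fix t :: real assume t: "0 < t"
      have "t * (t + l) \<le> (t + l)\<^sup>2 + 1" using t l by (simp add: power2_eq_square algebra_simps add_nonneg_nonneg)
      moreover have "(t + l)\<^sup>2 + 1 > 0" by (intro add_nonneg_pos) auto
      ultimately have "t / ((t + l)\<^sup>2 + 1) \<le> 1 / (t + l)"
        using t l by (simp add: pos_divide_le_eq pos_le_divide_eq)
      then show "t / ((t + l)\<^sup>2 + 1) - t / (1 + t\<^sup>2) \<le> 1 / (t + l) - t / (1 + t\<^sup>2)" by simp
    qed
  qed (rule integrable_m_neg[OF l])
  moreover have "0 \<le> c1 * l" "0 \<le> \<gamma> / l" using c1 \<gamma> l by auto
  ultimately show ?thesis unfolding m_neg_def by simp
qed

lemma nonreal_nonzero: "Im t \<noteq> Im z \<Longrightarrow> t - z \<noteq> 0"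
  by (auto simp: complex_eq_iff)

lemma m_diff:
  assumes l: "l > 0" and z: "Re z \<le> - l" "z \<notin> \<real>" and w: "Re w \<le> - l" "w \<notin> \<real>"
  shows "m z - m w = (z - w) * negative_kernel z w"
proof -
  have z0: "z \<noteq> 0" "w \<noteq> 0" using z w by (auto simp: nonreal_iff)
  let ?F = "\<lambda>z t. 1 / (of_real t - z) - of_real (t / (1 + t\<^sup>2))"
  have pw: "?F z t - ?F w t = (z - w) * (1 / ((of_real t - z) * (of_real t - w)))" for t
  proof -
    have "of_real t - z \<noteq> 0" "of_real t - w \<noteq> 0"
      using z w by (auto simp: nonreal_iff intro!: nonreal_nonzero)
    then show ?thesis by (simp add: field_simps)
  qed
  have "(\<integral>t. ?F z t \<partial>\<mu>) - (\<integral>t. ?F w t \<partial>\<mu>) = (\<integral>t. ?F z t - ?F w t \<partial>\<mu>)"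
    by (rule integral_diff[symmetric]; rule integrable_kernel; fact)
  also have "\<dots> = (z - w) * (\<integral>t. 1 / ((of_real t - z) * (of_real t - w)) \<partial>\<mu>)"
    unfolding pw by (rule integral_mult_right_zero)
  finally have I: "(\<integral>t. ?F z t \<partial>\<mu>) = (\<integral>t. ?F w t \<partial>\<mu>) + (z - w) * (\<integral>t. 1 / ((of_real t - z) * (of_real t - w)) \<partial>\<mu>)"
    by (simp add: algebra_simps)
  have G: "of_real \<gamma> / w - of_real \<gamma> / z = (z - w) * (of_real \<gamma> / (z * w))"
    using z0 by (simp add: field_simps)
  have "m z - m w = of_real c1 * (z - w) + (of_real \<gamma> / w - of_real \<gamma> / z) +
      (z - w) * (\<integral>t. 1 / ((of_real t - z) * (of_real t - w)) \<partial>\<mu>)"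
    unfolding m_eq[OF z(2)] m_eq[OF w(2)] I by (simp add: algebra_simps)
  then show ?thesis unfolding G negative_kernel_def by (simp add: algebra_simps)
qed

lemma negative_kernel_limit:
  assumes l: "l > 0" and z: "\<And>n. Re (z n) \<le> - l" "z \<longlonglongrightarrow> x" and w: "\<And>n. Re (w n) \<le> - l" "w \<longlonglongrightarrow> y"
  shows "(\<lambda>n. negative_kernel (z n) (w n)) \<longlonglongrightarrow> negative_kernel x y"
proof -
  have x: "Re x \<le> - l" by (rule LIMSEQ_le_const2[OF tendsto_Re[OF z(2)]]) (use z(1) in blast)
  have y: "Re y \<le> - l" by (rule LIMSEQ_le_const2[OF tendsto_Re[OF w(2)]]) (use w(1) in blast)
  have 0: "x \<noteq> 0" "y \<noteq> 0" using x y l by auto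
  have "(\<lambda>n. \<integral>t. 1 / ((of_real t - z n) * (of_real t - w n)) \<partial>\<mu>) \<longlonglongrightarrow>
      (\<integral>t. 1 / ((of_real t - x) * (of_real t - y)) \<partial>\<mu>)"
  proof (rule integral_dominated_convergence[where w="\<lambda>t. 1 / (t + l)\<^sup>2"])
    show "AE t in \<mu>. (\<lambda>n. 1 / ((of_real t - z n) * (of_real t - w n))) \<longlonglongrightarrow> 1 / ((of_real t - x) * (of_real t - y))"
      using AE_positive
    proof eventually_elim
      fix t :: real assume "0 < t"
      then have "Re (of_real t - x) > 0" "Re (of_real t - y) > 0" using x y l by auto
      then have "of_real t - x \<noteq> 0" "of_real t - y \<noteq> 0" by force+
      then have "(of_real t - x) * (of_real t - y) \<noteq> 0" by simp
      then show "(\<lambda>n. 1 / ((of_real t - z n) * (of_real t - w n))) \<longlonglongrightarrow> 1 / ((of_real t - x) * (of_real t - y))"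
        by (intro tendsto_intros z w)
    qed
    show "AE t in \<mu>. norm (1 / ((of_real t - z n) * (of_real t - w n))) \<le> 1 / (t + l)\<^sup>2" for n
      using AE_positive
    proof eventually_elim
      fix t :: real assume t: "0 < t"
      have "(t + l)\<^sup>2 \<le> norm (of_real t - z n) * norm (of_real t - w n)"
        unfolding power2_eq_square using t l norm_kernel_ge[OF t z(1)] norm_kernel_ge[OF t w(1)]
        by (intro mult_mono) auto
      then show "norm (1 / ((of_real t - z n) * (of_real t - w n))) \<le> 1 / (t + l)\<^sup>2"
        using t l by (simp add: norm_divide norm_mult frac_le)
    qed
  qed (use integrable_square_kernel[OF l] in \<open>simp_all cong: measurable_cong_sets add: sets_\<mu>\<close>)
  then show ?thesis unfolding negative_kernel_def
    by (intro tendsto_intros z w) (use 0 in auto)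
qed

text \<open>The kernels at \<open>z n\<close> and at \<open>- l\<close> differ by at most
  \<open>|z n + l| / (t + l)^2\<close>, whose integral is proportional to the distance of the two
  points.\<close>

lemma m_limit:
  assumes l: "l > 0" and z: "\<And>n. Re (z n) = - l" "\<And>n. z n \<notin> \<real>" "z \<longlonglongrightarrow> of_real (- l)"
  shows "(\<lambda>n. m (z n)) \<longlonglongrightarrow> of_real (m_neg l)"
proof -
  let ?F = "\<lambda>z t. 1 / (of_real t - z) - of_real (t / (1 + t\<^sup>2)) :: complex"
  have "(\<lambda>n. \<integral>t. ?F (z n) t \<partial>\<mu>) \<longlonglongrightarrow> (\<integral>t. of_real (1 / (t + l) - t / (1 + t\<^sup>2)) \<partial>\<mu>)"
  proof (rule LIM_zero_cancel, rule tendsto_zero_of_square[where Y="\<lambda>n. (norm (z n + of_real l) * (\<integral>t. 1 / (t + l)\<^sup>2 \<partial>\<mu>))\<^sup>2"])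
    fix n
    have ii: "integrable \<mu> (\<lambda>t. complex_of_real (1 / (t + l) - t / (1 + t\<^sup>2)))"
      using integrable_m_neg[OF l] by (simp only: complex_of_real_integrable_eq)
    have "norm ((\<integral>t. ?F (z n) t \<partial>\<mu>) - (\<integral>t. of_real (1 / (t + l) - t / (1 + t\<^sup>2)) \<partial>\<mu>)) =
        norm (\<integral>t. ?F (z n) t - of_real (1 / (t + l) - t / (1 + t\<^sup>2)) \<partial>\<mu>)"
      using integral_diff[OF integrable_kernel[OF z(2)] ii] by (simp only:)
    also have "\<dots> \<le> (\<integral>t. norm (?F (z n) t - of_real (1 / (t + l) - t / (1 + t\<^sup>2))) \<partial>\<mu>)"
      by (rule integral_norm_bound)
    also have "\<dots> \<le> (\<integral>t. norm (z n + of_real l) * (1 / (t + l)\<^sup>2) \<partial>\<mu>)"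
    proof (rule integral_mono_AE)
      show "integrable \<mu> (\<lambda>t. norm (?F (z n) t - of_real (1 / (t + l) - t / (1 + t\<^sup>2))))"
        by (rule integrable_norm, rule integrable_diff[OF integrable_kernel[OF z(2)] ii])
      show "AE t in \<mu>. norm (?F (z n) t - of_real (1 / (t + l) - t / (1 + t\<^sup>2))) \<le> norm (z n + of_real l) * (1 / (t + l)\<^sup>2)"
        using AE_positive
      proof eventually_elim
        fix t :: real assume t: "0 < t"
        have nz: "of_real t - z n \<noteq> 0" "complex_of_real (t + l) \<noteq> 0"
          using t l z(1)[of n] by (auto simp: complex_eq_iff)
        have "?F (z n) t - of_real (1 / (t + l) - t / (1 + t\<^sup>2)) =
            1 / (of_real t - z n) - 1 / of_real (t + l)" by (simp del: of_real_add)
        also have "\<dots> = (z n + of_real l) / ((of_real t - z n) * of_real (t + l))"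
          using nz by (simp add: diff_frac_eq)
        finally have "norm (?F (z n) t - of_real (1 / (t + l) - t / (1 + t\<^sup>2))) =
            norm (z n + of_real l) / (norm (of_real t - z n) * (t + l))"
          using t l by (simp only: norm_divide norm_mult norm_of_real abs_of_pos add_pos_pos)
        also have "\<dots> \<le> norm (z n + of_real l) / ((t + l) * (t + l))"
          using t l norm_kernel_ge[OF t, of "z n" l] z(1)[of n] by (intro divide_left_mono mult_right_mono mult_pos_pos) auto
        finally show "norm (?F (z n) t - of_real (1 / (t + l) - t / (1 + t\<^sup>2))) \<le> norm (z n + of_real l) * (1 / (t + l)\<^sup>2)"
          by (simp add: power2_eq_square)
      qed
    qed (intro integrable_mult_right integrable_square_kernel l)
    also have "\<dots> = norm (z n + of_real l) * (\<integral>t. 1 / (t + l)\<^sup>2 \<partial>\<mu>)" by (rule integral_mult_right_zero)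
    finally show "(norm ((\<integral>t. ?F (z n) t \<partial>\<mu>) - (\<integral>t. of_real (1 / (t + l) - t / (1 + t\<^sup>2)) \<partial>\<mu>)))\<^sup>2 \<le>
        (norm (z n + of_real l) * (\<integral>t. 1 / (t + l)\<^sup>2 \<partial>\<mu>))\<^sup>2" by (intro power_mono) auto
  next
    have "(\<lambda>n. (norm (z n + of_real l) * (\<integral>t. 1 / (t + l)\<^sup>2 \<partial>\<mu>))\<^sup>2) \<longlonglongrightarrow>
        (norm (of_real (- l) + complex_of_real l) * (\<integral>t. 1 / (t + l)\<^sup>2 \<partial>\<mu>))\<^sup>2" by (intro tendsto_intros z)
    then show "(\<lambda>n. (norm (z n + of_real l) * (\<integral>t. 1 / (t + l)\<^sup>2 \<partial>\<mu>))\<^sup>2) \<longlonglongrightarrow> 0" by simp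
  qed
  moreover have "(\<integral>t. complex_of_real (1 / (t + l) - t / (1 + t\<^sup>2)) \<partial>\<mu>) = of_real (\<integral>t. 1 / (t + l) - t / (1 + t\<^sup>2) \<partial>\<mu>)"
    by (rule integral_complex_of_real)
  ultimately have "(\<lambda>n. of_real c1 * z n + of_real c2 - of_real \<gamma> / z n + (\<integral>t. ?F (z n) t \<partial>\<mu>)) \<longlonglongrightarrow>
      of_real c1 * of_real (- l) + of_real c2 - of_real \<gamma> / of_real (- l) +
      of_real (\<integral>t. 1 / (t + l) - t / (1 + t\<^sup>2) \<partial>\<mu>)"
    using l by (intro tendsto_intros z) auto
  then show ?thesis unfolding m_eq[OF z(2)] by (simp add: m_neg_def)
qed

end

section \<open>Weyl solutions on the negative half-line\<close>

lemma fatou_square: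
  fixes g :: "nat \<Rightarrow> 'a \<Rightarrow> complex"
  assumes [measurable]: "\<And>n. g n \<in> borel_measurable M" "G \<in> borel_measurable M"
    and lim: "AE x in M. (\<lambda>n. g n x) \<longlonglongrightarrow> G x"
    and int: "\<And>n. integrable M (\<lambda>x. (norm (g n x))\<^sup>2)" and le: "\<And>n. (\<integral>x. (norm (g n x))\<^sup>2 \<partial>M) \<le> \<epsilon> n"
    and e: "\<epsilon> \<longlonglongrightarrow> e"
  shows "integrable M (\<lambda>x. (norm (G x))\<^sup>2)" and "(\<integral>x. (norm (G x))\<^sup>2 \<partial>M) \<le> e"
proof -
  have e0: "0 \<le> e"
  proof (rule LIMSEQ_le_const[OF e])
    have "0 \<le> \<epsilon> n" for n by (rule order_trans[OF _ le[of n]]) (intro integral_nonneg_AE, simp)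
    then show "\<exists>N. \<forall>n\<ge>N. 0 \<le> \<epsilon> n" by blast
  qed
  have nn: "(\<integral>\<^sup>+x. ennreal ((norm (g n x))\<^sup>2) \<partial>M) \<le> ennreal (\<epsilon> n)" for n
    by (subst nn_integral_eq_integral[OF int]) (auto intro: ennreal_leI le)
  have "(\<integral>\<^sup>+x. ennreal ((norm (G x))\<^sup>2) \<partial>M) = (\<integral>\<^sup>+x. liminf (\<lambda>n. ennreal ((norm (g n x))\<^sup>2)) \<partial>M)"
  proof (rule nn_integral_cong_AE, use lim in eventually_elim)
    fix x assume "(\<lambda>n. g n x) \<longlonglongrightarrow> G x"
    then have "(\<lambda>n. ennreal ((norm (g n x))\<^sup>2)) \<longlonglongrightarrow> ennreal ((norm (G x))\<^sup>2)"
      by (intro tendsto_ennrealI tendsto_intros)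
    then show "ennreal ((norm (G x))\<^sup>2) = liminf (\<lambda>n. ennreal ((norm (g n x))\<^sup>2))"
      by (intro lim_imp_Liminf[symmetric]) auto
  qed
  also have "\<dots> \<le> liminf (\<lambda>n. \<integral>\<^sup>+x. ennreal ((norm (g n x))\<^sup>2) \<partial>M)" by (rule nn_integral_liminf) measurable
  also have "\<dots> \<le> liminf (\<lambda>n. ennreal (\<epsilon> n))" by (rule Liminf_mono) (use nn in auto)
  also have "\<dots> = ennreal e" by (rule lim_imp_Liminf) (auto intro: tendsto_ennrealI e)
  finally have le': "(\<integral>\<^sup>+x. ennreal ((norm (G x))\<^sup>2) \<partial>M) \<le> ennreal e" .
  show i: "integrable M (\<lambda>x. (norm (G x))\<^sup>2)"
    by (rule integrableI_nonneg) (use order.strict_trans1[OF le' ennreal_less_top] in auto)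
  show "(\<integral>x. (norm (G x))\<^sup>2 \<partial>M) \<le> e"
    using le' e0 by (subst (asm) nn_integral_eq_integral[OF i]) auto
qed

lemma square_integrable_diff:
  fixes f g :: "'a \<Rightarrow> 'b::euclidean_space"
  assumes [measurable]: "f \<in> borel_measurable M" "g \<in> borel_measurable M"
    and "integrable M (\<lambda>x. (norm (f x))\<^sup>2)" "integrable M (\<lambda>x. (norm (g x))\<^sup>2)"
  shows "integrable M (\<lambda>x. (norm (f x - g x))\<^sup>2)"
proof (rule integrable_bound)
  show "integrable M (\<lambda>x. 2 * (norm (f x))\<^sup>2 + 2 * (norm (g x))\<^sup>2)" using assms by simp
  show "AE x in M. norm ((norm (f x - g x))\<^sup>2) \<le> norm (2 * (norm (f x))\<^sup>2 + 2 * (norm (g x))\<^sup>2)"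
    using square_norm_sum_le[of "f _" "- g _"] by auto
qed measurable

lemma L2_tendsto_integral_mult:
  fixes f g :: "nat \<Rightarrow> 'a \<Rightarrow> complex"
  assumes [measurable]: "\<And>n. f n \<in> borel_measurable M" "\<And>n. g n \<in> borel_measurable M"
      "F \<in> borel_measurable M" "G \<in> borel_measurable M"
    and F: "integrable M (\<lambda>x. (norm (F x))\<^sup>2)" and G: "integrable M (\<lambda>x. (norm (G x))\<^sup>2)"
    and f: "\<And>n. integrable M (\<lambda>x. (norm (f n x - F x))\<^sup>2)" "(\<lambda>n. \<integral>x. (norm (f n x - F x))\<^sup>2 \<partial>M) \<longlonglongrightarrow> 0"
    and g: "\<And>n. integrable M (\<lambda>x. (norm (g n x - G x))\<^sup>2)" "(\<lambda>n. \<integral>x. (norm (g n x - G x))\<^sup>2 \<partial>M) \<longlonglongrightarrow> 0"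
  shows "(\<lambda>n. \<integral>x. f n x * g n x \<partial>M) \<longlonglongrightarrow> (\<integral>x. F x * G x \<partial>M)"
proof -
  have FG: "integrable M (\<lambda>x. F x * G x)" by (rule integrable_L2_mult[OF _ _ F G]) measurable
  have i: "integrable M (\<lambda>x. (f n x - F x) * (g n x - G x))" "integrable M (\<lambda>x. (f n x - F x) * G x)"
    "integrable M (\<lambda>x. F x * (g n x - G x))" for n
    by (rule integrable_L2_mult[OF _ _ f(1) g(1)]; measurable)
      (rule integrable_L2_mult[OF _ _ f(1) G] integrable_L2_mult[OF _ _ F g(1)]; measurable)+
  have 1: "(\<lambda>n. \<integral>x. (f n x - F x) * (g n x - G x) \<partial>M) \<longlonglongrightarrow> 0"
  proof (rule tendsto_zero_of_square)
    show "(norm (\<integral>x. (f n x - F x) * (g n x - G x) \<partial>M))\<^sup>2 \<le>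
        (\<integral>x. (norm (f n x - F x))\<^sup>2 \<partial>M) * (\<integral>x. (norm (g n x - G x))\<^sup>2 \<partial>M)" for n
      by (rule Cauchy_Schwarz_integral_norm[OF _ _ f(1) g(1)]) measurable
    show "(\<lambda>n. (\<integral>x. (norm (f n x - F x))\<^sup>2 \<partial>M) * (\<integral>x. (norm (g n x - G x))\<^sup>2 \<partial>M)) \<longlonglongrightarrow> 0"
      using tendsto_mult[OF f(2) g(2)] by simp
  qed
  have 2: "(\<lambda>n. \<integral>x. (f n x - F x) * G x \<partial>M) \<longlonglongrightarrow> 0"
  proof (rule tendsto_zero_of_square)
    show "(norm (\<integral>x. (f n x - F x) * G x \<partial>M))\<^sup>2 \<le>
        (\<integral>x. (norm (f n x - F x))\<^sup>2 \<partial>M) * (\<integral>x. (norm (G x))\<^sup>2 \<partial>M)" for n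
      by (rule Cauchy_Schwarz_integral_norm[OF _ _ f(1) G]) measurable
    show "(\<lambda>n. (\<integral>x. (norm (f n x - F x))\<^sup>2 \<partial>M) * (\<integral>x. (norm (G x))\<^sup>2 \<partial>M)) \<longlonglongrightarrow> 0"
      using tendsto_mult[OF f(2) tendsto_const] by simp
  qed
  have 3: "(\<lambda>n. \<integral>x. F x * (g n x - G x) \<partial>M) \<longlonglongrightarrow> 0"
  proof (rule tendsto_zero_of_square)
    show "(norm (\<integral>x. F x * (g n x - G x) \<partial>M))\<^sup>2 \<le>
        (\<integral>x. (norm (F x))\<^sup>2 \<partial>M) * (\<integral>x. (norm (g n x - G x))\<^sup>2 \<partial>M)" for n
      by (rule Cauchy_Schwarz_integral_norm[OF _ _ F g(1)]) measurable
    show "(\<lambda>n. (\<integral>x. (norm (F x))\<^sup>2 \<partial>M) * (\<integral>x. (norm (g n x - G x))\<^sup>2 \<partial>M)) \<longlonglongrightarrow> 0"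
      using tendsto_mult[OF tendsto_const g(2)] by simp
  qed
  have "(\<integral>x. f n x * g n x \<partial>M) = (\<integral>x. (f n x - F x) * (g n x - G x) \<partial>M) + (\<integral>x. (f n x - F x) * G x \<partial>M) +
      (\<integral>x. F x * (g n x - G x) \<partial>M) + (\<integral>x. F x * G x \<partial>M)" for n
  proof -
    have "(\<integral>x. f n x * g n x \<partial>M) = (\<integral>x. (f n x - F x) * (g n x - G x) + (f n x - F x) * G x +
        F x * (g n x - G x) + F x * G x \<partial>M)"
      by (rule integral_cong) (auto simp: algebra_simps)
    then show ?thesis using i[of n] FG by (simp only: integral_add integrable_add)
  qed
  then show ?thesis using tendsto_add[OF tendsto_add[OF tendsto_add[OF 1 2] 3] tendsto_const] by simp
qed

text \<open>With the weights \<open>2 ^ n\<close> the integrals of the squared increments are still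
  summable, so the weighted series is finite almost everywhere. At such a point the increments are
  at most a multiple of \<open>2^(- n / 2)\<close>, hence summable themselves.\<close>

lemma AE_convergent_of_geometric:
  fixes f :: "nat \<Rightarrow> 'a \<Rightarrow> complex"
  assumes [measurable]: "\<And>n. f n \<in> borel_measurable M"
    and int: "\<And>n. integrable M (\<lambda>x. (norm (f n x - f (Suc n) x))\<^sup>2)"
    and le: "\<And>n. (\<integral>x. (norm (f n x - f (Suc n) x))\<^sup>2 \<partial>M) \<le> C / 4 ^ n"
  shows "AE x in M. convergent (\<lambda>n. f n x)"
proof -
  have C: "C \<ge> 0" using order_trans[OF integral_nonneg_AE le[of 0]] by simp
  let ?T = "\<lambda>n x. ennreal (2 ^ n * (norm (f n x - f (Suc n) x))\<^sup>2)"
  have T: "(\<integral>\<^sup>+x. ?T n x \<partial>M) \<le> ennreal (C * (1 / 2) ^ n)" for n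
  proof -
    have "(\<integral>\<^sup>+x. ?T n x \<partial>M) = ennreal (\<integral>x. 2 ^ n * (norm (f n x - f (Suc n) x))\<^sup>2 \<partial>M)"
      by (rule nn_integral_eq_integral) (use int in auto)
    also have "(\<integral>x. 2 ^ n * (norm (f n x - f (Suc n) x))\<^sup>2 \<partial>M) \<le> 2 ^ n * (C / 4 ^ n)"
      unfolding integral_mult_right_zero by (intro mult_left_mono le) simp
    also have "2 ^ n * (C / 4 ^ n) = C * (1 / 2) ^ n"
    proof -
      have "(4::real) ^ n = 2 ^ n * 2 ^ n" by (simp flip: power_mult_distrib)
      then show ?thesis by (simp add: power_one_over field_simps)
    qed
    finally show ?thesis by (simp add: ennreal_leI)
  qed
  have "(\<integral>\<^sup>+x. (\<Sum>n. ?T n x) \<partial>M) = (\<Sum>n. \<integral>\<^sup>+x. ?T n x \<partial>M)" by (rule nn_integral_suminf) measurable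
  also have "\<dots> \<le> (\<Sum>n. ennreal (C * (1 / 2) ^ n))" by (rule suminf_le[OF T]) auto
  also have "\<dots> = ennreal (\<Sum>n. C * (1 / 2) ^ n)"
    by (rule suminf_ennreal2) (use C in \<open>auto intro!: summable_mult summable_geometric\<close>)
  also have "\<dots> < \<infinity>" by simp
  finally have "AE x in M. (\<Sum>n. ?T n x) \<noteq> \<infinity>" by (intro nn_integral_PInf_AE) auto
  then show ?thesis
  proof eventually_elim
    fix x assume fin: "(\<Sum>n. ?T n x) \<noteq> \<infinity>"
    define S where "S = enn2real (\<Sum>n. ?T n x)"
    have S: "S \<ge> 0" "(\<Sum>n. ?T n x) = ennreal S"
      unfolding S_def by (rule enn2real_nonneg) (use fin in \<open>simp only: infinity_ennreal_def less_top ennreal_enn2real\<close>)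
    have "norm (f (Suc n) x - f n x) \<le> sqrt S * sqrt (1 / 2) ^ n" for n
    proof -
      have "(\<Sum>i\<in>{n}. ?T i x) \<le> (\<Sum>n. ?T n x)" by (rule sum_le_suminf) simp_all
      then have "2 ^ n * (norm (f n x - f (Suc n) x))\<^sup>2 \<le> S" unfolding S(2) using S(1) by simp
      then have "(norm (f n x - f (Suc n) x))\<^sup>2 \<le> S * (1 / 2) ^ n" by (simp add: power_one_over field_simps)
      then have "norm (f n x - f (Suc n) x) \<le> sqrt (S * (1 / 2) ^ n)" by (rule real_le_rsqrt)
      then show ?thesis by (simp add: real_sqrt_mult real_sqrt_power norm_minus_commute)
    qed
    note step = this
    have "sqrt (1 / 2) < 1" by (subst real_sqrt_lt_1_iff) simp
    then have "norm (sqrt (1 / 2)) < 1" unfolding real_norm_def by (simp only: abs_of_nonneg real_sqrt_ge_0_iff)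
    then have "summable (\<lambda>n. sqrt S * sqrt (1 / 2) ^ n)" by (intro summable_mult summable_geometric)
    then have "summable (\<lambda>n. f (Suc n) x - f n x)"
      by (rule summable_comparison_test'[where N=0]) (rule step)
    then have "convergent (\<lambda>n. \<Sum>i<n. f (Suc i) x - f i x)" by (simp add: summable_iff_convergent)
    then have "convergent (\<lambda>n. f n x - f 0 x)" by (simp only: sum_lessThan_telescope[of "\<lambda>i. f i x"])
    then show "convergent (\<lambda>n. f n x)" by (simp add: convergent_diff_const_right_iff)
  qed
qed

lemma test_function_cnj:
  assumes "test_function L h k"
  shows "test_function L (\<lambda>x. cnj (h x)) (\<lambda>x. cnj (k x))"
  using assms weak_derivative_linear[OF test_function_imp_weak_derivative[OF assms] bounded_linear_cnj]
  unfolding test_function_def by force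

text \<open>The coefficients are real. Conjugation turns the bilinear Gram identity into one for
  inner products, from which norms and distances can be computed.\<close>

lemma weyl_solution_cnj:
  assumes "weyl_solution L q \<upsilon> z f g \<Delta>"
  shows "weyl_solution L q \<upsilon> (cnj z) (\<lambda>x. cnj (f x)) (\<lambda>x. cnj (g x)) (cnj \<Delta>)"
proof -
  have f: "weak_derivative L f g" "finite_energy L f g" "f 0 = 1" "integrable \<upsilon> (\<lambda>x. (norm (f x))\<^sup>2)"
    and eq: "\<And>h k. test_function L h k \<Longrightarrow> \<Delta> * h 0 + (LBINT x. g x * k x) =
        z\<^sup>2 * (\<integral>x. f x * h x \<partial>\<upsilon>) - z * (LBINT x. of_real (q x) * (f x * k x + g x * h x))"
    using assms unfolding weyl_solution_def weak_solution_def by auto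
  have wd: "weak_derivative L (\<lambda>x. cnj (f x)) (\<lambda>x. cnj (g x))"
    by (rule weak_derivative_linear[OF f(1) bounded_linear_cnj])
  have "cnj \<Delta> * h 0 + (LBINT x. cnj (g x) * k x) = (cnj z)\<^sup>2 * (\<integral>x. cnj (f x) * h x \<partial>\<upsilon>) -
      cnj z * (LBINT x. of_real (q x) * (cnj (f x) * k x + cnj (g x) * h x))"
    if h: "test_function L h k" for h k
  proof -
    have cm: "cnj (\<integral>x. F x \<partial>M) = (\<integral>x. cnj (F x) \<partial>M)" for F and M :: "real measure"
      by (rule Bochner_Integration.integral_cnj[symmetric])
    from arg_cong[OF eq[OF test_function_cnj[OF h]], of cnj] show ?thesis
      unfolding complex_cnj_add complex_cnj_diff complex_cnj_mult complex_cnj_power cm complex_cnj_cnj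
        complex_cnj_complex_of_real .
  qed
  then show ?thesis
    using f wd finite_energy_cnj[OF f(2)] unfolding weyl_solution_def weak_solution_def by simp
qed

lemma borel_measurable_cnj [measurable (raw)]:
  assumes "f \<in> borel_measurable M"
  shows "(\<lambda>x. cnj (f x)) \<in> borel_measurable M"
  by (rule measurable_compose[OF assms borel_measurable_continuous_onI[OF continuous_on_cnj[OF continuous_on_id]]])

lemma integral_norm_diff_square:
  fixes f g :: "'a \<Rightarrow> complex"
  assumes [measurable]: "f \<in> borel_measurable M" "g \<in> borel_measurable M"
    and f: "integrable M (\<lambda>x. (norm (f x))\<^sup>2)" and g: "integrable M (\<lambda>x. (norm (g x))\<^sup>2)"
  shows "complex_of_real (\<integral>x. (norm (f x - g x))\<^sup>2 \<partial>M) = (\<integral>x. f x * cnj (f x) \<partial>M) - (\<integral>x. f x * cnj (g x) \<partial>M) -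
    (\<integral>x. g x * cnj (f x) \<partial>M) + (\<integral>x. g x * cnj (g x) \<partial>M)"
proof -
  have i: "integrable M (\<lambda>x. a x * cnj (b x))"
    if "a \<in> borel_measurable M" "b \<in> borel_measurable M"
      "integrable M (\<lambda>x. (norm (a x))\<^sup>2)" "integrable M (\<lambda>x. (norm (b x))\<^sup>2)" for a b :: "'a \<Rightarrow> complex"
    by (rule integrable_L2_mult) (use that in \<open>auto intro: borel_measurable_cnj\<close>)
  have "complex_of_real (\<integral>x. (norm (f x - g x))\<^sup>2 \<partial>M) = (\<integral>x. of_real ((norm (f x - g x))\<^sup>2) \<partial>M)"
    by (rule integral_complex_of_real[symmetric])
  also have "\<dots> = (\<integral>x. f x * cnj (f x) - f x * cnj (g x) - g x * cnj (f x) + g x * cnj (g x) \<partial>M)"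
    by (rule integral_cong[OF refl], simp only: complex_norm_square complex_cnj_diff)
      (simp add: algebra_simps)
  also have "\<dots> = (\<integral>x. f x * cnj (f x) \<partial>M) - (\<integral>x. f x * cnj (g x) \<partial>M) - (\<integral>x. g x * cnj (f x) \<partial>M) + (\<integral>x. g x * cnj (g x) \<partial>M)"
    by (simp only: integral_add integral_diff
        integrable_diff i[OF assms(1,1) f f] i[OF assms(1,2) f g] i[OF assms(2,1) g f] i[OF assms(2,2) g g])
  finally show ?thesis .
qed

text \<open>\<open>c * \<gamma> < 1\<close> for all \<open>c\<close> in \<open>[0, L)\<close>
  expresses that \<open>\<gamma>\<close> is at most \<open>1 / L\<close>; it will exclude zeros of
  the real solutions for small \<open>l\<close>.\<close>

locale weyl_problem = stieltjes_representation \<mu> m c1 c2 \<gamma>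
  for \<mu> :: "real measure" and m :: "complex \<Rightarrow> complex" and c1 c2 \<gamma> :: real +
  fixes L :: ereal and q :: "real \<Rightarrow> real" and \<upsilon> :: "real measure"
    and \<psi> \<psi>' :: "complex \<Rightarrow> real \<Rightarrow> complex"
  assumes L: "0 < L" and \<gamma>_L: "c \<in> half_open L \<Longrightarrow> c * \<gamma> < 1" and q: "local_L2 L q" and \<upsilon>: "borel_measure_on L \<upsilon>"
    and weyl: "z \<notin> \<real> \<Longrightarrow> weyl_solution L q \<upsilon> z (\<psi> z) (\<psi>' z) (z * m z)"
begin

text \<open>The derivative is divided by the spectral parameter, so that the Gram identity becomes a
  product of pairs (solution, scaled derivative) in one fixed space. Limits are taken in this
  space.\<close>

lemma weyl_kernel:
  assumes a: "weyl_solution L q \<upsilon> z a a' (z * m z)" and b: "weyl_solution L q \<upsilon> w b b' (w * m w)"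
    and l: "l > 0" and z: "Re z \<le> - l" "z \<notin> \<real>" and w: "Re w \<le> - l" "w \<notin> \<real>" and ne: "z \<noteq> w"
  shows "(\<integral>x. a x * b x \<partial>\<upsilon>) + (LBINT x. (a' x / z) * (b' x / w)) = negative_kernel z w"
proof -
  have z0: "z \<noteq> 0" "w \<noteq> 0" using z w by auto
  have "(z - w) * negative_kernel z w = z * m z / z - w * m w / w"
    using m_diff[OF l z w] z0 by simp
  also have "\<dots> = (z - w) * ((\<integral>x. a x * b x \<partial>\<upsilon>) + (LBINT x. a' x * b' x) / (z * w))"
    by (rule weyl_solution_gram[OF L \<upsilon> a b z0])
  also have "(LBINT x. a' x * b' x) / (z * w) = (LBINT x. (a' x / z) * (b' x / w))"
    by (simp flip: integral_divide_zero)
  finally show ?thesis using ne by simp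
qed

lemma weyl_cnj:
  assumes "weyl_solution L q \<upsilon> z a a' (z * m z)" "z \<notin> \<real>"
  shows "weyl_solution L q \<upsilon> (cnj z) (\<lambda>x. cnj (a x)) (\<lambda>x. cnj (a' x)) (cnj z * m (cnj z))"
  using weyl_solution_cnj[OF assms(1)] by (simp add: m_cnj[OF assms(2)])

text \<open>Expanding the square gives four kernel values, in which \<open>c1\<close> cancels and
  the squares of \<open>1 / z - 1 / w\<close> and \<open>1 / (t - z) - 1 / (t - w)\<close> remain.
  Both differences are of order \<open>|z - w|\<close> throughout the half-plane, on either side of
  the real axis. The hypothesis \<open>z \<noteq> cnj w\<close> stems from the division by
  \<open>z - cnj w\<close> in the Gram identity.\<close>

lemma weyl_distance:
  assumes a: "weyl_solution L q \<upsilon> z a a' (z * m z)" and b: "weyl_solution L q \<upsilon> w b b' (w * m w)"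
    and l: "l > 0" and z: "Re z \<le> - l" "z \<notin> \<real>" and w: "Re w \<le> - l" "w \<notin> \<real>" and ne: "z \<noteq> cnj w"
  shows "(\<integral>x. (norm (a x - b x))\<^sup>2 \<partial>\<upsilon>) + (LBINT x. (norm (a' x / z - b' x / w))\<^sup>2) \<le>
    (norm (z - w))\<^sup>2 * (\<gamma> / l ^ 4 + (\<integral>t. 1 / (t + l)\<^sup>2 \<partial>\<mu>) / l\<^sup>2)"
proof -
  have fin: "finite_energy L a a'" "finite_energy L b b'"
    and sq: "integrable \<upsilon> (\<lambda>x. (norm (a x))\<^sup>2)" "integrable \<upsilon> (\<lambda>x. (norm (b x))\<^sup>2)"
    using a b by (auto simp: weyl_solution_def)
  note fa = finite_energyD[OF fin(1)] and fb = finite_energyD[OF fin(2)]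
  have [measurable]: "a \<in> borel_measurable \<upsilon>" "b \<in> borel_measurable \<upsilon>"
    using borel_measure_on_measurable[OF \<upsilon>] weak_derivative_continuous_on fa(1) fb(1) by blast+
  note [measurable] = fa(2) fb(2)
  have z0: "z \<noteq> 0" "w \<noteq> 0" using z w by auto
  have sa: "integrable lborel (\<lambda>x. (norm (a' x / z))\<^sup>2)" and sb: "integrable lborel (\<lambda>x. (norm (b' x / w))\<^sup>2)"
    using fa(3) fb(3) by (auto simp: norm_divide power_divide)
  let ?K = "negative_kernel"
  have K: "?K z (cnj z) = (\<integral>x. a x * cnj (a x) \<partial>\<upsilon>) + (LBINT x. (a' x / z) * cnj (a' x / z))"
    "?K z (cnj w) = (\<integral>x. a x * cnj (b x) \<partial>\<upsilon>) + (LBINT x. (a' x / z) * cnj (b' x / w))"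
    "?K w (cnj z) = (\<integral>x. b x * cnj (a x) \<partial>\<upsilon>) + (LBINT x. (b' x / w) * cnj (a' x / z))"
    "?K w (cnj w) = (\<integral>x. b x * cnj (b x) \<partial>\<upsilon>) + (LBINT x. (b' x / w) * cnj (b' x / w))"
  proof -
    have c: "w \<noteq> cnj z" "z \<noteq> cnj z" "w \<noteq> cnj w" using ne z w by (auto simp: complex_is_Real_iff complex_eq_iff)
    have nr: "cnj z \<notin> \<real>" "cnj w \<notin> \<real>" and re: "Re (cnj z) \<le> - l" "Re (cnj w) \<le> - l"
      using z w by (auto simp: complex_is_Real_iff)
    note ca = weyl_cnj[OF a z(2)] and cb = weyl_cnj[OF b w(2)]
    show "?K z (cnj z) = (\<integral>x. a x * cnj (a x) \<partial>\<upsilon>) + (LBINT x. (a' x / z) * cnj (a' x / z))"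
      "?K z (cnj w) = (\<integral>x. a x * cnj (b x) \<partial>\<upsilon>) + (LBINT x. (a' x / z) * cnj (b' x / w))"
      "?K w (cnj z) = (\<integral>x. b x * cnj (a x) \<partial>\<upsilon>) + (LBINT x. (b' x / w) * cnj (a' x / z))"
      "?K w (cnj w) = (\<integral>x. b x * cnj (b x) \<partial>\<upsilon>) + (LBINT x. (b' x / w) * cnj (b' x / w))"
      unfolding complex_cnj_divide
      by (rule weyl_kernel[OF a ca l z re(1) nr(1) c(2), symmetric],
          rule weyl_kernel[OF a cb l z re(2) nr(2) ne, symmetric],
          rule weyl_kernel[OF b ca l w re(1) nr(1) c(1), symmetric],
          rule weyl_kernel[OF b cb l w re(2) nr(2) c(3), symmetric])
  qed
  have D1: "complex_of_real (\<integral>x. (norm (a x - b x))\<^sup>2 \<partial>\<upsilon>) = (\<integral>x. a x * cnj (a x) \<partial>\<upsilon>) -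
      (\<integral>x. a x * cnj (b x) \<partial>\<upsilon>) - (\<integral>x. b x * cnj (a x) \<partial>\<upsilon>) + (\<integral>x. b x * cnj (b x) \<partial>\<upsilon>)"
    by (rule integral_norm_diff_square[OF _ _ sq]) measurable
  have D2: "complex_of_real (LBINT x. (norm (a' x / z - b' x / w))\<^sup>2) =
      (LBINT x. (a' x / z) * cnj (a' x / z)) - (LBINT x. (a' x / z) * cnj (b' x / w)) -
      (LBINT x. (b' x / w) * cnj (a' x / z)) + (LBINT x. (b' x / w) * cnj (b' x / w))"
    by (rule integral_norm_diff_square[OF _ _ sa sb]) measurable
  have 1: "complex_of_real ((\<integral>x. (norm (a x - b x))\<^sup>2 \<partial>\<upsilon>) + (LBINT x. (norm (a' x / z - b' x / w))\<^sup>2)) =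
      ?K z (cnj z) - ?K z (cnj w) - ?K w (cnj z) + ?K w (cnj w)"
    unfolding K of_real_add
    by (simp only: D1 D2) (simp add: algebra_simps)
  let ?u = "\<lambda>t. 1 / (of_real t - z) - 1 / (of_real t - w)"
  have pw: "?u t * cnj (?u t) = 1 / ((of_real t - z) * (of_real t - cnj z)) -
      1 / ((of_real t - z) * (of_real t - cnj w)) - 1 / ((of_real t - w) * (of_real t - cnj z)) +
      1 / ((of_real t - w) * (of_real t - cnj w))" for t
  proof -
    have alg: "(A - B) * (C - D) = A * C - A * D - B * C + B * D" for A B C D :: complex
      by (simp add: algebra_simps)
    show ?thesis
      by (simp only: complex_cnj_diff complex_cnj_divide complex_cnj_one complex_cnj_complex_of_real alg
          times_divide_times_eq mult_1_left)
  qed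
  have ip: "integrable \<mu> (\<lambda>t. 1 / ((of_real t - u) * (of_real t - v)))"
    if "u \<in> {z, w}" "v \<in> {cnj z, cnj w}" for u v
    by (rule integrable_product_kernel[OF l]) (use that z w in auto)
  have I: "(\<integral>t. ?u t * cnj (?u t) \<partial>\<mu>) = (\<integral>t. 1 / ((of_real t - z) * (of_real t - cnj z)) \<partial>\<mu>) -
      (\<integral>t. 1 / ((of_real t - z) * (of_real t - cnj w)) \<partial>\<mu>) - (\<integral>t. 1 / ((of_real t - w) * (of_real t - cnj z)) \<partial>\<mu>) +
      (\<integral>t. 1 / ((of_real t - w) * (of_real t - cnj w)) \<partial>\<mu>)"
  proof -
    have "(\<integral>t. ?u t * cnj (?u t) \<partial>\<mu>) = (\<integral>t. 1 / ((of_real t - z) * (of_real t - cnj z)) -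
        1 / ((of_real t - z) * (of_real t - cnj w)) - 1 / ((of_real t - w) * (of_real t - cnj z)) +
        1 / ((of_real t - w) * (of_real t - cnj w)) \<partial>\<mu>)"
      by (rule integral_cong[OF refl pw])
    also have "\<dots> = (\<integral>t. 1 / ((of_real t - z) * (of_real t - cnj z)) \<partial>\<mu>) -
      (\<integral>t. 1 / ((of_real t - z) * (of_real t - cnj w)) \<partial>\<mu>) - (\<integral>t. 1 / ((of_real t - w) * (of_real t - cnj z)) \<partial>\<mu>) +
      (\<integral>t. 1 / ((of_real t - w) * (of_real t - cnj w)) \<partial>\<mu>)"
      by (simp only: integral_add integral_diff
        integrable_diff ip insertI1 insertI2)
    finally show ?thesis .
  qed
  have G: "of_real \<gamma> / (z * cnj z) - of_real \<gamma> / (z * cnj w) - of_real \<gamma> / (w * cnj z) + of_real \<gamma> / (w * cnj w) =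
      of_real \<gamma> * ((1 / z - 1 / w) * cnj (1 / z - 1 / w))"
    by (simp add: algebra_simps)
  have 2: "?K z (cnj z) - ?K z (cnj w) - ?K w (cnj z) + ?K w (cnj w) =
      of_real \<gamma> * ((1 / z - 1 / w) * cnj (1 / z - 1 / w)) + (\<integral>t. ?u t * cnj (?u t) \<partial>\<mu>)"
    unfolding I G[symmetric] negative_kernel_def by (simp add: algebra_simps)
  have nl: "l \<le> norm z" "l \<le> norm w" using z w abs_Re_le_cmod[of z] abs_Re_le_cmod[of w] l by auto
  have 3: "norm (of_real \<gamma> * ((1 / z - 1 / w) * cnj (1 / z - 1 / w))) \<le> (norm (z - w))\<^sup>2 * (\<gamma> / l ^ 4)"
  proof -
    have "1 / z - 1 / w = (w - z) / (z * w)" using z0 by (simp add: field_simps)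
    then have "norm (1 / z - 1 / w) = norm (z - w) / (norm z * norm w)" by (simp add: norm_divide norm_mult norm_minus_commute)
    also have "\<dots> \<le> norm (z - w) / (l * l)"
      using nl l by (intro divide_left_mono mult_mono mult_pos_pos) auto
    finally have "(norm (1 / z - 1 / w))\<^sup>2 \<le> (norm (z - w) / (l * l))\<^sup>2" by (intro power_mono) auto
    then have "\<gamma> * (norm (1 / z - 1 / w))\<^sup>2 \<le> \<gamma> * (norm (z - w) / (l * l))\<^sup>2" using \<gamma> by (rule mult_left_mono)
    also have "\<dots> = (norm (z - w))\<^sup>2 * (\<gamma> / l ^ 4)" by (simp add: power2_eq_square power4_eq_xxxx mult_ac)
    finally show ?thesis using \<gamma> by (simp only: norm_mult complex_mod_cnj norm_of_real power2_eq_square abs_of_nonneg)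
  qed
  have 4: "norm (\<integral>t. ?u t * cnj (?u t) \<partial>\<mu>) \<le> (norm (z - w))\<^sup>2 * ((\<integral>t. 1 / (t + l)\<^sup>2 \<partial>\<mu>) / l\<^sup>2)"
  proof -
    have "norm (\<integral>t. ?u t * cnj (?u t) \<partial>\<mu>) \<le> (\<integral>t. (norm (z - w))\<^sup>2 / l\<^sup>2 * (1 / (t + l)\<^sup>2) \<partial>\<mu>)"
    proof (rule order_trans[OF integral_norm_bound integral_mono_AE])
      show "integrable \<mu> (\<lambda>t. norm (?u t * cnj (?u t)))"
      proof (rule integrable_norm)
        have "integrable \<mu> (\<lambda>t. 1 / ((of_real t - z) * (of_real t - cnj z)) -
            1 / ((of_real t - z) * (of_real t - cnj w)) - 1 / ((of_real t - w) * (of_real t - cnj z)) +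
            1 / ((of_real t - w) * (of_real t - cnj w)))"
          by (intro integrable_add integrable_diff ip) auto
        then show "integrable \<mu> (\<lambda>t. ?u t * cnj (?u t))" by (simp only: pw)
      qed
      show "integrable \<mu> (\<lambda>t. (norm (z - w))\<^sup>2 / l\<^sup>2 * (1 / (t + l)\<^sup>2))"
        by (rule integrable_mult_right[OF integrable_square_kernel[OF l]])
      show "AE t in \<mu>. norm (?u t * cnj (?u t)) \<le> (norm (z - w))\<^sup>2 / l\<^sup>2 * (1 / (t + l)\<^sup>2)"
        using AE_positive
      proof eventually_elim
        fix t :: real assume t: "0 < t"
        note nz = norm_kernel_ge[OF t z(1)] norm_kernel_ge[OF t w(1)]
        have "of_real t - z \<noteq> 0" "of_real t - w \<noteq> 0" using nz t l by auto
        then have "?u t = (z - w) / ((of_real t - z) * (of_real t - w))" by (simp add: field_simps)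
        then have "norm (?u t) = norm (z - w) / (norm (of_real t - z) * norm (of_real t - w))"
          by (simp only: norm_divide norm_mult)
        also have "\<dots> \<le> norm (z - w) / (l * (t + l))"
          using nz t l by (intro divide_left_mono mult_mono mult_pos_pos) auto
        finally have "(norm (?u t))\<^sup>2 \<le> (norm (z - w) / (l * (t + l)))\<^sup>2" by (intro power_mono) auto
        then show "norm (?u t * cnj (?u t)) \<le> (norm (z - w))\<^sup>2 / l\<^sup>2 * (1 / (t + l)\<^sup>2)"
          by (simp only: norm_mult complex_mod_cnj power2_eq_square) (simp add: mult_ac)
      qed
    qed
    also have "\<dots> = (norm (z - w))\<^sup>2 / l\<^sup>2 * (\<integral>t. 1 / (t + l)\<^sup>2 \<partial>\<mu>)" by (rule integral_mult_right_zero)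
    finally show ?thesis by simp
  qed
  have "norm (complex_of_real ((\<integral>x. (norm (a x - b x))\<^sup>2 \<partial>\<upsilon>) + (LBINT x. (norm (a' x / z - b' x / w))\<^sup>2))) \<le>
      (norm (z - w))\<^sup>2 * (\<gamma> / l ^ 4) + (norm (z - w))\<^sup>2 * ((\<integral>t. 1 / (t + l)\<^sup>2 \<partial>\<mu>) / l\<^sup>2)"
    unfolding 1 2 by (rule norm_triangle_le[OF add_mono[OF 3 4]])
  then show ?thesis unfolding norm_of_real distrib_left by linarith
qed

end

section \<open>Real solutions as limits on the negative axis\<close>

context weyl_problem
begin

text \<open>The dyadic imaginary parts give squared distances of order \<open>4 ^ (- n)\<close>, the
  rate that makes the scaled derivatives converge almost everywhere.\<close>

definition approach :: "real \<Rightarrow> nat \<Rightarrow> complex" where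
  "approach l n = Complex (- l) (1 / 2 ^ n)"

lemma approach_simps [simp]: "Re (approach l n) = - l" "Im (approach l n) = 1 / 2 ^ n" "approach l n \<notin> \<real>"
  by (auto simp: approach_def complex_is_Real_iff)

lemma approach_tendsto: "approach l \<longlonglongrightarrow> of_real (- l)"
proof -
  have "(\<lambda>n. Complex (- l) ((1 / 2) ^ n)) \<longlonglongrightarrow> Complex (- l) 0"
    by (intro tendsto_intros LIMSEQ_power_zero) simp
  then show ?thesis by (simp add: approach_def[abs_def] power_one_over complex_of_real_def)
qed

text \<open>The last four conditions record how \<open>r\<close> and \<open>p\<close> arise from
  Weyl solutions; through them the Gram identity is inherited. The derivatives appear divided by the
  spectral parameter, as in that identity.\<close>

definition real_weyl :: "real \<Rightarrow> (real \<Rightarrow> real) \<Rightarrow> (real \<Rightarrow> real) \<Rightarrow> bool" where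
  "real_weyl l r p \<longleftrightarrow> weak_solution L q \<upsilon> (- l) r p (- l * m_neg l) \<and> r 0 = 1 \<and>
     integrable lborel (\<lambda>x. (p x)\<^sup>2) \<and> integrable \<upsilon> (\<lambda>x. (r x)\<^sup>2) \<and>
     (\<forall>n. integrable \<upsilon> (\<lambda>x. (norm (\<psi> (approach l n) x - of_real (r x)))\<^sup>2)) \<and>
     (\<lambda>n. \<integral>x. (norm (\<psi> (approach l n) x - of_real (r x)))\<^sup>2 \<partial>\<upsilon>) \<longlonglongrightarrow> 0 \<and>
     (\<forall>n. integrable lborel (\<lambda>x. (norm (\<psi>' (approach l n) x / approach l n - of_real (p x / (- l))))\<^sup>2)) \<and>
     (\<lambda>n. LBINT x. (norm (\<psi>' (approach l n) x / approach l n - of_real (p x / (- l))))\<^sup>2) \<longlonglongrightarrow> 0"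

lemma test_function_of_real:
  fixes h :: "real \<Rightarrow> real"
  shows "test_function L h k \<Longrightarrow> test_function L (\<lambda>x. complex_of_real (h x)) (\<lambda>x. complex_of_real (k x))"
  using weak_derivative_of_real[of L h k] unfolding test_function_def by auto

lemma real_weyl_exists:
  assumes l: "l > 0"
  shows "\<exists>r p. real_weyl l r p"
proof -
  define z where "z = approach l"
  define B where "B = \<gamma> / l ^ 4 + (\<integral>t. 1 / (t + l)\<^sup>2 \<partial>\<mu>) / l\<^sup>2"
  have B0: "B \<ge> 0" unfolding B_def using \<gamma> by (intro add_nonneg_nonneg divide_nonneg_nonneg integral_nonneg_AE) auto
  have zn: "Re (z n) = - l" "z n \<notin> \<real>" "Im (z n) = 1 / 2 ^ n" for n by (simp_all add: z_def)
  have z0: "z n \<noteq> 0" for n using zn(1)[of n] l by auto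
  have sol: "weyl_solution L q \<upsilon> (z n) (\<psi> (z n)) (\<psi>' (z n)) (z n * m (z n))" for n by (rule weyl[OF zn(2)])
  have fin: "finite_energy L (\<psi> (z n)) (\<psi>' (z n))" and sq\<upsilon>: "integrable \<upsilon> (\<lambda>x. (norm (\<psi> (z n) x))\<^sup>2)"
    and \<psi>0: "\<psi> (z n) 0 = 1" for n using sol[of n] by (auto simp: weyl_solution_def)
  note fD = finite_energyD[OF fin]
  note [measurable] = fD(2)
  have \<psi>m [measurable]: "\<psi> (z n) \<in> borel_measurable \<upsilon>" for n
    by (rule borel_measure_on_measurable[OF \<upsilon> weak_derivative_continuous_on[OF fD(1)]])
  define b where "b n x = \<psi>' (z n) x / z n" for n x
  have bm [measurable]: "b n \<in> borel_measurable borel" for n unfolding b_def by measurable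
  have bsq: "integrable lborel (\<lambda>x. (norm (b n x))\<^sup>2)" for n
    using fD(3)[of n] by (simp add: b_def norm_divide power_divide)
  have Im_pos: "Im (z n) > 0" for n using zn(3) by simp
  have zdiff: "(norm (z n - z k))\<^sup>2 \<le> 1 / 4 ^ n" if "n \<le> k" for n k
  proof -
    have "norm (z n - z k) = \<bar>1 / 2 ^ n - 1 / 2 ^ k\<bar>"
      using zn by (simp add: cmod_def)
    also have "\<dots> \<le> 1 / 2 ^ n" using that by (auto simp: abs_le_iff field_simps power_increasing)
    finally have "(norm (z n - z k))\<^sup>2 \<le> (1 / 2 ^ n)\<^sup>2" by (intro power_mono) auto
    also have "\<dots> = 1 / 4 ^ n" by (simp add: power_divide power2_eq_square flip: power_mult_distrib)
    finally show ?thesis .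
  qed
  have dist: "(\<integral>x. (norm (\<psi> (z n) x - \<psi> (z k) x))\<^sup>2 \<partial>\<upsilon>) + (LBINT x. (norm (b n x - b k x))\<^sup>2) \<le> B / 4 ^ n"
    if "n \<le> k" for n k
  proof -
    have "z n \<noteq> cnj (z k)" using Im_pos[of n] Im_pos[of k] by (auto simp: complex_eq_iff)
    then have "(\<integral>x. (norm (\<psi> (z n) x - \<psi> (z k) x))\<^sup>2 \<partial>\<upsilon>) + (LBINT x. (norm (b n x - b k x))\<^sup>2) \<le>
        (norm (z n - z k))\<^sup>2 * B"
      unfolding b_def B_def by (intro weyl_distance sol l zn) (simp_all add: zn)
    also have "\<dots> \<le> 1 / 4 ^ n * B" by (rule mult_right_mono[OF zdiff[OF that] B0])
    finally show ?thesis by simp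
  qed
  have nn\<upsilon>: "0 \<le> (\<integral>x. (norm (F x))\<^sup>2 \<partial>M)" for F :: "real \<Rightarrow> complex" and M by (intro integral_nonneg_AE) simp
  have dist\<upsilon>: "(\<integral>x. (norm (\<psi> (z n) x - \<psi> (z k) x))\<^sup>2 \<partial>\<upsilon>) \<le> B / 4 ^ n"
    and distb: "(LBINT x. (norm (b n x - b k x))\<^sup>2) \<le> B / 4 ^ n" if "n \<le> k" for n k
    using dist[OF that] nn\<upsilon>[of \<upsilon> "\<lambda>x. \<psi> (z n) x - \<psi> (z k) x"] nn\<upsilon>[of lborel "\<lambda>x. b n x - b k x"] by linarith+
  have bdi: "integrable lborel (\<lambda>x. (norm (b n x - b k x))\<^sup>2)" for n k
    by (rule square_integrable_diff[OF _ _ bsq bsq]) measurable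
  \<comment> \<open>The limit is formed pointwise, which yields a Borel function; Fatou's lemma then
    turns it into a limit in mean square.\<close>
  define P where "P x = lim (\<lambda>n. b n x)" for x
  have Pm [measurable]: "P \<in> borel_measurable borel" unfolding P_def by measurable
  have "AE x in lborel. convergent (\<lambda>n. b n x)"
    by (rule AE_convergent_of_geometric[where C=B]) (use bdi distb in auto)
  then have Plim: "AE x in lborel. (\<lambda>n. b n x) \<longlonglongrightarrow> P x"
    by eventually_elim (simp add: P_def convergent_LIMSEQ_iff)
  have P0: "P x = 0" if "x \<notin> half_open L" for x
    unfolding P_def b_def using fD(4)[OF that] by simp
  have Pd: "integrable lborel (\<lambda>x. (norm (b n x - P x))\<^sup>2)" "(LBINT x. (norm (b n x - P x))\<^sup>2) \<le> B / 4 ^ n" for n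
  proof -
    have lim: "AE x in lborel. (\<lambda>k. b n x - b (k + n) x) \<longlonglongrightarrow> b n x - P x"
      using Plim
    proof eventually_elim
      fix x assume "(\<lambda>n. b n x) \<longlonglongrightarrow> P x"
      then show "(\<lambda>k. b n x - b (k + n) x) \<longlonglongrightarrow> b n x - P x"
        by (intro tendsto_diff tendsto_const LIMSEQ_ignore_initial_segment)
    qed
    show "integrable lborel (\<lambda>x. (norm (b n x - P x))\<^sup>2)" "(LBINT x. (norm (b n x - P x))\<^sup>2) \<le> B / 4 ^ n"
      by (rule fatou_square[OF _ _ lim bdi distb tendsto_const]; simp)+
  qed
  have realP: "AE x in lborel. Im (P x) = 0"
  proof -
    \<comment> \<open>The solutions at \<open>z n\<close> and at the conjugate of the next point are
      close too, so the limit is real. The shift to \<open>Suc n\<close> is essential: the distance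
      bound excludes pairing a point with its own conjugate.\<close>
    define d where "d n x = b n x - cnj (b (Suc n) x)" for n x
    have di: "integrable lborel (\<lambda>x. (norm (d n x))\<^sup>2)" for n
      unfolding d_def by (rule square_integrable_diff) (use bsq in simp_all)
    have le: "(LBINT x. (norm (d n x))\<^sup>2) \<le> B * (2 / 2 ^ n)\<^sup>2" for n
    proof -
      have "z n \<noteq> cnj (cnj (z (Suc n)))" using zn(3)[of n] zn(3)[of "Suc n"] by (auto simp: complex_eq_iff)
      moreover have "cnj (z (Suc n)) \<notin> \<real>" using zn(2)[of "Suc n"] by (simp add: complex_is_Real_iff)
      ultimately have "(\<integral>x. (norm (\<psi> (z n) x - cnj (\<psi> (z (Suc n)) x)))\<^sup>2 \<partial>\<upsilon>) + (LBINT x. (norm (d n x))\<^sup>2) \<le>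
          (norm (z n - cnj (z (Suc n))))\<^sup>2 * B"
        using weyl_distance[OF sol[of n] weyl_cnj[OF sol[of "Suc n"] zn(2)] l _ zn(2)] zn(1)
        by (simp add: b_def d_def B_def)
      also have "\<dots> \<le> (2 / 2 ^ n)\<^sup>2 * B"
      proof (rule mult_right_mono[OF power_mono B0])
        have "norm (z n - cnj (z (Suc n))) = 1 / 2 ^ n + 1 / 2 ^ Suc n" using zn by (simp add: cmod_def)
        then show "norm (z n - cnj (z (Suc n))) \<le> 2 / 2 ^ n" by (simp add: field_simps)
      qed simp
      finally show ?thesis
        using nn\<upsilon>[of \<upsilon> "\<lambda>x. \<psi> (z n) x - cnj (\<psi> (z (Suc n)) x)"]
        unfolding mult.commute[of B] by linarith
    qed
    have lim: "AE x in lborel. (\<lambda>n. d n x) \<longlonglongrightarrow> P x - cnj (P x)"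
      using Plim by eventually_elim (unfold d_def, intro tendsto_intros, simp, rule LIMSEQ_Suc)
    have "(\<lambda>n. B * (2 * (1 / 2) ^ n)\<^sup>2) \<longlonglongrightarrow> B * (2 * 0)\<^sup>2" by (intro tendsto_intros LIMSEQ_power_zero) simp
    then have lim0: "(\<lambda>n. B * (2 / 2 ^ n)\<^sup>2) \<longlonglongrightarrow> 0" by (simp add: power_one_over)
    have "integrable lborel (\<lambda>x. (norm (P x - cnj (P x)))\<^sup>2)" "(LBINT x. (norm (P x - cnj (P x)))\<^sup>2) \<le> 0"
      by (rule fatou_square[OF _ _ lim di le lim0]; simp add: d_def)+
    then have "AE x in lborel. (norm (P x - cnj (P x)))\<^sup>2 = 0"
      using integral_nonneg_eq_0_iff_AE[of lborel "\<lambda>x. (norm (P x - cnj (P x)))\<^sup>2"]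
        nn\<upsilon>[of lborel "\<lambda>x. P x - cnj (P x)"] by (simp add: order_antisym)
    then show ?thesis by eventually_elim (simp add: complex_eq_iff)
  qed
  have Psq: "integrable lborel (\<lambda>x. (norm (P x))\<^sup>2)"
    using square_integrable_diff[OF _ _ bsq[of 0] Pd(1)[of 0]] by simp
  \<comment> \<open>This undoes the division by the spectral parameter, which tends to
    \<open>- l\<close>.\<close>
  define p where "p x = - l * Re (P x)" for x
  have pm [measurable]: "p \<in> borel_measurable borel" unfolding p_def by measurable
  have Pp: "AE x in lborel. P x = of_real (p x / (- l))"
    using realP by eventually_elim (use l in \<open>simp add: p_def complex_eq_iff\<close>)
  have bp: "(LBINT x. (norm (b n x - of_real (p x / (- l))))\<^sup>2) = (LBINT x. (norm (b n x - P x))\<^sup>2)"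
    "integrable lborel (\<lambda>x. (norm (b n x - of_real (p x / (- l))))\<^sup>2)" for n
    by (rule integral_cong_AE; (measurable)?; use Pp in eventually_elim, simp)
      (rule integrable_cong_AE_imp[OF Pd(1)[of n]]; (measurable)?; use Pp in eventually_elim, simp)
  have "(\<lambda>n. B * (1 / 4) ^ n) \<longlonglongrightarrow> B * 0" by (intro tendsto_intros LIMSEQ_power_zero) simp
  then have B4: "(\<lambda>n. B / 4 ^ n) \<longlonglongrightarrow> 0" by (simp only: power_one_over times_divide_eq_right mult_1_right mult_zero_right)
  have psq: "integrable lborel (\<lambda>x. (p x)\<^sup>2)"
  proof (rule integrable_cong_AE_imp)
    show "integrable lborel (\<lambda>x. l\<^sup>2 * (norm (P x))\<^sup>2)" using Psq by simp
    show "AE x in lborel. l\<^sup>2 * (norm (P x))\<^sup>2 = (p x)\<^sup>2"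
      using Pp by eventually_elim (use l in \<open>simp add: norm_divide power_divide\<close>)
  qed measurable
  define e where "e n = (LBINT x. (norm (\<psi>' (z n) x - of_real (p x)))\<^sup>2)" for n
  have ei: "integrable lborel (\<lambda>x. (norm (\<psi>' (z n) x - of_real (p x)))\<^sup>2)" for n
    by (rule square_integrable_diff) (use fD(3) psq in simp_all)
  have ele: "e n \<le> 2 * (norm (z n))\<^sup>2 * (B / 4 ^ n) + 2 * (norm (z n - of_real (- l)))\<^sup>2 * (LBINT x. (norm (P x))\<^sup>2)" for n
  proof -
    have "e n \<le> (LBINT x. 2 * (norm (z n))\<^sup>2 * (norm (b n x - P x))\<^sup>2 + 2 * (norm (z n - of_real (- l)))\<^sup>2 * (norm (P x))\<^sup>2)"
      unfolding e_def
    proof (rule integral_mono_AE[OF ei])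
      show "integrable lborel (\<lambda>x. 2 * (norm (z n))\<^sup>2 * (norm (b n x - P x))\<^sup>2 + 2 * (norm (z n - of_real (- l)))\<^sup>2 * (norm (P x))\<^sup>2)"
        using Pd(1)[of n] Psq by (intro integrable_add integrable_mult_right)
      show "AE x in lborel. (norm (\<psi>' (z n) x - of_real (p x)))\<^sup>2 \<le>
          2 * (norm (z n))\<^sup>2 * (norm (b n x - P x))\<^sup>2 + 2 * (norm (z n - of_real (- l)))\<^sup>2 * (norm (P x))\<^sup>2"
        using Pp
      proof eventually_elim
        fix x assume Px: "P x = of_real (p x / (- l))"
        have "\<psi>' (z n) x - of_real (p x) = z n * (b n x - P x) + (z n - of_real (- l)) * P x"
          using z0[of n] l by (simp add: b_def Px field_simps)
        then show "(norm (\<psi>' (z n) x - of_real (p x)))\<^sup>2 \<le>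
          2 * (norm (z n))\<^sup>2 * (norm (b n x - P x))\<^sup>2 + 2 * (norm (z n - of_real (- l)))\<^sup>2 * (norm (P x))\<^sup>2"
          using square_norm_sum_le[of "z n * (b n x - P x)" "(z n - of_real (- l)) * P x"]
          by (simp only: norm_mult power_mult_distrib mult.assoc)
      qed
    qed
    also have "\<dots> = 2 * (norm (z n))\<^sup>2 * (LBINT x. (norm (b n x - P x))\<^sup>2) +
        2 * (norm (z n - of_real (- l)))\<^sup>2 * (LBINT x. (norm (P x))\<^sup>2)"
      using Pd(1)[of n] Psq by simp
    also have "2 * (norm (z n))\<^sup>2 * (LBINT x. (norm (b n x - P x))\<^sup>2) \<le> 2 * (norm (z n))\<^sup>2 * (B / 4 ^ n)"
      by (intro mult_left_mono Pd(2)) simp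
    finally show ?thesis by simp
  qed
  have zlim: "z \<longlonglongrightarrow> of_real (- l)" unfolding z_def by (rule approach_tendsto)
  have elim: "e \<longlonglongrightarrow> 0"
  proof (rule tendsto_sandwich[OF _ _ tendsto_const])
    show "\<forall>\<^sub>F n in sequentially. 0 \<le> e n" unfolding e_def using nn\<upsilon> by simp
    show "\<forall>\<^sub>F n in sequentially. e n \<le> 2 * (norm (z n))\<^sup>2 * (B / 4 ^ n) +
        2 * (norm (z n - of_real (- l)))\<^sup>2 * (LBINT x. (norm (P x))\<^sup>2)" using ele by simp
    have "(\<lambda>n. 2 * (norm (z n))\<^sup>2 * (B / 4 ^ n) + 2 * (norm (z n - of_real (- l)))\<^sup>2 * (LBINT x. (norm (P x))\<^sup>2)) \<longlonglongrightarrow>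
        2 * (norm (complex_of_real (- l)))\<^sup>2 * 0 + 2 * (norm (of_real (- l) - complex_of_real (- l)))\<^sup>2 * (LBINT x. (norm (P x))\<^sup>2)"
      by (intro tendsto_intros zlim B4)
    then show "(\<lambda>n. 2 * (norm (z n))\<^sup>2 * (B / 4 ^ n) + 2 * (norm (z n - of_real (- l)))\<^sup>2 * (LBINT x. (norm (P x))\<^sup>2)) \<longlonglongrightarrow> 0"
      by simp
  qed
  define r where "r x = 1 + (LBINT t. indicator {0..x} t *\<^sub>R p t)" for x
  have r0: "r 0 = 1"
  proof -
    have "(LBINT t. indicator {0..0} t *\<^sub>R p t) = (\<integral>t. 0 \<partial>(lborel :: real measure))"
      by (rule integral_cong_AE; (measurable)?; use AE_lborel_singleton[of "0::real"] in eventually_elim, simp)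
    then show ?thesis by (simp add: r_def)
  qed
  have wdr: "weak_derivative L r p"
    unfolding weak_derivative_def
  proof (intro conjI ballI allI impI)
    show "integrable lborel (\<lambda>t. indicator {0..c} t *\<^sub>R (norm (p t))\<^sup>2)" for c
      by (rule integrable_mult_indicator) (use psq in auto)
    show "r x = r 0 + (LBINT t. indicator {0..x} t *\<^sub>R p t)" for x unfolding r0 by (simp only: r_def)
  qed (use P0 pm in \<open>auto simp: p_def\<close>)
  have wdd: "weak_derivative L (\<lambda>x. \<psi> (z n) x - of_real (r x)) (\<lambda>x. \<psi>' (z n) x - of_real (p x))" for n
    by (rule weak_derivative_sub[OF fD(1) weak_derivative_of_real[OF wdr]])
  \<comment> \<open>Both functions start at 1, so closeness of the derivatives in mean square gives
    uniform closeness on every \<open>{0..c}\<close>.\<close>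
  have ptw: "(norm (\<psi> (z n) x - of_real (r x)))\<^sup>2 \<le> x * e n" if x: "x \<in> half_open L" for n x
  proof -
    have "(norm ((\<psi> (z n) x - of_real (r x)) - (\<psi> (z n) 0 - of_real (r 0))))\<^sup>2 \<le>
        (x - 0) * (LBINT t. indicator {0<..x} t * (norm (\<psi>' (z n) t - of_real (p t)))\<^sup>2)"
      by (rule weak_derivative_diff_bound[OF wdd]) (use x half_open_nonneg in auto)
    also have "\<dots> \<le> (x - 0) * e n"
    proof (rule mult_left_mono)
      show "(LBINT t. indicator {0<..x} t * (norm (\<psi>' (z n) t - of_real (p t)))\<^sup>2) \<le> e n"
        unfolding e_def
        by (rule integral_mono[OF _ ei])
          (use integrable_mult_indicator[OF _ ei[of n], of "{0<..x}"] in \<open>auto simp: indicator_def\<close>)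
    qed (use x half_open_nonneg in auto)
    finally show ?thesis by (simp add: \<psi>0 r0)
  qed
  have rlim: "(\<lambda>n. \<psi> (z n) x) \<longlonglongrightarrow> of_real (r x)" if x: "x \<in> half_open L" for x
    by (rule LIM_zero_cancel, rule tendsto_zero_of_square[OF ptw[OF x]])
      (use tendsto_mult[OF tendsto_const elim, of x] in simp)
  have rm [measurable]: "r \<in> borel_measurable \<upsilon>"
    by (rule borel_measure_on_measurable[OF \<upsilon> weak_derivative_continuous_on[OF wdr]])
  have ri: "integrable \<upsilon> (\<lambda>x. (norm (\<psi> (z n) x - of_real (r x)))\<^sup>2)"
    and rle: "(\<integral>x. (norm (\<psi> (z n) x - of_real (r x)))\<^sup>2 \<partial>\<upsilon>) \<le> B / 4 ^ n" for n
  proof -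
    have di: "integrable \<upsilon> (\<lambda>x. (norm (\<psi> (z n) x - \<psi> (z (k + n)) x))\<^sup>2)" for k
      by (rule square_integrable_diff[OF _ _ sq\<upsilon> sq\<upsilon>]) measurable
    have lim: "AE x in \<upsilon>. (\<lambda>k. \<psi> (z n) x - \<psi> (z (k + n)) x) \<longlonglongrightarrow> \<psi> (z n) x - of_real (r x)"
      by (rule AE_I2, intro tendsto_intros LIMSEQ_ignore_initial_segment rlim)
        (simp add: borel_measure_on_space[OF \<upsilon>])
    have le: "(\<integral>x. (norm (\<psi> (z n) x - \<psi> (z (k + n)) x))\<^sup>2 \<partial>\<upsilon>) \<le> B / 4 ^ n" for k by (rule dist\<upsilon>) simp
    show "integrable \<upsilon> (\<lambda>x. (norm (\<psi> (z n) x - of_real (r x)))\<^sup>2)"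
      "(\<integral>x. (norm (\<psi> (z n) x - of_real (r x)))\<^sup>2 \<partial>\<upsilon>) \<le> B / 4 ^ n"
      by (rule fatou_square[OF _ _ lim di le tendsto_const]; measurable)+
  qed
  have rlim\<upsilon>: "(\<lambda>n. \<integral>x. (norm (\<psi> (z n) x - of_real (r x)))\<^sup>2 \<partial>\<upsilon>) \<longlonglongrightarrow> 0"
    by (rule tendsto_sandwich[OF _ _ tendsto_const B4]) (use rle nn\<upsilon> in auto)
  have rsq: "integrable \<upsilon> (\<lambda>x. (r x)\<^sup>2)"
  proof -
    have "integrable \<upsilon> (\<lambda>x. (norm (\<psi> (z 0) x - (\<psi> (z 0) x - of_real (r x))))\<^sup>2)"
      by (rule square_integrable_diff[OF _ _ sq\<upsilon> ri]) measurable
    then show ?thesis by simp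
  qed
  have "(- l * m_neg l) * h 0 + (LBINT x. p x * k x) =
      (- l)\<^sup>2 * (\<integral>x. r x * h x \<partial>\<upsilon>) - (- l) * (LBINT x. of_real (q x) * (r x * k x + p x * h x))"
    if h: "test_function L h k" for h k :: "real \<Rightarrow> real"
  proof -
    define H where "H x = complex_of_real (h x)" for x
    define K where "K x = complex_of_real (k x)" for x
    have HK: "test_function L H K" unfolding H_def K_def by (rule test_function_of_real[OF h])
    have wdH: "weak_derivative L H K" using HK by (simp add: test_function_def)
    note [measurable] = weak_derivative_measurable[OF wdH]
    have Hm [measurable]: "H \<in> borel_measurable \<upsilon>"
      by (rule borel_measure_on_measurable[OF \<upsilon> weak_derivative_continuous_on[OF wdH]])
    note qH = square_integrable_q_mult[OF q HK] and sH = test_function_square_integrable[OF HK]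
    have psqc: "integrable lborel (\<lambda>x. (norm (complex_of_real (p x)))\<^sup>2)" using psq by simp
    have rsqc: "integrable \<upsilon> (\<lambda>x. (norm (complex_of_real (r x)))\<^sup>2)" using rsq by simp
    have l1: "(\<lambda>n. LBINT x. \<psi>' (z n) x * K x) \<longlonglongrightarrow> (LBINT x. of_real (p x) * K x)"
      by (rule L2_tendsto_integral_mult[OF _ _ _ _ psqc sH(1) ei elim[unfolded e_def]]) simp_all
    have l2: "(\<lambda>n. \<integral>x. \<psi> (z n) x * H x \<partial>\<upsilon>) \<longlonglongrightarrow> (\<integral>x. of_real (r x) * H x \<partial>\<upsilon>)"
      by (rule L2_tendsto_integral_mult[OF _ _ _ _ rsqc sH(2)[OF \<upsilon>] ri rlim\<upsilon>]) simp_all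
    have l3: "(\<lambda>n. LBINT x. \<psi>' (z n) x * (of_real (q x) * H x)) \<longlonglongrightarrow> (LBINT x. of_real (p x) * (of_real (q x) * H x))"
      by (rule L2_tendsto_integral_mult[OF _ _ _ _ psqc qH(1) ei elim[unfolded e_def]]) (simp_all add: qH(2))
    have i3: "integrable lborel (\<lambda>x. \<psi>' (z n) x * (of_real (q x) * H x))" for n
      by (rule integrable_L2_mult[OF _ _ fD(3) qH(1)]) (simp_all add: qH(2))
    have i3': "integrable lborel (\<lambda>x. of_real (p x) * (of_real (q x) * H x))"
      by (rule integrable_L2_mult[OF _ _ psqc qH(1)]) (simp_all add: qH(2))
    obtain c where c: "c \<in> half_open L" and 0: "\<And>x. x \<in> half_open L \<Longrightarrow> c < x \<Longrightarrow> H x = 0 \<and> K x = 0"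
      using HK unfolding test_function_def by blast
    have qKm: "(\<lambda>x. of_real (q x) * K x) \<in> borel_measurable borel" using borel_measurable_integrable[OF qH(3)] by simp
    have K0: "K x = 0" if "x \<notin> half_open L" for x using weak_derivative_outside[OF wdH that] .
    have bnd: "norm (f x * (of_real (q x) * K x)) \<le> A * norm (of_real (q x) * K x)"
      if A: "\<forall>x\<in>{0..c}. norm (f x) \<le> A" for f :: "real \<Rightarrow> complex" and A x
    proof (cases "x \<in> {0..c}")
      case False
      then have "K x = 0" using K0[of x] 0[of x] half_open_nonneg[of x L] by (cases "x \<in> half_open L") force+
      then show ?thesis by simp
    qed (use A in \<open>simp add: norm_mult mult_right_mono\<close>)
    have i4: "integrable lborel (\<lambda>x. f x * (of_real (q x) * K x))" if wd: "weak_derivative L f f'" for f f'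
    proof -
      obtain A where A: "\<forall>x\<in>{0..c}. norm (f x) \<le> A" using ac_on_bounded[OF weak_derivative_ac_on[OF wd c]] by blast
      show ?thesis
      proof (rule integrable_bound)
        show "integrable lborel (\<lambda>x. A * norm (of_real (q x) * K x))" using qH(3) by (intro integrable_mult_right integrable_norm)
        show "AE x in lborel. norm (f x * (of_real (q x) * K x)) \<le> norm (A * norm (of_real (q x) * K x))"
          using order_trans[OF bnd[OF A] abs_ge_self] by (simp only: real_norm_def) simp
        show "(\<lambda>x. f x * (of_real (q x) * K x)) \<in> borel_measurable lborel"
          using measurable_mult_outside(1)[OF wd qKm] K0 by simp
      qed
    qed
    \<comment> \<open>The product of \<open>q\<close> and \<open>K\<close> is merely integrable, so
      mean square convergence of the other factor would not do; the uniform bound on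
      \<open>{0..c}\<close> is used instead.\<close>
    have l4: "(\<lambda>n. LBINT x. \<psi> (z n) x * (of_real (q x) * K x)) \<longlonglongrightarrow> (LBINT x. of_real (r x) * (of_real (q x) * K x))"
    proof (rule LIM_zero_cancel, rule tendsto_zero_of_square)
      fix n
      let ?A = "sqrt (c * e n)"
      have A: "\<forall>x\<in>{0..c}. norm (\<psi> (z n) x - of_real (r x)) \<le> ?A"
      proof
        fix x assume x: "x \<in> {0..c}"
        have "(norm (\<psi> (z n) x - of_real (r x)))\<^sup>2 \<le> x * e n" using x half_open_downward[OF c] by (intro ptw) auto
        also have "\<dots> \<le> c * e n" using x nn\<upsilon> unfolding e_def by (intro mult_right_mono) auto
        finally show "norm (\<psi> (z n) x - of_real (r x)) \<le> ?A" by (rule real_le_rsqrt)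
      qed
      have "(LBINT x. \<psi> (z n) x * (of_real (q x) * K x)) - (LBINT x. of_real (r x) * (of_real (q x) * K x)) =
          (LBINT x. (\<psi> (z n) x - of_real (r x)) * (of_real (q x) * K x))"
        unfolding left_diff_distrib
        by (rule integral_diff[symmetric, OF i4[OF fD(1)] i4[OF weak_derivative_of_real[OF wdr]]])
      moreover have "norm (LBINT x. (\<psi> (z n) x - of_real (r x)) * (of_real (q x) * K x)) \<le>
          (LBINT x. ?A * norm (of_real (q x) * K x))"
        by (rule integral_norm_bound_integral[OF i4[OF wdd]])
          (use qH(3) bnd[OF A] in \<open>auto intro!: integrable_mult_right integrable_norm\<close>)
      ultimately have "norm ((LBINT x. \<psi> (z n) x * (of_real (q x) * K x)) - (LBINT x. of_real (r x) * (of_real (q x) * K x))) \<le>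
          ?A * (LBINT x. norm (of_real (q x) * K x))" by (simp only: integral_mult_right_zero)
      then have "(norm ((LBINT x. \<psi> (z n) x * (of_real (q x) * K x)) - (LBINT x. of_real (r x) * (of_real (q x) * K x))))\<^sup>2 \<le>
          (?A * (LBINT x. norm (of_real (q x) * K x)))\<^sup>2" by (intro power_mono) auto
      also have "\<dots> = c * e n * (LBINT x. norm (of_real (q x) * K x))\<^sup>2"
        using half_open_nonneg[OF c] nn\<upsilon>[of lborel "\<lambda>x. \<psi>' (z n) x - of_real (p x)"] unfolding e_def by (simp add: power_mult_distrib)
      finally show "(norm ((LBINT x. \<psi> (z n) x * (of_real (q x) * K x)) - (LBINT x. of_real (r x) * (of_real (q x) * K x))))\<^sup>2 \<le>
          c * e n * (LBINT x. norm (of_real (q x) * K x))\<^sup>2" .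
    next
      show "(\<lambda>n. c * e n * (LBINT x. norm (of_real (q x) * K x))\<^sup>2) \<longlonglongrightarrow> 0"
        using tendsto_mult[OF tendsto_mult[OF tendsto_const elim] tendsto_const, of c] by simp
    qed
    have split: "(LBINT x. of_real (q x) * (f x * K x + g x * H x)) =
        (LBINT x. f x * (of_real (q x) * K x)) + (LBINT x. g x * (of_real (q x) * H x))"
      if "integrable lborel (\<lambda>x. f x * (of_real (q x) * K x))" "integrable lborel (\<lambda>x. g x * (of_real (q x) * H x))" for f g
      using integral_add[OF that] by (simp add: algebra_simps)
    have eq: "z n * m (z n) * H 0 + (LBINT x. \<psi>' (z n) x * K x) = (z n)\<^sup>2 * (\<integral>x. \<psi> (z n) x * H x \<partial>\<upsilon>) -
        z n * ((LBINT x. \<psi> (z n) x * (of_real (q x) * K x)) + (LBINT x. \<psi>' (z n) x * (of_real (q x) * H x)))" for n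
      using sol[of n] HK unfolding weyl_solution_def weak_solution_def split[OF i4[OF fD(1)] i3, symmetric] by blast
    have "(\<lambda>n. z n * m (z n) * H 0 + (LBINT x. \<psi>' (z n) x * K x)) \<longlonglongrightarrow>
        of_real (- l) * of_real (m_neg l) * H 0 + (LBINT x. of_real (p x) * K x)"
      by (intro tendsto_intros zlim l1 m_limit[OF l zn(1,2)])
    moreover have "(\<lambda>n. z n * m (z n) * H 0 + (LBINT x. \<psi>' (z n) x * K x)) \<longlonglongrightarrow>
        (of_real (- l))\<^sup>2 * (\<integral>x. of_real (r x) * H x \<partial>\<upsilon>) - of_real (- l) *
          ((LBINT x. of_real (r x) * (of_real (q x) * K x)) + (LBINT x. of_real (p x) * (of_real (q x) * H x)))"
      unfolding eq by (intro tendsto_intros zlim l2 l3 l4)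
    ultimately have "of_real (- l) * of_real (m_neg l) * H 0 + (LBINT x. of_real (p x) * K x) =
        (of_real (- l))\<^sup>2 * (\<integral>x. of_real (r x) * H x \<partial>\<upsilon>) - of_real (- l) *
          (LBINT x. of_real (q x) * (of_real (r x) * K x + of_real (p x) * H x))"
      unfolding split[OF i4[OF weak_derivative_of_real[OF wdr]] i3'] by (rule LIMSEQ_unique)
    then have "complex_of_real ((- l * m_neg l) * h 0 + (LBINT x. p x * k x)) =
        complex_of_real ((- l)\<^sup>2 * (\<integral>x. r x * h x \<partial>\<upsilon>) - (- l) * (LBINT x. of_real (q x) * (r x * k x + p x * h x)))"
      unfolding H_def K_def of_real_mult[symmetric] of_real_add[symmetric] integral_complex_of_real
      by (simp only: of_real_mult of_real_add of_real_diff of_real_power of_real_eq_id id_apply)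
    then show ?thesis by (simp only: of_real_eq_iff)
  qed
  then have "weak_solution L q \<upsilon> (- l) r p (- l * m_neg l)" unfolding weak_solution_def using wdr by blast
  moreover have "(\<lambda>n. LBINT x. (norm (b n x - of_real (p x / (- l))))\<^sup>2) \<longlonglongrightarrow> 0"
    unfolding bp(1) by (rule tendsto_sandwich[OF _ _ tendsto_const B4]) (use Pd(2) nn\<upsilon> in auto)
  ultimately have "real_weyl l r p"
    unfolding real_weyl_def using r0 psq rsq ri rlim\<upsilon> bp(2) unfolding b_def z_def by blast
  then show ?thesis by blast
qed

end

section \<open>Positivity of the Weyl solutions and Picone's inequality\<close>

context weyl_problem
begin

lemma real_weylD:
  assumes "real_weyl l r p"
  shows "weak_derivative L r p" "p \<in> borel_measurable borel" "r \<in> borel_measurable \<upsilon>" "r 0 = 1"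
    "integrable lborel (\<lambda>x. (p x)\<^sup>2)" "integrable \<upsilon> (\<lambda>x. (r x)\<^sup>2)"
    "test_function L h k \<Longrightarrow> - l * m_neg l * h 0 + (LBINT x. p x * k x) =
      l\<^sup>2 * (\<integral>x. r x * h x \<partial>\<upsilon>) + l * (LBINT x. q x * (r x * k x + p x * h x))"
proof -
  show wd: "weak_derivative L r p" using assms by (simp add: real_weyl_def weak_solution_def)
  show "p \<in> borel_measurable borel" by (rule weak_derivative_measurable[OF wd])
  show "r \<in> borel_measurable \<upsilon>"
    by (rule borel_measure_on_measurable[OF \<upsilon> weak_derivative_continuous_on[OF wd]])
  show "test_function L h k \<Longrightarrow> - l * m_neg l * h 0 + (LBINT x. p x * k x) =
      l\<^sup>2 * (\<integral>x. r x * h x \<partial>\<upsilon>) + l * (LBINT x. q x * (r x * k x + p x * h x))"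
    using assms unfolding real_weyl_def weak_solution_def by simp
qed (use assms in \<open>auto simp: real_weyl_def\<close>)

definition gram :: "real \<Rightarrow> real \<Rightarrow> real" where
  "gram l k = Re (negative_kernel (of_real (- l)) (of_real (- k)))"

lemma real_gram:
  assumes lk: "l > 0" "k > 0" and r: "real_weyl l r p" and s: "real_weyl k s o'"
  shows "(\<integral>x. r x * s x \<partial>\<upsilon>) + (LBINT x. p x * o' x) / (l * k) = gram l k"
proof -
  define b where "b = min l k"
  have b: "b > 0" "- l \<le> - b" "- k \<le> - b" using lk by (auto simp: b_def)
  \<comment> \<open>The index of the second sequence is shifted, so that the two points differ even
    for \<open>l = k\<close>.\<close>
  let ?z = "approach l" and ?w = "\<lambda>n. approach k (Suc n)"
  note rD = real_weylD[OF r] and sD = real_weylD[OF s]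
  note [measurable] = rD(2,3) sD(2,3)
  have fin: "finite_energy L (\<psi> z) (\<psi>' z)" if "z \<notin> \<real>" for z using weyl[OF that] by (simp add: weyl_solution_def)
  have pm: "\<psi>' z \<in> borel_measurable lborel" if "z \<notin> \<real>" for z using finite_energyD(2)[OF fin[OF that]] by simp
  have um: "\<psi> z \<in> borel_measurable \<upsilon>" if "z \<notin> \<real>" for z
    by (rule borel_measure_on_measurable[OF \<upsilon> weak_derivative_continuous_on[OF finite_energyD(1)[OF fin[OF that]]]])
  have 1: "(\<lambda>n. \<integral>x. \<psi> (?z n) x * \<psi> (?w n) x \<partial>\<upsilon>) \<longlonglongrightarrow> (\<integral>x. complex_of_real (r x) * complex_of_real (s x) \<partial>\<upsilon>)"
  proof (rule L2_tendsto_integral_mult)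
    show "(\<lambda>n. \<integral>x. (norm (\<psi> (?z n) x - complex_of_real (r x)))\<^sup>2 \<partial>\<upsilon>) \<longlonglongrightarrow> 0"
      "(\<lambda>n. \<integral>x. (norm (\<psi> (?w n) x - complex_of_real (s x)))\<^sup>2 \<partial>\<upsilon>) \<longlonglongrightarrow> 0"
      using r s LIMSEQ_Suc by (auto simp: real_weyl_def)
  qed (use r s um rD(6) sD(6) in \<open>auto simp: real_weyl_def\<close>)
  have 2: "(\<lambda>n. LBINT x. (\<psi>' (?z n) x / ?z n) * (\<psi>' (?w n) x / ?w n)) \<longlonglongrightarrow>
      (LBINT x. complex_of_real (p x / (- l)) * complex_of_real (o' x / (- k)))"
  proof (rule L2_tendsto_integral_mult)
    show "(\<lambda>n. LBINT x. (norm (\<psi>' (?z n) x / ?z n - complex_of_real (p x / (- l))))\<^sup>2) \<longlonglongrightarrow> 0"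
      using r by (simp only: real_weyl_def)
    show "(\<lambda>n. LBINT x. (norm (\<psi>' (?w n) x / ?w n - complex_of_real (o' x / (- k))))\<^sup>2) \<longlonglongrightarrow> 0"
      using s unfolding real_weyl_def by (elim conjE) (rule LIMSEQ_Suc)
    show "integrable lborel (\<lambda>x. (norm (\<psi>' (?z n) x / ?z n - complex_of_real (p x / (- l))))\<^sup>2)"
      "integrable lborel (\<lambda>x. (norm (\<psi>' (?w n) x / ?w n - complex_of_real (o' x / (- k))))\<^sup>2)" for n
      using r s by (simp_all only: real_weyl_def)
    show "integrable lborel (\<lambda>x. (norm (complex_of_real (p x / (- l))))\<^sup>2)"
      "integrable lborel (\<lambda>x. (norm (complex_of_real (o' x / (- k))))\<^sup>2)"
      using rD(5) sD(5) by (simp_all add: norm_divide power_divide)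
  qed (use pm in \<open>auto intro!: borel_measurable_divide\<close>)
  have "negative_kernel (?z n) (?w n) = (\<integral>x. \<psi> (?z n) x * \<psi> (?w n) x \<partial>\<upsilon>) + (LBINT x. (\<psi>' (?z n) x / ?z n) * (\<psi>' (?w n) x / ?w n))" for n
  proof (rule weyl_kernel[symmetric, OF weyl weyl b(1)])
    show "?z n \<noteq> ?w n"
    proof
      assume "?z n = ?w n"
      then have "Im (?z n) = Im (?w n)" by (rule arg_cong)
      then show False by simp
    qed
  qed (use b in auto)
  then have "(\<lambda>n. negative_kernel (?z n) (?w n)) \<longlonglongrightarrow> (\<integral>x. complex_of_real (r x) * complex_of_real (s x) \<partial>\<upsilon>) +
      (LBINT x. complex_of_real (p x / (- l)) * complex_of_real (o' x / (- k)))"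
    using tendsto_add[OF 1 2] by simp
  moreover have "(\<lambda>n. negative_kernel (?z n) (?w n)) \<longlonglongrightarrow> negative_kernel (of_real (- l)) (of_real (- k))"
    by (rule negative_kernel_limit[OF b(1) _ approach_tendsto _ LIMSEQ_Suc[OF approach_tendsto]]) (use b in auto)
  ultimately have "negative_kernel (of_real (- l)) (of_real (- k)) = (\<integral>x. complex_of_real (r x) * complex_of_real (s x) \<partial>\<upsilon>) +
      (LBINT x. complex_of_real (p x / (- l)) * complex_of_real (o' x / (- k)))" by (rule LIMSEQ_unique[symmetric])
  also have "\<dots> = complex_of_real ((\<integral>x. r x * s x \<partial>\<upsilon>) + (LBINT x. p x * o' x / (l * k)))"
    unfolding of_real_mult[symmetric] integral_complex_of_real of_real_add[symmetric] by simp
  finally show ?thesis unfolding gram_def by simp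
qed

lemma gram_limit:
  assumes "l > 0" "\<And>n. a n \<ge> l" "a \<longlonglongrightarrow> x" "\<And>n. b n \<ge> l" "b \<longlonglongrightarrow> y"
  shows "(\<lambda>n. gram (a n) (b n)) \<longlonglongrightarrow> gram x y"
  unfolding gram_def
  by (rule tendsto_Re, rule negative_kernel_limit[OF assms(1)])
    (use assms in \<open>auto intro!: tendsto_intros\<close>)

lemma m_neg_diff:
  assumes lk: "l > 0" "k > 0"
  shows "m_neg l - m_neg k = (k - l) * gram l k"
proof -
  define b where "b = min l k"
  have b: "b > 0" "- l \<le> - b" "- k \<le> - b" using lk by (auto simp: b_def)
  have "(\<lambda>n. m (approach l n) - m (approach k n)) \<longlonglongrightarrow> of_real (m_neg l) - of_real (m_neg k)"
    by (intro tendsto_diff m_limit lk approach_tendsto) simp_all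
  moreover have "m (approach l n) - m (approach k n) = (approach l n - approach k n) * negative_kernel (approach l n) (approach k n)" for n
    by (rule m_diff[OF b(1)]) (use b in auto)
  moreover have "(\<lambda>n. (approach l n - approach k n) * negative_kernel (approach l n) (approach k n)) \<longlonglongrightarrow>
      (of_real (- l) - of_real (- k)) * negative_kernel (of_real (- l)) (of_real (- k))"
    by (intro tendsto_intros approach_tendsto negative_kernel_limit[OF b(1)]) (use b in auto)
  ultimately have "complex_of_real (m_neg l) - of_real (m_neg k) = (of_real (- l) - of_real (- k)) * negative_kernel (of_real (- l)) (of_real (- k))"
    using LIMSEQ_unique by simp
  then have "Re (complex_of_real (m_neg l) - of_real (m_neg k)) = Re (of_real (k - l) * negative_kernel (of_real (- l)) (of_real (- k)))"
    by (simp only: of_real_diff[symmetric]) simp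
  then show ?thesis by (simp add: gram_def)
qed

text \<open>Continuous dependence on \<open>l\<close>, in terms of Gram numbers only. Splitting
  \<open>p - o'\<close> into \<open>l * (p / l - o' / k)\<close> and
  \<open>(l - k) * (o' / k)\<close> brings in the scaled derivatives to which these numbers refer.
  The bound tends to 0 as \<open>k\<close> tends to \<open>l\<close>.\<close>

lemma real_weyl_diff_bound:
  assumes lk: "l > 0" "k > 0" and r: "real_weyl l r p" and s: "real_weyl k s o'" and x: "x \<in> half_open L"
  shows "(r x - s x)\<^sup>2 \<le> x * (2 * l\<^sup>2 * (gram l l + gram k k - 2 * gram l k) + 2 * (l - k)\<^sup>2 * gram k k)"
proof -
  note rD = real_weylD[OF r] and sD = real_weylD[OF s]
  note [measurable] = rD(2,3) sD(2,3)
  have pp: "integrable lborel (\<lambda>x. p x * p x)" "integrable lborel (\<lambda>x. o' x * o' x)" "integrable lborel (\<lambda>x. p x * o' x)"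
    and rr: "integrable \<upsilon> (\<lambda>x. r x * r x)" "integrable \<upsilon> (\<lambda>x. s x * s x)" "integrable \<upsilon> (\<lambda>x. r x * s x)"
    using rD(5,6) sD(5,6) by (auto intro!: integrable_L2_mult)
  let ?I = "\<lambda>a b. \<integral>x. a x * b x \<partial>lborel" and ?U = "\<lambda>a b. \<integral>x. a x * b x \<partial>\<upsilon>"
  have g: "gram l l = ?U r r + ?I p p / (l * l)" "gram k k = ?U s s + ?I o' o' / (k * k)" "gram l k = ?U r s + ?I p o' / (l * k)"
    using real_gram[OF lk(1,1) r r] real_gram[OF lk(2,2) s s] real_gram[OF lk r s] by auto
  have "0 \<le> (\<integral>x. (r x - s x)\<^sup>2 \<partial>\<upsilon>)" by (intro integral_nonneg_AE) simp
  also have "\<dots> = ?U r r + ?U s s - 2 * ?U r s"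
  proof -
    have "(r x - s x)\<^sup>2 = r x * r x + s x * s x - 2 * (r x * s x)" for x
      by (simp add: power2_eq_square algebra_simps)
    then show ?thesis using rr by simp
  qed
  finally have u: "0 \<le> ?U r r + ?U s s - 2 * ?U r s" .
  have u2: "0 \<le> ?U s s" by (intro integral_nonneg_AE) simp
  have pd: "integrable lborel (\<lambda>x. (p x - o' x)\<^sup>2)"
    using square_integrable_diff[of p lborel o'] rD(5) sD(5) by simp
  have eqF: "(\<lambda>x. 2 * l\<^sup>2 * (p x / l - o' x / k)\<^sup>2 + 2 * (l - k)\<^sup>2 * (o' x / k)\<^sup>2) =
      (\<lambda>x. 2 * l\<^sup>2 / (l * l) * (p x * p x) + 2 * l\<^sup>2 / (k * k) * (o' x * o' x) - 4 * l\<^sup>2 / (l * k) * (p x * o' x) +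
        2 * (l - k)\<^sup>2 / (k * k) * (o' x * o' x))"
    using lk by (simp add: fun_eq_iff power2_eq_square field_simps)
  have "(LBINT x. (p x - o' x)\<^sup>2) \<le> (LBINT x. 2 * l\<^sup>2 * (p x / l - o' x / k)\<^sup>2 + 2 * (l - k)\<^sup>2 * (o' x / k)\<^sup>2)"
  proof (rule integral_mono)
    show "integrable lborel (\<lambda>x. 2 * l\<^sup>2 * (p x / l - o' x / k)\<^sup>2 + 2 * (l - k)\<^sup>2 * (o' x / k)\<^sup>2)"
      unfolding eqF
      by (intro integrable_add integrable_diff integrable_mult_right pp)
    fix x
    have "p x - o' x = l * (p x / l - o' x / k) + (l - k) * (o' x / k)"
      using lk by (simp add: field_simps)
    then show "(p x - o' x)\<^sup>2 \<le> 2 * l\<^sup>2 * (p x / l - o' x / k)\<^sup>2 + 2 * (l - k)\<^sup>2 * (o' x / k)\<^sup>2"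
      using square_norm_sum_le[of "l * (p x / l - o' x / k)" "(l - k) * (o' x / k)"]
      unfolding real_norm_def power2_abs power_mult_distrib[of l] power_mult_distrib[of "l - k"]
      by (simp only: mult.assoc)
  qed (rule pd)
  also have "\<dots> = 2 * l\<^sup>2 * (?I p p / (l * l) + ?I o' o' / (k * k) - 2 * (?I p o' / (l * k))) + 2 * (l - k)\<^sup>2 * (?I o' o' / (k * k))"
    unfolding eqF
    by (simp only: integral_add integral_diff integral_mult_right_zero
        integrable_add integrable_diff integrable_mult_right pp)
      (simp add: algebra_simps)
  also have "\<dots> \<le> 2 * l\<^sup>2 * (gram l l + gram k k - 2 * gram l k) + 2 * (l - k)\<^sup>2 * gram k k"
    using u u2 unfolding g by (intro add_mono mult_left_mono) auto
  finally have d: "(LBINT x. (p x - o' x)\<^sup>2) \<le> 2 * l\<^sup>2 * (gram l l + gram k k - 2 * gram l k) + 2 * (l - k)\<^sup>2 * gram k k" .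
  have "(norm ((r x - s x) - (r 0 - s 0)))\<^sup>2 \<le> (x - 0) * (LBINT t. indicator {0<..x} t * (norm (p t - o' t))\<^sup>2)"
    by (rule weak_derivative_diff_bound[OF weak_derivative_sub[OF rD(1) sD(1)]]) (use x half_open_nonneg in auto)
  also have "\<dots> \<le> x * (LBINT x. (p x - o' x)\<^sup>2)"
  proof (simp only: diff_0_right, rule mult_left_mono)
    show "(LBINT t. indicator {0<..x} t * (norm (p t - o' t))\<^sup>2) \<le> (LBINT x. (p x - o' x)\<^sup>2)"
      by (rule integral_mono) (use pd integrable_mult_indicator[OF _ pd, of "{0<..x}"] in \<open>auto simp: indicator_def\<close>)
  qed (use x half_open_nonneg in auto)
  also have "\<dots> \<le> x * (2 * l\<^sup>2 * (gram l l + gram k k - 2 * gram l k) + 2 * (l - k)\<^sup>2 * gram k k)"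
    by (rule mult_left_mono[OF d]) (use x half_open_nonneg in auto)
  finally show ?thesis using rD(4) sD(4) by simp
qed

text \<open>Testing the equation for \<open>r\<close> with \<open>h\<^sup>2 / r\<close> and using \<open>p (h\<^sup>2 / r)' = k\<^sup>2 - (k - h p / r)\<^sup>2\<close>.\<close>

lemma picone:
  assumes l: "l > 0" and r: "real_weyl l r p" and c: "c \<in> half_open L"
    and pos: "\<And>x. x \<in> {0..c} \<Longrightarrow> r x > 0"
    and h: "weak_derivative L h k" and h0: "\<And>x. x \<in> half_open L \<Longrightarrow> c < x \<Longrightarrow> h x = 0 \<and> k x = 0"
  shows "l * m_neg l * (h 0)\<^sup>2 + l\<^sup>2 * (\<integral>x. (h x)\<^sup>2 \<partial>\<upsilon>) + 2 * l * (LBINT x. q x * (h x * k x)) \<le>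
    (LBINT x. (k x)\<^sup>2)"
proof -
  note rD = real_weylD[OF r]
  note [measurable] = rD(2,3)
  \<comment> \<open>Positivity is known on \<open>{0..c}\<close> only. Stopping \<open>r\<close> at
    \<open>c\<close> gives a function with a reciprocal on all of \<open>[0, L)\<close>, and beyond
    \<open>c\<close> the factor \<open>h\<close> is 0.\<close>
  define rc where "rc x = r (min x c)" for x
  define pc where "pc x = indicator {..c} x *\<^sub>R p x" for x
  have wrc: "weak_derivative L rc pc" unfolding rc_def pc_def by (rule weak_derivative_min[OF rD(1) c])
  have rc_pos: "rc x > 0" if "x \<in> half_open L" for x
    unfolding rc_def using half_open_nonneg[OF that] half_open_nonneg[OF c] by (intro pos) auto
  define u where "u x = inverse (rc x)" for x
  define u' where "u' x = - (pc x / (rc x)\<^sup>2)" for x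
  have wu: "weak_derivative L u u'" unfolding u_def u'_def
    by (rule weak_derivative_inverse[OF wrc]) (use rc_pos in force)
  have th: "test_function L h k" using h h0 c unfolding test_function_def by blast
  define T where "T x = h x * (u x * h x)" for x
  define T' where "T' x = h x * (u x * k x + u' x * h x) + k x * (u x * h x)" for x
  have tT: "test_function L T T'"
    unfolding T_def T'_def by (rule test_function_mult[OF h test_function_mult[OF wu th]])
  have out: "k x = 0" "T' x = 0" if "x \<notin> half_open L" for x
    using weak_derivative_outside[OF h that] weak_derivative_outside[OF test_function_imp_weak_derivative[OF tT] that] by auto
  have T0: "T 0 = (h 0)\<^sup>2"
    using half_open_nonneg[OF c] rD(4) by (simp add: T_def u_def rc_def power2_eq_square)
  have rT: "r x * T x = (h x)\<^sup>2" if x: "x \<in> half_open L" for x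
  proof (cases "x \<le> c")
    case True
    then have "r x > 0" using half_open_nonneg[OF x] by (intro pos) auto
    then show ?thesis using True by (simp add: T_def u_def rc_def power2_eq_square)
  qed (use h0[OF x] in \<open>simp add: T_def\<close>)
  \<comment> \<open>The product of \<open>r\<close> and \<open>T\<close> is the square of
    \<open>h\<close>, so its derivative is \<open>2 * h x * k x\<close> and \<open>r\<close> drops
    out of the distribution term.\<close>
  have mid: "q x * (r x * T' x + p x * T x) = 2 * (q x * (h x * k x))" for x
  proof (cases "x \<in> half_open L")
    case True
    show ?thesis
    proof (cases "x \<le> c")
      case xc: True
      then have "r x > 0" using half_open_nonneg[OF True] by (intro pos) auto
      then show ?thesis using xc by (simp add: T_def T'_def u_def u'_def rc_def pc_def power2_eq_square field_simps)
    qed (use h0[OF True] in \<open>simp add: T_def T'_def\<close>)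
  qed (use q in \<open>simp add: local_L2_def\<close>)
  have le: "p x * T' x \<le> (k x)\<^sup>2" for x
  proof (cases "x \<in> half_open L")
    case True
    show ?thesis
    proof (cases "x \<le> c")
      case xc: True
      then have rx: "r x > 0" using half_open_nonneg[OF True] by (intro pos) auto
      have "p x * T' x = (k x)\<^sup>2 - (k x - h x * p x / r x)\<^sup>2"
        using xc rx by (simp add: T'_def u_def u'_def rc_def pc_def power2_eq_square field_simps)
      then show ?thesis by simp
    qed (use h0[OF True] in \<open>simp add: T_def T'_def\<close>)
  qed (use out in simp)
  have m [measurable]: "k \<in> borel_measurable borel" "T' \<in> borel_measurable borel"
    using weak_derivative_measurable[OF h] weak_derivative_measurable[OF test_function_imp_weak_derivative[OF tT]] by auto
  have k2: "integrable lborel (\<lambda>x. (k x)\<^sup>2)" using test_function_square_integrable(1)[OF th] by simp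
  have pT: "integrable lborel (\<lambda>x. p x * T' x)"
    by (rule integrable_L2_mult) (use rD(5) test_function_square_integrable(1)[OF tT] in simp_all)
  have "- l * m_neg l * (h 0)\<^sup>2 + (LBINT x. p x * T' x) =
      l\<^sup>2 * (\<integral>x. r x * T x \<partial>\<upsilon>) + l * (LBINT x. q x * (r x * T' x + p x * T x))"
    using rD(7)[OF tT] unfolding T0 .
  also have "(\<integral>x. r x * T x \<partial>\<upsilon>) = (\<integral>x. (h x)\<^sup>2 \<partial>\<upsilon>)"
    by (rule integral_cong) (use rT borel_measure_on_space[OF \<upsilon>] in auto)
  also have "(LBINT x. q x * (r x * T' x + p x * T x)) = 2 * (LBINT x. q x * (h x * k x))"
    unfolding mid by (rule integral_mult_right_zero)
  finally have "l * m_neg l * (h 0)\<^sup>2 + l\<^sup>2 * (\<integral>x. (h x)\<^sup>2 \<partial>\<upsilon>) + 2 * l * (LBINT x. q x * (h x * k x)) =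
      (LBINT x. p x * T' x)" by simp
  also have "\<dots> \<le> (LBINT x. (k x)\<^sup>2)" by (rule integral_mono[OF pT k2 le])
  finally show ?thesis .
qed

text \<open>Unique continuation: near \<open>x0\<close> the energy of a solution that vanishes beyond \<open>x0\<close> is dominated
  by a small multiple of itself.\<close>

lemma real_weyl_not_vanishing_beyond:
  assumes l: "l > 0" and r: "real_weyl l r p" and x0: "x0 \<in> half_open L" "0 < x0"
    and r0: "\<And>x. x \<in> half_open L \<Longrightarrow> x0 \<le> x \<Longrightarrow> r x = 0" and p0: "AE x in lborel. x0 < x \<longrightarrow> p x = 0"
  shows "\<exists>y\<in>{0..<x0}. r y = 0"
proof -
  note rD = real_weylD[OF r]
  note [measurable] = rD(2,3)
  define V where "V = measure \<upsilon> {0..x0}"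
  define Q where "Q = (LBINT x. indicator {0..x0} x * (q x)\<^sup>2)"
  have qm [measurable]: "q \<in> borel_measurable borel" and qi: "integrable lborel (\<lambda>x. indicator {0..x0} x * (q x)\<^sup>2)"
    using q x0 by (auto simp: local_L2_def)
  obtain d where d: "x0 < d" "d \<in> half_open L" using half_open_extend[OF x0(1)] by blast
  define a where "a n = x0 / real (Suc n)" for n
  have "a \<longlonglongrightarrow> 0" unfolding a_def using LIMSEQ_ignore_initial_segment[OF lim_const_over_n[of x0], of 1] by simp
  then have "(\<lambda>n. l\<^sup>2 * V * a n + 2 * l * sqrt (a n * Q)) \<longlonglongrightarrow> l\<^sup>2 * V * 0 + 2 * l * sqrt (0 * Q)"
    by (intro tendsto_intros)
  then have "\<forall>\<^sub>F n in sequentially. l\<^sup>2 * V * a n + 2 * l * sqrt (a n * Q) < 1"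
    by (rule order_tendstoD(2)) simp
  \<comment> \<open>This is the factor by which the energy \<open>E\<close> on the last stretch of
    length \<open>a n\<close> will be estimated by itself: the first term comes from the measure,
    the second from the distribution.\<close>
  then obtain n where n: "l\<^sup>2 * V * a n + 2 * l * sqrt (a n * Q) < 1" by (auto simp: eventually_sequentially)
  define y where "y = x0 - a n"
  have a: "a n > 0" "a n \<le> x0" using x0 by (auto simp: a_def field_simps)
  have y: "0 \<le> y" "y < x0" "x0 - y = a n" using a by (auto simp: y_def)
  have yL: "y \<in> half_open L" using half_open_downward[OF x0(1)] y by auto
  define E where "E = (LBINT x. indicator {y<..x0} x * (p x)\<^sup>2)"
  have Ei: "integrable lborel (\<lambda>x. indicator {y<..x0} x * (p x)\<^sup>2)"
    using integrable_mult_indicator[OF _ rD(5), of "{y<..x0}"] by simp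
  have E0: "E \<ge> 0" unfolding E_def by (intro integral_nonneg_AE) simp
  have bound: "(r x2 - r x1)\<^sup>2 \<le> a n * E" if "y \<le> x1" "x1 \<le> x2" "x2 \<le> x0" for x1 x2
  proof -
    have "(norm (r x2 - r x1))\<^sup>2 \<le> (x2 - x1) * (LBINT t. indicator {x1<..x2} t * (norm (p t))\<^sup>2)"
      by (rule weak_derivative_diff_bound[OF rD(1)]) (use that y half_open_downward[OF x0(1), of x2] in auto)
    also have "\<dots> \<le> a n * E"
    proof (rule mult_mono)
      show "(LBINT t. indicator {x1<..x2} t * (norm (p t))\<^sup>2) \<le> E"
        unfolding E_def using integrable_mult_indicator[OF _ rD(5), of "{x1<..x2}"] that
        by (intro integral_mono Ei) (auto simp: indicator_def)
    qed (use that y a in \<open>auto intro!: integral_nonneg_AE\<close>)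
    finally show ?thesis by simp
  qed
  define s where "s = sqrt (a n * E)"
  have sb: "\<bar>r x\<bar> \<le> s" "\<bar>r x - r y\<bar> \<le> s" if "y \<le> x" "x \<le> x0" for x
    using bound[of x x0] bound[of y x] that y r0[OF x0(1)] unfolding s_def
    by (auto intro!: real_le_rsqrt simp: power2_commute)
  \<comment> \<open>The test function vanishes up to \<open>y\<close> and has derivative
    \<open>p\<close> on \<open>(y, x0]\<close>. Its value 0 at the left end removes the term with
    \<open>m_neg\<close>. The factor \<open>\<rho>\<close> brings it back to 0 beyond
    \<open>x0\<close>, where \<open>r\<close> and \<open>p\<close> vanish and nothing is
    counted.\<close>
  define f where "f x = r (max x y) - r y" for x
  define f' where "f' x = indicator {y<..} x *\<^sub>R p x - 0" for x
  define \<rho> where "\<rho> x = (d - min (max x x0) d) / (d - x0)" for x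
  define \<kappa> where "\<kappa> x = - (indicator {x0<..d} x * indicator (half_open L) x / (d - x0))" for x :: real
  have wf: "weak_derivative L f f'" unfolding f_def f'_def
    by (rule weak_derivative_sub[OF weak_derivative_max[OF rD(1) yL] weak_derivative_const])
  have "weak_derivative L \<rho> \<kappa>" unfolding \<rho>_def \<kappa>_def
    by (rule weak_derivative_ramp) (use x0 d in auto)
  then have t\<rho>: "test_function L \<rho> \<kappa>"
    unfolding test_function_def by (intro conjI bexI[of _ d]) (use d in \<open>auto simp: \<rho>_def \<kappa>_def\<close>)
  have tT: "test_function L (\<lambda>x. f x * \<rho> x) (\<lambda>x. f x * \<kappa> x + f' x * \<rho> x)" by (rule test_function_mult[OF wf t\<rho>])
  have \<rho>1: "\<rho> x = 1" "\<kappa> x = 0" if "x \<le> x0" for x using that d by (auto simp: \<rho>_def \<kappa>_def)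
  have "f 0 = 0" using y by (simp add: f_def)
  then have eq: "(LBINT x. p x * (f x * \<kappa> x + f' x * \<rho> x)) = l\<^sup>2 * (\<integral>x. r x * (f x * \<rho> x) \<partial>\<upsilon>) +
      l * (LBINT x. q x * (r x * (f x * \<kappa> x + f' x * \<rho> x) + p x * (f x * \<rho> x)))"
    using rD(7)[OF tT] by simp
  have pm: "(\<lambda>x. f x * \<kappa> x + f' x * \<rho> x) \<in> borel_measurable borel"
    by (rule weak_derivative_measurable[OF test_function_imp_weak_derivative[OF tT]])
  have e1: "(LBINT x. p x * (f x * \<kappa> x + f' x * \<rho> x)) = E"
    unfolding E_def
  proof (rule integral_cong_AE)
    show "AE x in lborel. p x * (f x * \<kappa> x + f' x * \<rho> x) = indicator {y<..x0} x * (p x)\<^sup>2"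
      using p0
    proof eventually_elim
      fix x assume px: "x0 < x \<longrightarrow> p x = 0"
      show "p x * (f x * \<kappa> x + f' x * \<rho> x) = indicator {y<..x0} x * (p x)\<^sup>2"
        using px \<rho>1[of x] by (cases "x \<le> x0") (auto simp: f'_def indicator_def power2_eq_square)
    qed
  qed (use pm in measurable)
  have e2: "(\<integral>x. r x * (f x * \<rho> x) \<partial>\<upsilon>) \<le> V * (a n * E)"
  proof -
    have fin: "emeasure \<upsilon> {0..x0} < \<infinity>" "{0..x0} \<in> sets \<upsilon>" using borel_measure_on_Icc[OF \<upsilon> x0(1)] by auto
    have "norm (\<integral>x. r x * (f x * \<rho> x) \<partial>\<upsilon>) \<le> (\<integral>x. indicator {0..x0} x * (s * s) \<partial>\<upsilon>)"
    proof (rule integral_norm_bound_integral)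
      show "integrable \<upsilon> (\<lambda>x. r x * (f x * \<rho> x))"
        by (rule integrable_L2_mult)
          (use rD(6) test_function_square_integrable(2)[OF tT \<upsilon>]
            borel_measure_on_measurable[OF \<upsilon> weak_derivative_continuous_on[OF test_function_imp_weak_derivative[OF tT]]] in auto)
      show "integrable \<upsilon> (\<lambda>x. indicator {0..x0} x * (s * s))"
        using fin by (intro integrable_mult_left integrable_real_indicator) auto
      fix x assume "x \<in> space \<upsilon>"
      then have x: "x \<in> half_open L" using borel_measure_on_space[OF \<upsilon>] by simp
      consider "x \<le> y" | "y \<le> x" "x \<le> x0" | "x0 < x" by linarith
      then show "norm (r x * (f x * \<rho> x)) \<le> indicator {0..x0} x * (s * s)"
      proof cases
        case 1
        then show ?thesis by (auto simp: f_def max_def indicator_def)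
      next
        case 2
        then have "norm (r x * (f x * \<rho> x)) = \<bar>r x\<bar> * \<bar>r x - r y\<bar>" by (simp add: f_def \<rho>1 abs_mult)
        also have "\<dots> \<le> s * s" using sb[OF 2] by (intro mult_mono) auto
        finally show ?thesis using 2 half_open_nonneg[OF x] by simp
      qed (use r0[OF x] in simp)
    qed
    also have "\<dots> = V * (s * s)" using fin by (simp add: V_def)
    also have "s * s = a n * E" using a E0 by (simp add: s_def)
    finally show ?thesis by simp
  qed
  have e3: "(LBINT x. q x * (r x * (f x * \<kappa> x + f' x * \<rho> x) + p x * (f x * \<rho> x))) \<le> 2 * sqrt (a n * Q) * E"
  proof -
    let ?q = "\<lambda>x. indicator {0..x0} x * q x" and ?p = "\<lambda>x. indicator {y<..x0} x * p x"
    have q2: "integrable lborel (\<lambda>x. (norm (?q x))\<^sup>2)" "(LBINT x. (norm (?q x))\<^sup>2) = Q"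
      and p2: "integrable lborel (\<lambda>x. (norm (?p x))\<^sup>2)" "(LBINT x. (norm (?p x))\<^sup>2) = E"
    proof -
      have e: "(norm (indicator S x * g x))\<^sup>2 = indicator S x * (g x)\<^sup>2" for S x and g :: "real \<Rightarrow> real"
        by (auto simp: indicator_def)
      show "integrable lborel (\<lambda>x. (norm (?q x))\<^sup>2)" "(LBINT x. (norm (?q x))\<^sup>2) = Q"
        "integrable lborel (\<lambda>x. (norm (?p x))\<^sup>2)" "(LBINT x. (norm (?p x))\<^sup>2) = E"
        unfolding e Q_def E_def by (rule qi refl Ei)+
    qed
    have pq: "integrable lborel (\<lambda>x. norm (?q x) * norm (?p x))"
      using integrable_norm[OF integrable_L2_mult[OF _ _ q2(1) p2(1)]] unfolding norm_mult by measurable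
    have CS: "(LBINT x. norm (?q x) * norm (?p x)) \<le> sqrt (Q * E)"
      using Cauchy_Schwarz_integral[OF _ _ q2(1) p2(1)] unfolding q2(2) p2(2) by (intro real_le_rsqrt) simp
    have "(LBINT x. q x * (r x * (f x * \<kappa> x + f' x * \<rho> x) + p x * (f x * \<rho> x))) \<le>
        norm (LBINT x. q x * (r x * (f x * \<kappa> x + f' x * \<rho> x) + p x * (f x * \<rho> x)))" by simp
    also have "\<dots> \<le> (LBINT x. norm (q x * (r x * (f x * \<kappa> x + f' x * \<rho> x) + p x * (f x * \<rho> x))))"
      by (rule integral_norm_bound)
    also have "\<dots> \<le> (LBINT x. 2 * s * (norm (?q x) * norm (?p x)))"
    proof (rule integral_mono_AE')
      show "integrable lborel (\<lambda>x. 2 * s * (norm (?q x) * norm (?p x)))" by (rule integrable_mult_right[OF pq])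
      show "AE x in lborel. norm (q x * (r x * (f x * \<kappa> x + f' x * \<rho> x) + p x * (f x * \<rho> x))) \<le> 2 * s * (norm (?q x) * norm (?p x))"
        using p0
      proof eventually_elim
        fix x assume px: "x0 < x \<longrightarrow> p x = 0"
        show "norm (q x * (r x * (f x * \<kappa> x + f' x * \<rho> x) + p x * (f x * \<rho> x))) \<le> 2 * s * (norm (?q x) * norm (?p x))"
        proof (cases "x \<in> half_open L")
          case True
          consider "x \<le> y" | "y < x" "x \<le> x0" | "x0 < x" by linarith
          then show ?thesis
          proof cases
            case 1
            then have "f x = 0" "f' x = 0" using y by (auto simp: f_def f'_def max_def)
            then show ?thesis using a E0 by (simp add: s_def)
          next
            case 2
            then have "norm (q x * (r x * (f x * \<kappa> x + f' x * \<rho> x) + p x * (f x * \<rho> x))) =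
                \<bar>q x\<bar> * \<bar>p x\<bar> * \<bar>r x + (r x - r y)\<bar>"
              by (simp add: f_def f'_def \<rho>1 flip: abs_mult) (simp add: algebra_simps)
            also have "\<dots> \<le> \<bar>q x\<bar> * \<bar>p x\<bar> * (s + s)"
              using sb[of x] 2 by (intro mult_left_mono) auto
            finally show ?thesis using 2 y by (simp add: mult_ac)
          next
            case 3
            then show ?thesis using px r0[OF True] by simp
          qed
        next
          case False
          then have "q x = 0" using q by (simp add: local_L2_def)
          then show ?thesis by simp
        qed
      qed
    qed (use a E0 in \<open>simp add: s_def\<close>)
    also have "\<dots> = 2 * s * (LBINT x. norm (?q x) * norm (?p x))" by (rule integral_mult_right_zero)
    also have "\<dots> \<le> 2 * s * sqrt (Q * E)" using CS a E0 by (intro mult_left_mono) (auto simp: s_def)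
    also have "\<dots> = 2 * sqrt (a n * Q) * E"
      using E0 by (simp add: s_def real_sqrt_mult)
    finally show ?thesis .
  qed
  have "E \<le> l\<^sup>2 * (V * (a n * E)) + l * (2 * sqrt (a n * Q) * E)"
    using add_mono[OF mult_left_mono[OF e2, of "l\<^sup>2"] mult_left_mono[OF e3, of l]] l eq e1 by simp
  also have "\<dots> = (l\<^sup>2 * V * a n + 2 * l * sqrt (a n * Q)) * E" by (simp add: algebra_simps)
  finally have "0 \<le> (l\<^sup>2 * V * a n + 2 * l * sqrt (a n * Q) - 1) * E" by (simp add: left_diff_distrib)
  \<comment> \<open>With zero energy \<open>r\<close> is constant on \<open>{y..x0}\<close>, so it
    is 0 at \<open>y\<close> as well.\<close>
  then have "E = 0" using n E0 mult_neg_pos[of "l\<^sup>2 * V * a n + 2 * l * sqrt (a n * Q) - 1" E] by force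
  then have "r y = 0" using bound[of y x0] y r0[OF x0(1)] by simp
  then show ?thesis using y by auto
qed

end

section \<open>Absence of zeros\<close>

context weyl_problem
begin

text \<open>The scaled Gram number is \<open>c1 a^2 + \<gamma>\<close> plus the integral of
  \<open>(a / (t + a))^2\<close>, whose integrand tends to 0 for every \<open>t > 0\<close>. A bound
  \<open>M\<close> of the sequence provides the dominating function, as \<open>a / (t + a)\<close>
  increases with \<open>a\<close>.\<close>

lemma gram_scaled_tendsto:
  assumes a: "\<And>n. 0 < a n" "a \<longlonglongrightarrow> 0"
  shows "(\<lambda>n. (a n)\<^sup>2 * gram (a n) (a n)) \<longlonglongrightarrow> \<gamma>"
proof -
  obtain M where M: "\<And>n. a n \<le> M" "M > 0"
  proof -
    obtain K where K: "\<And>n. norm (a n) \<le> K" using convergent_imp_Bseq[of a] a(2) by (auto simp: convergent_def Bseq_def)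
    have "a n \<le> max K 1" for n using K[of n] abs_ge_self[of "a n"] unfolding real_norm_def by linarith
    then show ?thesis using that[of "max K 1"] by auto
  qed
  have eq: "(a n)\<^sup>2 * gram (a n) (a n) = c1 * (a n)\<^sup>2 + \<gamma> + (\<integral>t. (a n)\<^sup>2 * (1 / (t + a n)\<^sup>2) \<partial>\<mu>)" for n
  proof -
    have "(\<integral>t. 1 / ((complex_of_real t - of_real (- a n)) * (of_real t - of_real (- a n))) \<partial>\<mu>) =
        (\<integral>t. complex_of_real (1 / (t + a n)\<^sup>2) \<partial>\<mu>)" by (simp add: power2_eq_square)
    also have "\<dots> = of_real (\<integral>t. 1 / (t + a n)\<^sup>2 \<partial>\<mu>)" by (rule integral_complex_of_real)
    finally have "gram (a n) (a n) = c1 + \<gamma> / (a n)\<^sup>2 + (\<integral>t. 1 / (t + a n)\<^sup>2 \<partial>\<mu>)"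
      unfolding gram_def negative_kernel_def by (simp add: power2_eq_square flip: of_real_mult of_real_divide)
    then show ?thesis unfolding integral_mult_right_zero using a(1)[of n] by (simp add: field_simps)
  qed
  have "(\<lambda>n. \<integral>t. (a n)\<^sup>2 * (1 / (t + a n)\<^sup>2) \<partial>\<mu>) \<longlonglongrightarrow> (\<integral>t. 0 \<partial>\<mu>)"
  proof (rule integral_dominated_convergence[where w="\<lambda>t. M\<^sup>2 * (1 / (t + M)\<^sup>2)"])
    show "AE t in \<mu>. (\<lambda>n. (a n)\<^sup>2 * (1 / (t + a n)\<^sup>2)) \<longlonglongrightarrow> 0"
      using AE_positive
    proof eventually_elim
      fix t :: real assume "0 < t"
      then have "(\<lambda>n. (a n)\<^sup>2 * (1 / (t + a n)\<^sup>2)) \<longlonglongrightarrow> 0\<^sup>2 * (1 / (t + 0)\<^sup>2)"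
        by (intro tendsto_intros a) auto
      then show "(\<lambda>n. (a n)\<^sup>2 * (1 / (t + a n)\<^sup>2)) \<longlonglongrightarrow> 0" by simp
    qed
    show "AE t in \<mu>. norm ((a n)\<^sup>2 * (1 / (t + a n)\<^sup>2)) \<le> M\<^sup>2 * (1 / (t + M)\<^sup>2)" for n
      using AE_positive
    proof eventually_elim
      fix t :: real assume t: "0 < t"
      have "a n * (t + M) \<le> M * (t + a n)" using M(1)[of n] t a(1)[of n] by (simp add: algebra_simps)
      then have "a n / (t + a n) \<le> M / (t + M)" using t a(1)[of n] M by (simp add: divide_simps)
      then have "(a n / (t + a n))\<^sup>2 \<le> (M / (t + M))\<^sup>2" using t a(1)[of n] by (intro power_mono) auto
      then show "norm ((a n)\<^sup>2 * (1 / (t + a n)\<^sup>2)) \<le> M\<^sup>2 * (1 / (t + M)\<^sup>2)" by (simp add: power_divide)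
    qed
  qed (use integrable_mult_right[OF integrable_square_kernel[OF M(2)], of "M\<^sup>2"] in \<open>simp_all cong: measurable_cong_sets add: sets_\<mu>\<close>)
  then have "(\<lambda>n. c1 * (a n)\<^sup>2 + \<gamma> + (\<integral>t. (a n)\<^sup>2 * (1 / (t + a n)\<^sup>2) \<partial>\<mu>)) \<longlonglongrightarrow> c1 * 0\<^sup>2 + \<gamma> + 0"
    by (intro tendsto_intros a) simp
  then show ?thesis unfolding eq by simp
qed

lemma real_weyl_energy_le:
  assumes l: "l > 0" and r: "real_weyl l r p"
  shows "(LBINT x. (p x)\<^sup>2) \<le> l\<^sup>2 * gram l l"
proof -
  have "gram l l = (\<integral>x. r x * r x \<partial>\<upsilon>) + (LBINT x. p x * p x) / (l * l)"
    using real_gram[OF l l r r] by simp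
  moreover have "0 \<le> (\<integral>x. r x * r x \<partial>\<upsilon>)" by (intro integral_nonneg_AE) simp
  ultimately have "(LBINT x. p x * p x) / (l * l) \<le> gram l l" by simp
  then show ?thesis using l by (simp add: power2_eq_square pos_divide_le_eq mult_ac)
qed

text \<open>At \<open>l\<close> the solution \<open>h\<close> stopped at its first zero turns
  Picone's inequality into an equality; for \<open>k < l\<close> it is an inequality. Dividing the
  difference by \<open>l - k\<close> leaves the energy of \<open>h\<close> as an upper bound for
  \<open>gram k l\<close>, while \<open>gram l l\<close> is the energy of the whole
  solution.\<close>

lemma real_weyl_first_zero_contradiction:
  assumes l: "l > 0" and r: "real_weyl l r p" and c: "c \<in> half_open L" and x: "x \<in> {0..c}" "r x \<le> 0"
    and R: "\<And>k. 0 < k \<Longrightarrow> k < l \<Longrightarrow> real_weyl k (R k) (P k) \<and> (\<forall>x\<in>{0..c}. R k x > 0)"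
  shows False
proof -
  note rD = real_weylD[OF r]
  note [measurable] = rD(2,3)
  have cont: "continuous_on {0..c} r"
    by (rule continuous_on_subset[OF weak_derivative_continuous_on[OF rD(1)]]) (use half_open_downward[OF c] in auto)
  have "closed {y \<in> {0..c}. r y \<le> 0}"
    by (rule continuous_on_closed_Collect_le[OF cont]) (auto intro: continuous_intros)
  moreover have "bounded {y \<in> {0..c}. r y \<le> 0}" by (rule bounded_subset[OF bounded_closed_interval[of 0 c]]) auto
  ultimately have "compact {y \<in> {0..c}. r y \<le> 0}" by (simp add: compact_eq_bounded_closed)
  then obtain x0 where x0: "x0 \<in> {0..c}" "r x0 \<le> 0" and min: "\<And>y. y \<in> {0..c} \<Longrightarrow> r y \<le> 0 \<Longrightarrow> x0 \<le> y"
    using compact_attains_inf[of "{y \<in> {0..c}. r y \<le> 0}"] x by force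
  have x0L: "x0 \<in> half_open L" using x0 half_open_downward[OF c] by auto
  have "\<exists>y. 0 \<le> y \<and> y \<le> x0 \<and> r y = 0"
    by (rule IVT2') (use x0 rD(4) cont in \<open>auto intro: continuous_on_subset\<close>)
  then obtain y where y: "0 \<le> y" "y \<le> x0" "r y = 0" by blast
  then have "x0 \<le> y" using x0 by (intro min) auto
  then have rx0: "r x0 = 0" using y by simp
  then have x0_pos: "0 < x0" using rD(4) x0 by (cases "x0 = 0") auto
  define h where "h x = r (min x x0)" for x
  define k where "k x = indicator {..x0} x *\<^sub>R p x" for x
  have wh: "weak_derivative L h k" unfolding h_def k_def by (rule weak_derivative_min[OF rD(1) x0L])
  have h0: "h x = 0 \<and> k x = 0" if "x0 < x" for x using that rx0 by (simp add: h_def k_def)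
  have th: "test_function L h k" unfolding test_function_def using wh h0 x0L by blast
  define A where "A = (LBINT x. (k x)\<^sup>2)"
  define H where "H = (\<integral>x. (h x)\<^sup>2 \<partial>\<upsilon>)"
  define Q where "Q = 2 * (LBINT x. q x * (h x * k x))"
  have pk: "p x * k x = (k x)\<^sup>2" for x by (simp add: k_def indicator_def power2_eq_square)
  have rh: "r x * h x = (h x)\<^sup>2" for x using h0[of x] by (cases "x \<le> x0") (auto simp: h_def power2_eq_square)
  have mid: "q x * (r x * k x + p x * h x) = 2 * (q x * (h x * k x))" for x
    using h0[of x] by (cases "x \<le> x0") (auto simp: h_def k_def)
  have "h 0 = 1" using rD(4) x0_pos by (simp add: h_def)
  then have eq: "- l * m_neg l + A = l\<^sup>2 * H + l * Q"
    using rD(7)[OF th] unfolding pk rh mid A_def H_def Q_def integral_mult_right_zero by simp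
  have le: "gram k l \<le> H + A / (k * l)" if k: "0 < k" "k < l" for k
  proof -
    have "k * m_neg k * (h 0)\<^sup>2 + k\<^sup>2 * H + k * Q \<le> A"
      using picone[OF k(1) conjunct1[OF R[OF k]] c _ wh] R[OF k] h0 x0 unfolding H_def Q_def A_def by force
    then have "k * (m_neg k + k * H + Q) \<le> A" using \<open>h 0 = 1\<close> by (simp add: power2_eq_square algebra_simps)
    then have 1: "m_neg k + k * H + Q \<le> A / k" using k by (simp add: pos_le_divide_eq mult.commute)
    have "l * (m_neg l + l * H + Q) = A" using eq by (simp add: power2_eq_square algebra_simps)
    then have 2: "m_neg l + l * H + Q = A / l" using l by (simp add: field_simps)
    have "(l - k) * gram k l = m_neg k - m_neg l" by (rule m_neg_diff[OF k(1) l, symmetric])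
    also have "\<dots> \<le> (l - k) * H + (A / k - A / l)" using 1 2 by (simp add: algebra_simps)
    also have "A / k - A / l = (l - k) * (A / (k * l))" using k l by (simp add: field_simps)
    finally have "(l - k) * gram k l \<le> (l - k) * (H + A / (k * l))" by (simp add: distrib_left)
    then show ?thesis using k by simp
  qed
  \<comment> \<open>The sequence approaches \<open>l\<close> from below, where positivity is
    assumed, and stays above \<open>l / 2\<close>, away from 0.\<close>
  define a where "a n = l - (l / 2) / real (Suc n)" for n
  have a: "l / 2 \<le> a n" "a n < l" for n using l by (auto simp: a_def field_simps)
  have alim: "a \<longlonglongrightarrow> l"
  proof -
    have "(\<lambda>n. l - (l / 2) / real (Suc n)) \<longlonglongrightarrow> l - 0"
      by (intro tendsto_intros) (use LIMSEQ_ignore_initial_segment[OF lim_const_over_n[of "l / 2"], of 1] in simp)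
    then show ?thesis by (simp add: a_def[abs_def])
  qed
  have "(\<lambda>n. gram (a n) l) \<longlonglongrightarrow> gram l l"
    by (rule gram_limit[of "l / 2"]) (use l a alim in auto)
  moreover have "(\<lambda>n. H + A / (a n * l)) \<longlonglongrightarrow> H + A / (l * l)" by (intro tendsto_intros alim) (use l in auto)
  ultimately have "gram l l \<le> H + A / (l * l)"
    by (rule LIMSEQ_le) (use le a l in \<open>auto intro!: exI[of _ 0] simp: less_le_trans[of 0 "l / 2"]\<close>)
  moreover have "gram l l = (\<integral>x. (r x)\<^sup>2 \<partial>\<upsilon>) + (LBINT x. (p x)\<^sup>2) / (l * l)"
    using real_gram[OF l l r r] by (simp add: power2_eq_square)
  moreover have "H \<le> (\<integral>x. (r x)\<^sup>2 \<partial>\<upsilon>)"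
    unfolding H_def
  proof (rule integral_mono)
    show "integrable \<upsilon> (\<lambda>x. (h x)\<^sup>2)" using test_function_square_integrable(2)[OF th \<upsilon>] by simp
    show "(h x)\<^sup>2 \<le> (r x)\<^sup>2" for x using h0[of x] by (cases "x \<le> x0") (auto simp: h_def)
  qed (rule rD(6))
  ultimately have "(LBINT x. (p x)\<^sup>2) / (l * l) \<le> A / (l * l)" by linarith
  then have pA: "(LBINT x. (p x)\<^sup>2) \<le> A" using l by (simp add: divide_le_cancel)
  have k2: "integrable lborel (\<lambda>x. (k x)\<^sup>2)" using test_function_square_integrable(1)[OF th] by simp
  \<comment> \<open>\<open>k\<close> is \<open>p\<close> cut off at \<open>x0\<close>, so the
    product of \<open>p\<close> and \<open>k\<close> is the square of \<open>k\<close> and the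
    energies subtract.\<close>
  have d: "(p x)\<^sup>2 - (k x)\<^sup>2 = (p x - k x)\<^sup>2" for x by (simp add: k_def indicator_def)
  have di: "integrable lborel (\<lambda>x. (p x - k x)\<^sup>2)"
    using integrable_diff[OF rD(5) k2] unfolding d .
  have pk2: "(LBINT x. (p x - k x)\<^sup>2) = (LBINT x. (p x)\<^sup>2) - A"
    unfolding d[symmetric] A_def by (rule integral_diff[OF rD(5) k2])
  have "(LBINT x. (p x - k x)\<^sup>2) = 0"
  proof -
    have "0 \<le> (LBINT x. (p x - k x)\<^sup>2)" by (intro integral_nonneg_AE) simp
    with pk2 pA show ?thesis by linarith
  qed
  then have "AE x in lborel. (p x - k x)\<^sup>2 = 0"
    using integral_nonneg_eq_0_iff_AE[OF di] by simp
  then have p0: "AE x in lborel. x0 < x \<longrightarrow> p x = 0" by eventually_elim (auto simp: k_def)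
  have r0: "r x = 0" if x: "x \<in> half_open L" "x0 \<le> x" for x
  proof -
    have "r x - r x0 = (LBINT t. indicator {x0<..x} t *\<^sub>R p t)"
      by (rule weak_derivative_diff[OF rD(1)]) (use x x0 in auto)
    also have "\<dots> = (\<integral>t. 0 \<partial>(lborel :: real measure))"
      by (rule integral_cong_AE; (measurable)?; use p0 in eventually_elim, simp add: indicator_def)
    finally show ?thesis using rx0 by simp
  qed
  obtain y where "y \<in> {0..<x0}" "r y = 0"
    using real_weyl_not_vanishing_beyond[OF l r x0L x0_pos r0 p0] by blast
  then show False using min[of y] x0 by auto
qed

text \<open>The infimum of the parameters for which positivity fails on \<open>{0..c}\<close> is
  examined. If it is 0, the small energy does not let a solution descend from 1 to 0 within length
  \<open>c\<close>. If it is positive and positivity fails there, the first zero is contradictory.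
  Otherwise the minimum over \<open>{0..c}\<close> is positive, and continuity in \<open>l\<close>
  keeps nearby solutions positive, so the infimum could not be approached.\<close>

lemma real_weyl_positive:
  assumes R: "\<And>l. 0 < l \<Longrightarrow> real_weyl l (R l) (P l)" and c: "c \<in> half_open L"
  shows "\<forall>l>0. \<forall>x\<in>{0..c}. R l x > 0"
proof (rule ccontr)
  assume neg: "\<not> ?thesis"
  define B where "B = {l. 0 < l \<and> (\<exists>x\<in>{0..c}. R l x \<le> 0)}"
  obtain l y where "0 < l" "y \<in> {0..c}" "R l y \<le> 0" using neg by (auto simp: not_less)
  then have "l \<in> B" unfolding B_def by blast
  then have "B \<noteq> {}" by blast
  have "bdd_below B" by (rule bdd_belowI[of _ 0]) (auto simp: B_def)
  with \<open>B \<noteq> {}\<close> have "Inf B \<in> closure B" by (rule closure_contains_Inf)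
  then obtain a where a: "\<And>n. a n \<in> B" "a \<longlonglongrightarrow> Inf B" unfolding closure_sequential by blast
  define l where "l = Inf B"
  have lB: "l \<le> k" if "k \<in> B" for k unfolding l_def by (rule cInf_lower[OF that \<open>bdd_below B\<close>])
  have l0: "0 \<le> l" unfolding l_def by (rule cInf_greatest[OF \<open>B \<noteq> {}\<close>]) (auto simp: B_def)
  have an: "0 < a n" "\<exists>x\<in>{0..c}. R (a n) x \<le> 0" for n using a(1)[of n] by (auto simp: B_def)
  then obtain x where x: "\<And>n. x n \<in> {0..c}" "\<And>n. R (a n) (x n) \<le> 0" by metis
  have c0: "0 \<le> c" by (rule half_open_nonneg[OF c])
  have xL: "x n \<in> half_open L" for n using half_open_downward[OF c] x(1)[of n] by auto
  show False
  proof (cases "l = 0")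
    case True
    have "1 \<le> c * ((a n)\<^sup>2 * gram (a n) (a n))" for n
    proof -
      note D = real_weylD[OF R[OF an(1)[of n]]]
      note [measurable] = D(2)
      have "1 \<le> (norm (R (a n) (x n) - R (a n) 0))\<^sup>2" using x(2)[of n] D(4) by (simp add: one_le_power abs_le_square_iff)
      also have "\<dots> \<le> (x n - 0) * (LBINT t. indicator {0<..x n} t * (norm (P (a n) t))\<^sup>2)"
        by (rule weak_derivative_diff_bound[OF D(1)]) (use x(1)[of n] xL in auto)
      also have "\<dots> \<le> c * ((a n)\<^sup>2 * gram (a n) (a n))"
      proof (rule mult_mono)
        have "(LBINT t. indicator {0<..x n} t * (norm (P (a n) t))\<^sup>2) \<le> (LBINT t. (P (a n) t)\<^sup>2)"
          by (rule integral_mono) (use D(5) integrable_mult_indicator[OF _ D(5), of "{0<..x n}"] in \<open>auto simp: indicator_def\<close>)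
        also have "\<dots> \<le> (a n)\<^sup>2 * gram (a n) (a n)" by (rule real_weyl_energy_le[OF an(1) R[OF an(1)]])
        finally show "(LBINT t. indicator {0<..x n} t * (norm (P (a n) t))\<^sup>2) \<le> (a n)\<^sup>2 * gram (a n) (a n)" .
      qed (use x(1)[of n] c0 in \<open>auto intro!: integral_nonneg_AE\<close>)
      finally show ?thesis .
    qed
    moreover have "(\<lambda>n. c * ((a n)\<^sup>2 * gram (a n) (a n))) \<longlonglongrightarrow> c * \<gamma>"
      by (intro tendsto_intros gram_scaled_tendsto an) (use a(2) True in \<open>simp add: l_def\<close>)
    ultimately have "1 \<le> c * \<gamma>" by (intro LIMSEQ_le_const) auto
    then show False using \<gamma>_L[OF c] by simp
  next
    case False
    then have l: "0 < l" using l0 by simp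
    note D = real_weylD[OF R[OF l]]
    have pos: "R k y > 0" if "0 < k" "k < l" "y \<in> {0..c}" for k y
      using lB[of k] that by (force simp: B_def)
    show False
    proof (cases "\<exists>y\<in>{0..c}. R l y \<le> 0")
      case True
      then obtain y where "y \<in> {0..c}" "R l y \<le> 0" by blast
      then show False
        by (rule real_weyl_first_zero_contradiction[OF l R[OF l] c, where R=R and P=P]) (use R pos in auto)
    next
      case False
      have cont: "continuous_on {0..c} (R l)"
        by (rule continuous_on_subset[OF weak_derivative_continuous_on[OF D(1)]]) (use half_open_downward[OF c] in auto)
      obtain y where y: "y \<in> {0..c}" "\<And>u. u \<in> {0..c} \<Longrightarrow> R l y \<le> R l u"
        using continuous_attains_inf[OF compact_Icc _ cont] c0 by auto
      define \<delta> where "\<delta> = R l y"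
      have \<delta>: "\<delta> > 0" using False y by (auto simp: \<delta>_def not_le)
      let ?e = "\<lambda>n. 2 * l\<^sup>2 * (gram l l + gram (a n) (a n) - 2 * gram l (a n)) + 2 * (l - a n)\<^sup>2 * gram (a n) (a n)"
      have "\<delta>\<^sup>2 \<le> c * ?e n" for n
      proof -
        have "\<delta> \<le> R l (x n) - R (a n) (x n)" using y(2)[OF x(1)[of n]] x(2)[of n] by (simp add: \<delta>_def)
        then have "\<delta>\<^sup>2 \<le> (R l (x n) - R (a n) (x n))\<^sup>2" using \<delta> by (intro power_mono) auto
        also have b: "\<dots> \<le> x n * ?e n" by (rule real_weyl_diff_bound[OF l an(1) R[OF l] R[OF an(1)] xL])
        also have "\<dots> \<le> c * ?e n"
        proof (rule mult_right_mono)
          have "0 < x n * ?e n" using \<open>\<delta>\<^sup>2 \<le> (R l (x n) - R (a n) (x n))\<^sup>2\<close> b \<delta> by (meson less_le_trans zero_less_power)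
          then show "0 \<le> ?e n" using x(1)[of n] by (auto simp: zero_less_mult_iff)
        qed (use x(1)[of n] in auto)
        finally show ?thesis .
      qed
      moreover have "(\<lambda>n. c * ?e n) \<longlonglongrightarrow> c * (2 * l\<^sup>2 * (gram l l + gram l l - 2 * gram l l) + 2 * (l - l)\<^sup>2 * gram l l)"
        by (intro tendsto_intros gram_limit[OF l]) (use a lB l_def in auto)
      ultimately have "\<delta>\<^sup>2 \<le> 0" by (intro LIMSEQ_le_const) auto
      then show False using \<delta> by simp
    qed
  qed
qed

section \<open>Consequences for the measure and the distribution\<close>

lemma test_function_inequalities:
  assumes h: "test_function L h k"
  shows "(\<integral>x. (h x)\<^sup>2 \<partial>\<upsilon>) = 0" "(LBINT x. q x * (h x * k x)) \<le> 0"
proof -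
  obtain R P where R: "\<And>l. 0 < l \<Longrightarrow> real_weyl l (R l) (P l)" using real_weyl_exists by metis
  have wh: "weak_derivative L h k" using h by (simp add: test_function_def)
  obtain c where c: "c \<in> half_open L" "\<And>x. x \<in> half_open L \<Longrightarrow> c < x \<Longrightarrow> h x = 0 \<and> k x = 0"
    using h unfolding test_function_def by blast
  let ?A = "\<integral>x. (k x)\<^sup>2 \<partial>lborel" and ?H = "\<integral>x. (h x)\<^sup>2 \<partial>\<upsilon>" and ?Q = "\<integral>x. q x * (h x * k x) \<partial>lborel"
  \<comment> \<open>Dropping the boundary term, which is non-negative, leaves a polynomial in
    \<open>l\<close> that stays below \<open>?A\<close> for all \<open>l > 0\<close>. Its leading
    coefficient is therefore at most 0, and once that vanishes the linear one is at most 0 as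
    well.\<close>
  have le: "l\<^sup>2 * ?H + 2 * l * ?Q \<le> ?A" if l: "l > 0" for l
  proof -
    have "0 \<le> l * m_neg l * (h 0)\<^sup>2" using m_neg_nonneg[OF l] l by simp
    then show ?thesis
      using picone[OF l R[OF l] c(1) _ wh c(2)] real_weyl_positive[of R P, OF R c(1)] l by force
  qed
  have H0: "0 \<le> ?H" by (intro integral_nonneg_AE) simp
  have lim: "(\<lambda>n. b / real (Suc n)) \<longlonglongrightarrow> 0" for b :: real
    using LIMSEQ_ignore_initial_segment[OF lim_const_over_n[of b], of 1] by simp
  have "?H \<le> ?A / real (Suc n) / real (Suc n) - 2 * ?Q / real (Suc n)" for n
  proof -
    let ?l = "real (Suc n)"
    have "?H * ?l * ?l \<le> ?A - 2 * ?Q * ?l" using le[of ?l] by (simp add: power2_eq_square mult_ac del: of_nat_Suc)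
    then have "?H * ?l \<le> (?A - 2 * ?Q * ?l) / ?l" by (subst pos_le_divide_eq) auto
    then have "?H \<le> (?A - 2 * ?Q * ?l) / ?l / ?l" by (subst pos_le_divide_eq) auto
    then show ?thesis by (simp add: diff_divide_distrib del: of_nat_Suc)
  qed
  moreover have "(\<lambda>n. ?A / real (Suc n) / real (Suc n) - 2 * ?Q / real (Suc n)) \<longlonglongrightarrow> 0 * 0 - 0"
    unfolding divide_inverse[of "?A / _"]
    by (intro tendsto_intros lim LIMSEQ_inverse_real_of_nat)
  ultimately have "?H \<le> 0 * 0 - 0" by (intro LIMSEQ_le_const) auto
  then show H: "?H = 0" using H0 by simp
  have "2 * ?Q \<le> ?A / real (Suc n)" for n
  proof -
    have "2 * ?Q * real (Suc n) \<le> ?A" using le[of "real (Suc n)"] H by (simp add: mult_ac del: of_nat_Suc)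
    then show ?thesis by (subst pos_le_divide_eq) auto
  qed
  then have "2 * ?Q \<le> 0" using lim[of ?A] by (intro LIMSEQ_le_const) auto
  then show "?Q \<le> 0" by simp
qed

lemma emeasure_\<upsilon>_eq_0:
  assumes "A \<in> sets \<upsilon>"
  shows "emeasure \<upsilon> A = 0"
proof -
  have "emeasure \<upsilon> {0..c} = 0" if c: "c \<in> half_open L" for c
  proof -
    obtain d where d: "c < d" "d \<in> half_open L" using half_open_extend[OF c] by blast
    \<comment> \<open>This ramp is 1 on \<open>{0..c}\<close>, so a vanishing integral of its square
      makes the interval a null set.\<close>
    let ?\<rho> = "\<lambda>x. (d - min (max x c) d) / (d - c)"
    have "test_function L ?\<rho> (\<lambda>x. - (indicator {c<..d} x * indicator (half_open L) x / (d - c)))" (is "test_function L ?\<rho> ?\<kappa>")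
      unfolding test_function_def
      by (intro conjI bexI[of _ d] weak_derivative_ramp half_open_nonneg[OF c]) (use d in auto)
    note t = this
    have i: "integrable \<upsilon> (\<lambda>x. (?\<rho> x)\<^sup>2)"
      using test_function_square_integrable(2)[OF t \<upsilon>] unfolding real_norm_def power2_abs .
    have "(\<integral>x. (?\<rho> x)\<^sup>2 \<partial>\<upsilon>) = 0" by (rule test_function_inequalities(1)[OF t])
    then have "AE x in \<upsilon>. (?\<rho> x)\<^sup>2 = 0" using integral_nonneg_eq_0_iff_AE[OF i] by simp
    then have "AE x in \<upsilon>. x \<notin> {0..c}" by eventually_elim (use d in auto)
    then have "emeasure \<upsilon> {x \<in> space \<upsilon>. x \<in> {0..c}} = 0" by (rule emeasure_eq_0_AE)
    moreover have "{x \<in> space \<upsilon>. x \<in> {0..c}} = {0..c}"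
      using sets.sets_into_space[OF borel_measure_on_Icc(1)[OF \<upsilon> c]] by blast
    ultimately show ?thesis by (simp only:)
  qed
  then have "AE x in \<upsilon>. x \<notin> {0..c}" if "c \<in> half_open L" for c
    using that borel_measure_on_Icc(1)[OF \<upsilon> that] by (intro AE_not_in) (auto simp: null_sets_def)
  then have "AE x in \<upsilon>. \<forall>c\<in>\<rat> \<inter> half_open L. x \<notin> {0..c}"
    by (subst AE_ball_countable) (blast intro: countable_subset[OF _ countable_rat])+
  moreover have "AE x in \<upsilon>. x \<in> half_open L" by (rule AE_I2) (simp add: borel_measure_on_space[OF \<upsilon>])
  ultimately have "AE x in \<upsilon>. x \<notin> A"
  proof eventually_elim
    fix x assume x: "\<forall>c\<in>\<rat> \<inter> half_open L. x \<notin> {0..c}" "x \<in> half_open L"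
    obtain c where "x < c" "c \<in> half_open L" "c \<in> \<rat>" using half_open_extend[OF x(2)] by blast
    then have "x \<in> {0..c}" "c \<in> \<rat> \<inter> half_open L" using half_open_nonneg[OF x(2)] by auto
    with x(1) show "x \<notin> A" by blast
  qed
  then show ?thesis
    using AE_iff_measurable[OF assms, of "\<lambda>x. x \<notin> A"] sets.sets_into_space[OF assms] by auto
qed

end

section \<open>Monotone anti-derivatives\<close>

lemma local_L2_weak_derivative:
  assumes "local_L2 L q" "0 < L"
  shows "weak_derivative L (\<lambda>x. LBINT t. indicator {0..x} t *\<^sub>R q t) q"
  unfolding weak_derivative_def
proof (intro conjI ballI allI impI)
  have 0: "(LBINT t. indicator {0..0} t *\<^sub>R q t) = (\<integral>t. 0 \<partial>(lborel :: real measure))"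
    by (rule integral_cong_AE) (use assms AE_lborel_singleton[of "0::real"] in \<open>auto simp: local_L2_def elim!: eventually_mono\<close>)
  show "(LBINT t. indicator {0..x} t *\<^sub>R q t) =
      (LBINT t. indicator {0..0} t *\<^sub>R q t) + (LBINT t. indicator {0..x} t *\<^sub>R q t)" for x
    unfolding 0 by simp
qed (use assms in \<open>auto simp: local_L2_def\<close>)

text \<open>Since \<open>h x * k x\<close> is half the derivative of the square of \<open>h\<close>,
  the assumption \<open>form\<close> says that the distribution is non-negative on squares of real
  test functions.\<close>

locale nonincreasing_form =
  fixes L :: ereal and q :: "real \<Rightarrow> real"
  assumes L: "0 < L" and q: "local_L2 L q"
    and form: "test_function L h k \<Longrightarrow> (LBINT x. q x * (h x * k x)) \<le> 0"
begin

definition Q :: "real \<Rightarrow> real" where "Q x = (LBINT t. indicator {0..x} t *\<^sub>R q t)"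

text \<open>Points where \<open>q\<close> is the derivative of its own primitive. As an
  anti-derivative \<open>q\<close> matters only up to null sets, but its values on \<open>S\<close>
  are limits of averages, so pointwise monotonicity can be stated there.\<close>

definition S :: "real set" where
  "S = {x \<in> half_open L. 0 < x \<and> (Q has_vector_derivative q x) (at x)}"

lemma wQ: "weak_derivative L Q q"
  unfolding Q_def by (rule local_L2_weak_derivative[OF q L])

lemma qm [measurable]: "q \<in> borel_measurable borel"
  using q by (auto simp: local_L2_def)

lemma AE_S: "AE x in lborel. x \<in> half_open L \<longrightarrow> x \<in> S"
  using weak_derivative_AE[OF wQ] by eventually_elim (auto simp: S_def)

lemma S_above:
  assumes "c \<in> half_open L"
  obtains y where "c < y" "y \<in> S"
proof -
  obtain d where d: "c < d" "d \<in> half_open L" using half_open_extend[OF assms] by blast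
  have "\<exists>y\<in>{c<..<d}. y \<in> S"
  proof (rule ccontr)
    assume "\<not> ?thesis"
    with AE_S have "AE x in lborel. x \<notin> {c<..<d}"
      using half_open_downward[OF d(2)] half_open_nonneg[OF assms] by (auto elim!: eventually_mono)
    then have "emeasure lborel {x \<in> space lborel. x \<in> {c<..<d}} = 0" by (rule emeasure_eq_0_AE)
    moreover have "{x \<in> space lborel. x \<in> {c<..<d}} = {c<..<d}" by auto
    ultimately have "emeasure lborel {c<..<d} = 0" by (simp only:)
    then show False using d by simp
  qed
  then show ?thesis using that by auto
qed

text \<open>The average of \<open>q\<close> that a linear ramp of width \<open>e\<close> produces,
  up to a factor of order \<open>1 / e^2\<close>.\<close>

definition J :: "real \<Rightarrow> real \<Rightarrow> real" where
  "J a e = (LBINT x. indicator {a<..a + e} x *\<^sub>R (q x * (x - a)))"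

text \<open>Integration by parts turns \<open>J a e\<close> into the integral of
  \<open>Q (a + e) - Q x\<close>. Differentiability of \<open>Q\<close> at \<open>a\<close> alone
  then gives \<open>q a * e^2 / 2\<close> up to o(e^2), although \<open>q\<close> need not be
  continuous.\<close>

lemma J_tendsto:
  assumes a: "a \<in> S" and e: "\<And>n. 0 < e n" "e \<longlonglongrightarrow> 0" "\<And>n. a + e n \<in> half_open L"
  shows "(\<lambda>n. 2 * J a (e n) / (e n)\<^sup>2) \<longlonglongrightarrow> q a" "(\<lambda>n. (Q (a + e n) - Q a) / e n) \<longlonglongrightarrow> q a"
proof -
  have aL: "a \<in> half_open L" "0 \<le> a" and D: "(Q has_vector_derivative q a) (at a)" using a by (auto simp: S_def)
  have near: "\<exists>d>0. \<forall>s. 0 \<le> s \<and> s < d \<longrightarrow> \<bar>Q (a + s) - Q a - s * q a\<bar> \<le> \<epsilon> * s" if "\<epsilon> > 0" for \<epsilon>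
  proof -
    have "\<forall>e>0. \<exists>d>0. \<forall>y. norm (y - a) < d \<longrightarrow> norm (Q y - Q a - (y - a) *\<^sub>R q a) \<le> e * norm (y - a)"
      using D unfolding has_vector_derivative_def has_derivative_at_alt by (elim conjE)
    from this[rule_format, OF that]
    obtain d where d: "d > 0" "\<forall>y. norm (y - a) < d \<longrightarrow> norm (Q y - Q a - (y - a) *\<^sub>R q a) \<le> \<epsilon> * norm (y - a)"
      by (elim exE conjE)
    show ?thesis
    proof (intro exI[of _ d] conjI allI impI d(1))
      fix s assume "0 \<le> s \<and> s < d"
      then show "\<bar>Q (a + s) - Q a - s * q a\<bar> \<le> \<epsilon> * s" using d(2)[rule_format, of "a + s"] by simp
    qed
  qed
  have J_eq: "J a (e n) = (LBINT x. indicator {a<..a + e n} x *\<^sub>R (Q (a + e n) - Q x))"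
    and Qi: "integrable lborel (\<lambda>x. indicator {a<..a + e n} x *\<^sub>R (Q (a + e n) - Q x))" for n
  proof -
    have sub: "{a<..a + e n} \<subseteq> {0..a + e n}" using aL by auto
    have wid: "weak_derivative L (\<lambda>x. x - a) (\<lambda>x. indicator (half_open L) x - 0)"
      by (rule weak_derivative_sub[OF weak_derivative_ident weak_derivative_const])
    have diff: "Q (a + e n) * e n = (LBINT x. indicator {a<..a + e n} x *\<^sub>R (Q x * (indicator (half_open L) x - 0) + q x * (x - a)))"
      using weak_derivative_diff[OF weak_derivative_mult[OF wQ wid] aL(2) _ e(3)[of n]] e(1)[of n] by simp
    have cQ: "continuous_on {a..a + e n} Q"
      by (rule continuous_on_subset[OF weak_derivative_continuous_on[OF wQ]]) (use half_open_downward[OF e(3)[of n]] aL in auto)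
    have i1: "integrable lborel (\<lambda>x. indicator {a<..a + e n} x *\<^sub>R Q x)"
    proof -
      have "integrable lborel (\<lambda>x. indicator {a..a + e n} x *\<^sub>R Q x)" by (rule borel_integrable_compact[OF _ cQ]) simp
      then have "integrable lborel (\<lambda>x. indicator {a<..a + e n} x *\<^sub>R indicator {a..a + e n} x *\<^sub>R Q x)"
        by (rule integrable_mult_indicator[rotated]) simp
      moreover have "indicator {a<..a + e n} x *\<^sub>R indicator {a..a + e n} x *\<^sub>R Q x = indicator {a<..a + e n} x *\<^sub>R Q x" for x
        by (auto simp: indicator_def)
      ultimately show ?thesis by (simp only:)
    qed
    have i2: "integrable lborel (\<lambda>x. indicator {a<..a + e n} x *\<^sub>R Q (a + e n))"
      using e(1)[of n] by (simp add: integrable_indicator_iff)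
    have "integrable lborel (\<lambda>x. indicator {a<..a + e n} x *\<^sub>R (Q x * (indicator (half_open L) x - 0) + q x * (x - a)))"
      by (rule weak_derivative_integrable_sub[OF weak_derivative_mult[OF wQ wid] e(3) sub]) simp
    moreover have eqx: "indicator {a<..a + e n} x *\<^sub>R (Q x * (indicator (half_open L) x - 0) + q x * (x - a)) =
        indicator {a<..a + e n} x *\<^sub>R Q x + indicator {a<..a + e n} x *\<^sub>R (q x * (x - a))" for x
      using half_open_downward[OF e(3)[of n], of x] aL by (cases "x \<in> {a<..a + e n}") auto
    ultimately have "integrable lborel (\<lambda>x. indicator {a<..a + e n} x *\<^sub>R Q x + indicator {a<..a + e n} x *\<^sub>R (q x * (x - a)))"
      by (simp only:)
    from integrable_diff[OF this i1]
    have i3: "integrable lborel (\<lambda>x. indicator {a<..a + e n} x *\<^sub>R (q x * (x - a)))" by simp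
    have "Q (a + e n) * e n = (LBINT x. indicator {a<..a + e n} x *\<^sub>R Q x) + J a (e n)"
      unfolding diff eqx J_def by (rule integral_add[OF i1 i3])
    moreover have "(LBINT x. indicator {a<..a + e n} x *\<^sub>R Q (a + e n)) = Q (a + e n) * e n"
      using e(1)[of n] by simp
    ultimately show "J a (e n) = (LBINT x. indicator {a<..a + e n} x *\<^sub>R (Q (a + e n) - Q x))"
      unfolding scaleR_diff_right integral_diff[OF i2 i1] by simp
    show "integrable lborel (\<lambda>x. indicator {a<..a + e n} x *\<^sub>R (Q (a + e n) - Q x))"
      unfolding scaleR_diff_right by (rule integrable_diff[OF i2 i1])
  qed
  show "(\<lambda>n. 2 * J a (e n) / (e n)\<^sup>2) \<longlonglongrightarrow> q a"
  proof (rule LIMSEQ_I)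
    fix r :: real assume r: "r > 0"
    \<comment> \<open>The final estimate is \<open>4 * \<epsilon>\<close>, which is
      \<open>r / 2\<close>.\<close>
    define \<epsilon> where "\<epsilon> = r / 8"
    obtain d where d: "d > 0" "\<forall>s. 0 \<le> s \<and> s < d \<longrightarrow> \<bar>Q (a + s) - Q a - s * q a\<bar> \<le> \<epsilon> * s"
      using near[of \<epsilon>] r by (auto simp: \<epsilon>_def)
    obtain N where N: "\<And>n. n \<ge> N \<Longrightarrow> e n < d"
      using order_tendstoD(2)[OF e(2) d(1)] by (auto simp: eventually_sequentially)
    have "norm (2 * J a (e n) / (e n)\<^sup>2 - q a) < r" if n: "n \<ge> N" for n
    proof -
      let ?e = "e n" and ?I = "\<lambda>x. indicator {a<..a + e n} x :: real"
      have lin: "(LBINT x. ?I x *\<^sub>R (q a * (a + ?e - x))) = q a * (?e\<^sup>2 / 2)"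
        and lini: "integrable lborel (\<lambda>x. ?I x *\<^sub>R (q a * (a + ?e - x)))"
      proof -
        have "((\<lambda>x. - (a + ?e - x)\<^sup>2 / 2) has_vector_derivative (a + ?e - x)) (at x within {a..a + ?e})" for x
          unfolding has_real_derivative_iff_has_vector_derivative[symmetric]
          by (auto intro!: derivative_eq_intros simp: field_simps)
        from fundamental_theorem_of_calculus[OF _ this]
        have hi: "((\<lambda>x. a + ?e - x) has_integral (?e\<^sup>2 / 2)) {a..a + ?e}" using e(1)[of n] by simp
        have si: "set_integrable lborel {a..a + ?e} (\<lambda>x. a + ?e - x)"
          unfolding set_integrable_def by (rule borel_integrable_compact) (auto intro!: continuous_intros)
        have "(LBINT x. indicator {a..a + ?e} x *\<^sub>R (a + ?e - x)) = ?e\<^sup>2 / 2"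
          using set_borel_integral_eq_integral(2)[OF si] integral_unique[OF hi] by (simp add: set_lebesgue_integral_def)
        moreover have "(LBINT x. indicator {a..a + ?e} x *\<^sub>R (a + ?e - x)) = (LBINT x. ?I x *\<^sub>R (a + ?e - x))"
          by (rule integral_cong_AE; (measurable)?; use AE_lborel_singleton[of a] in eventually_elim, simp add: indicator_def)
        moreover have "(\<lambda>x. ?I x *\<^sub>R (q a * (a + ?e - x))) = (\<lambda>x. q a * (?I x *\<^sub>R (a + ?e - x)))" by (simp add: fun_eq_iff)
        ultimately show "(LBINT x. ?I x *\<^sub>R (q a * (a + ?e - x))) = q a * (?e\<^sup>2 / 2)" by simp
        have "integrable lborel (\<lambda>x. ?I x *\<^sub>R indicator {a..a + ?e} x *\<^sub>R (q a * (a + ?e - x)))"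
          by (rule integrable_mult_indicator[rotated], rule borel_integrable_compact) (auto intro!: continuous_intros)
        moreover have "?I x *\<^sub>R indicator {a..a + ?e} x *\<^sub>R (q a * (a + ?e - x)) = ?I x *\<^sub>R (q a * (a + ?e - x))" for x
          by (auto simp: indicator_def)
        ultimately show "integrable lborel (\<lambda>x. ?I x *\<^sub>R (q a * (a + ?e - x)))" by (simp only:)
      qed
      have "norm (J a ?e - q a * (?e\<^sup>2 / 2)) =
          norm (LBINT x. ?I x *\<^sub>R (Q (a + ?e) - Q x) - ?I x *\<^sub>R (q a * (a + ?e - x)))"
        unfolding J_eq lin[symmetric] using integral_diff[OF Qi lini] by simp
      also have "\<dots> \<le> (LBINT x. ?I x *\<^sub>R (2 * \<epsilon> * ?e))"
      proof (rule integral_norm_bound_integral)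
        show "integrable lborel (\<lambda>x. ?I x *\<^sub>R (Q (a + ?e) - Q x) - ?I x *\<^sub>R (q a * (a + ?e - x)))"
          by (rule integrable_diff[OF Qi lini])
        fix x
        show "norm (?I x *\<^sub>R (Q (a + ?e) - Q x) - ?I x *\<^sub>R (q a * (a + ?e - x))) \<le> ?I x *\<^sub>R (2 * \<epsilon> * ?e)"
        proof (cases "x \<in> {a<..a + ?e}")
          case True
          have "\<bar>Q (a + ?e) - Q a - ?e * q a\<bar> \<le> \<epsilon> * ?e" using d(2) N[OF n] e(1)[of n] by auto
          moreover have "\<bar>Q (a + (x - a)) - Q a - (x - a) * q a\<bar> \<le> \<epsilon> * (x - a)"
            using d(2)[rule_format, of "x - a"] N[OF n] True by auto
          moreover have "\<epsilon> * (x - a) \<le> \<epsilon> * ?e" using True r by (intro mult_left_mono) (auto simp: \<epsilon>_def)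
          moreover have "Q (a + ?e) - Q x - q a * (a + ?e - x) =
              (Q (a + ?e) - Q a - ?e * q a) - (Q (a + (x - a)) - Q a - (x - a) * q a)" by (simp add: algebra_simps)
          moreover note abs_triangle_ineq4[of "Q (a + ?e) - Q a - ?e * q a" "Q (a + (x - a)) - Q a - (x - a) * q a"]
          ultimately have "\<bar>Q (a + ?e) - Q x - q a * (a + ?e - x)\<bar> \<le> 2 * \<epsilon> * ?e" by linarith
          then show ?thesis using True by simp
        qed simp
      qed (use e(1)[of n] in \<open>simp add: integrable_indicator_iff\<close>)
      also have "\<dots> = 2 * \<epsilon> * ?e\<^sup>2" using e(1)[of n] by (simp add: power2_eq_square)
      finally have b: "norm (J a ?e - q a * (?e\<^sup>2 / 2)) \<le> 2 * \<epsilon> * ?e\<^sup>2" .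
      have "2 * J a ?e / ?e\<^sup>2 - q a = (J a ?e - q a * (?e\<^sup>2 / 2)) * (2 / ?e\<^sup>2)" using e(1)[of n] by (simp add: field_simps)
      moreover have "norm (2 / ?e\<^sup>2) = 2 / ?e\<^sup>2" by simp
      ultimately have "norm (2 * J a ?e / ?e\<^sup>2 - q a) = norm (J a ?e - q a * (?e\<^sup>2 / 2)) * (2 / ?e\<^sup>2)"
        by (simp only: norm_mult)
      also have "\<dots> \<le> (2 * \<epsilon> * ?e\<^sup>2) * (2 / ?e\<^sup>2)" by (rule mult_right_mono[OF b]) simp
      also have "\<dots> = 4 * \<epsilon>" using e(1)[of n] by simp
      also have "\<dots> < r" using r by (simp add: \<epsilon>_def)
      finally show ?thesis .
    qed
    then show "\<exists>N. \<forall>n\<ge>N. norm (2 * J a (e n) / (e n)\<^sup>2 - q a) < r" by blast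
  qed
  show "(\<lambda>n. (Q (a + e n) - Q a) / e n) \<longlonglongrightarrow> q a"
  proof (rule LIMSEQ_I)
    fix r :: real assume r: "r > 0"
    obtain d where d: "d > 0" "\<forall>s. 0 \<le> s \<and> s < d \<longrightarrow> \<bar>Q (a + s) - Q a - s * q a\<bar> \<le> r / 2 * s"
      using near[of "r / 2"] r by auto
    obtain N where N: "\<And>n. n \<ge> N \<Longrightarrow> e n < d"
      using order_tendstoD(2)[OF e(2) d(1)] by (auto simp: eventually_sequentially)
    have "norm ((Q (a + e n) - Q a) / e n - q a) < r" if n: "n \<ge> N" for n
    proof -
      have "(Q (a + e n) - Q a) / e n - q a = (Q (a + e n) - Q a - e n * q a) / e n" using e(1)[of n] by (simp add: field_simps)
      then have "norm ((Q (a + e n) - Q a) / e n - q a) = \<bar>Q (a + e n) - Q a - e n * q a\<bar> / e n" using e(1)[of n] by simp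
      also have "\<dots> \<le> (r / 2 * e n) / e n" using d(2) N[OF n] e(1)[of n] by (intro divide_right_mono) auto
      also have "\<dots> < r" using r e(1)[of n] by simp
      finally show ?thesis .
    qed
    then show "\<exists>N. \<forall>n\<ge>N. norm ((Q (a + e n) - Q a) / e n - q a) < r" by blast
  qed
qed

lemma ramp_test_function:
  assumes "0 \<le> c" "0 < e" "c + e \<in> half_open L"
  shows "test_function L (\<lambda>x. (c + e - min (max x c) (c + e)) / e) (\<lambda>x. - (indicator {c<..c + e} x * indicator (half_open L) x / e))"
  unfolding test_function_def
  using weak_derivative_ramp[of c "c + e" L] assms by (intro conjI bexI[of _ "c + e"]) auto

lemma integrable_J: "a + e \<in> half_open L \<Longrightarrow> 0 \<le> a \<Longrightarrow> integrable lborel (\<lambda>x. indicator {a<..a + e} x *\<^sub>R (q x * (x - a)))"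
  and integrable_q: "a + e \<in> half_open L \<Longrightarrow> 0 \<le> a \<Longrightarrow> integrable lborel (\<lambda>x. indicator {a<..a + e} x *\<^sub>R q x)"
proof -
  assume a: "a + e \<in> half_open L" "0 \<le> a"
  show i: "integrable lborel (\<lambda>x. indicator {a<..a + e} x *\<^sub>R q x)"
    by (rule weak_derivative_integrable_sub[OF wQ a(1)]) (use a in auto)
  show "integrable lborel (\<lambda>x. indicator {a<..a + e} x *\<^sub>R (q x * (x - a)))"
  proof (rule integrable_bound)
    show "integrable lborel (\<lambda>x. \<bar>e\<bar> * norm (indicator {a<..a + e} x *\<^sub>R q x))"
      by (rule integrable_mult_right[OF integrable_norm[OF i]])
    show "AE x in lborel. norm (indicator {a<..a + e} x *\<^sub>R (q x * (x - a))) \<le> norm (\<bar>e\<bar> * norm (indicator {a<..a + e} x *\<^sub>R q x))"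
    proof (rule AE_I2)
      fix x show "norm (indicator {a<..a + e} x *\<^sub>R (q x * (x - a))) \<le> norm (\<bar>e\<bar> * norm (indicator {a<..a + e} x *\<^sub>R q x))"
      proof (cases "x \<in> {a<..a + e}")
        case True
        then have "\<bar>x - a\<bar> * \<bar>q x\<bar> \<le> \<bar>e\<bar> * \<bar>q x\<bar>" by (intro mult_right_mono) auto
        with True show ?thesis by (simp add: abs_mult mult.commute)
      qed simp
    qed
  qed measurable
qed

lemma descending_ramp:
  assumes b: "0 \<le> b" "0 < e" "b + e \<in> half_open L"
  shows "(LBINT x. indicator {b<..b + e} x *\<^sub>R (q x * (e - (x - b)))) = e * (Q (b + e) - Q b) - J b e"
proof -
  have "Q (b + e) - Q b = (LBINT x. indicator {b<..b + e} x *\<^sub>R q x)"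
    by (rule weak_derivative_diff[OF wQ]) (use b in auto)
  moreover have "indicator {b<..b + e} x *\<^sub>R (q x * (e - (x - b))) =
      e * (indicator {b<..b + e} x *\<^sub>R q x) - indicator {b<..b + e} x *\<^sub>R (q x * (x - b))" for x
    by (simp add: algebra_simps)
  ultimately show ?thesis
    unfolding J_def using integrable_J[OF b(3,1)] integrable_q[OF b(3,1)] by simp
qed

text \<open>The test function is 1 up to \<open>b\<close> and falls linearly to 0 on
  \<open>(b, b + e]\<close>. The form then sees only a weighted average of \<open>q\<close> next to
  \<open>b\<close>, with a negative sign.\<close>

lemma q_nonneg_step:
  assumes b: "0 \<le> b" "0 < e" "b + e \<in> half_open L"
  shows "0 \<le> e * (Q (b + e) - Q b) - J b e"
proof -
  have "(LBINT x. q x * ((b + e - min (max x b) (b + e)) / e * - (indicator {b<..b + e} x * indicator (half_open L) x / e))) \<le> 0"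
    by (rule form[OF ramp_test_function[OF b]])
  also have "(\<lambda>x. q x * ((b + e - min (max x b) (b + e)) / e * - (indicator {b<..b + e} x * indicator (half_open L) x / e))) =
      (\<lambda>x. - (1 / e\<^sup>2) * (indicator {b<..b + e} x *\<^sub>R (q x * (e - (x - b)))))"
    using half_open_downward[OF b(3)] b(1) by (auto simp: fun_eq_iff indicator_def power2_eq_square field_simps)
  finally have "- (1 / e\<^sup>2) * (e * (Q (b + e) - Q b) - J b e) \<le> 0"
    unfolding integral_mult_right_zero descending_ramp[OF b] .
  moreover have "- (1 / e\<^sup>2) < 0" using b(2) by simp
  ultimately show ?thesis by (simp only: mult_le_0_iff) linarith
qed

text \<open>The trapezoid that rises on \<open>(a, a + e]\<close> and falls on
  \<open>(b, b + e]\<close> is a difference of two ramps; \<open>a + e \<le> b\<close> keeps its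
  slopes apart. The form compares weighted averages of \<open>q\<close> next to \<open>a\<close> and
  next to \<open>b\<close>.\<close>

lemma q_mono_step:
  assumes a: "0 \<le> a" "0 < e" "a + e \<le> b" "b + e \<in> half_open L"
  shows "J a e \<le> e * (Q (b + e) - Q b) - J b e"
proof -
  have b: "0 \<le> b" and aL: "a + e \<in> half_open L" using a half_open_downward[OF a(4), of "a + e"] by auto
  let ?ra = "\<lambda>x. (a + e - min (max x a) (a + e)) / e" and ?ka = "\<lambda>x. - (indicator {a<..a + e} x * indicator (half_open L) x / e)"
  let ?rb = "\<lambda>x. (b + e - min (max x b) (b + e)) / e" and ?kb = "\<lambda>x. - (indicator {b<..b + e} x * indicator (half_open L) x / e)"
  have "test_function L (\<lambda>x. ?rb x - ?ra x) (\<lambda>x. ?kb x - ?ka x)"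
    unfolding test_function_def
    using weak_derivative_sub[OF test_function_imp_weak_derivative[OF ramp_test_function[OF b a(2,4)]]
        test_function_imp_weak_derivative[OF ramp_test_function[OF a(1,2) aL]]] a
    by (intro conjI bexI[of _ "b + e"]) auto
  then have "(LBINT x. q x * ((?rb x - ?ra x) * (?kb x - ?ka x))) \<le> 0" by (rule form)
  also have "(\<lambda>x. q x * ((?rb x - ?ra x) * (?kb x - ?ka x))) =
      (\<lambda>x. (1 / e\<^sup>2) * (indicator {a<..a + e} x *\<^sub>R (q x * (x - a)) - indicator {b<..b + e} x *\<^sub>R (q x * (e - (x - b)))))"
  proof
    fix x
    consider "x \<le> a" | "a < x" "x \<le> a + e" | "a + e < x" "x \<le> b" | "b < x" "x \<le> b + e" | "b + e < x" by linarith
    then show "q x * ((?rb x - ?ra x) * (?kb x - ?ka x)) =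
      (1 / e\<^sup>2) * (indicator {a<..a + e} x *\<^sub>R (q x * (x - a)) - indicator {b<..b + e} x *\<^sub>R (q x * (e - (x - b))))"
    proof cases
      case 2
      moreover from this have "x \<in> half_open L" using half_open_downward[OF aL, of x] a by auto
      moreover have "q x * (1 - (a + e - x) / e) / e = q x * (x - a) / (e * e)" using a(2) by (simp add: field_simps)
      ultimately show ?thesis using a by (simp add: power2_eq_square)
    next
      case 4
      moreover from this have "x \<in> half_open L" using half_open_downward[OF a(4), of x] b by auto
      moreover have "q x * ((b + e - x) / e * - (1 / e)) = (1 / e\<^sup>2) * (- (q x * (e - (x - b))))"
        using a(2) by (simp add: power2_eq_square field_simps)
      ultimately show ?thesis using a by simp
    qed (use a in auto)
  qed
  also have "(LBINT x. (1 / e\<^sup>2) * (indicator {a<..a + e} x *\<^sub>R (q x * (x - a)) - indicator {b<..b + e} x *\<^sub>R (q x * (e - (x - b))))) =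
      (1 / e\<^sup>2) * (J a e - (e * (Q (b + e) - Q b) - J b e))"
  proof -
    have "integrable lborel (\<lambda>x. e * (indicator {b<..b + e} x *\<^sub>R q x) - indicator {b<..b + e} x *\<^sub>R (q x * (x - b)))"
      by (intro integrable_diff integrable_mult_right integrable_J integrable_q b a(4))
    then have "integrable lborel (\<lambda>x. indicator {b<..b + e} x *\<^sub>R (q x * (e - (x - b))))" by (simp add: algebra_simps)
    from integral_diff[OF integrable_J[OF aL a(1)] this]
    show ?thesis unfolding integral_mult_right_zero descending_ramp[OF b a(2,4)] J_def[symmetric] by simp
  qed
  finally show ?thesis using a(2) by (simp add: mult_le_0_iff divide_le_0_iff)
qed

lemma q_mono_nonneg:
  assumes b: "b \<in> S"
  shows "0 \<le> q b" "a \<in> S \<Longrightarrow> a < b \<Longrightarrow> q a \<le> q b"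
proof -
  have bL: "b \<in> half_open L" "0 < b" using b by (auto simp: S_def)
  obtain d where d: "b < d" "d \<in> half_open L" using half_open_extend[OF bL(1)] by blast
  have lim0: "(\<lambda>n. C / real (Suc n)) \<longlonglongrightarrow> 0" for C :: real
    using LIMSEQ_ignore_initial_segment[OF lim_const_over_n[of C], of 1] by simp
  have limb: "(\<lambda>n. 2 * (e n * (Q (b + e n) - Q b) - J b (e n)) / (e n)\<^sup>2) \<longlonglongrightarrow> q b"
    if e: "\<And>n. 0 < e n" "e \<longlonglongrightarrow> 0" "\<And>n. b + e n \<in> half_open L" for e
  proof -
    have "(\<lambda>n. 2 * ((Q (b + e n) - Q b) / e n) - 2 * J b (e n) / (e n)\<^sup>2) \<longlonglongrightarrow> 2 * q b - q b"
      by (intro tendsto_intros J_tendsto[OF b e])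
    moreover have "2 * ((Q (b + e n) - Q b) / e n) - 2 * J b (e n) / (e n)\<^sup>2 =
        2 * (e n * (Q (b + e n) - Q b) - J b (e n)) / (e n)\<^sup>2" for n
      using e(1)[of n] by (simp add: field_simps power2_eq_square)
    ultimately show ?thesis by simp
  qed
  have inL: "b + C / real (Suc n) \<in> half_open L" if "0 < C" "C \<le> d - b" for C n
  proof (rule half_open_downward[OF d(2)])
    have "C / real (Suc n) \<le> C / 1" using that by (intro divide_left_mono) auto
    then show "b + C / real (Suc n) \<le> d" using that by simp
  qed (use that bL in simp)
  show "0 \<le> q b"
  proof (rule LIMSEQ_le_const[OF limb[of "\<lambda>n. (d - b) / real (Suc n)"]])
    show "\<exists>N. \<forall>n\<ge>N. 0 \<le> 2 * ((d - b) / real (Suc n) * (Q (b + (d - b) / real (Suc n)) - Q b) - J b ((d - b) / real (Suc n))) /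
        ((d - b) / real (Suc n))\<^sup>2"
      using q_nonneg_step[OF less_imp_le[OF bL(2)] _ inL] d
      by (intro exI[of _ 0] allI impI divide_nonneg_nonneg mult_nonneg_nonneg) auto
  qed (use d inL lim0 in auto)
  assume a: "a \<in> S" "a < b"
  \<comment> \<open>Steps of at most \<open>b - a\<close> keep the two slopes disjoint; steps of at
    most \<open>d - b\<close> keep the trapezoid inside \<open>[0, L)\<close>.\<close>
  define C where "C = min (d - b) (b - a)"
  have C: "0 < C" "C \<le> d - b" "C \<le> b - a" using d a by (auto simp: C_def)
  define e where "e n = C / real (Suc n)" for n
  have e: "0 < e n" "e n \<le> C" for n using C by (auto simp: e_def divide_le_eq mult_le_cancel_left1)
  have bi: "b + e n \<in> half_open L" for n unfolding e_def by (rule inL[OF C(1,2)])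
  have aL: "0 \<le> a" using a by (auto simp: S_def)
  have ai: "a + e n \<in> half_open L" for n
    by (rule half_open_downward[OF bi[of n]]) (use aL a e(1)[of n] in auto)
  have el: "e \<longlonglongrightarrow> 0" unfolding e_def by (rule lim0)
  show "q a \<le> q b"
  proof (rule LIMSEQ_le[OF J_tendsto(1)[OF a(1) e(1) el ai] limb[OF e(1) el bi]])
    have "2 * J a (e n) / (e n)\<^sup>2 \<le> 2 * (e n * (Q (b + e n) - Q b) - J b (e n)) / (e n)\<^sup>2" for n
      using q_mono_step[OF aL e(1)[of n] _ bi[of n]] e(2)[of n] C(3) by (intro divide_right_mono) auto
    then show "\<exists>N. \<forall>n\<ge>N. 2 * J a (e n) / (e n)\<^sup>2 \<le> 2 * (e n * (Q (b + e n) - Q b) - J b (e n)) / (e n)\<^sup>2" by blast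
  qed
qed

section \<open>The Stieltjes measure of the anti-derivative\<close>

definition T :: "real set" where "T = {t. 0 \<le> t \<and> (\<exists>x\<in>S. t < q x)}"

text \<open>The generalized inverse of \<open>q\<close> on \<open>S\<close>. The measure will be the
  image of Lebesgue measure on the levels \<open>T\<close> under \<open>G\<close>, so that no
  one-sided continuous version of \<open>q\<close> has to be built. Levels below every value of
  \<open>q\<close> on \<open>S\<close> go to 0 and contribute to the mass at 0.\<close>

definition G :: "real \<Rightarrow> real" where "G t = Inf {x \<in> S. t < q x}"

lemma S_nonneg: "x \<in> S \<Longrightarrow> 0 \<le> x" "x \<in> S \<Longrightarrow> x \<in> half_open L"
  by (auto simp: S_def)

lemma G_less: "t \<in> T \<Longrightarrow> G t < y \<longleftrightarrow> (\<exists>x\<in>S. x < y \<and> t < q x)"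
  unfolding G_def by (subst cInf_less_iff) (auto simp: T_def S_nonneg intro!: bdd_belowI[of _ 0])

lemma G_half_open:
  assumes "t \<in> T"
  shows "G t \<in> half_open L"
proof -
  obtain x where x: "x \<in> S" "t < q x" using assms by (auto simp: T_def)
  show ?thesis
  proof (rule half_open_downward[OF S_nonneg(2)[OF x(1)]])
    show "0 \<le> G t" unfolding G_def by (rule cInf_greatest) (use x S_nonneg in auto)
    show "G t \<le> x" unfolding G_def by (rule cInf_lower) (use x S_nonneg in \<open>auto intro!: bdd_belowI[of _ 0]\<close>)
  qed
qed

lemma T_sets [measurable]: "T \<in> sets borel"
proof -
  have "T = {0..} \<inter> (\<Union>x\<in>S. {..<q x})" by (auto simp: T_def)
  also have "\<dots> \<in> sets borel" by (rule sets.Int, simp, rule borel_open, auto)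
  finally show ?thesis .
qed

lemma G_measurable: "G \<in> measurable (restrict_space lborel T) (restrict_space borel (half_open L))"
proof (rule measurable_restrict_space2)
  show "G \<in> space (restrict_space lborel T) \<rightarrow> half_open L" using G_half_open by (auto simp: space_restrict_space)
  show "G \<in> borel_measurable (restrict_space lborel T)"
  proof (rule borel_measurable_iff_less[THEN iffD2], rule allI)
    fix a
    have "{w \<in> space (restrict_space lborel T). G w < a} = {0..} \<inter> (\<Union>x\<in>{x \<in> S. x < a}. {..<q x})"
    proof (rule set_eqI)
      fix w show "w \<in> {w \<in> space (restrict_space lborel T). G w < a} \<longleftrightarrow> w \<in> {0..} \<inter> (\<Union>x\<in>{x \<in> S. x < a}. {..<q x})"
        using G_less[of w a] by (cases "w \<in> T") (auto simp: space_restrict_space T_def)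
    qed
    also have "\<dots> \<in> sets lborel" unfolding sets_lborel by (rule sets.Int, simp, rule borel_open, auto)
    finally have "{w \<in> space (restrict_space lborel T). G w < a} \<in> sets lborel" .
    moreover have "{w \<in> space (restrict_space lborel T). G w < a} \<subseteq> T" by (auto simp: space_restrict_space)
    ultimately show "{w \<in> space (restrict_space lborel T). G w < a} \<in> sets (restrict_space lborel T)"
      by (subst sets_restrict_space_iff) auto
  qed
qed

definition mass :: "real measure" where
  "mass = distr (restrict_space lborel T) (restrict_space borel (half_open L)) G"

lemma borel_measure_on_mass: "borel_measure_on L mass"
  unfolding borel_measure_on_def
proof (intro conjI allI impI)
  show "sets mass = sets (restrict_space borel (half_open L))" by (simp add: mass_def)
  fix K assume K: "compact K \<and> K \<subseteq> half_open L"
  show "emeasure mass K < \<infinity>"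
  proof (cases "K = {}")
    case False
    then obtain c where c: "c \<in> K" "\<And>x. x \<in> K \<Longrightarrow> x \<le> c" using compact_attains_sup[of K] K by blast
    obtain y where y: "c < y" "y \<in> S" using S_above[of c] c K by blast
    have "K = half_open L \<inter> K" using K by blast
    moreover have "K \<in> sets borel" using K by (simp add: borel_compact)
    ultimately have "K \<in> sets (restrict_space borel (half_open L))" by (auto simp: sets_restrict_space)
    then have "emeasure mass K = emeasure (restrict_space lborel T) (G -` K \<inter> space (restrict_space lborel T))"
      unfolding mass_def by (rule emeasure_distr[OF G_measurable])
    also have "\<dots> = emeasure lborel (G -` K \<inter> space (restrict_space lborel T))"
      by (rule emeasure_restrict_space) (auto simp: space_restrict_space)
    also have "\<dots> \<le> emeasure lborel {0..q y}"
    proof (rule emeasure_mono)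
      show "G -` K \<inter> space (restrict_space lborel T) \<subseteq> {0..q y}"
      proof
        fix t assume "t \<in> G -` K \<inter> space (restrict_space lborel T)"
        then have t: "G t \<in> K" "t \<in> T" by (auto simp: space_restrict_space)
        have "G t < y" using c(2)[OF t(1)] y by simp
        then obtain x where "x \<in> S" "x < y" "t < q x" using G_less[OF t(2)] by blast
        then show "t \<in> {0..q y}" using q_mono_nonneg(2)[OF y(2), of x] t(2) by (auto simp: T_def)
      qed
    qed simp
    also have "\<dots> < \<infinity>" by (simp add: emeasure_lborel_Icc_eq)
    finally show ?thesis .
  qed simp
qed

text \<open>A layer cake argument: \<open>q x\<close> is the length of the set of levels
  \<open>{0..<q x}\<close>. After exchanging the integrals, the level \<open>t\<close> contributes
  the integral of \<open>k\<close> over all \<open>x\<close> beyond \<open>G t\<close>, which is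
  \<open>- h (G t)\<close>.\<close>

lemma integral_mass:
  fixes h k :: "real \<Rightarrow> complex"
  assumes h: "test_function L h k"
  shows "(\<integral>x. h x \<partial>mass) = - (LBINT x. of_real (q x) * k x)"
proof -
  have wd: "weak_derivative L h k" using h by (simp add: test_function_def)
  have k0: "\<And>x. x \<notin> half_open L \<Longrightarrow> k x = 0" and km [measurable]: "k \<in> borel_measurable borel"
    using weak_derivative_outside[OF wd] weak_derivative_measurable[OF wd] by auto
  obtain c where c: "c \<in> half_open L" and v: "\<And>x. x \<in> half_open L \<Longrightarrow> c < x \<Longrightarrow> h x = 0 \<and> k x = 0"
    using h unfolding test_function_def by blast
  obtain y where y: "c < y" "y \<in> S" using S_above[OF c] by blast
  have yL: "y \<in> half_open L" by (rule S_nonneg(2)[OF y(2)])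
  define F where "F x t = indicator {0..<q x} t *\<^sub>R indicator {0..y} x *\<^sub>R k x" for x t
  have F_eq: "indicator T t *\<^sub>R h (G t) = - (LBINT x. F x t)" for t
  proof -
    \<comment> \<open>At \<open>x = G t\<close> the infimum does not decide whether
      \<open>t < q x\<close>; this single point and the points outside \<open>S\<close> are left
      out.\<close>
    have ae: "AE x in lborel. F x t = indicator T t *\<^sub>R (indicator ({G t<..} \<inter> {0..y}) x *\<^sub>R k x)"
      using AE_S AE_lborel_singleton[of "G t"]
    proof eventually_elim
      fix x assume x: "x \<in> half_open L \<longrightarrow> x \<in> S" "x \<noteq> G t"
      show "F x t = indicator T t *\<^sub>R (indicator ({G t<..} \<inter> {0..y}) x *\<^sub>R k x)"
      proof (cases "x \<in> half_open L")
        case True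
        with x have xS: "x \<in> S" by blast
        have "t \<in> T \<and> G t < x \<longleftrightarrow> 0 \<le> t \<and> t < q x"
        proof
          assume t: "t \<in> T \<and> G t < x"
          then obtain x' where "x' \<in> S" "x' < x" "t < q x'" using G_less[of t x] by blast
          then show "0 \<le> t \<and> t < q x" using q_mono_nonneg(2)[OF xS, of x'] t by (auto simp: T_def)
        next
          assume t: "0 \<le> t \<and> t < q x"
          have "G t \<le> x" unfolding G_def
            by (rule cInf_lower) (use t xS S_nonneg in \<open>auto intro!: bdd_belowI[of _ 0]\<close>)
          then show "t \<in> T \<and> G t < x" using x(2) t xS by (auto simp: T_def)
        qed
        then show ?thesis unfolding F_def by (cases "t \<in> T \<and> G t < x") (auto split: split_indicator)
      qed (simp add: F_def k0)
    qed
    have "(LBINT x. F x t) = (LBINT x. indicator T t *\<^sub>R (indicator ({G t<..} \<inter> {0..y}) x *\<^sub>R k x))"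
    proof (rule integral_cong_AE[OF _ _ ae])
      have "(\<lambda>x. F x t) = (\<lambda>x. (if 0 \<le> t \<and> t < q x then 1 else 0) *\<^sub>R indicator {0..y} x *\<^sub>R k x)"
        by (auto simp: F_def fun_eq_iff indicator_def)
      also have "\<dots> \<in> borel_measurable lborel" by measurable
      finally show "(\<lambda>x. F x t) \<in> borel_measurable lborel" .
    qed measurable
    also have "\<dots> = indicator T t *\<^sub>R (LBINT x. indicator ({G t<..} \<inter> {0..y}) x *\<^sub>R k x)"
      by (cases "t \<in> T") simp_all
    also have "\<dots> = - (indicator T t *\<^sub>R h (G t))"
    proof (cases "t \<in> T")
      case True
      have G0: "0 \<le> G t" using half_open_nonneg[OF G_half_open[OF True]] .
      have "(LBINT x. indicator ({G t<..} \<inter> {0..y}) x *\<^sub>R k x) = - h (G t)"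
      proof (cases "G t \<le> y")
        case le: True
        have "{G t<..} \<inter> {0..y} = {G t<..y}" using G0 by auto
        then have "(LBINT x. indicator ({G t<..} \<inter> {0..y}) x *\<^sub>R k x) = h y - h (G t)"
          using weak_derivative_diff[OF wd G0 le yL] by simp
        then show ?thesis using v[OF yL y(1)] by simp
      next
        case False
        then have "{G t<..} \<inter> {0..y} = {}" by auto
        then show ?thesis using v[OF G_half_open[OF True]] y(1) False by simp
      qed
      then show ?thesis using True by simp
    qed simp
    finally show ?thesis by simp
  qed
  have iq: "integrable lborel (\<lambda>x. indicator {0..y} x *\<^sub>R (of_real (q x) * k x))"
    by (rule integrable_mult_indicator[OF _ square_integrable_q_mult(3)[OF q h]]) simp
  have inner: "(LBINT t. indicator {0..<r} t *\<^sub>R u) = max 0 r *\<^sub>R u" for r :: real and u :: "'b::euclidean_space"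
    by (cases "0 \<le> r") (simp_all add: max_def)
  have F_inner: "(LBINT t. F x t) = max 0 (q x) *\<^sub>R indicator {0..y} x *\<^sub>R k x" for x
    unfolding F_def by (rule inner)
  have Fm: "case_prod F \<in> borel_measurable (lborel \<Otimes>\<^sub>M lborel)"
  proof -
    have "case_prod F = (\<lambda>p. (if 0 \<le> snd p \<and> snd p < q (fst p) then 1 else 0) *\<^sub>R indicator {0..y} (fst p) *\<^sub>R k (fst p))"
      by (auto simp: F_def fun_eq_iff indicator_def)
    also have "\<dots> \<in> borel_measurable (borel \<Otimes>\<^sub>M borel)" by measurable
    finally show ?thesis by (simp cong: measurable_cong_sets)
  qed
  have Fi: "integrable (lborel \<Otimes>\<^sub>M lborel) (case_prod F)"
  proof (rule lborel_pair.Fubini_integrable[OF Fm])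
    have "norm (F x t) = indicator {0..<q x} t *\<^sub>R (indicator {0..y} x * norm (k x))" for x t by (simp add: F_def)
    then have n: "(LBINT t. norm (case_prod F (x, t))) = max 0 (q x) *\<^sub>R (indicator {0..y} x * norm (k x))" for x
      unfolding prod.case by (simp only: inner)
    show "integrable lborel (\<lambda>x. LBINT t. norm (case_prod F (x, t)))"
      unfolding n
    proof (rule integrable_bound[OF iq])
      show "AE x in lborel. norm (max 0 (q x) *\<^sub>R (indicator {0..y} x * norm (k x))) \<le> norm (indicator {0..y} x *\<^sub>R (of_real (q x) * k x))"
        by (rule AE_I2) (auto simp: indicator_def norm_mult max_def intro: mult_nonpos_nonneg)
    qed measurable
    show "AE x in lborel. integrable lborel (\<lambda>t. case_prod F (x, t))"
    proof (rule AE_I2)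
      fix x show "integrable lborel (\<lambda>t. case_prod F (x, t))"
        by (cases "0 \<le> q x") (simp_all add: F_def integrable_indicator_iff)
    qed
  qed
  have "(\<integral>x. h x \<partial>mass) = (\<integral>t. h (G t) \<partial>restrict_space lborel T)"
    unfolding mass_def
    by (rule integral_distr[OF G_measurable borel_measurable_continuous_on_restrict[OF weak_derivative_continuous_on[OF wd]]])
  also have "\<dots> = (LBINT t. indicator T t *\<^sub>R h (G t))" by (rule integral_restrict_space) simp
  also have "\<dots> = - (LBINT t. (LBINT x. F x t))" unfolding F_eq by simp
  also have "(LBINT t. (LBINT x. F x t)) = (LBINT x. max 0 (q x) *\<^sub>R indicator {0..y} x *\<^sub>R k x)"
    unfolding lborel_pair.Fubini_integral[OF Fi] F_inner ..
  also have "\<dots> = (LBINT x. of_real (q x) * k x)"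
  proof (rule integral_cong_AE)
    show "AE x in lborel. max 0 (q x) *\<^sub>R indicator {0..y} x *\<^sub>R k x = of_real (q x) * k x"
      using AE_S
    proof eventually_elim
      fix x assume x: "x \<in> half_open L \<longrightarrow> x \<in> S"
      show "max 0 (q x) *\<^sub>R indicator {0..y} x *\<^sub>R k x = of_real (q x) * k x"
      proof (cases "x \<in> half_open L \<and> x \<le> y")
        case True
        then show ?thesis using q_mono_nonneg(1)[of x] x half_open_nonneg[of x L] by (simp add: scaleR_conv_of_real)
      next
        case False
        then have "k x = 0" using k0[of x] v[of x] y(1) by (cases "x \<in> half_open L") auto
        then show ?thesis by simp
      qed
    qed
  qed measurable
  finally show ?thesis .
qed

end

section \<open>The representing function is Herglotz--Nevanlinna\<close>

context herglotz_representation
begin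

lemma inverse_square_le:
  assumes z: "z \<notin> \<real>"
  shows "1 / (norm (of_real t - z))\<^sup>2 \<le> (2 + (1 + 2 * (norm z)\<^sup>2) / (Im z)\<^sup>2) * (1 / (1 + t\<^sup>2))"
proof -
  define d where "d = norm (of_real t - z)"
  have Im: "\<bar>Im z\<bar> > 0" using z by (simp add: nonreal_iff)
  have d: "\<bar>Im z\<bar> \<le> d" unfolding d_def by (rule Im_le_norm)
  then have d2: "(Im z)\<^sup>2 \<le> d\<^sup>2" by (rule abs_le_square_iff[THEN iffD1, OF order_trans]) simp
  have "t\<^sup>2 \<le> 2 * d\<^sup>2 + 2 * (norm z)\<^sup>2"
    using square_norm_sum_le[of "of_real t - z" z] by (simp add: d_def)
  moreover have "1 + 2 * (norm z)\<^sup>2 \<le> (1 + 2 * (norm z)\<^sup>2) * (d\<^sup>2 / (Im z)\<^sup>2)"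
    using d2 Im by (simp add: mult_le_cancel_left1 le_divide_eq add_pos_nonneg)
  ultimately have "1 + t\<^sup>2 \<le> (2 + (1 + 2 * (norm z)\<^sup>2) / (Im z)\<^sup>2) * d\<^sup>2" by (simp add: algebra_simps)
  moreover have "0 < 1 + t\<^sup>2" by (intro add_pos_nonneg) auto
  moreover have "0 < d\<^sup>2" using d Im by simp
  ultimately show ?thesis unfolding d_def[symmetric] by (simp add: divide_le_eq le_divide_eq)
qed

lemma kernel_integral_has_derivative:
  fixes z :: complex
  assumes z: "z \<notin> \<real>"
  shows "((\<lambda>z. \<integral>t. 1 / (of_real t - z) - of_real (t / (1 + t\<^sup>2)) \<partial>\<mu>) has_field_derivative
    (\<integral>t. 1 / ((of_real t - z) * (of_real t - z)) \<partial>\<mu>)) (at z)" (is "(?F has_field_derivative _) _")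
  unfolding has_field_derivative_iff tendsto_at_iff_sequentially
proof (intro allI impI)
  fix X assume X: "\<forall>i. X i \<in> UNIV - {z}" "X \<longlonglongrightarrow> z"
  have Im: "\<bar>Im z\<bar> > 0" using z by (simp add: nonreal_iff)
  \<comment> \<open>Leaving out finitely many terms keeps the sequence within
    \<open>|Im z| / 2\<close> of \<open>z\<close>, hence off the real axis and with
    \<open>|t - w n| \<ge> |t - z| / 2\<close> for all \<open>t\<close>.\<close>
  obtain N where N: "\<And>n. n \<ge> N \<Longrightarrow> norm (X n - z) < \<bar>Im z\<bar> / 2"
    using LIMSEQ_D[OF X(2), of "\<bar>Im z\<bar> / 2"] Im by auto
  define w where "w n = X (n + N)" for n
  have w: "w n \<noteq> z" "norm (w n - z) < \<bar>Im z\<bar> / 2" for n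
    using X N by (auto simp: w_def)
  have wlim: "w \<longlonglongrightarrow> z" unfolding w_def by (rule LIMSEQ_ignore_initial_segment[OF X(2)])
  have wnr: "w n \<notin> \<real>" for n
    unfolding nonreal_iff using w(2)[of n] abs_Im_le_cmod[of "w n - z"] Im by auto
  have nz: "of_real t - z \<noteq> 0" and nw: "of_real t - w n \<noteq> 0" for t n
    using z wnr by (metis Reals_of_real eq_iff_diff_eq_0)+
  have quot: "(?F (w n) - ?F z) / (w n - z) = (\<integral>t. 1 / ((of_real t - w n) * (of_real t - z)) \<partial>\<mu>)" for n
  proof -
    have "?F (w n) - ?F z = (\<integral>t. (1 / (of_real t - w n) - of_real (t / (1 + t\<^sup>2))) - (1 / (of_real t - z) - of_real (t / (1 + t\<^sup>2))) \<partial>\<mu>)"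
      by (rule integral_diff[OF integrable_kernel[OF wnr] integrable_kernel[OF z], symmetric])
    also have "\<dots> = (\<integral>t. (w n - z) * (1 / ((of_real t - w n) * (of_real t - z))) \<partial>\<mu>)"
    proof (rule integral_cong[OF refl])
      fix t
      have "1 / A - c - (1 / B - c) = (B - A) * (1 / (A * B))" if "A \<noteq> 0" "B \<noteq> 0" for A B c :: complex
        using that by (simp add: field_simps)
      from this[OF nw nz] show "(1 / (of_real t - w n) - of_real (t / (1 + t\<^sup>2))) - (1 / (of_real t - z) - of_real (t / (1 + t\<^sup>2))) =
          (w n - z) * (1 / ((of_real t - w n) * (of_real t - z)))" for t by simp
    qed
    finally have "?F (w n) - ?F z = (w n - z) * (\<integral>t. 1 / ((of_real t - w n) * (of_real t - z)) \<partial>\<mu>)"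
      by (simp only: integral_mult_right_zero)
    moreover have "w n - z \<noteq> 0" using w(1)[of n] by simp
    ultimately show ?thesis by (simp only: nonzero_mult_div_cancel_left not_False_eq_True)
  qed
  have "(\<lambda>n. \<integral>t. 1 / ((of_real t - w n) * (of_real t - z)) \<partial>\<mu>) \<longlonglongrightarrow>
      (\<integral>t. 1 / ((of_real t - z) * (of_real t - z)) \<partial>\<mu>)"
  proof (rule integral_dominated_convergence)
    let ?g = "\<lambda>t. 2 * ((2 + (1 + 2 * (norm z)\<^sup>2) / (Im z)\<^sup>2) * (1 / (1 + t\<^sup>2)))"
    show "integrable \<mu> ?g" by (intro integrable_mult_right \<mu>_int)
    have "(\<lambda>t. 1 / ((of_real t - w n) * (of_real t - z))) \<in> borel_measurable borel" for n by measurable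
    then show "(\<lambda>t. 1 / ((of_real t - w n) * (of_real t - z))) \<in> borel_measurable \<mu>" for n
      by (simp add: measurable_cong_sets[OF sets_\<mu> refl])
    have "(\<lambda>t. 1 / ((of_real t - z) * (of_real t - z))) \<in> borel_measurable borel" by measurable
    then show "(\<lambda>t. 1 / ((of_real t - z) * (of_real t - z))) \<in> borel_measurable \<mu>"
      by (simp add: measurable_cong_sets[OF sets_\<mu> refl])
    show "AE t in \<mu>. (\<lambda>n. 1 / ((of_real t - w n) * (of_real t - z))) \<longlonglongrightarrow> 1 / ((of_real t - z) * (of_real t - z))"
      using nz by (intro AE_I2 tendsto_intros wlim) auto
    show "AE t in \<mu>. norm (1 / ((of_real t - w n) * (of_real t - z))) \<le> ?g t" for n
    proof (rule AE_I2)
      fix t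
      let ?d = "norm (of_real t - z)"
      have d: "\<bar>Im z\<bar> \<le> ?d" by (rule Im_le_norm)
      have "?d \<le> norm (of_real t - w n) + norm (w n - z)"
        using norm_triangle_ineq[of "of_real t - w n" "w n - z"] by simp
      then have "?d / 2 \<le> norm (of_real t - w n)" using w(2)[of n] d by linarith
      then have "?d / 2 * ?d \<le> norm (of_real t - w n) * ?d" by (rule mult_right_mono) simp
      then have "1 / (norm (of_real t - w n) * ?d) \<le> 1 / (?d / 2 * ?d)"
      proof (intro divide_left_mono mult_pos_pos)
        show "0 < norm (of_real t - w n)" using nw[of t n] unfolding zero_less_norm_iff .
        show "0 < ?d" "0 < ?d" "0 < ?d / 2" using d Im by linarith+
      qed auto
      also have "\<dots> = 2 * (1 / ?d\<^sup>2)" by (simp add: power2_eq_square)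
      also have "\<dots> \<le> ?g t" by (rule mult_left_mono[OF inverse_square_le[OF z]]) simp
      finally show "norm (1 / ((of_real t - w n) * (of_real t - z))) \<le> ?g t" by (simp add: norm_divide norm_mult)
    qed
  qed
  then have "(\<lambda>n. (?F (w n) - ?F z) / (w n - z)) \<longlonglongrightarrow> (\<integral>t. 1 / ((of_real t - z) * (of_real t - z)) \<partial>\<mu>)"
    by (simp only: quot)
  then have "(\<lambda>n. ((\<lambda>y. (?F y - ?F z) / (y - z)) \<circ> X) (n + N)) \<longlonglongrightarrow> (\<integral>t. 1 / ((of_real t - z) * (of_real t - z)) \<partial>\<mu>)"
    by (simp only: w_def o_def)
  then show "((\<lambda>y. (?F y - ?F z) / (y - z)) \<circ> X) \<longlonglongrightarrow> (\<integral>t. 1 / ((of_real t - z) * (of_real t - z)) \<partial>\<mu>)"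
    by (rule LIMSEQ_offset)
qed

lemma m_analytic: "m analytic_on - \<real>"
proof -
  let ?F = "\<lambda>z. \<integral>t. 1 / (of_real t - z) - of_real (t / (1 + t\<^sup>2)) \<partial>\<mu>"
  have "?F holomorphic_on - \<real>"
    unfolding holomorphic_on_def field_differentiable_def
    using has_field_derivative_at_within[OF kernel_integral_has_derivative] by blast
  then have "(\<lambda>z. of_real c1 * z + of_real c2 - of_real \<gamma> / z + ?F z) holomorphic_on - \<real>"
    by (intro holomorphic_intros) auto
  then have "m holomorphic_on - \<real>"
    by (rule holomorphic_transform) (simp add: m_eq)
  then show ?thesis by (simp add: analytic_on_open open_Compl closed_complex_Reals)
qed

text \<open>Every other part of the representation has non-negative imaginary part. The linear term
  is kept because its growth along the imaginary axis later forces \<open>c1 = 0\<close>.\<close>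

lemma Im_m_ge:
  assumes z: "Im z > 0"
  shows "c1 * Im z \<le> Im (m z)"
proof -
  have nr: "z \<notin> \<real>" using z by (simp add: nonreal_iff)
  have "Im (\<integral>t. 1 / (of_real t - z) - of_real (t / (1 + t\<^sup>2)) \<partial>\<mu>) =
      (\<integral>t. Im (1 / (of_real t - z) - of_real (t / (1 + t\<^sup>2))) \<partial>\<mu>)"
    by (rule integral_Im[OF integrable_kernel[OF nr], symmetric])
  also have "\<dots> \<ge> 0"
  proof (rule integral_nonneg)
    fix t
    have "Im (1 / (of_real t - z)) = Im z / ((t - Re z)\<^sup>2 + (Im z)\<^sup>2)" by (simp add: Im_divide)
    then show "0 \<le> Im (1 / (of_real t - z) - of_real (t / (1 + t\<^sup>2)))" using z by simp
  qed
  finally have "0 \<le> Im (\<integral>t. 1 / (of_real t - z) - of_real (t / (1 + t\<^sup>2)) \<partial>\<mu>)" .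
  moreover have "Im (of_real \<gamma> / z) \<le> 0" using z \<gamma> by (simp add: Im_divide divide_nonpos_nonneg)
  ultimately show ?thesis unfolding m_eq[OF nr] by simp
qed

text \<open>Analyticity, symmetry and the half-plane condition for \<open>m\<close> itself follow
  from the representation, so a single condition remains to be decided.\<close>

lemma stieltjes_function_iff: "stieltjes_function m \<longleftrightarrow> (\<forall>z. Im z > 0 \<longrightarrow> Im (z * m z) \<ge> 0)"
proof -
  have "herglotz_nevanlinna m"
    unfolding herglotz_nevanlinna_def
  proof (intro conjI allI impI m_analytic)
    show "0 \<le> Im (m z)" if "0 < Im z" for z
      using Im_m_ge[OF that] mult_nonneg_nonneg[OF c1, of "Im z"] that by linarith
  qed (simp add: m_cnj)
  moreover have "(\<lambda>z. z * m z) analytic_on - \<real>" by (intro analytic_intros m_analytic)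
  ultimately show ?thesis
    unfolding stieltjes_function_def herglotz_nevanlinna_def by (simp add: m_cnj)
qed

end

section \<open>The integral representation\<close>

text \<open>The case of a vanishing \<open>\<upsilon>\<close> and a measure \<open>\<nu>\<close> in
  place of the distribution: the equation of a string with mass distribution \<open>\<nu>\<close>,
  in weak form.\<close>

locale string_problem = herglotz_representation \<mu> m c1 c2 \<gamma>
  for \<mu> :: "real measure" and m :: "complex \<Rightarrow> complex" and c1 c2 \<gamma> :: real +
  fixes L :: ereal and \<nu> :: "real measure" and \<psi> \<psi>' :: "complex \<Rightarrow> real \<Rightarrow> complex"
  assumes L: "0 < L" and \<nu>: "borel_measure_on L \<nu>"
    and sol: "z \<notin> \<real> \<Longrightarrow> test_function L h k \<Longrightarrow>
      z * m z * h 0 + (LBINT x. \<psi>' z x * k x) = z * (\<integral>x. \<psi> z x * h x \<partial>\<nu>)"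
    and fe: "z \<notin> \<real> \<Longrightarrow> finite_energy L (\<psi> z) (\<psi>' z)"
    and \<psi>_0: "z \<notin> \<real> \<Longrightarrow> \<psi> z 0 = 1"
begin

lemma \<psi>_continuous: "z \<notin> \<real> \<Longrightarrow> continuous_on (half_open L) (\<psi> z)"
  using weak_derivative_continuous_on finite_energyD(1)[OF fe] by blast

text \<open>\<open>I\<close> stands for the integral of \<open>|\<psi> z|^2\<close> over
  \<open>\<nu>\<close> and is obtained as a limit of cut-off integrals, which are real. Their
  convergence comes from the equation and not from a bound on the solution; afterwards only this
  formula and the lower bounds over \<open>{0..c}\<close> are used.\<close>

lemma energy_identity:
  assumes z: "z \<notin> \<real>"
  obtains I where "m z = of_real I - of_real (LBINT x. (norm (\<psi>' z x))\<^sup>2) / z"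
    "\<And>c. c \<in> half_open L \<Longrightarrow> (\<integral>x. indicator {0..c} x * (norm (\<psi> z x))\<^sup>2 \<partial>\<nu>) \<le> I"
proof -
  define E where "E = (LBINT x. (norm (\<psi>' z x))\<^sup>2)"
  have z0: "z \<noteq> 0" using z by auto
  note f = fe[OF z] and fd = finite_energyD[OF fe[OF z]]
  have wdc: "weak_derivative L (\<lambda>x. cnj (\<psi> z x)) (\<lambda>x. cnj (\<psi>' z x))"
    by (rule weak_derivative_linear[OF fd(1) bounded_linear_cnj])
  note fc = finite_energy_cnj[OF f]
  obtain \<rho> \<kappa> :: "nat \<Rightarrow> real \<Rightarrow> real" where
      test: "\<And>n. test_function L (\<lambda>x. complex_of_real (\<rho> n x)) (\<lambda>x. complex_of_real (\<kappa> n x))"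
      and \<rho>0: "\<And>n. \<rho> n 0 = 1" and \<rho>: "\<And>n x. 0 \<le> \<rho> n x" "\<And>n x. \<rho> n x \<le> 1"
        "\<And>x. x \<in> half_open L \<Longrightarrow> (\<lambda>n. \<rho> n x) \<longlonglongrightarrow> 1" "\<And>n. \<rho> n \<in> borel_measurable borel"
      and \<kappa>: "\<And>a a' b b'. finite_energy L a a' \<Longrightarrow> finite_energy L b b' \<Longrightarrow>
          (\<lambda>n. LBINT x. a' x * (b x * complex_of_real (\<kappa> n x))) \<longlonglongrightarrow> 0"
        "\<And>n a a' b b'. finite_energy L a a' \<Longrightarrow> finite_energy L b b' \<Longrightarrow>
          integrable lborel (\<lambda>x. a' x * (b x * complex_of_real (\<kappa> n x)))"
    using cutoff_sequence[OF L] by blast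
  note tf = test_function_mult[OF wdc test]
  define X where "X n = (LBINT x. \<psi>' z x * (cnj (\<psi> z x) * complex_of_real (\<kappa> n x) + cnj (\<psi>' z x) * complex_of_real (\<rho> n x)))" for n
  define J where "J n = (\<integral>x. (norm (\<psi> z x))\<^sup>2 * \<rho> n x \<partial>\<nu>)" for n
  have "(LBINT x. \<psi>' z x * cnj (\<psi>' z x)) = complex_of_real E"
    unfolding E_def complex_norm_square[symmetric] by (rule integral_complex_of_real)
  then have Xlim: "X \<longlonglongrightarrow> complex_of_real E"
    unfolding X_def using finite_energy_cutoff_limit(1)[OF L f fc \<rho> \<kappa>[OF f fc]] by simp
  have XJ: "of_real (J n) = m z + X n / z" for n
  proof -
    have "\<psi> z x * (cnj (\<psi> z x) * complex_of_real (\<rho> n x)) = complex_of_real ((norm (\<psi> z x))\<^sup>2 * \<rho> n x)" for x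
      unfolding of_real_mult complex_norm_square by (simp add: mult.assoc)
    then have "(\<integral>x. \<psi> z x * (cnj (\<psi> z x) * complex_of_real (\<rho> n x)) \<partial>\<nu>) = of_real (J n)"
      unfolding J_def by (simp only: integral_complex_of_real)
    with sol[OF z tf[of n]] have "z * m z + X n = z * of_real (J n)" by (simp add: \<rho>0 \<psi>_0[OF z] X_def)
    then have "of_real (J n) = (z * m z + X n) / z" using z0 by (simp only: nonzero_mult_div_cancel_left not_False_eq_True)
    then show ?thesis using z0 by (simp add: add_divide_distrib)
  qed
  define I where "I = Re (m z + of_real E / z)"
  have lim: "(\<lambda>n. complex_of_real (J n)) \<longlonglongrightarrow> m z + of_real E / z"
    unfolding XJ using Xlim z0 by (intro tendsto_intros)
  from tendsto_Re[OF lim] have Jlim: "J \<longlonglongrightarrow> I" unfolding I_def by simp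
  then have "(\<lambda>n. complex_of_real (J n)) \<longlonglongrightarrow> of_real I" by (rule tendsto_of_real)
  from LIMSEQ_unique[OF lim this] have mI: "m z = of_real I - of_real E / z" by (simp add: eq_diff_eq)
  have ib: "(\<integral>x. indicator {0..c} x * (norm (\<psi> z x))\<^sup>2 \<partial>\<nu>) \<le> I" if c: "c \<in> half_open L" for c
  proof (rule LIMSEQ_le[OF _ Jlim])
    have cn: "continuous_on (half_open L) (\<lambda>x. (norm (\<psi> z x))\<^sup>2)"
      by (intro continuous_intros \<psi>_continuous[OF z])
    have ii: "integrable \<nu> (\<lambda>x. indicator {0..c} x * (norm (\<psi> z x))\<^sup>2)"
      using borel_measure_on_integrable[OF \<nu> c cn] by simp
    have r: "continuous_on (half_open L) (\<rho> n)" for n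
      using continuous_on_Re[OF weak_derivative_continuous_on[OF test_function_imp_weak_derivative[OF test[of n]]]] by simp
    have iin: "integrable \<nu> (\<lambda>x. indicator {0..c} x * ((norm (\<psi> z x))\<^sup>2 * \<rho> n x))" for n
      using borel_measure_on_integrable[OF \<nu> c continuous_on_mult[OF cn r]] by simp
    show "(\<lambda>n. \<integral>x. indicator {0..c} x * ((norm (\<psi> z x))\<^sup>2 * \<rho> n x) \<partial>\<nu>) \<longlonglongrightarrow> (\<integral>x. indicator {0..c} x * (norm (\<psi> z x))\<^sup>2 \<partial>\<nu>)"
    proof (rule integral_dominated_convergence[OF _ _ ii])
      show "AE x in \<nu>. (\<lambda>n. indicator {0..c} x * ((norm (\<psi> z x))\<^sup>2 * \<rho> n x)) \<longlonglongrightarrow> indicator {0..c} x * (norm (\<psi> z x))\<^sup>2"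
      proof (rule AE_I2)
        fix x assume "x \<in> space \<nu>"
        then have "(\<lambda>n. indicator {0..c} x * ((norm (\<psi> z x))\<^sup>2 * \<rho> n x)) \<longlonglongrightarrow> indicator {0..c} x * ((norm (\<psi> z x))\<^sup>2 * 1)"
          by (intro tendsto_intros \<rho>(3)) (simp add: borel_measure_on_space[OF \<nu>])
        then show "(\<lambda>n. indicator {0..c} x * ((norm (\<psi> z x))\<^sup>2 * \<rho> n x)) \<longlonglongrightarrow> indicator {0..c} x * (norm (\<psi> z x))\<^sup>2" by simp
      qed
      show "AE x in \<nu>. norm (indicator {0..c} x * ((norm (\<psi> z x))\<^sup>2 * \<rho> n x)) \<le> indicator {0..c} x * (norm (\<psi> z x))\<^sup>2" for n
      proof (rule AE_I2)
        fix x
        have "(norm (\<psi> z x))\<^sup>2 * \<rho> n x \<le> (norm (\<psi> z x))\<^sup>2 * 1" by (rule mult_left_mono[OF \<rho>(2)]) simp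
        then show "norm (indicator {0..c} x * ((norm (\<psi> z x))\<^sup>2 * \<rho> n x)) \<le> indicator {0..c} x * (norm (\<psi> z x))\<^sup>2"
          using \<rho>(1)[of n x] by (cases "x \<in> {0..c}") auto
      qed
    qed (use ii iin in \<open>blast dest: borel_measurable_integrable\<close>)+
    show "\<exists>N. \<forall>n\<ge>N. (\<integral>x. indicator {0..c} x * ((norm (\<psi> z x))\<^sup>2 * \<rho> n x) \<partial>\<nu>) \<le> J n"
    proof (intro exI allI impI)
      fix n
      obtain d where d: "d \<in> half_open L" "\<And>x. x \<in> half_open L \<Longrightarrow> d < x \<Longrightarrow> \<rho> n x = 0"
        using test[of n] by (auto simp: test_function_def)
      have "integrable \<nu> (\<lambda>x. (norm (\<psi> z x))\<^sup>2 * \<rho> n x)"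
        by (rule borel_measure_on_supported(2)[OF \<nu> d(1), THEN iffD2, OF _ borel_measure_on_integrable[OF \<nu> d(1) continuous_on_mult[OF cn r]]])
          (simp add: d(2))
      then show "(\<integral>x. indicator {0..c} x * ((norm (\<psi> z x))\<^sup>2 * \<rho> n x) \<partial>\<nu>) \<le> J n"
        unfolding J_def using \<rho>(1)[of n] by (intro integral_mono[OF iin]) (auto split: split_indicator)
    qed
  qed
  show ?thesis by (rule that[of I]) (use mI ib in \<open>auto simp: E_def\<close>)
qed

lemma Im_z_m_nonneg:
  assumes "Im z > 0"
  shows "0 \<le> Im (z * m z)"
proof -
  have z: "z \<notin> \<real>" using assms by (simp add: nonreal_iff)
  obtain I where I: "m z = of_real I - of_real (LBINT x. (norm (\<psi>' z x))\<^sup>2) / z"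
    "\<And>c. c \<in> half_open L \<Longrightarrow> (\<integral>x. indicator {0..c} x * (norm (\<psi> z x))\<^sup>2 \<partial>\<nu>) \<le> I"
    using energy_identity[OF z] by blast
  have "0 \<le> (\<integral>x. indicator {0..0} x * (norm (\<psi> z x))\<^sup>2 \<partial>\<nu>)" by (rule integral_nonneg) simp
  then have "0 \<le> I" using I(2)[OF zero_in_half_open[OF L]] by linarith
  moreover have "z * m z = z * of_real I - of_real (LBINT x. (norm (\<psi>' z x))\<^sup>2)"
    using z unfolding I(1) by (auto simp: right_diff_distrib)
  ultimately show ?thesis using assms by simp
qed

sublocale stieltjes_representation
  by unfold_locales (rule Im_z_m_nonneg)

text \<open>On the imaginary axis the derivative term is purely imaginary, so the real part of
  \<open>m\<close> is \<open>I\<close>, and \<open>I\<close> is at least the integral over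
  \<open>{0..0}\<close>, where the solution is 1.\<close>

lemma mass_at_zero:
  assumes y: "0 < y"
  shows "measure \<nu> {0} \<le> Re (m (Complex 0 y))"
proof -
  let ?z = "Complex 0 y"
  have z: "?z \<notin> \<real>" using y by (simp add: complex_is_Real_iff)
  obtain I where I: "m ?z = of_real I - of_real (LBINT x. (norm (\<psi>' ?z x))\<^sup>2) / ?z"
    "\<And>c. c \<in> half_open L \<Longrightarrow> (\<integral>x. indicator {0..c} x * (norm (\<psi> ?z x))\<^sup>2 \<partial>\<nu>) \<le> I"
    using energy_identity[OF z] by blast
  have "(\<integral>x. indicator {0..0} x * (norm (\<psi> ?z x))\<^sup>2 \<partial>\<nu>) = (\<integral>x. indicator {0} x \<partial>\<nu>)"
    by (rule integral_cong) (auto simp: \<psi>_0[OF z] split: split_indicator)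
  also have "\<dots> = measure \<nu> {0}"
    using zero_in_half_open[OF L] by (simp add: borel_measure_on_space[OF \<nu>])
  finally show ?thesis using I(2)[OF zero_in_half_open[OF L]] by (simp add: I(1) Re_divide)
qed

text \<open>Real and imaginary part of the energy identity give \<open>I \<le> A\<close> and
  \<open>E \<le> y * A\<close> for the norm \<open>A\<close> of \<open>m\<close>. The equation
  tested with a ramp of width \<open>e\<close> and the Cauchy-Schwarz inequality give
  \<open>y * A \<le> y * sqrt (I * N) + sqrt (E / e)\<close>. Inserting the first two bounds and
  dividing by \<open>sqrt A\<close> closes the estimate on itself.\<close>

lemma norm_m_le:
  assumes y: "0 < y" and e: "0 < e" "e \<in> half_open L"
  shows "norm (m (Complex 0 y)) \<le> (sqrt (measure \<nu> {0..e}) + 1 / sqrt (y * e))\<^sup>2"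
proof -
  let ?z = "Complex 0 y"
  have z: "?z \<notin> \<real>" using y by (simp add: complex_is_Real_iff)
  have nz: "norm ?z = y" using y by (simp add: cmod_def)
  define E where "E = (LBINT x. (norm (\<psi>' ?z x))\<^sup>2)"
  define N where "N = measure \<nu> {0..e}"
  define A where "A = norm (m ?z)"
  obtain I where I: "m ?z = of_real I - of_real E / ?z"
    "\<And>c. c \<in> half_open L \<Longrightarrow> (\<integral>x. indicator {0..c} x * (norm (\<psi> ?z x))\<^sup>2 \<partial>\<nu>) \<le> I"
    using energy_identity[OF z] unfolding E_def by blast
  have "Re (m ?z) = I" "Im (m ?z) = E / y"
    using y by (simp_all add: I(1) Re_divide Im_divide power2_eq_square)
  then have IA: "I \<le> A" and "E / y \<le> A"
    unfolding A_def using complex_Re_le_cmod[of "m ?z"] order_trans[OF abs_ge_self abs_Im_le_cmod[of "m ?z"]] by simp_all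
  then have EA: "E \<le> y * A" using y by (simp add: divide_le_eq mult.commute)
  define h where "h x = complex_of_real ((e - min (max x 0) e) / (e - 0))" for x
  define k where "k x = complex_of_real (- (indicator {0<..e} x * indicator (half_open L) x / (e - 0)))" for x :: real
  have wd: "weak_derivative L h k"
    unfolding h_def k_def by (rule weak_derivative_of_real[OF weak_derivative_ramp]) (use e in auto)
  have h: "test_function L h k"
    unfolding test_function_def using wd e by (auto simp: h_def k_def intro!: bexI[of _ e])
  have h_le: "norm (h x) \<le> 1" for x
  proof -
    have "0 \<le> (e - min (max x 0) e) / (e - 0)" "(e - min (max x 0) e) / (e - 0) \<le> 1" using e by auto
    then show ?thesis unfolding h_def norm_of_real by simp
  qed
  have h_out: "h x = 0" if "e < x" for x using that e by (simp add: h_def)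
  note fd = finite_energyD[OF fe[OF z]]
  have eq: "?z * m ?z + (LBINT x. \<psi>' ?z x * k x) = ?z * (\<integral>x. \<psi> ?z x * h x \<partial>\<nu>)"
    using sol[OF z h] e by (simp add: h_def)
  have bound1: "(norm (LBINT x. \<psi>' ?z x * k x))\<^sup>2 \<le> E * (1 / e)"
  proof -
    have k2: "(norm (k x))\<^sup>2 = indicator {0<..e} x * (1 / e\<^sup>2)" for x
      using half_open_downward[OF e(2), of x] e by (cases "x \<in> {0<..e}") (auto simp: k_def norm_divide power_divide)
    have ki: "integrable lborel (\<lambda>x. (norm (k x))\<^sup>2)" and "(LBINT x. (norm (k x))\<^sup>2) = e * (1 / e\<^sup>2)"
      unfolding k2 using e by (simp_all add: integrable_indicator_iff)
    then show ?thesis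
      using Cauchy_Schwarz_integral_norm[OF _ _ fd(3) ki] fd(2) weak_derivative_measurable[OF wd] e
      by (simp add: E_def power2_eq_square)
  qed
  have bound2: "(norm (\<integral>x. \<psi> ?z x * h x \<partial>\<nu>))\<^sup>2 \<le> I * N"
  proof -
    let ?f = "\<lambda>x. indicator {0..e} x *\<^sub>R \<psi> ?z x" and ?h = "\<lambda>x. indicator {0..e} x *\<^sub>R h x"
    have ch: "continuous_on (half_open L) h" by (rule weak_derivative_continuous_on[OF wd])
    have fi: "integrable \<nu> ?f" and hi: "integrable \<nu> ?h"
      by (intro borel_measure_on_integrable[OF \<nu> e(2)] \<psi>_continuous[OF z] ch)+
    have f2: "(norm (?f x))\<^sup>2 = indicator {0..e} x * (norm (\<psi> ?z x))\<^sup>2"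
      and h2: "(norm (?h x))\<^sup>2 = indicator {0..e} x * (norm (h x))\<^sup>2" for x
      by (auto split: split_indicator)
    have fi2: "integrable \<nu> (\<lambda>x. (norm (?f x))\<^sup>2)" and hi2: "integrable \<nu> (\<lambda>x. (norm (?h x))\<^sup>2)"
      unfolding f2 h2
      unfolding real_scaleR_def[symmetric]
      by (intro borel_measure_on_integrable[OF \<nu> e(2)] continuous_intros \<psi>_continuous[OF z] ch)+
    have "(\<integral>x. \<psi> ?z x * h x \<partial>\<nu>) = (\<integral>x. indicator {0..e} x *\<^sub>R (\<psi> ?z x * h x) \<partial>\<nu>)"
      by (rule borel_measure_on_supported(1)[OF \<nu> e(2)]) (simp add: h_out)
    also have "\<dots> = (\<integral>x. ?f x * ?h x \<partial>\<nu>)"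
      by (rule integral_cong) (auto split: split_indicator)
    finally have "(norm (\<integral>x. \<psi> ?z x * h x \<partial>\<nu>))\<^sup>2 \<le> (\<integral>x. (norm (?f x))\<^sup>2 \<partial>\<nu>) * (\<integral>x. (norm (?h x))\<^sup>2 \<partial>\<nu>)"
      using Cauchy_Schwarz_integral_norm[OF borel_measurable_integrable[OF fi] borel_measurable_integrable[OF hi] fi2 hi2]
      by simp
    also have "\<dots> \<le> I * N"
    proof (rule mult_mono)
      show "(\<integral>x. (norm (?f x))\<^sup>2 \<partial>\<nu>) \<le> I" unfolding f2 by (rule I(2)[OF e(2)])
      have "(\<integral>x. (norm (?h x))\<^sup>2 \<partial>\<nu>) \<le> (\<integral>x. indicator {0..e} x \<partial>\<nu>)"
      proof (rule integral_mono[OF hi2])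
        show "integrable \<nu> (indicator {0..e} :: real \<Rightarrow> real)"
          using borel_measure_on_Icc[OF \<nu> e(2)] by (simp add: integrable_indicator_iff)
        show "(norm (?h x))\<^sup>2 \<le> indicator {0..e} x" for x
          unfolding h2 using power_mono[OF h_le[of x], of 2] by (auto split: split_indicator)
      qed
      also have "\<dots> = N"
        using half_open_downward[OF e(2)] unfolding N_def
        by (simp add: borel_measure_on_space[OF \<nu>]) (rule arg_cong[of _ _ "measure \<nu>"], auto)
      finally show "(\<integral>x. (norm (?h x))\<^sup>2 \<partial>\<nu>) \<le> N" .
      show "0 \<le> I" by (rule order_trans[OF integral_nonneg I(2)[OF e(2)]]) simp
    qed (rule integral_nonneg, simp)
    finally show ?thesis .
  qed
  have A0: "0 \<le> A" and N0: "0 \<le> N" by (simp_all add: A_def N_def)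
  have "y * A \<le> y * norm (\<integral>x. \<psi> ?z x * h x \<partial>\<nu>) + norm (LBINT x. \<psi>' ?z x * k x)"
  proof -
    have "?z * m ?z = ?z * (\<integral>x. \<psi> ?z x * h x \<partial>\<nu>) - (LBINT x. \<psi>' ?z x * k x)" using eq by (simp add: eq_diff_eq)
    from arg_cong[OF this, of norm] norm_triangle_ineq4[of "?z * (\<integral>x. \<psi> ?z x * h x \<partial>\<nu>)" "\<integral>x. \<psi>' ?z x * k x \<partial>lborel"]
    show ?thesis by (simp only: norm_mult nz A_def)
  qed
  also have "\<dots> \<le> y * (sqrt A * sqrt N) + sqrt y * sqrt A / sqrt e"
  proof (rule add_mono)
    have "(norm (\<integral>x. \<psi> ?z x * h x \<partial>\<nu>))\<^sup>2 \<le> A * N"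
      using bound2 mult_right_mono[OF IA N0] by linarith
    then have "norm (\<integral>x. \<psi> ?z x * h x \<partial>\<nu>) \<le> sqrt (A * N)" by (rule real_le_rsqrt)
    then show "y * norm (\<integral>x. \<psi> ?z x * h x \<partial>\<nu>) \<le> y * (sqrt A * sqrt N)"
      using y by (simp add: real_sqrt_mult)
    have "E * (1 / e) \<le> y * A * (1 / e)" by (rule mult_right_mono[OF EA]) (use e in simp)
    with bound1 have "(norm (LBINT x. \<psi>' ?z x * k x))\<^sup>2 \<le> y * A / e" by simp
    then have "norm (LBINT x. \<psi>' ?z x * k x) \<le> sqrt (y * A / e)" by (rule real_le_rsqrt)
    then show "norm (LBINT x. \<psi>' ?z x * k x) \<le> sqrt y * sqrt A / sqrt e"
      by (simp add: real_sqrt_mult real_sqrt_divide)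
  qed
  also have "\<dots> = y * (sqrt A * (sqrt N + 1 / sqrt (y * e)))"
  proof -
    have "s * u / v = s * s * (u * (1 / (s * v)))" if "s \<noteq> 0" for s u v :: real
      using that by (cases "v = 0") (simp_all add: field_simps)
    from this[of "sqrt y" "sqrt A" "sqrt e"] have "sqrt y * sqrt A / sqrt e = y * (sqrt A * (1 / (sqrt y * sqrt e)))"
      using y by (simp only: real_sqrt_mult_self abs_of_pos real_sqrt_eq_zero_cancel_iff less_imp_neq[THEN not_sym] not_False_eq_True simp_thms)
    then show ?thesis by (simp only: real_sqrt_mult distrib_left)
  qed
  finally have "A \<le> sqrt A * (sqrt N + 1 / sqrt (y * e))" using y by simp
  then have "sqrt A * sqrt A \<le> sqrt A * (sqrt N + 1 / sqrt (y * e))" using A0 by simp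
  moreover have "0 \<le> sqrt N + 1 / sqrt (y * e)" using N0 y e by simp
  ultimately have "sqrt A \<le> sqrt N + 1 / sqrt (y * e)"
  proof (cases "A = 0")
    case False
    then have "0 < sqrt A" using A0 by simp
    then show ?thesis using \<open>sqrt A * sqrt A \<le> sqrt A * (sqrt N + 1 / sqrt (y * e))\<close> by (simp only: mult_le_cancel_left_pos)
  qed simp
  from power_mono[OF this, of 2] show ?thesis using A0 unfolding A_def[symmetric] N_def[symmetric] by simp
qed

lemma c1_eq_0: "c1 = 0"
proof (rule ccontr)
  assume "c1 \<noteq> 0"
  with c1 have p: "c1 > 0" by simp
  obtain e where e: "0 < e" "e \<in> half_open L" using half_open_extend[OF zero_in_half_open[OF L]] by blast
  define B where "B = (sqrt (measure \<nu> {0..e}) + 1 / sqrt e)\<^sup>2"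
  \<comment> \<open>Then \<open>c1 * y\<close> is \<open>B + c1\<close>, larger than the bound
    \<open>B\<close>, which is valid since \<open>y \<ge> 1\<close>.\<close>
  define y where "y = B / c1 + 1"
  have B0: "0 \<le> B" by (simp add: B_def)
  have y: "1 \<le> y" using B0 p by (simp add: y_def)
  have "c1 * y \<le> norm (m (Complex 0 y))"
    using Im_m_ge[of "Complex 0 y"] abs_Im_le_cmod[of "m (Complex 0 y)"] y by simp
  also have "\<dots> \<le> (sqrt (measure \<nu> {0..e}) + 1 / sqrt (y * e))\<^sup>2" by (rule norm_m_le) (use y e in auto)
  also have "\<dots> \<le> B"
    unfolding B_def using y e
    by (intro power_mono add_left_mono divide_left_mono real_sqrt_le_mono) (auto simp: mult_le_cancel_right1)
  finally show False using p by (simp add: y_def distrib_left)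
qed

lemma Re_m_imaginary:
  assumes y: "0 < y"
  shows "Re (m (Complex 0 y)) = c2 - (\<integral>t. t / (1 + t\<^sup>2) - t / (t\<^sup>2 + y\<^sup>2) \<partial>\<mu>)"
    and "integrable \<mu> (\<lambda>t. t / (1 + t\<^sup>2) - t / (t\<^sup>2 + y\<^sup>2))"
proof -
  let ?z = "Complex 0 y"
  have z: "?z \<notin> \<real>" using y by (simp add: complex_is_Real_iff)
  have Re: "Re (1 / (of_real t - ?z) - of_real (t / (1 + t\<^sup>2))) = - (t / (1 + t\<^sup>2) - t / (t\<^sup>2 + y\<^sup>2))" for t
  proof -
    have "Re (1 / (of_real t - ?z)) = t / (t\<^sup>2 + y\<^sup>2)" by (simp add: Re_divide)
    then show ?thesis unfolding minus_complex.sel Re_complex_of_real by simp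
  qed
  have "integrable \<mu> (\<lambda>t. - Re (1 / (of_real t - ?z) - of_real (t / (1 + t\<^sup>2))))"
    by (rule Bochner_Integration.integrable_minus[OF integrable_Re[OF integrable_kernel[OF z]]])
  then show "integrable \<mu> (\<lambda>t. t / (1 + t\<^sup>2) - t / (t\<^sup>2 + y\<^sup>2))"
    unfolding Re minus_minus .
  have "Re (\<integral>t. 1 / (of_real t - ?z) - of_real (t / (1 + t\<^sup>2)) \<partial>\<mu>) =
      (\<integral>t. Re (1 / (of_real t - ?z) - of_real (t / (1 + t\<^sup>2))) \<partial>\<mu>)"
    by (rule integral_Re[OF integrable_kernel[OF z], symmetric])
  also have "\<dots> = - (\<integral>t. t / (1 + t\<^sup>2) - t / (t\<^sup>2 + y\<^sup>2) \<partial>\<mu>)"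
    unfolding Re by (rule Bochner_Integration.integral_minus)
  finally show "Re (m ?z) = c2 - (\<integral>t. t / (1 + t\<^sup>2) - t / (t\<^sup>2 + y\<^sup>2) \<partial>\<mu>)"
    unfolding m_eq[OF z] by (simp add: Re_divide)
qed

text \<open>Along \<open>y = n + 1\<close> the integrands increase to \<open>t / (1 + t^2)\<close>,
  and their integrals stay below \<open>c2\<close> because the real part of \<open>m\<close> is
  non-negative there; monotone convergence gives integrability. The limit of the real parts lies
  between the mass at 0 and the mass of \<open>{0..e}\<close> for every positive \<open>e\<close> in
  \<open>[0, L)\<close>.\<close>

lemma constant_eq_mass:
  shows "integrable \<mu> (\<lambda>t. t / (1 + t\<^sup>2))" "c2 - (\<integral>t. t / (1 + t\<^sup>2) \<partial>\<mu>) = measure \<nu> {0}"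
proof -
  define u where "u n t = t / (1 + t\<^sup>2) - t / (t\<^sup>2 + (real (Suc n))\<^sup>2)" for n t
  define a where "a n = (\<integral>t. u n t \<partial>\<mu>)" for n
  have ui: "integrable \<mu> (u n)" and Re: "Re (m (Complex 0 (real (Suc n)))) = c2 - a n" for n
    unfolding a_def u_def using Re_m_imaginary[of "real (Suc n)"] by simp_all
  have mono: "AE t in \<mu>. mono (\<lambda>n. u n t)"
    using AE_positive
  proof eventually_elim
    fix t :: real assume t: "0 < t"
    show "mono (\<lambda>n. u n t)"
    proof (rule monoI)
      fix i j :: nat assume "i \<le> j"
      then have "(real (Suc i))\<^sup>2 \<le> (real (Suc j))\<^sup>2" by (intro power_mono) auto
      then have "t / (t\<^sup>2 + (real (Suc j))\<^sup>2) \<le> t / (t\<^sup>2 + (real (Suc i))\<^sup>2)"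
        using t by (intro divide_left_mono add_left_mono mult_pos_pos add_pos_nonneg) auto
      then show "u i t \<le> u j t" by (simp add: u_def)
    qed
  qed
  have "a i \<le> a j" if "i \<le> j" for i j
    unfolding a_def by (rule integral_mono_AE[OF ui ui]) (use mono in eventually_elim, use that in \<open>simp add: mono_def\<close>)
  then have inc: "incseq a" by (simp add: incseq_def)
  have "a n \<le> c2" for n
    using mass_at_zero[of "real (Suc n)"] Re[of n] order_trans[OF measure_nonneg[of \<nu> "{0}"]] by fastforce
  then obtain b where b: "a \<longlonglongrightarrow> b" using incseq_convergent[OF inc] by blast
  have ulim: "AE t in \<mu>. (\<lambda>n. u n t) \<longlonglongrightarrow> t / (1 + t\<^sup>2)"
  proof (rule AE_I2)
    fix t :: real
    have "(\<lambda>n. t / (t\<^sup>2 + (real (Suc n))\<^sup>2)) \<longlonglongrightarrow> 0"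
    proof (rule real_tendsto_divide_at_top[OF tendsto_const], rule filterlim_tendsto_add_at_top[OF tendsto_const])
      show "filterlim (\<lambda>n. (real (Suc n))\<^sup>2) at_top sequentially"
        by (intro filterlim_pow_at_top filterlim_compose[OF filterlim_real_sequentially filterlim_Suc]) simp
    qed
    then have "(\<lambda>n. t / (1 + t\<^sup>2) - t / (t\<^sup>2 + (real (Suc n))\<^sup>2)) \<longlonglongrightarrow> t / (1 + t\<^sup>2) - 0" by (intro tendsto_intros)
    then show "(\<lambda>n. u n t) \<longlonglongrightarrow> t / (1 + t\<^sup>2)" by (simp add: u_def)
  qed
  have "(\<lambda>t::real. t / (1 + t\<^sup>2)) \<in> borel_measurable borel" by measurable
  then have um: "(\<lambda>t. t / (1 + t\<^sup>2)) \<in> borel_measurable \<mu>" by (simp add: measurable_cong_sets[OF sets_\<mu> refl])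
  show "integrable \<mu> (\<lambda>t. t / (1 + t\<^sup>2))"
    by (rule integrable_monotone_convergence[OF ui mono ulim b[unfolded a_def] um])
  have bi: "(\<integral>t. t / (1 + t\<^sup>2) \<partial>\<mu>) = b"
    by (rule integral_monotone_convergence[OF ui mono ulim b[unfolded a_def] um])
  have lim: "(\<lambda>n. Re (m (Complex 0 (real (Suc n))))) \<longlonglongrightarrow> c2 - b"
    unfolding Re by (intro tendsto_intros b)
  have ge: "measure \<nu> {0} \<le> c2 - b"
    by (rule LIMSEQ_le_const[OF lim]) (use mass_at_zero in auto)
  have le: "c2 - b \<le> measure \<nu> {0..e}" if e: "0 < e" "e \<in> half_open L" for e
  proof (rule LIMSEQ_le[OF lim])
    have "(\<lambda>n. 1 / sqrt (real (Suc n) * e)) \<longlonglongrightarrow> 0"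
    proof (rule real_tendsto_divide_at_top[OF tendsto_const], rule filterlim_compose[OF sqrt_at_top])
      show "filterlim (\<lambda>n. real (Suc n) * e) at_top sequentially"
        by (rule filterlim_at_top_mult_tendsto_pos[OF tendsto_const e(1) filterlim_compose[OF filterlim_real_sequentially filterlim_Suc]])
    qed
    then have "(\<lambda>n. (sqrt (measure \<nu> {0..e}) + 1 / sqrt (real (Suc n) * e))\<^sup>2) \<longlonglongrightarrow> (sqrt (measure \<nu> {0..e}) + 0)\<^sup>2"
      by (intro tendsto_intros)
    then show "(\<lambda>n. (sqrt (measure \<nu> {0..e}) + 1 / sqrt (real (Suc n) * e))\<^sup>2) \<longlonglongrightarrow> measure \<nu> {0..e}" by simp
    have "Re (m (Complex 0 (real (Suc n)))) \<le> (sqrt (measure \<nu> {0..e}) + 1 / sqrt (real (Suc n) * e))\<^sup>2" for n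
      by (rule order_trans[OF complex_Re_le_cmod norm_m_le[OF _ e]]) simp
    then show "\<exists>N. \<forall>n\<ge>N. Re (m (Complex 0 (real (Suc n)))) \<le> (sqrt (measure \<nu> {0..e}) + 1 / sqrt (real (Suc n) * e))\<^sup>2" by blast
  qed
  obtain d where d: "0 < d" "d \<in> half_open L" using half_open_extend[OF zero_in_half_open[OF L]] by blast
  define e where "e n = d / real (Suc n)" for n
  have e: "0 < e n" "e n \<in> half_open L" for n
  proof -
    show p: "0 < e n" using d by (simp add: e_def)
    have "d / real (Suc n) \<le> d / 1" using d by (intro divide_left_mono) auto
    then show "e n \<in> half_open L" using half_open_downward[OF d(2), of "e n"] p by (simp add: e_def)
  qed
  have elim: "e \<longlonglongrightarrow> 0" unfolding e_def
    using LIMSEQ_ignore_initial_segment[OF lim_const_over_n[of d], of 1] by simp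
  have "(\<lambda>n. measure \<nu> {0..e n}) \<longlonglongrightarrow> measure \<nu> (\<Inter>n. {0..e n})"
  proof (rule Lim_measure_decseq)
    show "range (\<lambda>n. {0..e n}) \<subseteq> sets \<nu>" using borel_measure_on_Icc(1)[OF \<nu> e(2)] by auto
    have "e j \<le> e i" if "i \<le> j" for i j
      unfolding e_def using that d by (intro divide_left_mono) auto
    then show "decseq (\<lambda>n. {0..e n})" by (fastforce simp: decseq_def intro: order_trans)
    show "emeasure \<nu> {0..e n} \<noteq> \<infinity>" for n using borel_measure_on_Icc(2)[OF \<nu> e(2)] by (metis less_irrefl)
  qed
  moreover have "(\<Inter>n. {0..e n}) = {0}"
  proof -
    have "x \<le> 0" if "\<forall>n. x \<le> e n" for x using LIMSEQ_le_const[OF elim, of x] that by blast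
    then show ?thesis using less_imp_le[OF e(1)] by (auto intro: antisym)
  qed
  ultimately have "(\<lambda>n. measure \<nu> {0..e n}) \<longlonglongrightarrow> measure \<nu> {0}" by simp
  then have "c2 - b \<le> measure \<nu> {0}"
    by (rule LIMSEQ_le_const) (use le[OF e] in blast)
  with ge show "c2 - (\<integral>t. t / (1 + t\<^sup>2) \<partial>\<mu>) = measure \<nu> {0}" unfolding bi by simp
qed

text \<open>Once \<open>t / (1 + t^2)\<close> is integrable, the compensating term may be split off;
  it merges with \<open>c2\<close> into the mass at 0.\<close>

lemma stieltjes_formula:
  fixes z :: complex
  assumes z: "z \<notin> \<real>"
  shows "set_integrable \<mu> {0<..} (\<lambda>t. 1 / (of_real t - z))"
    and "m z = of_real (measure \<nu> {0}) - of_real \<gamma> / z + (LINT t:{0<..}|\<mu>. 1 / (of_real t - z))"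
proof -
  note i = constant_eq_mass(1)
  have io: "integrable \<mu> (\<lambda>t. complex_of_real (t / (1 + t\<^sup>2)))" by (rule integrable_of_real[OF i])
  have im: "integrable \<mu> (\<lambda>t. 1 / (of_real t - z))"
    using integrable_add[OF integrable_kernel[OF z] io] by simp
  then show "set_integrable \<mu> {0<..} (\<lambda>t. 1 / (of_real t - z))"
    unfolding set_integrable_def by (rule integrable_mult_indicator[rotated]) (simp add: sets_\<mu>)
  then have mi: "(\<lambda>t. indicator {0<..} t *\<^sub>R (1 / (of_real t - z))) \<in> borel_measurable \<mu>"
    unfolding set_integrable_def by (rule borel_measurable_integrable)
  have "(LINT t:{0<..}|\<mu>. 1 / (of_real t - z)) = (\<integral>t. 1 / (of_real t - z) \<partial>\<mu>)"
    unfolding set_lebesgue_integral_def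
    by (rule integral_cong_AE[OF mi borel_measurable_integrable[OF im]]) (use AE_positive in eventually_elim, simp)
  moreover have "(\<integral>t. 1 / (of_real t - z) - of_real (t / (1 + t\<^sup>2)) \<partial>\<mu>) =
      (\<integral>t. 1 / (of_real t - z) \<partial>\<mu>) - of_real (\<integral>t. t / (1 + t\<^sup>2) \<partial>\<mu>)"
    unfolding integral_diff[OF im io] by (simp only: integral_complex_of_real)
  moreover have "complex_of_real c2 = of_real (measure \<nu> {0}) + of_real (\<integral>t. t / (1 + t\<^sup>2) \<partial>\<mu>)"
    unfolding constant_eq_mass(2)[symmetric] by simp
  ultimately show "m z = of_real (measure \<nu> {0}) - of_real \<gamma> / z + (LINT t:{0<..}|\<mu>. 1 / (of_real t - z))"
    unfolding m_eq[OF z] by (simp add: c1_eq_0)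
qed

end

section \<open>Weyl solutions of a triple\<close>

lemma inverse_length_bounds:
  assumes "0 < L"
  shows "0 \<le> inverse_length L" "c \<in> half_open L \<Longrightarrow> c * inverse_length L < 1"
  using assms by (cases L; simp add: inverse_length_def half_open_def divide_less_eq)+

lemma spectral_measure_representation:
  assumes "spectral_measure L m \<mu>" "0 < L"
  obtains c1 c2 where "herglotz_representation \<mu> m c1 c2 (inverse_length L)"
proof -
  obtain c1 c2 :: real where c: "c1 \<ge> 0" "\<And>z. z \<notin> \<real> \<Longrightarrow> m z = of_real c1 * z + of_real c2 - recip_Lz L z +
      (LINT t|\<mu>. 1 / (of_real t - z) - of_real (t / (1 + t\<^sup>2)))"
    using assms(1) unfolding spectral_measure_def by blast
  show ?thesis
    by (rule that, unfold_locales)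
      (use assms(1) c inverse_length_bounds(1)[OF assms(2)] in \<open>auto simp: spectral_measure_def recip_Lz_eq\<close>)
qed

lemma normalized_weyl_solution:
  assumes L: "0 < L" and q: "represents L q \<omega>" and m: "weyl_titchmarsh_function L \<omega> \<upsilon> m" and z: "z \<notin> \<real>"
  shows "\<exists>f g. weyl_solution L q \<upsilon> z f g (z * m z)"
proof -
  obtain f \<Delta> where sol: "solution L \<omega> \<upsilon> z f \<Delta>" and H: "f \<in> H_prime L" and sq: "square_integrable \<upsilon> f"
    and f0: "f 0 \<noteq> 0" and mz: "m z = \<Delta> / (z * f 0)"
    using m z unfolding weyl_titchmarsh_function_def by blast
  obtain g where g: "weak_solution L q \<upsilon> z f g \<Delta>" using solution_imp_weak_solution[OF sol q] by blast
  then have wd: "weak_derivative L f g" by (simp add: weak_solution_def)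
  have z0: "z \<noteq> 0" using z by auto
  define a where "a = 1 / f 0"
  have wda: "weak_derivative L (\<lambda>x. a * f x) (\<lambda>x. a * g x)" by (rule weak_derivative_cmult[OF wd])
  have "weak_solution L q \<upsilon> z (\<lambda>x. a * f x) (\<lambda>x. a * g x) (z * m z)"
    unfolding weak_solution_def
  proof (intro conjI allI impI wda)
    fix h k :: "real \<Rightarrow> complex" assume h: "test_function L h k"
    have eq: "\<Delta> * h 0 + (LBINT x. g x * k x) =
        z\<^sup>2 * (\<integral>x. f x * h x \<partial>\<upsilon>) - z * (LBINT x. of_real (q x) * (f x * k x + g x * h x))"
      using g h by (simp add: weak_solution_def)
    have e1: "(LBINT x. a * g x * k x) = a * (LBINT x. g x * k x)"
      and e2: "(\<integral>x. a * f x * h x \<partial>\<upsilon>) = a * (\<integral>x. f x * h x \<partial>\<upsilon>)"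
      by (simp_all only: mult.assoc integral_mult_right_zero)
    have "of_real (q x) * (a * f x * k x + a * g x * h x) = a * (of_real (q x) * (f x * k x + g x * h x))" for x
      by (simp add: algebra_simps)
    then have e3: "(LBINT x. of_real (q x) * (a * f x * k x + a * g x * h x)) =
        a * (LBINT x. of_real (q x) * (f x * k x + g x * h x))"
      by (simp only: integral_mult_right_zero)
    have "z * m z = a * \<Delta>" using z0 f0 by (simp add: mz a_def)
    then have "z * m z * h 0 + a * (LBINT x. g x * k x) = a * (\<Delta> * h 0 + (LBINT x. g x * k x))"
      by (simp add: algebra_simps)
    then show "z * m z * h 0 + (LBINT x. a * g x * k x) =
        z\<^sup>2 * (\<integral>x. a * f x * h x \<partial>\<upsilon>) - z * (LBINT x. of_real (q x) * (a * f x * k x + a * g x * h x))"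
      unfolding e1 e2 e3 eq by (simp add: algebra_simps)
  qed
  moreover have "finite_energy L (\<lambda>x. a * f x) (\<lambda>x. a * g x)"
    unfolding finite_energy_def
  proof (intro conjI wda impI)
    note [measurable] = weak_derivative_measurable[OF wd]
    have "AE x in lborel. x \<in> half_open L \<longrightarrow> (norm (der L f x))\<^sup>2 = (norm (g x))\<^sup>2"
      using AE_der[OF wd] by eventually_elim simp
    from lebesgue_on_transfer(3)[OF this _ half_open_measurable subset_refl]
    have "integrable lborel (\<lambda>x. indicator (half_open L) x *\<^sub>R (norm (g x))\<^sup>2)"
      using H by (simp add: H_prime_def square_integrable_def)
    moreover have "indicator (half_open L) x *\<^sub>R (norm (g x))\<^sup>2 = (norm (g x))\<^sup>2" for x
      using weak_derivative_outside[OF wd, of x] by (cases "x \<in> half_open L") auto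
    ultimately have "integrable lborel (\<lambda>x. (norm (g x))\<^sup>2)" by (simp only:)
    then show "integrable lborel (\<lambda>x. (norm (a * g x))\<^sup>2)" by (simp add: norm_mult power_mult_distrib)
    assume "L < \<infinity>"
    then have "(f \<longlongrightarrow> 0) (at_left (real_of_ereal L))" using H by (simp add: H_prime_def)
    from tendsto_mult_right_zero[OF this] show "((\<lambda>x. a * f x) \<longlongrightarrow> 0) (at_left (real_of_ereal L))" .
  qed
  moreover have "a * f 0 = 1" using f0 by (simp add: a_def)
  moreover have "integrable \<upsilon> (\<lambda>x. (norm (a * f x))\<^sup>2)"
    using sq by (simp add: norm_mult power_mult_distrib square_integrable_def)
  ultimately show ?thesis unfolding weyl_solution_def by blast
qed

text \<open>The product of \<open>f\<close> and \<open>h\<close> is a test function, on which the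
  distribution has two expressions, by \<open>q\<close> and by \<open>\<nu>\<close>; equating them
  replaces the term with \<open>q\<close>.\<close>

lemma string_equation:
  assumes L: "0 < L" and q: "represents L q \<omega>" and \<upsilon>: "\<And>A. A \<in> sets \<upsilon> \<Longrightarrow> emeasure \<upsilon> A = 0"
    and \<nu>: "is_measure_distribution L \<omega> \<nu>" and f: "weyl_solution L q \<upsilon> z f g \<Delta>" and h: "test_function L h k"
  shows "\<Delta> * h 0 + (LBINT x. g x * k x) = z * (\<integral>x. f x * h x \<partial>\<nu>)"
proof -
  have wd: "weak_derivative L f g" and eq: "\<Delta> * h 0 + (LBINT x. g x * k x) =
      z\<^sup>2 * (\<integral>x. f x * h x \<partial>\<upsilon>) - z * (LBINT x. of_real (q x) * (f x * k x + g x * h x))"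
    using f h by (auto simp: weyl_solution_def weak_solution_def)
  have "AE x in \<upsilon>. f x * h x = 0"
    by (rule AE_I[of _ _ "space \<upsilon>"]) (auto simp: \<upsilon>)
  then have "(\<integral>x. f x * h x \<partial>\<upsilon>) = 0" by (rule integral_eq_zero_AE)
  moreover note tf = test_function_mult[OF wd h]
  have "\<omega> (\<lambda>x. f x * h x) = - (LBINT x. of_real (q x) * (f x * k x + g x * h x))"
    using q tf by (simp add: represents_def)
  moreover have "\<omega> (\<lambda>x. f x * h x) = (\<integral>x. f x * h x \<partial>\<nu>)"
    using \<nu> test_function_imp_H1_c[OF tf] by (simp add: is_measure_distribution_def)
  ultimately show ?thesis unfolding eq by simp
qed

section \<open>The characterization\<close>

theorem proposition7p3:
  fixes L :: ereal
    and \<omega> :: "(real \<Rightarrow> complex) \<Rightarrow> complex"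
    and \<upsilon> \<mu> :: "real measure"
    and m :: "complex \<Rightarrow> complex"
  assumes "0 < L"
    and "\<omega> \<in> Hm1_loc L" and "real_valued L \<omega>"
    and "borel_measure_on L \<upsilon>"
    and "weyl_titchmarsh_function L \<omega> \<upsilon> m"
    and "spectral_measure L m \<mu>"
  shows "(stieltjes_function m \<longleftrightarrow>
            (\<forall>A\<in>sets \<upsilon>. emeasure \<upsilon> A = 0) \<and> (\<exists>\<nu>. is_measure_distribution L \<omega> \<nu>)) \<and>
         (stieltjes_function m \<longrightarrow>
            (\<forall>\<nu>. is_measure_distribution L \<omega> \<nu> \<longrightarrow>
               (\<forall>z. z \<notin> \<real> \<longrightarrow>
                  set_integrable \<mu> {0<..} (\<lambda>t. 1 / (complex_of_real t - z)) \<and>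
                  m z = of_real (measure \<nu> {0}) - recip_Lz L z +
                    (LINT t:{0<..}|\<mu>. 1 / (complex_of_real t - z)))))"
proof -
  obtain q where rep: "represents L q \<omega>" using real_valued_represents[OF assms(3)] by blast
  then have q2: "local_L2 L q" by (simp add: represents_def)
  obtain c1 c2 where "herglotz_representation \<mu> m c1 c2 (inverse_length L)"
    using spectral_measure_representation[OF assms(6,1)] by blast
  then interpret herglotz_representation \<mu> m c1 c2 "inverse_length L" .
  have "\<forall>z. \<exists>f g. z \<notin> \<real> \<longrightarrow> weyl_solution L q \<upsilon> z f g (z * m z)"
    using normalized_weyl_solution[OF assms(1) rep assms(5)] by blast
  then obtain \<psi> \<psi>' where weyl: "\<And>z. z \<notin> \<real> \<Longrightarrow> weyl_solution L q \<upsilon> z (\<psi> z) (\<psi>' z) (z * m z)"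
    by metis
  \<comment> \<open>The representing measure is arbitrary here. This serves the converse direction
    and also the integral formula, which is claimed for every such \<open>\<nu>\<close>.\<close>
  have string: "string_problem \<mu> m c1 c2 (inverse_length L) L \<nu> \<psi> \<psi>'"
    if "\<forall>A\<in>sets \<upsilon>. emeasure \<upsilon> A = 0" "is_measure_distribution L \<omega> \<nu>" for \<nu>
  proof unfold_locales
    show "borel_measure_on L \<nu>" using that(2) by (simp add: is_measure_distribution_def)
    show "z * m z * h 0 + (LBINT x. \<psi>' z x * k x) = z * (\<integral>x. \<psi> z x * h x \<partial>\<nu>)"
      if "z \<notin> \<real>" "test_function L h k" for z h k
      by (rule string_equation[OF assms(1) rep _ \<open>is_measure_distribution L \<omega> \<nu>\<close> weyl[OF that(1)] that(2)])
        (use \<open>\<forall>A\<in>sets \<upsilon>. emeasure \<upsilon> A = 0\<close> in blast)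
  qed (use assms(1) weyl in \<open>auto simp: weyl_solution_def\<close>)
  have null: "\<forall>A\<in>sets \<upsilon>. emeasure \<upsilon> A = 0" and mass: "\<exists>\<nu>. is_measure_distribution L \<omega> \<nu>"
    if S: "stieltjes_function m"
  proof -
    interpret weyl_problem \<mu> m c1 c2 "inverse_length L" L q \<upsilon> \<psi> \<psi>'
    proof unfold_locales
      show "0 \<le> Im (z * m z)" if "0 < Im z" for z using S that by (simp add: stieltjes_function_iff)
    qed (use assms(1,4) q2 weyl inverse_length_bounds(2) in auto)
    show "\<forall>A\<in>sets \<upsilon>. emeasure \<upsilon> A = 0" using emeasure_\<upsilon>_eq_0 by blast
    \<comment> \<open>The measure is built from \<open>q\<close> alone; it represents the
      distribution because every element of \<open>H1_c L\<close> is part of a test pair.\<close>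
    interpret form: nonincreasing_form L q
      by unfold_locales (use assms(1) q2 test_function_inequalities(2) in auto)
    have "\<omega> h = (\<integral>x. h x \<partial>form.mass)" if h: "h \<in> H1_c L" for h
    proof -
      obtain k where k: "test_function L h k" using H1_c_imp_test_function[OF h assms(1)] by blast
      then have "\<omega> h = - (LBINT x. of_real (q x) * k x)" using rep by (simp add: represents_def)
      then show ?thesis using form.integral_mass[OF k] by simp
    qed
    then show "\<exists>\<nu>. is_measure_distribution L \<omega> \<nu>"
      using form.borel_measure_on_mass unfolding is_measure_distribution_def by blast
  qed
  show ?thesis
  proof (intro conjI iffI impI allI)
    show "\<forall>A\<in>sets \<upsilon>. emeasure \<upsilon> A = 0" "\<exists>\<nu>. is_measure_distribution L \<omega> \<nu>" if "stieltjes_function m"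
      using null mass that by blast+
    show "stieltjes_function m"
      if "(\<forall>A\<in>sets \<upsilon>. emeasure \<upsilon> A = 0) \<and> (\<exists>\<nu>. is_measure_distribution L \<omega> \<nu>)"
      using that string_problem.Im_z_m_nonneg[OF string] unfolding stieltjes_function_iff by blast
    fix \<nu> and z :: complex
    assume "stieltjes_function m" and \<nu>: "is_measure_distribution L \<omega> \<nu>" and z: "z \<notin> \<real>"
    then interpret string: string_problem \<mu> m c1 c2 "inverse_length L" L \<nu> \<psi> \<psi>'
      using string null by blast
    show "set_integrable \<mu> {0<..} (\<lambda>t. 1 / (complex_of_real t - z))"
      by (rule string.stieltjes_formula(1)[OF z])
    show "m z = of_real (measure \<nu> {0}) - recip_Lz L z + (LINT t:{0<..}|\<mu>. 1 / (complex_of_real t - z))"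
      unfolding recip_Lz_eq by (rule string.stieltjes_formula(2)[OF z])
  qed
qed

end
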